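(* Assume either condition (A1) when $s\in I_\mu^-$, or condition (A2) when $s\in I_\mu^+$. Let $s\in I_\mu^\circ\setminus\{0\}$ and $q=\Lambda'(s)$. Then, for any $0<\gamma\le\min\{|s|,1\}$, there exists a constant $\delta>0$ such that for any $z\in B_\delta(0)$ and $n\ge1$, $$R_{s,z}^n=\lambda_{s,z}^n\Pi_{s,z}+N_{s,z}^n,$$ where $z\mapsto\lambda_{s,z}=e^{-qz}\frac{\kappa(s+z)}{\kappa(s)}:B_\delta(0)\to\mathbb C$ is analytic, and $z\mapsto\Pi_{s,z}$ and $z\mapsto N_{s,z}$, $B_\delta(0)\to\mathscr L(\mathscr B_\gamma,\mathscr B_\gamma)$, are analytic with $\Pi_{s,z}N_{s,z}=N_{s,z}\Pi_{s,z}=0$ and $\Pi_{s,0}(\varphi)(v)=\pi_s(\varphi)$ for $\varphi\in\mathscr B_\gamma$ and $v\in\mathcal S$. Moreover, for any compact set $J\subseteq(I_\mu^+)^\circ\cup(I_\mu^-)^\circ$, it holds that $$\sup_{s\in J}\sup_{z\in B_\delta(0)}\rho(N_{s,z})<1.$$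
   Context: Let $d\ge2$. $\mathbb R^d$ carries the standard scalar product and the norm $\|v\|=\sum_i|v_i|$; $\mathbb R^d_+$ is the set of vectors with non-negative coordinates; $\mathcal S=\{v\in\mathbb R^d_+:\|v\|=1\}$. $\mathbb G$ is the semigroup of non-negative $d\times d$ matrices, $\|g\|=\sum_{i,j}g^{i,j}$, $g>0$ means all entries are strictly positive, $g^{\mathrm T}$ is the transpose, $g\cdot v=gv/\|gv\|$. $(g_n)_{n\ge1}$ are i.i.d. in $\mathbb G$ with law $\mu$, $G_n=g_n\cdots g_1$; $\Gamma_\mu$ is the closed semigroup spanned by $\operatorname{supp}\mu$. Condition (A1): $0\notin\Gamma_\mu$ and there is a constant $\varkappa_0>1$ such that for $\mu$-almost every $g$: $g>0$ and $\max_{i,j}g^{i,j}\le\varkappa_0\min_{i,j}g^{i,j}$. Condition (A2): $0\notin\Gamma_\mu$ and there is a constant $\varkappa>1$ such that for $\mu$-almost every $g$: $g>0$ and $\max_ig^{i,j}\le\varkappa\min_ig^{i,j}$ for all $1\le j\le d$. $I_\mu^+=\{s\ge0:\mathbb E\|g_1\|^s<\infty\}$, $I_\mu^-=\{s\le0:\mathbb E\|g_1\|^s<\infty\}$, $I_\mu=I_\mu^+\cup I_\mu^-$; the superscript $\circ$ denotes the interior. $\kappa(s)=\lim_n(\mathbb E\|G_n\|^s)^{1/n}$, $\Lambda=\log\kappa$; $\Lambda$ is analytic on $I_\mu^\circ$ and $\kappa(s+z)$ for small complex $z$ denotes the analytic extension. $P_s\varphi(v)=\int\|gv\|^s\varphi(g\cdot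 v)\mu(dg)$, $P_s^*\varphi(v)=\int\|g^{\mathrm T}v\|^s\varphi(g^{\mathrm T}\cdot v)\mu(dg)$, and on measures $(P_s\eta)\varphi=\eta(P_s\varphi)$ (likewise for $P_s^*$). Under the hypotheses there are unique probability measures $\nu_s,\nu_s^*$ on $\mathcal S$ with $P_s\nu_s=\kappa(s)\nu_s$, $P_s^*\nu_s^*=\kappa(s)\nu_s^*$, and $r_s(v)=\int\langle v,u\rangle^s\nu_s^*(du)$ is strictly positive, continuous and satisfies $P_sr_s=\kappa(s)r_s$. $\pi_s(\varphi)=\nu_s(\varphi r_s)/\nu_s(r_s)$. For $z\in\mathbb C$ with $s+\Re z\in I_\mu$ and $q=\Lambda'(s)$, the perturbed operator is, for continuous $\varphi$ on $\mathcal S$, $$R_{s,z}\varphi(v)=\frac1{\kappa(s)r_s(v)}\int_{\mathbb G}\|gv\|^s\,r_s(g\cdot v)\,e^{z(\log\|gv\|-q)}\varphi(g\cdot v)\,\mu(dg),\quad v\in\mathcal S.$$ $B_\delta(0)=\{z\in\mathbb C:|z|<\delta\}$. The space $\mathcal S$ is equipped with the Hilbert cross-ratio metric $\mathbf d(u,v)=\frac{1-m(u,v)m(v,u)}{1+m(u,v)m(v,u)}$, $m(u,v)=\sup\{\lambda\ge0:\lambda v_i\le u_i\ \forall i\}$. $\mathscr B_\gamma$ is the Banach space of complex-valued continuous $\varphi$ on $\mathcal S$ with $\|\varphi\|_\gamma=\sup|\varphi|+\sup_{u\ne v}|\varphi(u)-\varphi(v)|/\mathbf d(u,v)^\gamma<\infty$;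 $\mathscr L(\mathscr B_\gamma,\mathscr B_\gamma)$ is the set of bounded linear operators on it and $\rho(A)$ is the spectral radius of such an operator $A$. *)

theory Defs
  imports "HOL-Probability.Probability"
begin

definition l1norm :: "real ^ 'n \<Rightarrow> real" where
  "l1norm v = (\<Sum>i\<in>UNIV. \<bar>v $ i\<bar>)"

definition simplex_S :: "(real ^ 'n) set" where
  "simplex_S = {v. (\<forall>i. 0 \<le> v $ i) \<and> l1norm v = 1}"

definition nonneg_mats :: "(real ^ 'n ^ 'n) set" where
  "nonneg_mats = {g. \<forall>i j. 0 \<le> g $ i $ j}"

definition mnorm :: "real ^ 'n ^ 'n \<Rightarrow> real" where
  "mnorm g = (\<Sum>i\<in>UNIV. \<Sum>j\<in>UNIV. g $ i $ j)"

definition act :: "real ^ 'n ^ 'n \<Rightarrow> real ^ 'n \<Rightarrow> real ^ 'n" where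
  "act g v = (g *v v) /\<^sub>R l1norm (g *v v)"

definition pos_mat :: "real ^ 'n ^ 'n \<Rightarrow> bool" where
  "pos_mat g \<longleftrightarrow> (\<forall>i j. 0 < g $ i $ j)"

text \<open>A law \<open>\<mu>\<close> is a probability measure on the space \<open>nonneg_mats\<close> itself, that is, its
  sigma-algebra is \<open>restrict_space borel nonneg_mats\<close>; measures on the simplex are
  treated in the same way. Thus functions that are only continuous on the simplex cause no
  measurability problem.\<close>

definition law_on_nonneg_mats :: "(real ^ 'n ^ 'n) measure \<Rightarrow> bool" where
  "law_on_nonneg_mats \<mu> \<longleftrightarrow>
     prob_space \<mu> \<and> sets \<mu> = sets (restrict_space borel nonneg_mats)"

definition supp :: "(real ^ 'n ^ 'n) measure \<Rightarrow> (real ^ 'n ^ 'n) set" where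
  "supp \<mu> = {g \<in> nonneg_mats. \<forall>U. open U \<longrightarrow> g \<in> U \<longrightarrow> 0 < emeasure \<mu> (U \<inter> nonneg_mats)}"

definition Gamma_semigroup :: "(real ^ 'n ^ 'n) measure \<Rightarrow> (real ^ 'n ^ 'n) set" where
  "Gamma_semigroup \<mu> =
     \<Inter>{H. closed H \<and> supp \<mu> \<subseteq> H \<and> (\<forall>a\<in>H. \<forall>b\<in>H. a ** b \<in> H)}"

definition cond_A1 :: "(real ^ 'n ^ 'n) measure \<Rightarrow> bool" where
  "cond_A1 \<mu> \<longleftrightarrow> 0 \<notin> Gamma_semigroup \<mu> \<and>
     (\<exists>k0>1. AE g in \<mu>. pos_mat g \<and>
        Max {g $ i $ j |i j. True} \<le> k0 * Min {g $ i $ j |i j. True})"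

definition cond_A2 :: "(real ^ 'n ^ 'n) measure \<Rightarrow> bool" where
  "cond_A2 \<mu> \<longleftrightarrow> 0 \<notin> Gamma_semigroup \<mu> \<and>
     (\<exists>k>1. AE g in \<mu>. pos_mat g \<and>
        (\<forall>j. Max {g $ i $ j |i. True} \<le> k * Min {g $ i $ j |i. True}))"

definition I_plus :: "(real ^ 'n ^ 'n) measure \<Rightarrow> real set" where
  "I_plus \<mu> = {s. 0 \<le> s \<and> (\<integral>\<^sup>+ g. ennreal (mnorm g powr s) \<partial>\<mu>) < \<infinity>}"

text \<open>Since \<open>0 powr s = 0\<close> also for negative \<open>s\<close>, the set \<open>I_minus\<close> has its intended meaning
  only for laws that do not charge the zero matrix, which both \<open>cond_A1\<close> and \<open>cond_A2\<close>
  guarantee.\<close>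

definition I_minus :: "(real ^ 'n ^ 'n) measure \<Rightarrow> real set" where
  "I_minus \<mu> = {s. s \<le> 0 \<and> (\<integral>\<^sup>+ g. ennreal (mnorm g powr s) \<partial>\<mu>) < \<infinity>}"

definition I_mu :: "(real ^ 'n ^ 'n) measure \<Rightarrow> real set" where
  "I_mu \<mu> = I_plus \<mu> \<union> I_minus \<mu>"

text \<open>The i.i.d. sequence \<open>(g\<^sub>n)\<close>, \<open>n \<ge> 1\<close>, is the coordinate process on the infinite product
  of copies of \<open>\<mu>\<close>; \<open>kappa\<close> depends on the sequence only through its law.\<close>

primrec mat_prod :: "(nat \<Rightarrow> real ^ 'n ^ 'n) \<Rightarrow> nat \<Rightarrow> real ^ 'n ^ 'n" where
  "mat_prod \<omega> 0 = mat 1"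
| "mat_prod \<omega> (Suc n) = \<omega> (Suc n) ** mat_prod \<omega> n"

definition kappa :: "(real ^ 'n ^ 'n) measure \<Rightarrow> real \<Rightarrow> real" where
  "kappa \<mu> s = lim (\<lambda>n. (\<integral>\<omega>. mnorm (mat_prod \<omega> n) powr s \<partial>(PiM {1..} (\<lambda>_. \<mu>)))
                          powr (1 / real n))"

definition Lambda :: "(real ^ 'n ^ 'n) measure \<Rightarrow> real \<Rightarrow> real" where
  "Lambda \<mu> s = ln (kappa \<mu> s)"

definition analytic_extension_at ::
  "(real \<Rightarrow> real) \<Rightarrow> real \<Rightarrow> real \<Rightarrow> (complex \<Rightarrow> complex) \<Rightarrow> bool" where
  "analytic_extension_at f s \<delta> F \<longleftrightarrow>
     F analytic_on ball (of_real s) \<delta> \<and>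
     (\<forall>t. \<bar>t - s\<bar> < \<delta> \<longrightarrow> F (of_real t) = of_real (f t))"

definition P_op :: "(real ^ 'n ^ 'n) measure \<Rightarrow> real \<Rightarrow> (real ^ 'n \<Rightarrow> complex) \<Rightarrow> real ^ 'n \<Rightarrow> complex"
  where "P_op \<mu> s \<phi> v = (\<integral>g. of_real (l1norm (g *v v) powr s) * \<phi> (act g v) \<partial>\<mu>)"

definition P_star_op ::
  "(real ^ 'n ^ 'n) measure \<Rightarrow> real \<Rightarrow> (real ^ 'n \<Rightarrow> complex) \<Rightarrow> real ^ 'n \<Rightarrow> complex"
  where "P_star_op \<mu> s \<phi> v =
    (\<integral>g. of_real (l1norm (transpose g *v v) powr s) * \<phi> (act (transpose g) v) \<partial>\<mu>)"

text \<open>\<open>eigenmeasure A k \<nu>\<close>: \<open>\<nu>\<close> is a probability measure on the simplex with \<open>A \<nu> = k \<nu>\<close>,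
  where \<open>A\<close> acts on measures by duality with continuous functions.\<close>

definition eigenmeasure ::
  "((real ^ 'n \<Rightarrow> complex) \<Rightarrow> real ^ 'n \<Rightarrow> complex) \<Rightarrow> real \<Rightarrow> (real ^ 'n) measure \<Rightarrow> bool" where
  "eigenmeasure A k \<nu> \<longleftrightarrow>
     prob_space \<nu> \<and> sets \<nu> = sets (restrict_space borel simplex_S) \<and>
     (\<forall>\<phi>. continuous_on simplex_S \<phi> \<longrightarrow> (\<integral>v. A \<phi> v \<partial>\<nu>) = of_real k * (\<integral>v. \<phi> v \<partial>\<nu>))"

definition nu :: "(real ^ 'n ^ 'n) measure \<Rightarrow> real \<Rightarrow> (real ^ 'n) measure" where
  "nu \<mu> s = (THE \<nu>. eigenmeasure (P_op \<mu> s) (kappa \<mu> s) \<nu>)"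

definition nu_star :: "(real ^ 'n ^ 'n) measure \<Rightarrow> real \<Rightarrow> (real ^ 'n) measure" where
  "nu_star \<mu> s = (THE \<nu>. eigenmeasure (P_star_op \<mu> s) (kappa \<mu> s) \<nu>)"

definition r_fun :: "(real ^ 'n ^ 'n) measure \<Rightarrow> real \<Rightarrow> real ^ 'n \<Rightarrow> real" where
  "r_fun \<mu> s v = (\<integral>u. (v \<bullet> u) powr s \<partial>(nu_star \<mu> s))"

definition pi_s :: "(real ^ 'n ^ 'n) measure \<Rightarrow> real \<Rightarrow> (real ^ 'n \<Rightarrow> complex) \<Rightarrow> complex" where
  "pi_s \<mu> s \<phi> = (\<integral>v. \<phi> v * of_real (r_fun \<mu> s v) \<partial>(nu \<mu> s)) / of_real (\<integral>v. r_fun \<mu> s v \<partial>(nu \<mu> s))"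

text \<open>Functions on the simplex are represented by functions on the whole space that vanish
  outside the simplex, hence the case distinction.\<close>

definition R_op ::
  "(real ^ 'n ^ 'n) measure \<Rightarrow> real \<Rightarrow> complex \<Rightarrow> (real ^ 'n \<Rightarrow> complex) \<Rightarrow> real ^ 'n \<Rightarrow> complex"
  where "R_op \<mu> s z \<phi> v =
    (if v \<in> simplex_S
     then (1 / of_real (kappa \<mu> s * r_fun \<mu> s v)) *
       (\<integral>g. of_real (l1norm (g *v v) powr s) * of_real (r_fun \<mu> s (act g v))
            * exp (z * of_real (ln (l1norm (g *v v)) - deriv (Lambda \<mu>) s))
            * \<phi> (act g v) \<partial>\<mu>)
     else 0)"

definition m_ratio :: "real ^ 'n \<Rightarrow> real ^ 'n \<Rightarrow> real" where
  "m_ratio u v = Sup {l. 0 \<le> l \<and> (\<forall>i. l * v $ i \<le> u $ i)}"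

definition d_hilbert :: "real ^ 'n \<Rightarrow> real ^ 'n \<Rightarrow> real" where
  "d_hilbert u v = (1 - m_ratio u v * m_ratio v u) / (1 + m_ratio u v * m_ratio v u)"

definition ext_norm_B :: "real \<Rightarrow> (real ^ 'n \<Rightarrow> complex) \<Rightarrow> ennreal" where
  "ext_norm_B \<gamma> \<phi> =
     (SUP v\<in>simplex_S. ennreal (cmod (\<phi> v))) +
     (SUP (u, v)\<in>{(u, v). u \<in> simplex_S \<and> v \<in> simplex_S \<and> u \<noteq> v}.
        ennreal (cmod (\<phi> u - \<phi> v) / d_hilbert u v powr \<gamma>))"

definition space_B :: "real \<Rightarrow> (real ^ 'n \<Rightarrow> complex) set" where
  "space_B \<gamma> = {\<phi>. continuous_on simplex_S \<phi> \<and> (\<forall>v. v \<notin> simplex_S \<longrightarrow> \<phi> v = 0) \<and>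
                   ext_norm_B \<gamma> \<phi> < \<infinity>}"

definition norm_B :: "real \<Rightarrow> (real ^ 'n \<Rightarrow> complex) \<Rightarrow> real" where
  "norm_B \<gamma> \<phi> = enn2real (ext_norm_B \<gamma> \<phi>)"

text \<open>Operators on \<open>space_B \<gamma>\<close> are functions whose values outside \<open>space_B \<gamma>\<close> are irrelevant.\<close>

type_synonym 'n operator = "(real ^ 'n \<Rightarrow> complex) \<Rightarrow> real ^ 'n \<Rightarrow> complex"

definition bounded_ops :: "real \<Rightarrow> 'n::finite operator set" where
  "bounded_ops \<gamma> = {T.
     (\<forall>\<phi>\<in>space_B \<gamma>. T \<phi> \<in> space_B \<gamma>) \<and>
     (\<forall>\<phi>\<in>space_B \<gamma>. \<forall>\<psi>\<in>space_B \<gamma>. T (\<lambda>v. \<phi> v + \<psi> v) = (\<lambda>v. T \<phi> v + T \<psi> v)) \<and>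
     (\<forall>c. \<forall>\<phi>\<in>space_B \<gamma>. T (\<lambda>v. c * \<phi> v) = (\<lambda>v. c * T \<phi> v)) \<and>
     (\<exists>C. \<forall>\<phi>\<in>space_B \<gamma>. norm_B \<gamma> (T \<phi>) \<le> C * norm_B \<gamma> \<phi>)}"

definition op_norm_B :: "real \<Rightarrow> 'n::finite operator \<Rightarrow> real" where
  "op_norm_B \<gamma> T = Sup {norm_B \<gamma> (T \<phi>) |\<phi>. \<phi> \<in> space_B \<gamma> \<and> norm_B \<gamma> \<phi> \<le> 1}"

definition spectrum_B :: "real \<Rightarrow> 'n::finite operator \<Rightarrow> complex set" where
  "spectrum_B \<gamma> T = {l. \<not> (\<exists>S\<in>bounded_ops \<gamma>. \<forall>\<phi>\<in>space_B \<gamma>.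
     S (\<lambda>v. l * \<phi> v - T \<phi> v) = \<phi> \<and> (\<lambda>v. l * S \<phi> v - T (S \<phi>) v) = \<phi>)}"

definition spec_radius_B :: "real \<Rightarrow> 'n::finite operator \<Rightarrow> real" where
  "spec_radius_B \<gamma> T = Sup (cmod ` spectrum_B \<gamma> T)"

text \<open>Analyticity of an operator-valued map on an open set is, as for \<open>analytic_on\<close> in the
  library, complex differentiability at every point, here in the operator norm.\<close>

definition op_analytic_on :: "real \<Rightarrow> (complex \<Rightarrow> 'n::finite operator) \<Rightarrow> complex set \<Rightarrow> bool" where
  "op_analytic_on \<gamma> F D \<longleftrightarrow> open D \<and> (\<forall>z\<in>D. F z \<in> bounded_ops \<gamma>) \<and>
     (\<forall>z\<in>D. \<exists>T\<in>bounded_ops \<gamma>.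
        ((\<lambda>w. op_norm_B \<gamma> (\<lambda>\<phi> v. (F w \<phi> v - F z \<phi> v) / (w - z) - T \<phi> v)) \<longlongrightarrow> 0) (at z))"

text \<open>Here \<open>K\<close> is the (unique) analytic extension of \<open>kappa \<mu>\<close> to the complex disc of radius
  \<open>\<delta>\<close> around \<open>s\<close>. The requirement \<open>s + Re z \<in> I_mu \<mu>\<close> is the condition under which
  \<open>R_op \<mu> s z\<close> is a meaningful operator.\<close>

definition spectral_decomposition ::
  "(real ^ 'n ^ 'n) measure \<Rightarrow> real \<Rightarrow> real \<Rightarrow> real \<Rightarrow>
   (complex \<Rightarrow> 'n::finite operator) \<Rightarrow> (complex \<Rightarrow> 'n operator) \<Rightarrow> bool" where
  "spectral_decomposition \<mu> \<gamma> s \<delta> Proj N \<longleftrightarrow>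
     (\<forall>z\<in>ball 0 \<delta>. s + Re z \<in> I_mu \<mu>) \<and>
     (\<exists>K lam.
        analytic_extension_at (kappa \<mu>) s \<delta> K \<and>
        lam = (\<lambda>z. exp (- of_real (deriv (Lambda \<mu>) s) * z)
                     * (K (of_real s + z) / of_real (kappa \<mu> s))) \<and>
        lam analytic_on ball 0 \<delta> \<and>
        (\<forall>z\<in>ball 0 \<delta>. \<forall>n\<ge>1. \<forall>\<phi>\<in>space_B \<gamma>.
           (R_op \<mu> s z ^^ n) \<phi> = (\<lambda>v. lam z ^ n * Proj z \<phi> v + (N z ^^ n) \<phi> v))) \<and>
     op_analytic_on \<gamma> Proj (ball 0 \<delta>) \<and>
     op_analytic_on \<gamma> N (ball 0 \<delta>) \<and>
     (\<forall>z\<in>ball 0 \<delta>. \<forall>\<phi>\<in>space_B \<gamma>.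
        Proj z (N z \<phi>) = (\<lambda>v. 0) \<and> N z (Proj z \<phi>) = (\<lambda>v. 0)) \<and>
     (\<forall>\<phi>\<in>space_B \<gamma>. \<forall>v\<in>simplex_S. Proj 0 \<phi> v = pi_s \<mu> s \<phi>)"

end

theory Submission
 imports Defs "HOL-Complex_Analysis.Cauchy_Integral_Formula" "HOL-Library.Function_Algebras"
begin

abbreviation "\<S> \<equiv> simplex_S"

text \<open>A positive matrix contracts the Hilbert metric (Birkhoff). Lifted to functions that are
 homogeneous of degree \<open>s\<close> on the cone, where the transfer operator is \<open>A F x = \<integral> F (g x) \<mu>(dg)\<close>,
 this makes the oscillation of the ratio of two iterates \<open>A^n F / A^n G\<close> decay geometrically. The
 limits of such ratios define \<open>\<kappa>(s)\<close> and a positive functional on continuous functions, hence by the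
 Riesz representation theorem the eigenmeasure; the same for the transposed law gives \<open>\<nu>\<^sub>s\<^sup>*\<close>, and
 Fubini shows that \<open>r\<^sub>s\<close> is an eigenfunction. Taking \<open>G = r\<^sub>s\<close>, one obtains the spectral gap of
 \<open>P\<^sub>s\<close> on the Hoelder space.

 For complex \<open>w\<close> near \<open>s\<close> no holomorphic functional calculus is needed: in a norm in which
 \<open>P\<^sub>s\<close> contracts the kernel of the eigenfunctional \<open>l\<close> in one step, the normalized iterates
 \<open>P\<^sub>w^n r\<^sub>s / l(P\<^sub>w^n r\<^sub>s)\<close> and \<open>l(P\<^sub>w^n f) / l(P\<^sub>w^n r\<^sub>s)\<close> converge geometrically and uniformly in \<open>w\<close>, so
 eigenvector, eigenfunctional and eigenvalue are holomorphic. Multiplication by \<open>r\<^sub>s\<close> conjugates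
 \<open>R\<^sub>s\<^sub>,\<^sub>z\<close> to a multiple of \<open>P\<^sub>s\<^sub>+\<^sub>z\<close>. A spectral gap near one point \<open>s\<close> serves all nearby real
 parameters, and a finite cover of \<open>J\<close> gives the uniform bound.\<close>

text \<open>The obstacle is the sign of \<open>s\<close>: \<open>t powr s\<close> increases for
  \<open>s > 0\<close> and decreases for \<open>s < 0\<close>, and comparable columns alone give no
  lower bound for the norm of \<open>g *v v\<close> in terms of \<open>mnorm g\<close>. Both signs
  are handled by one class of order-respecting homogeneous functions, where the loss is always a
  power \<open>\<bar>s\<bar>\<close> of a cross ratio. The decay of ratios is a Doeblin argument:
  for positive \<open>F\<close> the weights \<open>F (G x) / A^n F x\<close> form a Markov kernel
  over random products \<open>G\<close>, kernels with different starting points have a common part,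
  and the contraction of the metric controls the rest. The transposed law also yields the
  eigenvalue: in \<open>x \<bullet> G_n 1\<close> the leftmost factor of \<open>G_n\<close> can be
  moved to \<open>x\<close> as its transpose, so the moments defining \<open>\<kappa>(s)\<close> are
  iterates of the transposed operator; the eigenfunction \<open>r_s\<close> then identifies the
  eigenvalue of the direct operator with \<open>\<kappa>(s)\<close>. In the perturbation argument
  all rates are \<open>1 - j \<epsilon>\<close> with \<open>\<epsilon>\<close> an eighth of the gap,
  and holomorphy is proved for scalar functions only; Cauchy's estimates lift it to the operator
  norm.\<close>

section \<open>Riesz representation of a positive functional on a compact metric space\<close>

locale positive_functional =
 fixes S :: "'a::metric_space set" and L :: "('a => real) => real"
 assumes compact: "compact S"
  and L_add: "!!f g. continuous_on S f ==> continuous_on S g ==> L (%x. f x + g x) = L f + L g"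
  and L_scale: "!!c f. continuous_on S f ==> L (%x. c * f x) = c * L f"
  and L_pos: "!!f. continuous_on S f ==> (!!x. x \<in> S ==> 0 <= f x) ==> 0 <= L f"
  and L_one: "L (%x. 1) = 1"
begin

lemma L_diff:
 assumes "continuous_on S f" "continuous_on S g"
 shows "L (%x. f x - g x) = L f - L g"
 using L_add[OF assms(1) continuous_on_mult_left[OF assms(2), of "-1"]] L_scale[OF assms(2), of "-1"]
 by simp

lemma L_mono:
 assumes "continuous_on S f" "continuous_on S g" "!!x. x \<in> S ==> f x <= g x"
 shows "L f <= L g"
 using L_pos[of "%x. g x - f x"] L_diff[OF assms(2,1)] assms by (auto intro: continuous_on_diff)

lemma L_sum:
 fixes n :: nat
 assumes "!!i. i < n ==> continuous_on S (f i)"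
 shows "L (%x. \<Sum>i<n. f i x) = (\<Sum>i<n. L (f i))"
 using assms
proof (induction n)
 case 0
 then show ?case using L_scale[of "%_. 0" 0] by simp
next
 case (Suc n)
 have "L (%x. (\<Sum>i<n. f i x) + f n x) = L (%x. \<Sum>i<n. f i x) + L (f n)"
  by (intro L_add continuous_on_sum) (auto intro: Suc.prems)
 then show ?case using Suc by simp
qed

text \<open>Sequences of non-negative continuous functions take the place of covers by open sets:
  the cost of a cover is read off from \<open>L\<close> directly, without first assigning a content
  to open sets.\<close>

definition cover :: "'a set => (nat => 'a => real) => bool" where
 "cover A f \<longleftrightarrow> (\<forall>n. continuous_on S (f n)) & (\<forall>n. \<forall>x\<in>S. 0 <= f n x) &
   (\<forall>x\<in>A. 1 <= (\<Sum>n. ennreal (f n x)))"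

definition outer :: "'a set => ennreal" where
 "outer A = (INF f\<in>{f. cover A f}. \<Sum>n. ennreal (L (f n)))"

lemma outer_le: "cover A f ==> outer A <= (\<Sum>n. ennreal (L (f n)))"
 unfolding outer_def by (intro INF_lower) simp

lemma outer_le_single:
 assumes "continuous_on S f" "!!x. x \<in> S ==> 0 <= f x" "!!x. x \<in> A ==> 1 <= f x"
 shows "outer A <= ennreal (L f)"
proof -
 define F where "F = (%n x. if n = (0::nat) then f x else 0)"
 have L0: "L (%x. 0) = 0" using L_scale[of "%_. 0" 0] by simp
 have *: "(\<Sum>n. ennreal (F n x)) = ennreal (f x)" for x
  by (subst suminf_finite[of "{0}"]) (auto simp: F_def)
 have "continuous_on S (F n)" for n using assms(1) by (cases "n = 0") (auto simp: F_def)
 then have "cover A F"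
  unfolding cover_def * using assms by (auto simp: F_def one_ennreal_def[symmetric] ennreal_leI simp flip: ennreal_1)
 moreover have "(\<Sum>n. ennreal (L (F n))) = ennreal (L f)"
  by (subst suminf_finite[of "{0}"]) (auto simp: F_def L0)
 ultimately show ?thesis using outer_le by metis
qed

lemma outer_close:
 assumes "A \<subseteq> S" "0 < e"
 obtains f where "cover A f" "(\<Sum>n. ennreal (L (f n))) <= outer A + ennreal e"
proof -
 have "outer A <= 1" using outer_le_single[of "%_. 1" A] by (simp add: L_one)
 then have fin: "outer A ~= \<infinity>" by (auto simp: top_unique)
 then have "outer A < outer A + ennreal e"
  using assms(2) by (simp add: ennreal_add_left_cancel_less[of _ 0, simplified])
 then obtain f where "cover A f" "(\<Sum>n. ennreal (L (f n))) < outer A + ennreal e"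
  unfolding outer_def INF_less_iff by auto
 then show ?thesis using that by (auto intro: less_imp_le)
qed

lemma outer_mono: "A \<subseteq> B ==> outer A <= outer B"
 unfolding outer_def by (intro INF_superset_mono) (auto simp: cover_def subset_iff)

lemma outer_empty: "outer {} = 0"
proof -
 have "cover {} (%_ _. 0)" by (simp add: cover_def)
 from outer_le[OF this] show ?thesis using L_scale[of "%_. 0" 0] by simp
qed

text \<open>A doubly indexed cover is flattened along the pairing of indices. This serves countable
  subadditivity as well as \<open>outer_split\<close>, where each function of a cover is itself cut
  into infinitely many pieces.\<close>

lemma cover_pairs:
 assumes "!!i j. continuous_on S (f i j)" "!!i j x. x \<in> S ==> 0 <= f i j x"
  and "!!x. x \<in> A ==> 1 <= (\<Sum>i. \<Sum>j. ennreal (f i j x))"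
 shows "outer A <= (\<Sum>i. \<Sum>j. ennreal (L (f i j)))"
proof -
 define F where "F n = (case prod_decode n of (i, j) => f i j)" for n
 have "(\<Sum>n. ennreal (F n x)) = (\<Sum>i. \<Sum>j. ennreal (f i j x))" for x
  using suminf_ennreal_2dimen[of "%i. \<Sum>j. ennreal (f i j x)" "%(i, j). ennreal (f i j x)"]
  by (simp add: F_def case_prod_beta')
 then have "cover A F"
  using assms unfolding cover_def by (auto simp: F_def case_prod_beta')
 moreover have "(\<Sum>n. ennreal (L (F n))) = (\<Sum>i. \<Sum>j. ennreal (L (f i j)))"
  using suminf_ennreal_2dimen[of "%i. \<Sum>j. ennreal (L (f i j))" "%(i, j). ennreal (L (f i j))"]
  by (simp add: F_def case_prod_beta')
 ultimately show ?thesis using outer_le by metis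
qed

lemma suminf_half_ennreal: "0 < e ==> (\<Sum>n. ennreal (e * (1/2) ^ Suc n)) = ennreal e"
 using sums_mult[OF power_half_series, of e] by (intro suminf_ennreal_eq) auto

lemma outer_subadd:
 fixes A :: "nat => 'a set"
 assumes A: "!!i. A i \<subseteq> S"
 shows "outer (\<Union>i. A i) <= (\<Sum>i. outer (A i))"
proof (rule ennreal_le_epsilon)
 fix e :: real assume e: "0 < e"
 have "\<exists>f. cover (A i) f & (\<Sum>n. ennreal (L (f n))) <= outer (A i) + ennreal (e * (1/2) ^ Suc i)" for i
  using outer_close[OF A[of i], of "e * (1/2) ^ Suc i"] e by (metis mult_pos_pos half_gt_zero_iff zero_less_one zero_less_power)
 then obtain f where f: "!!i. cover (A i) (f i)"
  "!!i. (\<Sum>n. ennreal (L (f i n))) <= outer (A i) + ennreal (e * (1/2) ^ Suc i)" by metis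
 have "outer (\<Union>i. A i) <= (\<Sum>i. \<Sum>j. ennreal (L (f i j)))"
 proof (rule cover_pairs)
  fix x assume "x \<in> (\<Union>i. A i)"
  then obtain i where "x \<in> A i" by auto
  then have "1 <= (\<Sum>j. ennreal (f i j x))" using f(1)[of i] by (auto simp: cover_def)
  also have "... <= (\<Sum>i. \<Sum>j. ennreal (f i j x))"
   using sum_le_suminf[of "%i. \<Sum>j. ennreal (f i j x)" "{i}"] by simp
  finally show "1 <= (\<Sum>i. \<Sum>j. ennreal (f i j x))" .
 qed (use f(1) in \<open>auto simp: cover_def\<close>)
 also have "... <= (\<Sum>i. outer (A i) + ennreal (e * (1/2) ^ Suc i))"
  by (intro suminf_le f(2)) auto
 also have "... = (\<Sum>i. outer (A i)) + ennreal e"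
  using suminf_half_ennreal[OF e] by (subst suminf_add[symmetric]) auto
 finally show "outer (\<Union>i. A i) <= (\<Sum>i. outer (A i)) + ennreal e" .
qed

lemma outer_measure_space_outer: "outer_measure_space (Pow S) outer"
 unfolding outer_measure_space_def positive_def increasing_def countably_subadditive_def
 using outer_empty outer_mono outer_subadd by (auto simp: Pow_def image_subset_iff)

lemma add_mono3: "a <= b + d ==> b + c = g ==> a + c <= g + d" for a b c d g :: ennreal
proof -
 assume "a <= b + d" "b + c = g"
 then have "a + c <= (b + d) + c" by (intro add_right_mono)
 also have "(b + d) + c = (b + c) + d" by (simp only: add.assoc add.commute add.left_commute)
 finally show "a + c <= g + d" using \<open>b + c = g\<close> by simp
qed

text \<open>Caratheodory's criterion for the open set \<open>{g > 0}\<close>. The cut-offs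
  \<open>G k = min 1 (k g)\<close> increase to its indicator, so the increments
  \<open>f n * (G (k+1) - G k)\<close> cover the part inside, while \<open>f n * (1 - G k)\<close>
  covers the part outside for every single \<open>k\<close>, because \<open>G k\<close> vanishes
  there. Cutting off the \<open>n\<close>-th function at a large index \<open>k n\<close> makes the
  two costs add up to \<open>L (f n)\<close> with a summable error.\<close>

lemma outer_split:
 fixes g :: "'a => real"
 assumes g: "continuous_on S g" "!!x. x \<in> S ==> 0 <= g x" and A: "A \<subseteq> S"
 shows "outer ({x\<in>S. 0 < g x} \<inter> A) + outer ((S - {x\<in>S. 0 < g x}) \<inter> A) <= outer A"
proof (rule ennreal_le_epsilon)
 fix e :: real assume e: "0 < e"
 obtain f where f: "cover A f" "(\<Sum>n. ennreal (L (f n))) <= outer A + ennreal (e/2)"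
  using outer_close[OF A, of "e/2"] e by auto
 have fc: "continuous_on S (f n)" and f0: "x \<in> S ==> 0 <= f n x" for n x
  using f(1) by (auto simp: cover_def)
 define G where "G k x = min 1 (real k * g x)" for k x
 have Gc: "continuous_on S (G k)" for k unfolding G_def by (intro continuous_intros g)
 have G01: "0 <= G k x" "G k x <= 1" "G k x <= G (Suc k) x" if "x \<in> S" for k x
  using g(2)[OF that] by (auto simp: G_def min_def algebra_simps intro: order_trans)
 have G0: "G 0 x = 0" for x by (simp add: G_def)
 have LG: "L (%x. f n x * (G (Suc k) x - G k x)) = L (%x. f n x * G (Suc k) x) - L (%x. f n x * G k x)" for n k
  unfolding right_diff_distrib by (intro L_diff continuous_intros fc Gc)
 have LGs: "(\<Sum>k<m. L (%x. f n x * (G (Suc k) x - G k x))) = L (%x. f n x * G m x)" for n m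
  using sum_lessThan_telescope[of "%k. L (%x. f n x * G k x)" m] L_scale[of "%_. 0" 0]
  unfolding LG by (simp add: G0)
 have LGpos: "0 <= L (%x. f n x * (G (Suc k) x - G k x))" for n k
  by (intro L_pos continuous_intros fc Gc) (use f0 G01 in \<open>auto simp: mult_nonneg_nonneg\<close>)
 have LGn: "0 <= L (%x. f n x * G k x)" for n k
  by (intro L_pos continuous_intros fc Gc) (use f0 G01 in \<open>auto simp: mult_nonneg_nonneg\<close>)
 \<comment> \<open>The increments telescope, so this series is the supremum over \<open>m\<close> of
   \<open>L (f n * G m)\<close>; being at most \<open>L (f n)\<close>, it is finite and can be
   approximated within the error allotted to \<open>n\<close>.\<close>
 define l where "l n = (\<Sum>k. ennreal (L (%x. f n x * (G (Suc k) x - G k x))))" for n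
 have l: "l n = (SUP m. ennreal (L (%x. f n x * G m x)))" for n
  unfolding l_def suminf_eq_SUP by (simp add: sum_ennreal LGpos LGs)
 have lfin: "l n <= ennreal (L (f n))" for n
  unfolding l
  by (intro SUP_least ennreal_leI L_mono continuous_intros fc Gc)
   (use f0 G01 in \<open>auto intro: mult_left_le\<close>)
 have "\<exists>k. l n <= ennreal (L (%x. f n x * G k x)) + ennreal (e/2 * (1/2) ^ Suc n)" for n
 proof -
  have "l n ~= \<infinity>" using lfin[of n] by (auto simp: top_unique)
  then show ?thesis
   using SUP_approx_ennreal[of "e/2 * (1/2) ^ Suc n" UNIV "l n" "%m. ennreal (L (%x. f n x * G m x))"] e l[of n]
   by (auto intro: less_imp_le)
 qed
 then obtain k where k: "!!n. l n <= ennreal (L (%x. f n x * G (k n) x)) + ennreal (e/2 * (1/2) ^ Suc n)"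
  by metis
 have c1: "outer ({x\<in>S. 0 < g x} \<inter> A) <= (\<Sum>n. l n)"
  unfolding l_def
 proof (rule cover_pairs)
  fix x assume x: "x \<in> {x\<in>S. 0 < g x} \<inter> A"
  have "(\<Sum>k. ennreal (f n x * (G (Suc k) x - G k x))) = ennreal (f n x)" for n
  proof -
   obtain m where m: "1 < real m * g x" using x reals_Archimedean3[of "g x"] by auto
   have "eventually (%j. G j x = 1) sequentially"
    using eventually_ge_at_top[of m]
   proof eventually_elim
    case (elim j)
    then have "real m * g x <= real j * g x" using x by (intro mult_right_mono) auto
    then show ?case using m by (simp add: G_def)
   qed
   then have "(%j. G j x) \<longlonglongrightarrow> 1" by (rule tendsto_eventually)
   then have "(%k. G (Suc k) x - G k x) sums (1 - G 0 x)" by (rule telescope_sums)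
   then have "(%k. f n x * (G (Suc k) x - G k x)) sums (f n x * 1)"
    unfolding G0 by (intro sums_mult) simp
   then show ?thesis using x f0 G01 by (intro suminf_ennreal_eq) (auto simp: mult_nonneg_nonneg)
  qed
  then show "1 <= (\<Sum>n. \<Sum>k. ennreal (f n x * (G (Suc k) x - G k x)))"
   using f(1) x by (auto simp: cover_def)
 qed (use f0 G01 in \<open>auto intro!: continuous_intros fc Gc simp: mult_nonneg_nonneg\<close>)
 have c2: "outer ((S - {x\<in>S. 0 < g x}) \<inter> A) <= (\<Sum>n. ennreal (L (%x. f n x * (1 - G (k n) x))))"
 proof (rule outer_le)
  have "G j x = 0" if "x \<in> S" "\<not> 0 < g x" for j x using g(2)[OF that(1)] that by (auto simp: G_def)
  then show "cover ((S - {x\<in>S. 0 < g x}) \<inter> A) (%n x. f n x * (1 - G (k n) x))"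
   using f(1) G01 unfolding cover_def by (auto intro!: continuous_intros fc Gc mult_nonneg_nonneg)
 qed
 have step: "l n + ennreal (L (%x. f n x * (1 - G (k n) x))) <= ennreal (L (f n)) + ennreal (e/2 * (1/2) ^ Suc n)" for n
 proof -
  have "L (%x. f n x * (1 - G (k n) x)) = L (f n) - L (%x. f n x * G (k n) x)"
   unfolding right_diff_distrib mult_1_right by (intro L_diff continuous_intros fc Gc)
  moreover have "L (%x. f n x * G (k n) x) <= L (f n)"
   by (intro L_mono continuous_intros fc Gc) (use f0 G01 in \<open>auto intro: mult_left_le\<close>)
  ultimately have "ennreal (L (%x. f n x * G (k n) x)) + ennreal (L (%x. f n x * (1 - G (k n) x))) = ennreal (L (f n))"
   using LGn[of n "k n"] by (simp flip: ennreal_plus)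
  then show ?thesis by (rule add_mono3[OF k[of n]])
 qed
 have "outer ({x\<in>S. 0 < g x} \<inter> A) + outer ((S - {x\<in>S. 0 < g x}) \<inter> A)
   <= (\<Sum>n. l n) + (\<Sum>n. ennreal (L (%x. f n x * (1 - G (k n) x))))"
  by (intro add_mono c1 c2)
 also have "... = (\<Sum>n. l n + ennreal (L (%x. f n x * (1 - G (k n) x))))"
  by (intro suminf_add) auto
 also have "... <= (\<Sum>n. ennreal (L (f n)) + ennreal (e/2 * (1/2) ^ Suc n))"
  by (intro suminf_le step) auto
 also have "... = (\<Sum>n. ennreal (L (f n))) + ennreal (e/2)"
 proof -
  have "(\<Sum>n. ennreal (L (f n)) + ennreal (e/2 * (1/2) ^ Suc n))
    = (\<Sum>n. ennreal (L (f n))) + (\<Sum>n. ennreal (e/2 * (1/2) ^ Suc n))"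
   by (rule suminf_add[symmetric]) auto
  then show ?thesis using suminf_half_ennreal[of "e/2"] e by (simp only: half_gt_zero)
 qed
 also have "... <= outer A + ennreal (e/2) + ennreal (e/2)"
  by (intro add_right_mono f(2))
 also have "... = outer A + ennreal e" using e by (simp add: add.assoc flip: ennreal_plus)
 finally show "outer ({x\<in>S. 0 < g x} \<inter> A) + outer ((S - {x\<in>S. 0 < g x}) \<inter> A) <= outer A + ennreal e" .
qed

lemma open_in_lambda_system:
 fixes g :: "'a => real"
 assumes "continuous_on S g" "!!x. x \<in> S ==> 0 <= g x"
 shows "{x\<in>S. 0 < g x} \<in> lambda_system S (Pow S) outer"
proof -
 interpret sigma_algebra S "Pow S" by (rule sigma_algebra_Pow)
 have "subadditive (Pow S) outer"
  using outer_measure_space_outer unfolding outer_measure_space_def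
  by (intro countably_subadditive_subadditive) auto
 then have "outer A <= outer ({x\<in>S. 0 < g x} \<inter> A) + outer ((S - {x\<in>S. 0 < g x}) \<inter> A)" if "A \<subseteq> S" for A
  using subadditiveD[of "Pow S" outer "{x\<in>S. 0 < g x} \<inter> A" "(S - {x\<in>S. 0 < g x}) \<inter> A"] that
  by (auto simp: Int_Un_distrib2[symmetric] Un_absorb1 Int_absorb1)
 then show ?thesis
  using outer_split[OF assms] by (auto simp: lambda_system_def intro: antisym)
qed

text \<open>The lower bound is Dini's argument: by compactness a finite partial sum of a cover of
  \<open>S\<close> exceeds \<open>1 - e\<close> everywhere, and \<open>L\<close> is monotone and
  normalized.\<close>

lemma outer_whole: "outer S = 1"
proof (rule antisym)
 show "outer S <= 1" using outer_le_single[of "%_. 1" S] by (simp add: L_one)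
 show "1 <= outer S"
  unfolding outer_def
 proof (rule INF_greatest, rule ennreal_le_epsilon, clarify)
  fix f and e :: real assume f: "cover S f" and e: "0 < e"
  have fc: "continuous_on S (f n)" and f0: "x \<in> S ==> 0 <= f n x" for n x
   using f(1) by (auto simp: cover_def)
  have "\<exists>N. \<forall>x\<in>S. 1 - e < (\<Sum>n<N. f n x)"
  proof (rule ccontr)
   assume "\<not> ?thesis"
   then obtain X where X: "!!N. X N \<in> S" "!!N. (\<Sum>n<N. f n (X N)) <= 1 - e" by (meson not_less)
   obtain x r where x: "x \<in> S" "strict_mono (r :: nat => nat)" "(X \<circ> r) \<longlonglongrightarrow> x"
    using compact X(1) unfolding compact_def by metis
   have "(\<Sum>n<M. f n x) <= 1 - e" for M
   proof (rule tendsto_upperbound)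
    have "continuous_on S (%x. \<Sum>n<M. f n x)" by (intro continuous_intros fc)
    then show "(%j. \<Sum>n<M. f n ((X \<circ> r) j)) \<longlonglongrightarrow> (\<Sum>n<M. f n x)"
     using x X(1) unfolding continuous_on_sequentially by (auto simp: o_def)
    show "eventually (%j. (\<Sum>n<M. f n ((X \<circ> r) j)) <= 1 - e) sequentially"
     using eventually_ge_at_top[of M]
    proof eventually_elim
     case (elim j)
     then have "M <= r j" using seq_suble[OF x(2), of j] by linarith
     then have "(\<Sum>n<M. f n ((X \<circ> r) j)) <= (\<Sum>n<r j. f n (X (r j)))"
      using f0 X(1) by (auto intro!: sum_mono2)
     then show ?case using X(2)[of "r j"] by linarith
    qed
   qed simp
   then have "(\<Sum>n. ennreal (f n x)) <= ennreal (1 - e)"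
    unfolding suminf_eq_SUP using f0 x(1) by (intro SUP_least) (simp add: sum_ennreal ennreal_leI)
   moreover have "1 <= (\<Sum>n. ennreal (f n x))" using f x(1) by (auto simp: cover_def)
   ultimately have "ennreal 1 <= ennreal (1 - e)" by (metis ennreal_1 order_trans)
   then show False using e by (cases "0 <= 1 - e") (auto simp: ennreal_neg)
  qed
  then obtain N where N: "\<forall>x\<in>S. 1 - e < (\<Sum>n<N. f n x)" by auto
  have "L (%x. (1 - e) * 1) <= L (%x. \<Sum>n<N. f n x)"
   using N by (intro L_mono continuous_intros fc) (auto intro: less_imp_le)
  also have "... = (\<Sum>n<N. L (f n))" by (intro L_sum fc)
  finally have "1 <= (\<Sum>n<N. L (f n)) + e" using L_scale[of "%_. 1" "1 - e"] L_one by simp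
  then have "1 <= ennreal ((\<Sum>n<N. L (f n)) + e)" by (metis ennreal_1 ennreal_leI)
  also have "... = (\<Sum>n<N. ennreal (L (f n))) + ennreal e"
   using L_pos[OF fc f0] e by (simp add: ennreal_plus sum_nonneg sum_ennreal)
  also have "... <= (\<Sum>n. ennreal (L (f n))) + ennreal e"
   by (intro add_right_mono sum_le_suminf) auto
  finally show "1 <= (\<Sum>n. ennreal (L (f n))) + ennreal e" .
 qed
qed

lemma borel_subset_lambda_system:
 "sets (restrict_space borel S) \<subseteq> lambda_system S (Pow S) outer"
proof -
 interpret sigma_algebra S "Pow S" by (rule sigma_algebra_Pow)
 have "measure_space S (lambda_system S (Pow S) outer) outer"
  by (rule caratheodory_lemma[OF outer_measure_space_outer])
 then interpret ls: sigma_algebra S "lambda_system S (Pow S) outer"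
  by (simp add: measure_space_def)
 have op: "S \<inter> U \<in> lambda_system S (Pow S) outer" if U: "open U" for U
 \<comment> \<open>\<open>infdist\<close> to the empty set is 0 by convention, so the distance to
   the complement describes only proper open sets.\<close>
 proof (cases "U = UNIV")
  case True then show ?thesis using ls.top by simp
 next
  case False
  have "S \<inter> U = {x\<in>S. 0 < infdist x (-U)}"
   using in_closed_iff_infdist_zero[of "-U"] U False infdist_nonneg
   by (auto simp: less_le)
  moreover have "continuous_on S (%x. infdist x (-U))" by (intro continuous_intros)
  ultimately show ?thesis using open_in_lambda_system infdist_nonneg by metis
 qed
 have "S \<inter> B \<in> lambda_system S (Pow S) outer" if "B \<in> sigma_sets UNIV {U. open U}" for B
  using that
 proof induction
  case (Basic a) then show ?case using op by simp
 next
  case Empty then show ?case by simp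
 next
  case (Compl a)
  have "S \<inter> (UNIV - a) = S - (S \<inter> a)" by auto
  then show ?case using ls.compl_sets[OF Compl.IH] by simp
 next
  case (Union a)
  then have "(\<Union>i. S \<inter> a i) \<in> lambda_system S (Pow S) outer" by (intro ls.countable_UN) auto
  then show ?case by (simp only: Int_UN_distrib)
 qed
 then show ?thesis unfolding sets_restrict_space borel_def by (auto simp: sets_measure_of_conv)
qed

definition rep :: "'a measure" where
 "rep = measure_of S (sets (restrict_space borel S)) outer"

lemma sets_rep: "sets rep = sets (restrict_space borel S)"
 and space_rep: "space rep = S"
 and emeasure_rep: "A \<in> sets (restrict_space borel S) ==> emeasure rep A = outer A"
proof -
 have sa: "sigma_algebra S (sets (restrict_space borel S))"
  using sets.sigma_algebra_axioms[of "restrict_space borel S"] by (simp add: space_restrict_space)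
 interpret P: sigma_algebra S "Pow S" by (rule sigma_algebra_Pow)
 have "measure_space S (sets (restrict_space borel S)) outer"
  by (rule measure_down[OF P.caratheodory_lemma[OF outer_measure_space_outer] sa borel_subset_lambda_system])
 then have "countably_additive (sets (restrict_space borel S)) outer"
  "positive (sets (restrict_space borel S)) outer"
  by (auto simp: measure_space_def)
 then show "A \<in> sets (restrict_space borel S) ==> emeasure rep A = outer A"
  unfolding rep_def using sa by (intro emeasure_measure_of_sigma)
 show "sets rep = sets (restrict_space borel S)" "space rep = S"
  using sa unfolding rep_def
  by (simp_all add: sigma_algebra.sets_measure_of_eq sigma_algebra.space_measure_of_eq)
qed

lemma prob_space_rep: "prob_space rep"
proof
 have "S \<in> sets (restrict_space borel S)"
  using sets.top[of "restrict_space borel S"] by (simp add: space_restrict_space)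
 then show "emeasure rep (space rep) = 1"
  by (simp add: space_rep emeasure_rep outer_whole)
qed

lemma measurable_rep: "continuous_on S f ==> f \<in> borel_measurable rep"
 for f :: "'a => 'b::topological_space"
 using borel_measurable_continuous_on_restrict[of S f] by (simp add: measurable_cong_sets[OF sets_rep refl])

text \<open>A layer-cake comparison: \<open>F i\<close> is the slice of \<open>f\<close> between the
  heights \<open>i/N\<close> and \<open>(i+1)/N\<close>. On \<open>E i\<close> the function
  \<open>N * F i\<close> equals 1, which bounds the measure of \<open>E i\<close> by
  \<open>N * L (F i)\<close>; summing the layers recovers the integral up to
  \<open>1/N\<close>.\<close>

lemma integral_rep_le:
 assumes f: "continuous_on S f" and f01: "!!x. x \<in> S ==> 0 <= f x & f x <= 1"
 shows "(\<integral>x. f x \<partial>rep) <= L f"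
proof -
 interpret prob_space rep by (rule prob_space_rep)
 note meas = measurable_rep[OF f, measurable]
 have fint: "integrable rep f"
  using f01 by (intro integrable_const_bound[of _ 1] AE_I2) (auto simp: space_rep abs_le_iff)
 have "(\<integral>x. f x \<partial>rep) <= L f + 1 / real N" if N: "0 < N" for N :: nat
 proof -
  define F where "F i x = min (max (f x - real i / N) 0) (1 / N)" for i :: nat and x
  define E where "E i = {x\<in>space rep. real (Suc i) / N <= f x}" for i
  have E[measurable]: "E i \<in> sets rep" for i unfolding E_def by measurable
  have Fc: "continuous_on S (F i)" for i unfolding F_def by (intro continuous_intros f)
  have sumF: "(\<Sum>i<n. F i x) = min (max (f x) 0) (real n / N)" for n x
  proof (induction n)
   case (Suc n)
   have "(\<Sum>i<Suc n. F i x) = min (max (f x) 0) (real n / N) + F n x" by (simp add: Suc)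
   also have "... = min (max (f x) 0) (real (Suc n) / N)"
   proof -
    define y where "y = real n / N"
    define z where "z = 1 / real N"
    have "real (Suc n) / N = y + z" by (simp add: y_def z_def add_divide_distrib)
    moreover have "0 <= y" "0 < z" using N by (auto simp: y_def z_def)
    ultimately show ?thesis unfolding F_def y_def[symmetric] z_def[symmetric] by (auto simp: min_def max_def)
   qed
   finally show ?case .
  qed (use N in auto)
  have mE: "measure rep (E i) <= N * L (F i)" for i
  proof -
   have "1 <= N * F i x" if "x \<in> E i" for x
   proof -
    have "1 / N <= f x - real i / N" using that by (simp add: E_def add_divide_distrib)
    moreover have "0 < 1 / real N" using N by simp
    ultimately have "F i x = 1 / N" unfolding F_def by linarith
    then show ?thesis using N by simp
   qed
   then have "emeasure rep (E i) <= ennreal (L (%x. N * F i x))"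
    using E[of i] N unfolding sets_rep emeasure_rep[OF E[unfolded sets_rep]]
    by (intro outer_le_single continuous_intros Fc) (auto simp: F_def)
   moreover have "0 <= L (%x. N * F i x)" by (intro L_pos continuous_intros Fc) (auto simp: F_def)
   ultimately show ?thesis using L_scale[OF Fc] by (simp add: emeasure_eq_measure)
  qed
  have pt: "f x <= 1 / N + (\<Sum>i<N. (1/N) * indicator (E i) x)" if x: "x \<in> space rep" for x
  proof -
   have "F i x <= (1/N) * indicator (E (i - 1)) x" if "0 < i" for i
    using that x N by (auto simp: F_def E_def indicator_def field_simps min_def max_def)
   then have "F (Suc i) x <= (1/N) * indicator (E i) x" for i using diff_Suc_1 by (metis zero_less_Suc)
   then have "(\<Sum>i<N. F (Suc i) x) <= (\<Sum>i<N. (1/N) * indicator (E i) x)" by (intro sum_mono)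
   moreover have "(\<Sum>i<Suc N. F i x) = F 0 x + (\<Sum>i<N. F (Suc i) x)" by (rule sum.lessThan_Suc_shift)
   moreover have "F 0 x <= 1/N" by (simp add: F_def)
   moreover have "f x <= (\<Sum>i<Suc N. F i x)"
   proof -
    have "0 <= f x" "f x <= 1" using f01[of x] x by (auto simp: space_rep)
    moreover have "1 <= real (Suc N) / N" using N by simp
    ultimately show ?thesis unfolding sumF by simp
   qed
   ultimately show ?thesis by linarith
  qed
  have Ei: "integrable rep (indicator (E i) :: _ => real)" for i
   by (intro integrable_real_indicator E) (simp add: emeasure_eq_measure)
  have "(\<integral>x. f x \<partial>rep) <= (\<integral>x. 1 / N + (\<Sum>i<N. (1/N) * indicator (E i) x) \<partial>rep)"
   using pt by (intro integral_mono fint Bochner_Integration.integrable_add Bochner_Integration.integrable_sum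
     integrable_mult_right integrable_const Ei) auto
  also have "... = 1 / N + (\<Sum>i<N. (1/N) * measure rep (E i))"
   using Ei by (subst Bochner_Integration.integral_add) (auto simp: prob_space)
  also have "... <= 1 / N + (\<Sum>i<N. L (F i))"
   using mE N by (intro add_left_mono sum_mono) (simp add: field_simps)
  also have "(\<Sum>i<N. L (F i)) = L (%x. \<Sum>i<N. F i x)" by (simp add: L_sum Fc)
  also have "... <= L f"
   using f01 N unfolding sumF by (intro L_mono continuous_intros f) (auto simp: min_def max_def)
  finally show ?thesis by simp
 qed
 then have "\<forall>N. (\<integral>x. f x \<partial>rep) <= L f + 1 / real (Suc N)" by blast
 moreover have "(%N. L f + 1 / real (Suc N)) \<longlonglongrightarrow> L f + 0"
  using lim_inverse_n' by (intro tendsto_intros) (simp add: LIMSEQ_Suc[OF lim_1_over_n] del: of_nat_Suc)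
 ultimately show ?thesis by (intro LIMSEQ_le_const[of "%N. L f + 1 / real (Suc N)" "L f"]) auto
qed

theorem integral_rep:
 assumes f: "continuous_on S f"
 shows "(\<integral>x. f x \<partial>rep) = L f"
proof -
 interpret prob_space rep by (rule prob_space_rep)
 obtain B where B: "!!x. x \<in> S ==> \<bar>f x\<bar> <= B"
  using compact_imp_bounded[OF compact_continuous_image[OF f compact]] by (auto simp: bounded_iff)
 define D where "D = max B 1"
 have D: "0 < D" and BD: "!!x. x \<in> S ==> \<bar>f x\<bar> <= D" using B by (auto simp: D_def max_def intro: order_trans)
 have fint: "integrable rep f"
  using BD by (intro integrable_const_bound[of _ D] AE_I2 measurable_rep f) (auto simp: space_rep)
 \<comment> \<open>The one-sided estimate is applied to \<open>c f + 1/2\<close>, which has values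
   in \<open>[0, 1]\<close>, with \<open>c\<close> of either sign; this yields both
   inequalities.\<close>
 have *: "c * (\<integral>x. f x \<partial>rep) + 1/2 <= c * L f + 1/2" if c: "\<bar>c\<bar> = 1 / (2 * D)" for c
 proof -
  have "(\<integral>x. c * f x + 1/2 * 1 \<partial>rep) <= L (%x. c * f x + 1/2 * 1)"
  proof (intro integral_rep_le continuous_intros f)
   fix x assume "x \<in> S"
   then have "\<bar>c * f x\<bar> <= 1 / (2 * D) * D" unfolding abs_mult c using BD D by (intro mult_left_mono) auto
   then show "0 <= c * f x + 1/2 * 1 & c * f x + 1/2 * 1 <= 1" using D by auto
  qed
  also have "... = c * L f + 1/2"
   using L_add[of "%x. c * f x" "%x. 1/2 * 1"] L_scale[OF f] L_scale[of "%_. 1" "1/2"] L_one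
   by (simp add: continuous_intros f)
  finally show ?thesis using fint by (simp add: prob_space)
 qed
 from *[of "1 / (2 * D)"] *[of "- 1 / (2 * D)"] D show ?thesis by (simp add: field_simps)
qed

end

section \<open>Geometric convergence in Banach spaces of functions\<close>

definition sc :: "complex => ('x => complex) => 'x => complex" where
 "sc c f = (%x. c * f x)"

lemma sc_apply [simp]: "sc c f x = c * f x" by (simp add: sc_def)

text \<open>\<open>d\<close> is kept abstract so that the same telescoping serves complex sequences
  and sequences in a function space.\<close>

lemma geometric_increments:
 fixes d :: "nat => nat => real"
 assumes refl: "!!n. d n n = 0" and tri: "!!n m. d n (Suc m) <= d n m + d m (Suc m)"
  and inc: "!!n. d n (Suc n) <= B * q ^ n" and q: "0 <= q" "q < 1" and "0 <= B" and "n <= m"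
 shows "d n m <= B * q ^ n / (1 - q)"
proof -
 have *: "d n (n + k) <= B * q ^ n * (\<Sum>j<k. q ^ j)" for k
 proof (induction k)
  case 0 then show ?case by (simp add: refl)
 next
  case (Suc k)
  have "d n (n + Suc k) <= d n (n + k) + d (n + k) (Suc (n + k))" using tri by simp
  also have "... <= B * q ^ n * (\<Sum>j<k. q ^ j) + B * q ^ (n + k)" by (intro add_mono Suc inc)
  finally show ?case by (simp add: algebra_simps power_add)
 qed
 have "(\<Sum>j<k. q ^ j) <= 1 / (1 - q)" for k
  using sum_gp_strict[of q k] q by (simp add: divide_right_mono)
 then have "B * q ^ n * (\<Sum>j<m - n. q ^ j) <= B * q ^ n * (1 / (1 - q))"
  using q assms(6) by (intro mult_left_mono) auto
 then show ?thesis using *[of "m - n"] \<open>n <= m\<close> by simp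
qed

lemma geometric_increments_lim:
 fixes x :: "nat => complex"
 assumes inc: "!!n. cmod (x (Suc n) - x n) <= B * q ^ n" and q: "0 <= q" "q < 1"
 shows "x \<longlonglongrightarrow> lim x" "cmod (x n - lim x) <= B * q ^ n / (1 - q)"
proof -
 have B: "0 <= B" using order_trans[OF norm_ge_zero inc[of 0]] by simp
 have *: "cmod (x m - x n) <= B * q ^ n / (1 - q)" if "n <= m" for n m
 proof (rule geometric_increments[of "%n m. cmod (x m - x n)", OF _ _ inc q B that])
  show "cmod (x (Suc m) - x n) <= cmod (x m - x n) + cmod (x (Suc m) - x m)" for n m
   using norm_triangle_ineq[of "x m - x n" "x (Suc m) - x m"] by simp
 qed simp
 have t0: "(%n. B * q ^ n / (1 - q)) \<longlonglongrightarrow> B * 0 / (1 - q)"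
  using q by (intro tendsto_intros LIMSEQ_power_zero) auto
 have "Cauchy x"
 proof (rule metric_CauchyI)
  fix e :: real assume "0 < e"
  then obtain N where N: "!!n. n >= N ==> B * q ^ n / (1 - q) < e / 2"
   using order_tendstoD(2)[OF t0, of "e / 2"] by (auto simp: eventually_sequentially)
  have "dist (x m) (x n) < e" if "N <= m" "N <= n" for m n
   using *[OF that(1)] *[OF that(2)] N[OF order_refl] dist_triangle2[of "x m" "x n" "x N"]
   unfolding dist_norm by linarith
  then show "\<exists>M. \<forall>m\<ge>M. \<forall>n\<ge>M. dist (x m) (x n) < e" by blast
 qed
 then show l: "x \<longlonglongrightarrow> lim x" by (simp add: Cauchy_convergent_iff convergent_LIMSEQ_iff)
 have "(%m. cmod (x m - x n)) \<longlonglongrightarrow> cmod (lim x - x n)" by (intro tendsto_intros l)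
 then have "cmod (lim x - x n) <= B * q ^ n / (1 - q)"
  by (rule LIMSEQ_le_const2) (use * in blast)
 then show "cmod (x n - lim x) <= B * q ^ n / (1 - q)" by (simp add: norm_minus_commute)
qed

text \<open>The norm dominates every point evaluation (\<open>nm_ev\<close>), so limits in norm are
  pointwise limits and identities between limits of operators can be verified point by
  point.\<close>

locale fspace =
 fixes V :: "('x => complex) set" and nm :: "('x => complex) => real"
 assumes V_0: "0 \<in> V"
  and V_add: "f \<in> V ==> h \<in> V ==> f + h \<in> V"
  and V_sc: "f \<in> V ==> sc c f \<in> V"
  and nm_add: "f \<in> V ==> h \<in> V ==> nm (f + h) <= nm f + nm h"
  and nm_sc: "f \<in> V ==> nm (sc c f) = cmod c * nm f"
  and nm_ev: "f \<in> V ==> cmod (f x) <= nm f"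
  and complete: "(!!n. F n \<in> V) ==> (!!e. 0 < e ==> \<exists>N. \<forall>n\<ge>N. \<forall>m\<ge>N. nm (F n - F m) < e) ==>
    \<exists>f\<in>V. (%n. nm (F n - f)) \<longlonglongrightarrow> 0"
begin

lemma minus_sc: "f - h = f + sc (-1) h" by (rule ext) simp

lemma V_diff: "f \<in> V ==> h \<in> V ==> f - h \<in> V"
 unfolding minus_sc by (intro V_add V_sc)

lemma nm_diff: "f \<in> V ==> h \<in> V ==> nm (f - h) <= nm f + nm h"
 unfolding minus_sc using nm_add[of f "sc (-1) h"] by (simp add: V_sc nm_sc)

lemma nm_nonneg: "f \<in> V ==> 0 <= nm f"
 using nm_ev[of f undefined] norm_ge_zero order_trans by blast

lemma nm_0: "nm 0 = 0"
proof -
 have "sc 0 0 = (0 :: 'x => complex)" by (rule ext) simp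
 then show ?thesis using nm_sc[OF V_0, of 0] by simp
qed

lemma nm_zero [simp]: "nm (%x. 0) = 0" using nm_0 by (simp add: zero_fun_def)

lemma nm_diff_commute: "f \<in> V ==> h \<in> V ==> nm (f - h) = nm (h - f)"
proof -
 assume "f \<in> V" "h \<in> V"
 moreover have "f - h = sc (-1) (h - f)" by (rule ext) simp
 ultimately show ?thesis using nm_sc[of "h - f" "-1"] by (simp add: V_diff)
qed

lemma nm_diff_triangle: "f \<in> V ==> h \<in> V ==> \<xi> \<in> V ==> nm (f - h) <= nm (f - \<xi>) + nm (\<xi> - h)"
 using nm_add[of "f - \<xi>" "\<xi> - h"] by (simp add: V_diff)

lemma geometric_limit:
 assumes V: "!!n. F n \<in> V" and inc: "!!n. nm (F (Suc n) - F n) <= B * q ^ n" and q: "0 <= q" "q < 1"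
 shows "\<exists>f\<in>V. (\<forall>x. (%n. F n x) \<longlonglongrightarrow> f x) & (\<forall>n. nm (F n - f) <= B * q ^ n / (1 - q))"
proof -
 have B: "0 <= B" using order_trans[OF nm_nonneg inc[of 0]] V by (simp add: V_diff)
 have *: "nm (F n - F m) <= B * q ^ n / (1 - q)" if "n <= m" for n m
 proof (rule geometric_increments[OF _ _ _ q B that])
  show "nm (F n - F (Suc n)) <= B * q ^ n" for n using inc[of n] V nm_diff_commute by metis
  show "nm (F n - F (Suc m)) <= nm (F n - F m) + nm (F m - F (Suc m))" for n m
   by (intro nm_diff_triangle V)
 qed simp
 have t0: "(%n. B * q ^ n / (1 - q)) \<longlonglongrightarrow> B * 0 / (1 - q)"
  using q by (intro tendsto_intros LIMSEQ_power_zero) auto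
 have "\<exists>N. \<forall>n\<ge>N. \<forall>m\<ge>N. nm (F n - F m) < e" if "0 < e" for e
 proof -
  have "\<exists>N. \<forall>n\<ge>N. B * q ^ n / (1 - q) < e"
   using order_tendstoD(2)[OF t0, of e] that by (auto simp: eventually_sequentially)
  then obtain N where N: "!!n. n >= N ==> B * q ^ n / (1 - q) < e" by blast
  have "nm (F n - F m) < e" if "N <= n" "N <= m" for n m
  proof (cases "n <= m")
   case True then show ?thesis using *[OF True] N[OF that(1)] by linarith
  next
   case False then show ?thesis using *[of m n] N[OF that(2)] nm_diff_commute[OF V[of n] V[of m]] by auto
  qed
  then show ?thesis by blast
 qed
 then obtain f where f: "f \<in> V" "(%n. nm (F n - f)) \<longlonglongrightarrow> 0"
  using complete[of F] V by blast
 have "(%n. F n x) \<longlonglongrightarrow> f x" for x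
 proof (rule LIM_zero_cancel, rule Lim_null_comparison[OF _ f(2)])
  show "\<forall>\<^sub>F n in sequentially. norm (F n x - f x) <= nm (F n - f)"
   using nm_ev[OF V_diff[OF V f(1)], of _ x] by (intro always_eventually allI) auto
 qed
 moreover have "nm (F n - f) <= B * q ^ n / (1 - q)" for n
 proof (rule LIMSEQ_le_const[of "%m. B * q ^ n / (1 - q) + nm (F m - f)"])
  show "(%m. B * q ^ n / (1 - q) + nm (F m - f)) \<longlonglongrightarrow> B * q ^ n / (1 - q)"
   using tendsto_add[OF tendsto_const f(2)] by simp
  show "\<exists>N. \<forall>m\<ge>N. nm (F n - f) <= B * q ^ n / (1 - q) + nm (F m - f)"
   using * nm_diff_triangle[OF V f(1) V] by (intro exI[of _ n]) (meson add_right_mono order_trans)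
 qed
 ultimately show ?thesis using f(1) by blast
qed

end

section \<open>Analytic perturbation of a simple dominant eigenvalue by power iteration\<close>

text \<open>The analytic input consists of \<open>T_hol\<close> and \<open>l_hol\<close>: pointwise
  holomorphic bounded families are sent to holomorphic functions. The factor
  \<open>(1 + nm h)^2 (1 + \<Lambda>)\<close> in \<open>small\<close> majorizes the combinations of
  constants by which \<open>\<eta>\<close> is multiplied in the estimates.\<close>

locale perturbed_family = fspace V nm
 for V :: "('x => complex) set" and nm :: "('x => complex) => real" +
 fixes T :: "complex => ('x => complex) => 'x => complex" and D :: "complex set" and w0 :: complex
  and l :: "('x => complex) => complex" and h :: "'x => complex" and \<theta> \<eta> \<Lambda> \<epsilon> :: real
 assumes open_D: "open D" and w0: "w0 \<in> D"
  and T_V: "w \<in> D ==> \<phi> \<in> V ==> T w \<phi> \<in> V"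
  and T_add: "w \<in> D ==> \<phi> \<in> V ==> \<psi> \<in> V ==> T w (\<phi> + \<psi>) = T w \<phi> + T w \<psi>"
  and T_sc: "w \<in> D ==> \<phi> \<in> V ==> T w (sc c \<phi>) = sc c (T w \<phi>)"
  and l_add: "\<phi> \<in> V ==> \<psi> \<in> V ==> l (\<phi> + \<psi>) = l \<phi> + l \<psi>"
  and l_sc: "\<phi> \<in> V ==> l (sc c \<phi>) = c * l \<phi>"
  and l_bound: "\<phi> \<in> V ==> cmod (l \<phi>) <= \<Lambda> * nm \<phi>"
  and h_V: "h \<in> V" and l_h: "l h = 1"
  and T_h: "T w0 h = h" and l_T: "\<phi> \<in> V ==> l (T w0 \<phi>) = l \<phi>"
  and contr: "\<phi> \<in> V ==> l \<phi> = 0 ==> nm (T w0 \<phi>) <= \<theta> * nm \<phi>"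
  and near: "w \<in> D ==> \<phi> \<in> V ==> nm (T w \<phi> - T w0 \<phi>) <= \<eta> * nm \<phi>"
  and T_hol: "(!!w. w \<in> D ==> f w \<in> V) ==> (!!x. (%w. f w x) holomorphic_on D) ==>
    (!!w. w \<in> D ==> nm (f w) <= C) ==> (%w. T w (f w) x) holomorphic_on D"
  and l_hol: "(!!w. w \<in> D ==> f w \<in> V) ==> (!!x. (%w. f w x) holomorphic_on D) ==>
    (!!w. w \<in> D ==> nm (f w) <= C) ==> (%w. l (f w)) holomorphic_on D"
  and \<theta>: "0 <= \<theta>" "\<theta> < 1" and \<epsilon>: "\<epsilon> = (1 - \<theta>) / 8" and \<eta>: "0 <= \<eta>" and \<Lambda>: "0 <= \<Lambda>"
  and small: "\<eta> * ((1 + nm h)\<^sup>2 * (1 + \<Lambda>)) <= \<epsilon>"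
begin

abbreviation "H \<equiv> nm h"

lemma H: "0 <= H" by (rule nm_nonneg[OF h_V])
lemma \<epsilon>_pos: "0 < \<epsilon>" "\<epsilon> <= 1/8" using \<epsilon> \<theta> by auto

lemma small_consequences:
 "\<Lambda> * \<eta> * (H + 1) <= \<epsilon>" "\<eta> * (H + 1) + \<Lambda> * \<eta> * (H + 1) * H <= \<epsilon>" "\<eta> <= \<epsilon>" "\<Lambda> * \<eta> <= \<epsilon>"
proof -
 have 1: "\<eta> * x <= \<epsilon>" if "x <= (1 + H)\<^sup>2 * (1 + \<Lambda>)" for x
  using mult_left_mono[OF that \<eta>] small by linarith
 have "0 <= H * \<Lambda>" "0 <= H * (H * \<Lambda>)" "0 <= H * H" using H \<Lambda> by auto
 then have "\<Lambda> * (H + 1) <= (1 + H)\<^sup>2 * (1 + \<Lambda>)" "(H + 1) + \<Lambda> * (H + 1) * H <= (1 + H)\<^sup>2 * (1 + \<Lambda>)"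
  "1 <= (1 + H)\<^sup>2 * (1 + \<Lambda>)" "\<Lambda> <= (1 + H)\<^sup>2 * (1 + \<Lambda>)"
  using H \<Lambda> by (auto simp: power2_eq_square algebra_simps)
 from this[THEN 1] show "\<Lambda> * \<eta> * (H + 1) <= \<epsilon>" "\<eta> * (H + 1) + \<Lambda> * \<eta> * (H + 1) * H <= \<epsilon>" "\<eta> <= \<epsilon>" "\<Lambda> * \<eta> <= \<epsilon>"
  by (simp_all add: algebra_simps)
qed

lemma T_diff: "w \<in> D ==> f \<in> V ==> \<psi> \<in> V ==> T w (f - \<psi>) = T w f - T w \<psi>"
 unfolding minus_sc by (simp add: T_add T_sc V_sc)

lemma l_diff: "f \<in> V ==> \<psi> \<in> V ==> l (f - \<psi>) = l f - l \<psi>"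
 unfolding minus_sc by (simp add: l_add l_sc V_sc)

lemma T_pow_V: "w \<in> D ==> f \<in> V ==> (T w ^^ n) f \<in> V"
 by (induction n) (auto intro: T_V)

lemma T_pow_add: "w \<in> D ==> f \<in> V ==> \<psi> \<in> V ==> (T w ^^ n) (f + \<psi>) = (T w ^^ n) f + (T w ^^ n) \<psi>"
 by (induction n) (auto simp: T_add T_pow_V)

lemma T_pow_sc: "w \<in> D ==> f \<in> V ==> (T w ^^ n) (sc c f) = sc c ((T w ^^ n) f)"
 by (induction n) (auto simp: T_sc T_pow_V)

lemma l_Tw:
 assumes "w \<in> D" "f \<in> V"
 shows "cmod (l (T w f) - l f) <= \<Lambda> * \<eta> * nm f"
proof -
 have "l (T w f) - l f = l (T w f - T w0 f)"
  using assms w0 by (simp add: l_diff T_V l_T)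
 moreover have "cmod (l (T w f - T w0 f)) <= \<Lambda> * nm (T w f - T w0 f)"
  using assms w0 by (intro l_bound V_diff T_V)
 moreover have "\<Lambda> * nm (T w f - T w0 f) <= \<Lambda> * (\<eta> * nm f)"
  using near[OF assms] \<Lambda> by (intro mult_left_mono)
 ultimately show ?thesis by (simp add: mult.assoc)
qed

lemma T_bound: "w \<in> D ==> f \<in> V ==> nm (T w f) <= (\<eta> + \<theta> * (1 + \<Lambda> * H) + \<Lambda> * H) * nm f"
proof -
 assume w: "w \<in> D" and f: "f \<in> V"
 let ?\<psi> = "f - sc (l f) h"
 have \<psi>: "?\<psi> \<in> V" "l ?\<psi> = 0" using f h_V by (auto intro: V_diff V_sc simp: l_diff l_sc V_sc l_h)
 have "T w0 f = T w0 ?\<psi> + sc (l f) h"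
  using f h_V w0 by (simp add: T_diff T_sc V_sc T_h)
 then have "T w f = (T w f - T w0 f) + (T w0 ?\<psi> + sc (l f) h)" by simp
 moreover have "nm ((T w f - T w0 f) + (T w0 ?\<psi> + sc (l f) h))
   <= nm (T w f - T w0 f) + (nm (T w0 ?\<psi>) + nm (sc (l f) h))"
  using w w0 f \<psi>(1) h_V by (intro order_trans[OF nm_add] add_mono order_refl nm_add V_diff V_add T_V V_sc)
 ultimately have "nm (T w f) <= nm (T w f - T w0 f) + (nm (T w0 ?\<psi>) + nm (sc (l f) h))" by simp
 moreover have l: "nm (sc (l f) h) <= \<Lambda> * nm f * H"
  unfolding nm_sc[OF h_V] using l_bound[OF f] H by (intro mult_right_mono)
 moreover have "nm (T w0 ?\<psi>) <= \<theta> * (nm f + \<Lambda> * nm f * H)"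
  using contr[OF \<psi>] nm_diff[OF f V_sc[OF h_V], of "l f"] l \<theta>
  by (meson add_left_mono mult_left_mono order_trans)
 ultimately show ?thesis using near[OF w f] by (simp add: algebra_simps)
qed

text \<open>\<open>u\<close> is the power iteration for the eigenvector, normalized by
  \<open>l\<close>, and \<open>c\<close> the corresponding iteration for the eigenfunctional.
  \<open>Dv\<close> subtracts the multiple of the iterate of \<open>h\<close> that carries the value
  of \<open>l\<close>, so that \<open>contr\<close> applies to it.\<close>

definition a where "a w n = l ((T w ^^ n) h)"
definition u where "u w n = sc (1 / a w n) ((T w ^^ n) h)"
definition c where "c w n f = l ((T w ^^ n) f) / a w n"
definition Dv where "Dv w n f = (T w ^^ n) f - sc (c w n f) ((T w ^^ n) h)"

text \<open>With \<open>b\<close> the ratio of successive values of \<open>a\<close>, one has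
  \<open>b (u_{n+1} - h) = T w0 (u_n - h) + (T w - T w0) u_n - (b - 1) h\<close>. As
  \<open>l (u_n - h) = 0\<close>, the first term contracts by \<open>\<theta>\<close>; the other two
  together contribute at most \<open>\<epsilon>\<close>. Since
  \<open>\<theta> + \<epsilon> <= 1 - \<epsilon> <= cmod b\<close>, the unit ball around
  \<open>h\<close> is never left.\<close>

lemma u_invariant:
 assumes w: "w \<in> D"
 shows "a w n ~= 0 & nm (u w n - h) <= 1 & cmod (a w (Suc n) / a w n - 1) <= \<epsilon>"
proof (induction n)
 have step: "cmod (a w (Suc n) / a w n - 1) <= \<epsilon>" if "a w n ~= 0" "nm (u w n - h) <= 1" for n
 proof -
  have uV: "u w n \<in> V" unfolding u_def by (intro V_sc T_pow_V w h_V)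
  have "nm (u w n) <= H + 1" using nm_add[of "u w n - h" h] that(2) uV h_V by (simp add: V_diff)
  have lu: "l (u w n) = 1" using that(1) unfolding u_def a_def by (simp add: l_sc T_pow_V w h_V)
  have "T w (u w n) = sc (1 / a w n) ((T w ^^ Suc n) h)"
   unfolding u_def using w h_V by (simp add: T_sc T_pow_V)
  then have "l (T w (u w n)) = a w (Suc n) / a w n"
   using w h_V l_sc[of "(T w ^^ Suc n) h"] T_pow_V[of w h "Suc n"] unfolding a_def by simp
  then have "cmod (a w (Suc n) / a w n - 1) <= \<Lambda> * \<eta> * nm (u w n)" using l_Tw[OF w uV] lu by simp
  also have "... <= \<Lambda> * \<eta> * (H + 1)" using \<open>nm (u w n) <= H + 1\<close> \<Lambda> \<eta> by (intro mult_left_mono) auto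
  finally show ?thesis using small_consequences(1) by linarith
 qed
 {
  case 0
  have "u w 0 = h" "a w 0 = 1" unfolding u_def a_def by (auto simp: l_h)
  then show ?case using step[of 0] by (simp add: nm_0)
 next
  case (Suc n)
  define b where "b = a w (Suc n) / a w n"
  have an: "a w n ~= 0" and b1: "cmod (b - 1) <= \<epsilon>" and un: "nm (u w n - h) <= 1"
   using Suc by (auto simp: b_def fun_diff_def)
  have bge: "1 - \<epsilon> <= cmod b" using norm_triangle_ineq2[of 1 "1 - b"] b1 by (simp add: norm_minus_commute)
  then have b0: "b ~= 0" using \<epsilon>_pos by auto
  then have aS: "a w (Suc n) ~= 0" using an by (auto simp: b_def)
  have uV: "u w n \<in> V" unfolding u_def by (intro V_sc T_pow_V w h_V)
  have dV: "u w n - h \<in> V" using uV h_V by (rule V_diff)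
  have nmu: "nm (u w n) <= H + 1" using nm_add[of "u w n - h" h] un uV h_V by (simp add: V_diff)
  have lu: "l (u w n) = 1" using an unfolding u_def a_def by (simp add: l_sc T_pow_V w h_V)
  have ld: "l (u w n - h) = 0" using lu by (simp add: l_diff uV h_V l_h)
  have Tu: "T w (u w n) = sc b (u w (Suc n))"
   unfolding u_def b_def using w h_V an aS by (subst T_sc) (auto simp: T_pow_V)
  have V': "u w (Suc n) - h \<in> V" unfolding u_def by (intro V_diff V_sc T_pow_V w h_V)
  have "sc b (u w (Suc n) - h) = (T w0 (u w n - h) + (T w (u w n) - T w0 (u w n))) - sc (b - 1) h"
   using Tu w w0 uV h_V by (auto simp: T_diff T_h fun_eq_iff algebra_simps)
  then have "cmod b * nm (u w (Suc n) - h) = nm ((T w0 (u w n - h) + (T w (u w n) - T w0 (u w n))) - sc (b - 1) h)"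
   using nm_sc[OF V', of b] by simp
  also have "... <= (nm (T w0 (u w n - h)) + nm (T w (u w n) - T w0 (u w n))) + nm (sc (b - 1) h)"
   using w w0 uV h_V dV by (intro order_trans[OF nm_diff] add_mono order_refl nm_add V_diff V_add T_V V_sc)
  also have "... <= (\<theta> * 1 + \<eta> * (H + 1)) + \<Lambda> * \<eta> * (H + 1) * H"
  proof (intro add_mono)
   show "nm (T w0 (u w n - h)) <= \<theta> * 1"
    using contr[OF dV ld] un \<theta> by (meson mult_left_mono order_trans)
   show "nm (T w (u w n) - T w0 (u w n)) <= \<eta> * (H + 1)"
    using near[OF w uV] nmu \<eta> by (meson mult_left_mono order_trans)
   have uSV: "u w (Suc n) \<in> V" unfolding u_def by (intro V_sc T_pow_V w h_V)
   have "l (u w (Suc n)) = 1"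
    unfolding u_def using aS T_pow_V[OF w h_V, of "Suc n"] by (simp add: l_sc a_def del: funpow.simps)
   then have "l (T w (u w n)) = b" unfolding Tu l_sc[OF uSV] by simp
   then have "cmod (b - 1) <= \<Lambda> * \<eta> * (H + 1)"
    using l_Tw[OF w uV] lu nmu \<Lambda> \<eta> by (metis mult_left_mono mult_nonneg_nonneg order_trans)
   then show "nm (sc (b - 1) h) <= \<Lambda> * \<eta> * (H + 1) * H"
    unfolding nm_sc[OF h_V] using H by (intro mult_right_mono)
  qed
  also have "... <= 1 - \<epsilon>"
  proof -
   have "\<theta> * 1 + y + z <= 1 - \<epsilon>" if "y + z <= \<epsilon>" for y z
    using that \<epsilon> \<epsilon>_pos by simp
   then show ?thesis using small_consequences(2) by blast
  qed
  finally have "cmod b * nm (u w (Suc n) - h) <= cmod b * 1" using bge by linarith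
  then have "nm (u w (Suc n) - h) <= 1" using b0 by (subst (asm) mult_le_cancel_left) auto
  then show ?case using step[OF aS] aS by (simp add: fun_diff_def)
 }
qed

lemma u_V: "w \<in> D ==> u w n \<in> V" unfolding u_def by (intro V_sc T_pow_V h_V)
lemma u_near: "w \<in> D ==> nm (u w n - h) <= 1" using u_invariant by blast
lemma nm_u: "w \<in> D ==> nm (u w n) <= H + 1"
 using nm_add[OF V_diff[OF u_V h_V] h_V, of w n] u_near[of w n] by simp
lemma a_nz: "w \<in> D ==> a w n ~= 0" using u_invariant by blast
lemma a_0: "a w 0 = 1" by (simp add: a_def l_h)

lemma a_ratio: "w \<in> D ==> 1 - \<epsilon> <= cmod (a w (Suc n) / a w n)" "w \<in> D ==> cmod (a w (Suc n) / a w n) <= 1 + \<epsilon>"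
 using u_invariant[of w n] norm_triangle_ineq2[of 1 "1 - a w (Suc n) / a w n"]
  norm_triangle_ineq[of 1 "a w (Suc n) / a w n - 1"] by (auto simp: norm_minus_commute)

lemma a_growth: "w \<in> D ==> (1 - \<epsilon>) ^ n <= cmod (a w n) & cmod (a w n) <= (1 + \<epsilon>) ^ n"
proof (induction n)
 case (Suc n)
 have "cmod (a w (Suc n)) = cmod (a w (Suc n) / a w n) * cmod (a w n)"
  using a_nz[of w n] Suc by (simp add: norm_divide)
 then show ?case using a_ratio[of w n] Suc \<epsilon>_pos by (auto intro!: mult_mono)
qed (simp add: a_0)

text \<open>A ladder of rates starting at \<open>\<theta> = 1 - 8 \<epsilon>\<close>: the
  perturbation costs two \<open>\<epsilon>\<close> on the kernel component (\<open>\<rho>\<close>),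
  division by \<open>a w n\<close>, which may shrink like \<open>(1 - \<epsilon>)^n\<close>, costs
  one more (\<open>q\<close> below), and the growth \<open>(1 + \<epsilon>)^n\<close> of
  \<open>a\<close> the last one, leaving \<open>1 - 4 \<epsilon>\<close> in
  \<open>spectral_gap\<close>. The eigenvalue stays above \<open>1 - \<epsilon>\<close>.\<close>

definition \<rho> where "\<rho> = 1 - 6 * \<epsilon>"

lemma \<rho>: "0 <= \<rho>" "\<rho> < 1" using \<epsilon>_pos by (auto simp: \<rho>_def)

lemma Dv_V: "w \<in> D ==> f \<in> V ==> Dv w n f \<in> V"
 unfolding Dv_def by (intro V_diff V_sc T_pow_V h_V)

lemma l_Dv: "w \<in> D ==> f \<in> V ==> l (Dv w n f) = 0"
 unfolding Dv_def c_def using a_nz[of w n] by (simp add: l_diff V_sc T_pow_V h_V l_sc a_def)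

lemma l_T_Dv: "w \<in> D ==> f \<in> V ==> l (T w (Dv w n f)) = (c w (Suc n) f - c w n f) * a w (Suc n)"
proof -
 assume w: "w \<in> D" and f: "f \<in> V"
 have "T w (Dv w n f) = (T w ^^ Suc n) f - sc (c w n f) ((T w ^^ Suc n) h)"
  unfolding Dv_def using w f h_V by (simp add: T_diff T_sc T_pow_V V_sc)
 then show ?thesis
  using w f h_V a_nz[OF w, of "Suc n"] T_pow_V[OF w, of _ "Suc n"]
  by (simp add: l_diff V_sc l_sc c_def[of w "Suc n"] a_def left_diff_distrib del: funpow.simps)
qed

lemma Dv_Suc: "w \<in> D ==> f \<in> V ==> Dv w (Suc n) f = T w (Dv w n f) - sc (l (T w (Dv w n f))) (u w (Suc n))"
proof -
 assume w: "w \<in> D" and f: "f \<in> V"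
 have "T w (Dv w n f) = (T w ^^ Suc n) f - sc (c w n f) ((T w ^^ Suc n) h)"
  unfolding Dv_def using w f h_V by (simp add: T_diff T_sc T_pow_V V_sc)
 then have "T w (Dv w n f) x = (T w ^^ Suc n) f x - c w n f * (T w ^^ Suc n) h x" for x by simp
 then show ?thesis unfolding l_T_Dv[OF w f] using a_nz[OF w, of "Suc n"]
  by (simp add: Dv_def[of w "Suc n"] u_def fun_eq_iff left_diff_distrib diff_divide_distrib del: funpow.simps)
qed

lemma Dv_bound: "w \<in> D ==> f \<in> V ==> nm (Dv w n f) <= \<rho> ^ n * nm (Dv w 0 f)"
proof (induction n)
 case (Suc n)
 let ?\<psi> = "Dv w n f"
 have V: "?\<psi> \<in> V" and l0: "l ?\<psi> = 0" using Suc.prems Dv_V l_Dv by auto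
 have w: "w \<in> D" by fact
 have lT: "cmod (l (T w ?\<psi>)) <= \<Lambda> * \<eta> * nm ?\<psi>" using l_Tw[OF w V] l0 by simp
 have "nm (T w ?\<psi>) <= nm (T w ?\<psi> - T w0 ?\<psi>) + nm (T w0 ?\<psi>)"
  using nm_add[of "T w ?\<psi> - T w0 ?\<psi>" "T w0 ?\<psi>"] w w0 V by (simp add: V_diff T_V)
 then have 1: "nm (T w ?\<psi>) <= (\<eta> + \<theta>) * nm ?\<psi>"
  using near[OF w V] contr[OF V l0] by (simp add: distrib_right)
 have "nm (Dv w (Suc n) f) <= nm (T w ?\<psi>) + nm (sc (l (T w ?\<psi>)) (u w (Suc n)))"
  unfolding Dv_Suc[OF w Suc.prems(2)] by (intro nm_diff T_V w V V_sc u_V)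
 also have "nm (sc (l (T w ?\<psi>)) (u w (Suc n))) <= (\<Lambda> * \<eta> * nm ?\<psi>) * (H + 1)"
  unfolding nm_sc[OF u_V[OF w]] using lT nm_u[OF w, of "Suc n"] nm_nonneg[OF u_V[OF w], of "Suc n"]
  by (intro mult_mono) (auto intro: order_trans[OF norm_ge_zero])
 also have "nm (T w ?\<psi>) + (\<Lambda> * \<eta> * nm ?\<psi>) * (H + 1) <= (\<eta> + \<theta> + \<Lambda> * \<eta> * (H + 1)) * nm ?\<psi>"
  using 1 by (simp add: algebra_simps)
 also have "... <= \<rho> * nm ?\<psi>"
  using small_consequences \<epsilon> nm_nonneg[OF V] by (intro mult_right_mono) (auto simp: \<rho>_def)
 also have "... <= \<rho> * (\<rho> ^ n * nm (Dv w 0 f))" using Suc \<rho> by (intro mult_left_mono) auto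
 finally show ?case by (simp add: mult.assoc)
qed simp

lemma Dv_0: "Dv w 0 f = f - sc (l f) h" by (simp add: Dv_def c_def a_0)

lemma Dv_0_bound: "f \<in> V ==> nm (Dv w 0 f) <= (1 + \<Lambda> * H) * nm f"
proof -
 assume f: "f \<in> V"
 have "nm (Dv w 0 f) <= nm f + cmod (l f) * H"
  unfolding Dv_0 using nm_diff[OF f V_sc[OF h_V]] by (simp add: nm_sc h_V)
 also have "... <= nm f + \<Lambda> * nm f * H" using l_bound[OF f] H by (intro add_left_mono mult_right_mono)
 finally show ?thesis by (simp add: algebra_simps)
qed

definition q where "q = 1 - 5 * \<epsilon>"

lemma q: "0 <= q" "q < 1" "\<rho> / (1 - \<epsilon>) <= q" "\<rho> <= q * (1 - \<epsilon>)" "q * (1 + \<epsilon>) <= 1 - 4 * \<epsilon>"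
 using \<epsilon>_pos mult_nonneg_nonneg[of \<epsilon> \<epsilon>] by (auto simp: q_def \<rho>_def field_simps power2_eq_square)

text \<open>\<open>l\<close> vanishes on \<open>Dv w n f\<close> and is invariant under
  \<open>T w0\<close>, so \<open>l (T w (Dv w n f))\<close> sees only the perturbation. By
  \<open>l_T_Dv\<close> this number is the increment of \<open>c\<close> times
  \<open>a w (Suc n)\<close>.\<close>

lemma c_increment:
 assumes w: "w \<in> D" and f: "f \<in> V"
 shows "cmod (c w (Suc n) f - c w n f) <= \<Lambda> * \<eta> * nm (Dv w 0 f) / (1 - \<epsilon>) * q ^ n"
proof -
 have "cmod (l (T w (Dv w n f))) <= \<Lambda> * \<eta> * nm (Dv w n f)"
  using l_Tw[OF w Dv_V[OF w f], of n] l_Dv[OF w f] by simp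
 also have "... <= \<Lambda> * \<eta> * (\<rho> ^ n * nm (Dv w 0 f))"
  using Dv_bound[OF w f] \<Lambda> \<eta> by (intro mult_left_mono) auto
 finally have 1: "cmod (c w (Suc n) f - c w n f) * cmod (a w (Suc n)) <= \<Lambda> * \<eta> * (\<rho> ^ n * nm (Dv w 0 f))"
  unfolding l_T_Dv[OF w f] norm_mult .
 have "cmod (c w (Suc n) f - c w n f) * (1 - \<epsilon>) ^ Suc n <= \<Lambda> * \<eta> * (\<rho> ^ n * nm (Dv w 0 f))"
  using a_growth[OF w, of "Suc n"] by (intro order_trans[OF mult_left_mono 1]) auto
 also have "... <= \<Lambda> * \<eta> * ((q * (1 - \<epsilon>)) ^ n * nm (Dv w 0 f))"
  using q \<rho> \<Lambda> \<eta> nm_nonneg[OF Dv_V[OF w f, of 0]] by (intro mult_left_mono mult_right_mono power_mono) auto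
 also have "... = (\<Lambda> * \<eta> * nm (Dv w 0 f) / (1 - \<epsilon>) * q ^ n) * (1 - \<epsilon>) ^ Suc n"
  using \<epsilon>_pos by (simp add: power_mult_distrib)
 finally show ?thesis using \<epsilon>_pos by (subst (asm) mult_le_cancel_right_pos) auto
qed

definition Lw where "Lw w f = lim (%n. c w n f)"

lemma c_lim: "w \<in> D ==> f \<in> V ==> (%n. c w n f) \<longlonglongrightarrow> Lw w f"
 unfolding Lw_def by (rule geometric_increments_lim[OF c_increment q(1,2)])

lemma c_lim_bound: "w \<in> D ==> f \<in> V ==>
  cmod (c w n f - Lw w f) <= \<Lambda> * \<eta> * nm (Dv w 0 f) / (1 - \<epsilon>) * q ^ n / (1 - q)"
 unfolding Lw_def by (rule geometric_increments_lim[OF c_increment q(1,2)])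

definition C0 where "C0 = \<Lambda> * \<eta> * (1 + \<Lambda> * H) / (1 - \<epsilon>) / (1 - q)"

lemma C0: "0 <= C0" unfolding C0_def using \<Lambda> \<eta> H \<epsilon>_pos q by (intro divide_nonneg_nonneg mult_nonneg_nonneg) auto

lemma c_lim_bound': "w \<in> D ==> f \<in> V ==> cmod (c w n f - Lw w f) <= C0 * q ^ n * nm f"
proof -
 assume w: "w \<in> D" and f: "f \<in> V"
 have "\<Lambda> * \<eta> * nm (Dv w 0 f) / (1 - \<epsilon>) * q ^ n / (1 - q)
   <= \<Lambda> * \<eta> * ((1 + \<Lambda> * H) * nm f) / (1 - \<epsilon>) * q ^ n / (1 - q)"
  using Dv_0_bound[OF f] \<Lambda> \<eta> q \<epsilon>_pos
  by (intro divide_right_mono mult_right_mono mult_left_mono) auto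
 then show ?thesis using c_lim_bound[OF w f, of n] by (simp add: C0_def mult_ac)
qed

lemma Lw_add: "w \<in> D ==> f \<in> V ==> \<psi> \<in> V ==> Lw w (f + \<psi>) = Lw w f + Lw w \<psi>"
proof -
 assume w: "w \<in> D" "f \<in> V" "\<psi> \<in> V"
 have "c w n (f + \<psi>) = c w n f + c w n \<psi>" for n
  using w by (simp add: c_def T_pow_add l_add T_pow_V add_divide_distrib)
 then have "(%n. c w n (f + \<psi>)) \<longlonglongrightarrow> Lw w f + Lw w \<psi>"
  using w by (simp add: tendsto_add c_lim)
 then show ?thesis using c_lim[of w "f + \<psi>"] w V_add LIMSEQ_unique by blast
qed

lemma Lw_sc: "w \<in> D ==> f \<in> V ==> Lw w (sc b f) = b * Lw w f"
proof -
 assume w: "w \<in> D" "f \<in> V"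
 have "c w n (sc b f) = b * c w n f" for n
  using w by (simp add: c_def T_pow_sc l_sc T_pow_V)
 then have "(%n. c w n (sc b f)) \<longlonglongrightarrow> b * Lw w f"
  using w by (simp add: tendsto_mult_left c_lim)
 then show ?thesis using c_lim[of w "sc b f"] w V_sc LIMSEQ_unique by blast
qed

lemma Lw_diff: "w \<in> D ==> f \<in> V ==> \<psi> \<in> V ==> Lw w (f - \<psi>) = Lw w f - Lw w \<psi>"
 unfolding minus_sc by (simp add: Lw_add Lw_sc V_sc)

lemma Lw_h: "w \<in> D ==> Lw w h = 1"
 using c_lim[of w h] a_nz[of w] h_V by (simp add: c_def a_def LIMSEQ_const_iff)

lemma Lw_bound: "w \<in> D ==> f \<in> V ==> cmod (Lw w f) <= (\<Lambda> + C0) * nm f"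
 using c_lim_bound'[of w f 0] l_bound[of f] norm_triangle_ineq4[of "c w 0 f" "c w 0 f - Lw w f"]
 by (simp add: c_def a_0 distrib_right)

definition K where "K w = Lw w (T w h)"

text \<open>Places the ratios whose limit is the eigenvalue among the sequences
  \<open>c w n f\<close>, from which they inherit convergence, rate and holomorphy.\<close>

lemma a_ratio_eq: "w \<in> D ==> a w (Suc n) / a w n = c w n (T w h)"
 by (simp add: c_def a_def funpow_swap1)

lemma K_lim: "w \<in> D ==> (%n. a w (Suc n) / a w n) \<longlonglongrightarrow> K w"
 unfolding K_def using c_lim[of w "T w h"] by (simp add: a_ratio_eq T_V h_V)

lemma K_near: "w \<in> D ==> cmod (K w - 1) <= \<epsilon>"
 by (rule LIMSEQ_le_const2[OF tendsto_norm[OF tendsto_diff[OF K_lim tendsto_const]]])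
  (use u_invariant in blast)+

lemma K_ge: "w \<in> D ==> 1 - \<epsilon> <= cmod (K w)"
 using K_near[of w] norm_triangle_ineq2[of 1 "1 - K w"] by (simp add: norm_minus_commute)

lemma Lw_T: "w \<in> D ==> f \<in> V ==> Lw w (T w f) = K w * Lw w f"
proof -
 assume w: "w \<in> D" and f: "f \<in> V"
 have "c w n (T w f) = (a w (Suc n) / a w n) * c w (Suc n) f" for n
  using a_nz[OF w, of "Suc n"] by (simp add: c_def funpow_swap1)
 moreover have "(%n. (a w (Suc n) / a w n) * c w (Suc n) f) \<longlonglongrightarrow> K w * Lw w f"
  by (intro tendsto_mult K_lim w LIMSEQ_Suc[OF c_lim] f)
 ultimately show ?thesis using c_lim[OF w T_V[OF w f]] LIMSEQ_unique by auto
qed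

definition hw where "hw w = (%x. lim (%n. u w n x))"
definition Cu where "Cu = (1 + \<Lambda> * H) * (H + \<eta> * H) / (1 - \<epsilon>)"

lemma hw:
 assumes w: "w \<in> D"
 shows "hw w \<in> V" "(%n. u w n x) \<longlonglongrightarrow> hw w x" "nm (u w n - hw w) <= Cu * q ^ n / (1 - q)"
proof -
 have inc: "nm (u w (Suc n) - u w n) <= Cu * q ^ n" for n
 proof -
  have ThV: "T w h \<in> V" by (intro T_V w h_V)
  have "(T w ^^ Suc n) h = sc (a w (Suc n) / a w n) ((T w ^^ n) h) + Dv w n (T w h)"
   unfolding a_ratio_eq[OF w] Dv_def by (simp add: funpow_swap1)
  then have "u w (Suc n) - u w n = sc (1 / a w (Suc n)) (Dv w n (T w h))"
   unfolding u_def using a_nz[OF w, of n] a_nz[OF w, of "Suc n"] by (simp add: fun_eq_iff distrib_left)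
  then have "nm (u w (Suc n) - u w n) = nm (Dv w n (T w h)) / cmod (a w (Suc n))"
   by (simp add: nm_sc Dv_V w ThV norm_divide)
  also have "... <= (\<rho> ^ n * ((1 + \<Lambda> * H) * nm (T w h))) / (1 - \<epsilon>) ^ Suc n"
   using Dv_bound[OF w ThV, of n] Dv_0_bound[OF ThV, of w] a_growth[OF w, of "Suc n"] \<rho> \<epsilon>_pos
    nm_nonneg[OF Dv_V[OF w ThV]]
   by (intro frac_le) (auto intro: order_trans[OF _ mult_left_mono] simp: mult_nonneg_nonneg H \<Lambda> nm_nonneg ThV)
  also have "... <= ((q * (1 - \<epsilon>)) ^ n * ((1 + \<Lambda> * H) * (H + \<eta> * H))) / (1 - \<epsilon>) ^ Suc n"
  proof (intro divide_right_mono mult_mono power_mono mult_left_mono)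
   show "nm (T w h) <= H + \<eta> * H"
    using nm_add[of "T w h - h" h] near[OF w h_V] ThV h_V by (simp add: V_diff T_h)
  qed (use q \<rho> \<epsilon>_pos H \<Lambda> \<eta> in \<open>auto simp: nm_nonneg ThV\<close>)
  also have "... = Cu * q ^ n" using \<epsilon>_pos by (simp add: Cu_def power_mult_distrib)
  finally show ?thesis .
 qed
 obtain f where f: "f \<in> V" "!!x. (%n. u w n x) \<longlonglongrightarrow> f x" "!!n. nm (u w n - f) <= Cu * q ^ n / (1 - q)"
  using geometric_limit[OF u_V[OF w] inc q(1,2)] by blast
 then have "hw w = f" unfolding hw_def by (auto simp: fun_eq_iff intro!: limI)
 then show "hw w \<in> V" "(%n. u w n x) \<longlonglongrightarrow> hw w x" "nm (u w n - hw w) <= Cu * q ^ n / (1 - q)"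
  using f by auto
qed

lemma q_null: "(%n. B * q ^ n / (1 - q)) \<longlonglongrightarrow> 0"
 using q tendsto_divide[OF tendsto_mult[OF tendsto_const LIMSEQ_power_zero[of q]] tendsto_const, of "1 - q" B] by simp

lemma nm_u_hw: "w \<in> D ==> (%n. nm (u w n - hw w)) \<longlonglongrightarrow> 0"
 by (rule Lim_null_comparison[OF _ q_null[of Cu]])
  (use hw(3) nm_nonneg[OF V_diff[OF u_V hw(1)]] in auto)

lemma nm_hw: assumes w: "w \<in> D" shows "nm (hw w - h) <= 1"
proof (rule LIMSEQ_le_const[of "%n. nm (u w n - hw w) + 1"])
 show "(%n. nm (u w n - hw w) + 1) \<longlonglongrightarrow> 1" using tendsto_add[OF nm_u_hw[OF w] tendsto_const[of 1]] by simp
 have "nm (hw w - h) <= nm (u w n - hw w) + 1" for n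
  using nm_diff_triangle[OF hw(1)[OF w] h_V u_V[OF w, of n]] u_near[OF w, of n]
   nm_diff_commute[OF hw(1)[OF w] u_V[OF w, of n]] by simp
 then show "\<exists>N. \<forall>n\<ge>N. nm (hw w - h) <= nm (u w n - hw w) + 1" by blast
qed

lemma l_hw: assumes w: "w \<in> D" shows "l (hw w) = 1"
proof -
 have "(%n. l (u w n) - l (hw w)) \<longlonglongrightarrow> 0"
 proof (rule Lim_null_comparison)
  show "\<forall>\<^sub>F n in sequentially. norm (l (u w n) - l (hw w)) <= \<Lambda> * nm (u w n - hw w)"
   using l_bound[OF V_diff[OF u_V[OF w] hw(1)[OF w]]] l_diff[OF u_V[OF w] hw(1)[OF w]] by simp
  show "(%n. \<Lambda> * nm (u w n - hw w)) \<longlonglongrightarrow> 0" using tendsto_mult_left[OF nm_u_hw[OF w]] by simp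
 qed
 moreover have "l (u w n) = 1" for n
  unfolding u_def using a_nz[OF w, of n] by (simp add: l_sc T_pow_V w h_V a_def)
 ultimately show ?thesis by (simp add: LIMSEQ_const_iff)
qed

lemma T_hw: assumes w: "w \<in> D" shows "T w (hw w) = sc (K w) (hw w)"
proof
 fix x
 define B where "B = \<eta> + \<theta> * (1 + \<Lambda> * H) + \<Lambda> * H"
 have "(%n. T w (u w n) x - T w (hw w) x) \<longlonglongrightarrow> 0"
 proof (rule Lim_null_comparison)
  have "cmod (T w (u w n - hw w) x) <= B * nm (u w n - hw w)" for n
   using nm_ev[OF T_V[OF w V_diff[OF u_V[OF w] hw(1)[OF w]]]] T_bound[OF w V_diff[OF u_V[OF w] hw(1)[OF w]]]
   unfolding B_def by (meson order_trans)
  then show "\<forall>\<^sub>F n in sequentially. norm (T w (u w n) x - T w (hw w) x) <= B * nm (u w n - hw w)"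
   using T_diff[OF w u_V[OF w] hw(1)[OF w]] by simp
  show "(%n. B * nm (u w n - hw w)) \<longlonglongrightarrow> 0" using tendsto_mult_left[OF nm_u_hw[OF w]] by simp
 qed
 then have "(%n. T w (u w n) x) \<longlonglongrightarrow> T w (hw w) x" by (rule LIM_zero_cancel)
 moreover have "T w (u w n) x = (a w (Suc n) / a w n) * u w (Suc n) x" for n
  unfolding u_def using w h_V a_nz[OF w, of "Suc n"] by (simp add: T_sc T_pow_V)
 moreover have "(%n. (a w (Suc n) / a w n) * u w (Suc n) x) \<longlonglongrightarrow> K w * hw w x"
  by (intro tendsto_mult K_lim w LIMSEQ_Suc[OF hw(2)])
 ultimately show "T w (hw w) x = sc (K w) (hw w) x" using LIMSEQ_unique by simp
qed

text \<open>\<open>hw w - h\<close> has norm at most 1 and lies in the kernel of \<open>l\<close>,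
  so \<open>Lw\<close> of it is at most the total drift of \<open>c\<close>, which is below
  \<open>\<epsilon> / (7/8) / (5 \<epsilon>) = 8/35\<close>. Hence \<open>g\<close> is bounded away
  from 0 and \<open>hh\<close> can be normalized.\<close>

lemma Lw_hw_near: assumes w: "w \<in> D" shows "cmod (Lw w (hw w) - 1) <= 1/4"
proof -
 let ?\<psi> = "hw w - h"
 have V: "?\<psi> \<in> V" by (intro V_diff hw w h_V)
 have l0: "l ?\<psi> = 0" by (simp add: l_diff hw w h_V l_hw l_h)
 have D0: "Dv w 0 ?\<psi> = ?\<psi>" unfolding Dv_0 l0 by (simp add: fun_eq_iff)
 have "cmod (Lw w ?\<psi>) <= \<Lambda> * \<eta> * nm ?\<psi> / (1 - \<epsilon>) / (1 - q)"
  using c_lim_bound[OF w V, of 0] l0 unfolding D0 by (simp add: c_def)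
 also have "... <= \<epsilon> * 1 / (7/8) / (1 - q)"
  using \<epsilon>_pos q \<Lambda> \<eta> V small_consequences(4) nm_hw[OF w]
  by (intro divide_right_mono frac_le mult_mono nm_nonneg) auto
 also have "... <= 1/4" using \<epsilon>_pos by (simp add: q_def)
 finally show ?thesis using Lw_diff[OF w hw(1)[OF w] h_V] Lw_h[OF w] by simp
qed

definition g where "g w = Lw w (hw w)"
definition hh where "hh w = sc (1 / g w) (hw w)"

lemma g_ge: "w \<in> D ==> 3/4 <= cmod (g w)"
 using Lw_hw_near[of w] norm_triangle_ineq2[of 1 "1 - g w"] by (simp add: g_def norm_minus_commute)

lemma g_nz: "w \<in> D ==> g w ~= 0" using g_ge[of w] by auto

lemma hh_V: "w \<in> D ==> hh w \<in> V" unfolding hh_def by (intro V_sc hw)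
lemma Lw_hh: "w \<in> D ==> Lw w (hh w) = 1"
 unfolding hh_def using g_nz[of w] by (simp add: Lw_sc hw g_def)
lemma T_hh: "w \<in> D ==> T w (hh w) = sc (K w) (hh w)"
 unfolding hh_def by (simp add: T_sc hw T_hw fun_eq_iff)

lemma nm_hw_le: "w \<in> D ==> nm (hw w) <= H + 1"
 using nm_add[OF V_diff[OF hw(1) h_V] h_V, of w] nm_hw[of w] by simp

lemma nm_hh: "w \<in> D ==> nm (hh w) <= 4/3 * (H + 1)"
proof -
 assume w: "w \<in> D"
 have "nm (hh w) = 1 / cmod (g w) * nm (hw w)"
  unfolding hh_def by (simp add: nm_sc hw w norm_divide)
 also have "... <= 1 / (3/4) * (H + 1)"
  using g_ge[OF w] nm_hw_le[OF w] H nm_nonneg[OF hw(1)[OF w]] by (intro mult_mono frac_le) auto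
 finally show ?thesis by simp
qed

lemma T_pow_hh: "w \<in> D ==> (T w ^^ n) (hh w) = sc (K w ^ n) (hh w)"
proof (induction n)
 case (Suc n)
 have IH: "(T w ^^ n) (hh w) = sc (K w ^ n) (hh w)" using Suc by (simp add: fun_eq_iff)
 have "(T w ^^ Suc n) (hh w) = T w (sc (K w ^ n) (hh w))" unfolding IH[symmetric] by simp
 also have "... = sc (K w ^ n) (sc (K w) (hh w))" using Suc.prems by (simp only: T_sc[OF _ hh_V] T_hh)
 finally show ?case by (simp add: fun_eq_iff)
qed (simp add: fun_eq_iff)

lemma T_pow_hw: "w \<in> D ==> (T w ^^ n) (hw w) = sc (K w ^ n) (hw w)"
proof (induction n)
 case (Suc n)
 have IH: "(T w ^^ n) (hw w) = sc (K w ^ n) (hw w)" using Suc by (simp add: fun_eq_iff)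
 have "(T w ^^ Suc n) (hw w) = T w (sc (K w ^ n) (hw w))" unfolding IH[symmetric] by simp
 also have "... = sc (K w ^ n) (sc (K w) (hw w))" using Suc.prems by (simp only: T_sc[OF _ hw(1)] T_hw)
 finally show ?case by (simp add: fun_eq_iff)
qed (simp add: fun_eq_iff)

text \<open>Once \<open>Lw w f\<close> times the eigenvector is removed, the iterate is a multiple
  of \<open>u w n\<close> plus a kernel component. The coefficient of \<open>u w n\<close> is
  \<open>a w n\<close> times a sequence tending to 0 like \<open>q^n\<close>, and the kernel
  component decays like \<open>\<rho>^n\<close>.\<close>

theorem spectral_gap:
 "\<exists>C\<ge>0. \<forall>w\<in>D. \<forall>f\<in>V. \<forall>n. nm ((T w ^^ n) f - sc (K w ^ n * Lw w f) (hh w)) <= C * (1 - 4 * \<epsilon>) ^ n * nm f"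
proof -
 define E where "E = 1 + (\<Lambda> + C0) * (4/3 * (H + 1))"
 define C where "C = (C0 * (H + 1) + (1 + \<Lambda> * H)) * E"
 have E: "0 <= E" using \<Lambda> C0 H by (auto simp: E_def)
 have "nm ((T w ^^ n) f - sc (K w ^ n * Lw w f) (hh w)) <= C * (1 - 4 * \<epsilon>) ^ n * nm f"
  if w: "w \<in> D" and f: "f \<in> V" for w f n
 proof -
  let ?\<psi> = "f - sc (Lw w f) (hh w)"
  have V: "?\<psi> \<in> V" by (intro V_diff f V_sc hh_V w)
  have L0: "Lw w ?\<psi> = 0" by (simp add: Lw_diff w f V_sc hh_V Lw_sc Lw_hh)
  have "cmod (Lw w f) * nm (hh w) <= ((\<Lambda> + C0) * nm f) * (4/3 * (H + 1))"
   using Lw_bound[OF w f] nm_hh[OF w] nm_nonneg[OF f] nm_nonneg[OF hh_V[OF w]] \<Lambda> C0 by (intro mult_mono) auto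
  then have nm\<psi>: "nm ?\<psi> <= E * nm f"
   using nm_diff[OF f V_sc[OF hh_V[OF w]], of "Lw w f"] unfolding nm_sc[OF hh_V[OF w]] E_def distrib_right
   by (simp add: mult_ac)
  have "(T w ^^ n) f - sc (K w ^ n * Lw w f) (hh w) = (T w ^^ n) ?\<psi>"
  proof -
   have "(T w ^^ n) ?\<psi> = (T w ^^ n) f - (T w ^^ n) (sc (Lw w f) (hh w))"
    using T_pow_add[OF w V V_sc[OF hh_V[OF w]], of n "Lw w f"] by (simp add: fun_eq_iff)
   then show ?thesis by (simp add: T_pow_sc w hh_V T_pow_hh fun_eq_iff)
  qed
  also have "... = sc (c w n ?\<psi> * a w n) (u w n) + Dv w n ?\<psi>"
   unfolding Dv_def u_def using a_nz[OF w, of n] by (simp add: fun_eq_iff)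
  finally have eq: "(T w ^^ n) f - sc (K w ^ n * Lw w f) (hh w) = sc (c w n ?\<psi> * a w n) (u w n) + Dv w n ?\<psi>" .
  have "nm ((T w ^^ n) f - sc (K w ^ n * Lw w f) (hh w)) <= nm (sc (c w n ?\<psi> * a w n) (u w n)) + nm (Dv w n ?\<psi>)"
   unfolding eq by (intro nm_add V_sc u_V Dv_V V w)
  also have "... <= (C0 * q ^ n * nm ?\<psi>) * (1 + \<epsilon>) ^ n * (H + 1) + \<rho> ^ n * ((1 + \<Lambda> * H) * nm ?\<psi>)"
  proof (intro add_mono)
   show "nm (sc (c w n ?\<psi> * a w n) (u w n)) <= (C0 * q ^ n * nm ?\<psi>) * (1 + \<epsilon>) ^ n * (H + 1)"
    unfolding nm_sc[OF u_V[OF w]] norm_mult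
    using c_lim_bound'[OF w V, of n] L0 a_growth[OF w, of n] nm_u[OF w, of n] C0 q nm_nonneg[OF V] nm_nonneg[OF u_V[OF w]] \<epsilon>_pos
    by (intro mult_mono) auto
   show "nm (Dv w n ?\<psi>) <= \<rho> ^ n * ((1 + \<Lambda> * H) * nm ?\<psi>)"
    using Dv_bound[OF w V, of n] Dv_0_bound[OF V, of w] \<rho> by (meson mult_left_mono order_trans zero_le_power)
  qed
  also have "... = (C0 * (H + 1) * (q * (1 + \<epsilon>)) ^ n + (1 + \<Lambda> * H) * \<rho> ^ n) * nm ?\<psi>"
  proof -
   have "C0 * x * m * y * z + r * (k * m) = (C0 * z * (x * y) + k * r) * m" for x y z m r k :: real
    by (simp add: algebra_simps)
   then show ?thesis unfolding power_mult_distrib by blast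
  qed
  also have "... <= (C0 * (H + 1) * (1 - 4 * \<epsilon>) ^ n + (1 + \<Lambda> * H) * (1 - 4 * \<epsilon>) ^ n) * (E * nm f)"
   using q \<rho> \<epsilon>_pos C0 H \<Lambda> nm\<psi> nm_nonneg[OF V]
   by (intro mult_mono add_mono mult_left_mono power_mono) (auto simp: \<rho>_def)
  also have "... = C * (1 - 4 * \<epsilon>) ^ n * nm f" by (simp add: C_def algebra_simps)
  finally show ?thesis .
 qed
 moreover have "0 <= C" unfolding C_def using E C0 H \<Lambda> by (intro mult_nonneg_nonneg add_nonneg_nonneg) auto
 ultimately show ?thesis by blast
qed

lemma T_pow_bound: "w \<in> D ==> f \<in> V ==> nm ((T w ^^ n) f) <= (\<eta> + \<theta> * (1 + \<Lambda> * H) + \<Lambda> * H) ^ n * nm f"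
proof (induction n)
 case (Suc n)
 have "0 <= \<eta> + \<theta> * (1 + \<Lambda> * H) + \<Lambda> * H" using \<eta> \<theta> \<Lambda> H by auto
 then show ?case
  using T_bound[OF Suc.prems(1) T_pow_V[OF Suc.prems], of n] mult_left_mono[OF Suc.IH[OF Suc.prems]]
  by (simp add: mult.assoc) (meson order_trans)
qed simp

lemma T_pow_hol: "f \<in> V ==> (%w. (T w ^^ n) f x) holomorphic_on D"
proof (induction n arbitrary: x)
 case (Suc n)
 have "(%w. T w ((T w ^^ n) f) x) holomorphic_on D"
  by (rule T_hol) (use Suc T_pow_V T_pow_bound in auto)
 then show ?case by simp
qed simp

lemma l_T_pow_hol: "f \<in> V ==> (%w. l ((T w ^^ n) f)) holomorphic_on D"
 by (rule l_hol) (use T_pow_V T_pow_bound T_pow_hol in auto)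

lemma a_hol: "(%w. a w n) holomorphic_on D"
 unfolding a_def by (rule l_T_pow_hol[OF h_V])

lemma c_hol: "f \<in> V ==> (%w. c w n f) holomorphic_on D"
 unfolding c_def by (intro holomorphic_on_divide l_T_pow_hol a_hol) (auto simp: a_nz)

lemma hol_limit:
 assumes hol: "!!n. f n holomorphic_on D" and b: "!!n w. w \<in> D ==> cmod (f n w - F w) <= B * q ^ n"
 shows "F holomorphic_on D"
proof (rule holomorphic_uniform_sequence[OF open_D hol])
 fix z assume "z \<in> D"
 then obtain r where r: "0 < r" "cball z r \<subseteq> D" using open_D open_contains_cball by blast
 have "uniform_limit (cball z r) f F sequentially"
 proof (rule uniform_limitI)
  fix e :: real assume e: "0 < e"
  have "(%n. B * q ^ n) \<longlonglongrightarrow> B * 0" using q by (intro tendsto_intros LIMSEQ_power_zero) auto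
  then have "\<forall>\<^sub>F n in sequentially. B * q ^ n < e" using e by (intro order_tendstoD(2)) auto
  then show "\<forall>\<^sub>F n in sequentially. \<forall>x\<in>cball z r. dist (f n x) (F x) < e"
   by eventually_elim (use b r in \<open>auto simp: dist_norm intro: le_less_trans\<close>)
 qed
 then show "\<exists>d>0. cball z d \<subseteq> D & uniform_limit (cball z d) f F sequentially" using r by blast
qed

lemma Lw_hol: "f \<in> V ==> (%w. Lw w f) holomorphic_on D"
 by (rule hol_limit[of "%n w. c w n f" _ "C0 * nm f"])
  (use c_hol c_lim_bound' in \<open>auto simp: mult_ac\<close>)

lemma K_hol: "K holomorphic_on D"
proof (rule hol_limit[of "%n w. a w (Suc n) / a w n" _ "C0 * ((\<eta> + \<theta> * (1 + \<Lambda> * H) + \<Lambda> * H) * H)"])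
 show "(%w. a w (Suc n) / a w n) holomorphic_on D" for n
  by (intro holomorphic_on_divide a_hol) (auto simp: a_nz)
 fix n w assume w: "w \<in> D"
 have "cmod (a w (Suc n) / a w n - K w) <= C0 * q ^ n * nm (T w h)"
  unfolding a_ratio_eq[OF w] K_def by (intro c_lim_bound' w T_V h_V)
 also have "... <= C0 * q ^ n * ((\<eta> + \<theta> * (1 + \<Lambda> * H) + \<Lambda> * H) * H)"
  using C0 q by (intro mult_left_mono T_bound w h_V) auto
 finally show "cmod (a w (Suc n) / a w n - K w) <= C0 * ((\<eta> + \<theta> * (1 + \<Lambda> * H) + \<Lambda> * H) * H) * q ^ n"
  by (simp add: mult_ac)
qed

lemma hw_hol: "(%w. hw w x) holomorphic_on D"
proof (rule hol_limit[of "%n w. u w n x" _ "Cu / (1 - q)"])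
 show "(%w. u w n x) holomorphic_on D" for n
  unfolding u_def sc_apply
  by (intro holomorphic_on_mult holomorphic_on_divide holomorphic_on_const a_hol T_pow_hol h_V) (auto simp: a_nz)
 fix n w assume w: "w \<in> D"
 show "cmod (u w n x - hw w x) <= Cu / (1 - q) * q ^ n"
  using nm_ev[OF V_diff[OF u_V[OF w] hw(1)[OF w]], of n x] hw(3)[OF w, of n] by simp
qed

text \<open>\<open>Lw_hol\<close> concerns a fixed vector, while \<open>hw w\<close> moves with
  \<open>w\<close>. By the eigenvector equation and \<open>l (hw w) = 1\<close>, however,
  \<open>c w n (hw w)\<close> equals \<open>K w ^ n / a w n\<close>, which is holomorphic.\<close>

lemma g_hol: "g holomorphic_on D"
proof (rule hol_limit[of "%n w. K w ^ n / a w n" _ "C0 * (H + 1)"])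
 show "(%w. K w ^ n / a w n) holomorphic_on D" for n
  by (intro holomorphic_on_divide holomorphic_on_power K_hol a_hol) (auto simp: a_nz)
 fix n w assume w: "w \<in> D"
 have "c w n (hw w) = K w ^ n / a w n"
  unfolding c_def by (simp add: T_pow_hw w l_sc hw l_hw)
 then have "cmod (K w ^ n / a w n - g w) <= C0 * q ^ n * nm (hw w)"
  unfolding g_def using c_lim_bound'[OF w hw(1)[OF w], of n] by simp
 also have "... <= C0 * q ^ n * (H + 1)" using C0 q nm_hw_le[OF w] by (intro mult_left_mono) auto
 finally show "cmod (K w ^ n / a w n - g w) <= C0 * (H + 1) * q ^ n" by (simp add: mult_ac)
qed

lemma hh_hol: "(%w. hh w x) holomorphic_on D"
 unfolding hh_def sc_apply
 by (intro holomorphic_on_mult holomorphic_on_divide holomorphic_on_const hw_hol g_hol) (auto simp: g_nz)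

end

section \<open>Non-negative vectors and the simplex\<close>

abbreviation nonneg_vec :: "real ^ 'n => bool" where
 "nonneg_vec x \<equiv> \<forall>i. 0 <= x $ i"

lemma l1norm_nonneg_vec: "nonneg_vec x ==> l1norm x = (\<Sum>i\<in>UNIV. x $ i)"
 by (simp add: l1norm_def)

lemma l1norm_ge_0: "0 <= l1norm x" by (simp add: l1norm_def sum_nonneg)

lemma l1norm_scaleR: "l1norm (c *\<^sub>R x) = \<bar>c\<bar> * l1norm x"
 by (simp add: l1norm_def abs_mult sum_distrib_left)

lemma l1norm_eq_0: "l1norm x = 0 \<longleftrightarrow> x = 0"
 by (simp add: l1norm_def sum_nonneg_eq_0_iff vec_eq_iff)

lemma l1norm_pos: "x ~= 0 ==> 0 < l1norm x"
 using l1norm_ge_0[of x] l1norm_eq_0[of x] by linarith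

lemma continuous_on_l1norm [continuous_intros]:
 "continuous_on A f ==> continuous_on A (%x. l1norm (f x :: real ^ 'n))"
 unfolding l1norm_def by (intro continuous_intros)

lemma simplex_D:
 assumes "v \<in> \<S>"
 shows "0 <= v $ i" "v $ i <= 1" "(\<Sum>i\<in>UNIV. v $ i) = 1" "l1norm v = 1" "v ~= 0"
proof -
 show *: "0 <= v $ i" for i using assms by (auto simp: simplex_S_def)
 show l: "l1norm v = 1" using assms by (auto simp: simplex_S_def)
 show s: "(\<Sum>i\<in>UNIV. v $ i) = 1" using l * by (simp add: l1norm_nonneg_vec)
 show "v $ i <= 1" using member_le_sum[of i UNIV "%i. v $ i"] * s by simp
 show "v ~= 0" using l l1norm_eq_0[of v] by auto
qed

lemma simplex_I: "nonneg_vec v ==> (\<Sum>i\<in>UNIV. v $ i) = 1 ==> v \<in> \<S>"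
 by (simp add: simplex_S_def l1norm_nonneg_vec)

lemma normalize_simplex: "nonneg_vec x ==> x ~= 0 ==> x /\<^sub>R l1norm x \<in> \<S>"
 using l1norm_pos[of x] by (auto simp: simplex_S_def l1norm_scaleR)

definition center :: "real ^ 'n" where "center = (\<chi> i. 1 / real CARD('n))"

lemma center_simplex: "center \<in> \<S>"
 by (rule simplex_I) (auto simp: center_def)

lemma closed_simplex: "closed (\<S> :: (real ^ 'n) set)"
proof -
 have "\<S> = (\<Inter>i. {v::real^'n. 0 <= v $ i}) \<inter> {v. l1norm v = 1}" by (auto simp: simplex_S_def)
 moreover have "closed {v::real^'n. l1norm v = 1}"
  by (intro closed_Collect_eq continuous_intros)
 moreover have "closed {v::real^'n. 0 <= v $ i}" for i
  by (intro closed_Collect_le continuous_intros)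
 ultimately show ?thesis by (metis (no_types, lifting) closed_INT closed_Int)
qed

lemma norm_le_l1norm: "norm x <= l1norm x" unfolding l1norm_def by (rule norm_le_l1_cart)

lemma compact_simplex: "compact (\<S> :: (real ^ 'n) set)"
proof -
 have "\<S> \<subseteq> cball (0::real^'n) 1" using norm_le_l1norm simplex_D(4) by (metis mem_cball_0 subsetI)
 then show ?thesis using closed_simplex bounded_subset bounded_cball compact_eq_bounded_closed by blast
qed

subsection \<open>The Hilbert cross-ratio metric\<close>

lemma m_ratio:
 assumes u: "u \<in> \<S>" and v: "v \<in> \<S>"
 shows m_ratio_ge: "0 <= l ==> (!!i. l * v $ i <= u $ i) ==> l <= m_ratio u v"
  and m_ratio_0: "0 <= m_ratio u v" and m_ratio_1: "m_ratio u v <= 1"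
  and m_ratio_le: "m_ratio u v * v $ i <= u $ i"
proof -
 let ?A = "{l. 0 <= l & (\<forall>i. l * v $ i <= u $ i)}"
 have le1: "l <= 1" if "l \<in> ?A" for l
 proof -
  have "(\<Sum>i\<in>UNIV. l * v $ i) <= (\<Sum>i\<in>UNIV. u $ i)" using that by (intro sum_mono) auto
  then show ?thesis using simplex_D(3)[OF u] simplex_D(3)[OF v] by (simp add: sum_distrib_left[symmetric])
 qed
 then have bdd: "bdd_above ?A" by (intro bdd_aboveI)
 have 0: "0 \<in> ?A" using simplex_D(1)[OF u] by simp
 show ge: "0 <= l ==> (!!i. l * v $ i <= u $ i) ==> l <= m_ratio u v" for l
  unfolding m_ratio_def by (intro cSup_upper bdd) auto
 show "0 <= m_ratio u v" using ge[of 0] simplex_D(1)[OF u] by simp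
 show "m_ratio u v <= 1" unfolding m_ratio_def using 0 le1 by (intro cSup_least) auto
 show "m_ratio u v * v $ i <= u $ i"
 proof (cases "v $ i = 0")
  case True then show ?thesis using simplex_D(1)[OF u] by simp
 next
  case False
  then have pos: "0 < v $ i" using simplex_D(1)[OF v, of i] by linarith
  have "m_ratio u v <= u $ i / v $ i"
   unfolding m_ratio_def using 0 pos by (intro cSup_least) (auto simp: field_simps)
  then show ?thesis using pos by (simp add: field_simps)
 qed
qed

text \<open>In terms of Hilbert's projective metric \<open>D\<close> this is
  \<open>exp (-D)\<close>, and \<open>d_hilbert\<close> is \<open>tanh (D/2)\<close>. Since
  \<open>d_hilbert\<close> decreases in \<open>cr\<close>, upper bounds for distances are obtained
  as lower bounds for \<open>cr\<close>.\<close>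

definition cr :: "real ^ 'n => real ^ 'n => real" where
 "cr u v = m_ratio u v * m_ratio v u"

lemma cr_bounds: "u \<in> \<S> ==> v \<in> \<S> ==> 0 <= cr u v" "u \<in> \<S> ==> v \<in> \<S> ==> cr u v <= 1"
 unfolding cr_def using m_ratio_0[of u v] m_ratio_0[of v u] m_ratio_1[of u v] m_ratio_1[of v u]
 by (auto intro: mult_le_one)

lemma cr_commute: "cr u v = cr v u" by (simp add: cr_def mult.commute)

lemma d_hilbert_cr: "d_hilbert u v = (1 - cr u v) / (1 + cr u v)"
 by (simp add: d_hilbert_def cr_def)

lemma d_hilbert_bounds:
 assumes "u \<in> \<S>" "v \<in> \<S>"
 shows "0 <= d_hilbert u v" "d_hilbert u v <= 1" "cr u v = (1 - d_hilbert u v) / (1 + d_hilbert u v)"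
proof -
 note c = cr_bounds[OF assms]
 show "0 <= d_hilbert u v" "d_hilbert u v <= 1" unfolding d_hilbert_cr using c by (auto simp: field_simps)
 have "1 + d_hilbert u v = 2 / (1 + cr u v)" "1 - d_hilbert u v = 2 * cr u v / (1 + cr u v)"
  unfolding d_hilbert_cr using c by (auto simp: field_simps)
 then show "cr u v = (1 - d_hilbert u v) / (1 + d_hilbert u v)" using c by simp
qed

lemma d_hilbert_commute: "d_hilbert u v = d_hilbert v u" unfolding d_hilbert_cr cr_commute[of u v] ..

lemma cr_eq_1: assumes "u \<in> \<S>" "v \<in> \<S>" "cr u v = 1" shows "u = v"
proof -
 have "m_ratio u v = 1" "m_ratio v u = 1"
  using assms(3) m_ratio_0[OF assms(1,2)] m_ratio_1[OF assms(1,2)] m_ratio_0[OF assms(2,1)] m_ratio_1[OF assms(2,1)]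
   mult_left_le[of "m_ratio v u" "m_ratio u v"] mult_right_le_one_le[of "m_ratio v u" "m_ratio u v"]
   mult_left_le_one_le[of "m_ratio v u" "m_ratio u v"]
  unfolding cr_def by linarith+
 then show ?thesis using m_ratio_le[OF assms(1,2)] m_ratio_le[OF assms(2,1)]
  by (simp add: vec_eq_iff) (meson antisym)
qed

lemma d_hilbert_pos: "u \<in> \<S> ==> v \<in> \<S> ==> u ~= v ==> 0 < d_hilbert u v"
 unfolding d_hilbert_cr using cr_bounds[of u v] cr_eq_1[of u v] by (auto simp: field_simps less_le)

lemma d_hilbert_self: "v \<in> \<S> ==> d_hilbert v v = 0"
proof -
 assume v: "v \<in> \<S>"
 have "1 <= m_ratio v v" by (intro m_ratio_ge v) auto
 then have "m_ratio v v = 1" using m_ratio_1[OF v v] by simp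
 then show ?thesis by (simp add: d_hilbert_cr cr_def)
qed

text \<open>The smallest ratio \<open>u $ i / v $ i\<close> is admissible in
  \<open>m_ratio u v\<close>, and likewise with the roles exchanged. The product of these two ratios
  is a single cross ratio, which \<open>R\<close> bounds from below.\<close>

lemma cr_ge:
 fixes u v :: "real ^ 'n"
 assumes u: "u \<in> \<S>" and v: "v \<in> \<S>" and pos: "!!i. 0 < u $ i" "!!i. 0 < v $ i"
  and R: "!!i k. R * (v $ i * u $ k) <= u $ i * v $ k"
 shows "R <= cr u v"
proof -
 have "\<exists>i. \<forall>j. u $ i / v $ i <= u $ j / v $ j" using ex_min_if_finite[of "range (%i. u $ i / v $ i)"]
  by (auto simp: not_less)
 then obtain i where i: "!!j. u $ i / v $ i <= u $ j / v $ j" by blast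
 have "\<exists>i. \<forall>j. v $ i / u $ i <= v $ j / u $ j" using ex_min_if_finite[of "range (%i. v $ i / u $ i)"]
  by (auto simp: not_less)
 then obtain k where k: "!!j. v $ k / u $ k <= v $ j / u $ j" by blast
 have a: "u $ i / v $ i <= m_ratio u v"
 proof (rule m_ratio_ge[OF u v])
  show "0 <= u $ i / v $ i" using pos less_imp_le by (intro divide_nonneg_nonneg) auto
  show "u $ i / v $ i * v $ j <= u $ j" for j using i[of j] pos(2)[of j] by (simp add: pos_le_divide_eq)
 qed
 have b: "v $ k / u $ k <= m_ratio v u"
 proof (rule m_ratio_ge[OF v u])
  show "0 <= v $ k / u $ k" using pos less_imp_le by (intro divide_nonneg_nonneg) auto
  show "v $ k / u $ k * u $ j <= v $ j" for j using k[of j] pos(1)[of j] by (simp add: pos_le_divide_eq)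
 qed
 have "R <= (u $ i / v $ i) * (v $ k / u $ k)"
  using R[of i k] pos(1)[of k] pos(2)[of i] by (simp add: field_simps)
 also have "... <= cr u v"
  unfolding cr_def using a b pos by (intro mult_mono m_ratio_0 u v) (auto intro: less_imp_le)
 finally show ?thesis .
qed

text \<open>By \<open>m_ratio u v * v <= u\<close> a coordinate drops by at most
  \<open>1 - m_ratio u v <= 1 - cr\<close>, and \<open>1 - cr = d (1 + cr) <= 2 d\<close>.
  Consequently Euclidean Lipschitz functions are Lipschitz for \<open>d_hilbert\<close>.\<close>

lemma coord_diff_le: "u \<in> \<S> ==> v \<in> \<S> ==> \<bar>u $ i - v $ i\<bar> <= 2 * d_hilbert u v"
proof -
 have *: "v $ i - u $ i <= 2 * d_hilbert u v" if u: "u \<in> \<S>" and v: "v \<in> \<S>" for u v :: "real ^ 'a"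
 proof -
  have "v $ i - u $ i <= (1 - m_ratio u v) * v $ i" using m_ratio_le[OF u v, of i] by (simp add: algebra_simps)
  also have "... <= (1 - cr u v) * 1"
  proof (intro mult_mono)
   have "cr u v <= m_ratio u v * 1" unfolding cr_def by (intro mult_left_mono m_ratio_0 m_ratio_1 u v)
   then show "1 - m_ratio u v <= 1 - cr u v" by simp
  qed (use simplex_D[OF v] cr_bounds[OF u v] in auto)
  also have "1 - cr u v <= 2 * d_hilbert u v"
   unfolding d_hilbert_cr using cr_bounds[OF u v] zero_le_square[of "1 - cr u v"] by (simp add: field_simps)
  finally show ?thesis by simp
 qed
 show "u \<in> \<S> ==> v \<in> \<S> ==> \<bar>u $ i - v $ i\<bar> <= 2 * d_hilbert u v"
  using *[of u v] *[of v u] by (simp add: d_hilbert_commute abs_le_iff)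
qed

lemma dist_le_d_hilbert:
 fixes u v :: "real ^ 'n"
 shows "u \<in> \<S> ==> v \<in> \<S> ==> dist u v <= 2 * real CARD('n) * d_hilbert u v"
proof -
 assume uv: "u \<in> \<S>" "v \<in> \<S>"
 have "dist u v <= (\<Sum>i\<in>UNIV. \<bar>(u - v) $ i\<bar>)" unfolding dist_norm by (rule norm_le_l1_cart)
 also have "... <= (\<Sum>i\<in>(UNIV :: 'n set). 2 * d_hilbert u v)" using coord_diff_le[OF uv] by (intro sum_mono) auto
 finally show ?thesis by (simp add: mult_ac)
qed

section \<open>Positive matrices and Birkhoff's contraction\<close>

text \<open>For a positive matrix, the best such \<open>p\<close> is \<open>exp (-D)\<close> with
  \<open>D\<close> the projective diameter of the image of the cone.\<close>

definition cross_ratio_bound :: "real => real ^ 'n ^ 'm => bool" where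
 "cross_ratio_bound p g \<longleftrightarrow> (\<forall>i j k l. p * (g $ i $ l * g $ k $ j) <= g $ i $ j * g $ k $ l)"

lemma mat_vec_nth: "(g *v x) $ i = (\<Sum>j\<in>UNIV. g $ i $ j * x $ j)" for g :: "real ^ 'n ^ 'm"
 by (simp add: matrix_vector_mult_def)

lemma pos_mat_vec_pos:
 fixes g :: "real ^ 'n ^ 'n"
 assumes "pos_mat g" "nonneg_vec x" "x ~= 0"
 shows "0 < (g *v x) $ i"
proof -
 obtain j where "x $ j ~= 0" using assms(3) by (auto simp: vec_eq_iff)
 then have "0 < x $ j" using assms(2) by (simp add: less_le)
 then show ?thesis unfolding mat_vec_nth using assms(1,2)
  by (intro sum_pos2[of _ j]) (auto simp: pos_mat_def less_imp_le)
qed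

lemma pos_mat_act:
 fixes g :: "real ^ 'n ^ 'n"
 assumes "pos_mat g" "v \<in> \<S>"
 shows "act g v \<in> \<S>" "0 < act g v $ i" "0 < l1norm (g *v v)" "g *v v = l1norm (g *v v) *\<^sub>R act g v"
proof -
 have p: "0 < (g *v v) $ i" for i using pos_mat_vec_pos[OF assms(1)] simplex_D[OF assms(2)] by auto
 then have nz: "g *v v ~= 0" by (auto simp: vec_eq_iff less_le)
 show l: "0 < l1norm (g *v v)" using l1norm_pos[OF nz] .
 show "act g v \<in> \<S>" unfolding act_def using normalize_simplex[OF _ nz] p by (auto intro: less_imp_le)
 show "0 < act g v $ i" unfolding act_def using p l by simp
 show "g *v v = l1norm (g *v v) *\<^sub>R act g v" unfolding act_def using l by simp
qed

lemma cross_ratio_vec: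
 fixes g :: "real ^ 'n ^ 'm"
 assumes p: "cross_ratio_bound p g" and x: "nonneg_vec x" and y: "nonneg_vec y"
 shows "p * ((g *v x) $ k * (g *v y) $ i) <= (g *v x) $ i * (g *v y) $ k"
proof -
 have "p * ((g *v x) $ k * (g *v y) $ i) = (\<Sum>j\<in>UNIV. \<Sum>l\<in>UNIV. p * (g $ i $ l * g $ k $ j) * (x $ j * y $ l))"
  unfolding mat_vec_nth sum_product by (simp add: sum_distrib_left mult_ac)
 also have "... <= (\<Sum>j\<in>UNIV. \<Sum>l\<in>UNIV. (g $ i $ j * g $ k $ l) * (x $ j * y $ l))"
  using p x y by (intro sum_mono mult_right_mono) (auto simp: cross_ratio_bound_def)
 also have "... = (g *v x) $ i * (g *v y) $ k"
  unfolding mat_vec_nth sum_product by (simp add: sum_distrib_left mult_ac)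
 finally show ?thesis .
qed

text \<open>Birkhoff's contraction: with \<open>x = u - m v\<close> and \<open>y = v - m' u\<close>, where \<open>m = m(u,v)\<close> and
 \<open>m' = m(v,u)\<close>, the images of \<open>u\<close> and \<open>v\<close> are combinations of \<open>g x\<close> and \<open>g y\<close>, whose
 coordinates satisfy the cross ratio bound.\<close>

lemma birkhoff_contraction:
 fixes g :: "real ^ 'n ^ 'n"
 assumes g: "pos_mat g" and p: "cross_ratio_bound p g" "0 <= p" "p <= 1"
  and u: "u \<in> \<S>" and v: "v \<in> \<S>"
 shows "d_hilbert (act g u) (act g v) <= (1 - p) / (1 + p) * d_hilbert u v"
proof (cases "u = v")
 case True
 then show ?thesis using d_hilbert_self[OF v] d_hilbert_self[OF pos_mat_act(1)[OF g v]] by simp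
next
 case False
 define m where "m = m_ratio u v"
 define m' where "m' = m_ratio v u"
 define q where "q = cr u v"
 have q: "q = m * m'" by (simp add: q_def cr_def m_def m'_def)
 have m: "0 <= m" "0 <= m'" using m_ratio_0[OF u v] m_ratio_0[OF v u] by (auto simp: m_def m'_def)
 have q01: "0 <= q" "q < 1" using cr_bounds[OF u v] cr_eq_1[OF u v] False by (auto simp: q_def less_le)
 define X where "X = g *v (u - m *\<^sub>R v)"
 define Y where "Y = g *v (v - m' *\<^sub>R u)"
 have x0: "nonneg_vec (u - m *\<^sub>R v)" using m_ratio_le[OF u v] by (simp add: m_def)
 have y0: "nonneg_vec (v - m' *\<^sub>R u)" using m_ratio_le[OF v u] by (simp add: m'_def)
 have X0: "0 <= X $ i" for i unfolding X_def mat_vec_nth using g x0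
  by (intro sum_nonneg mult_nonneg_nonneg) (auto simp: pos_mat_def less_imp_le)
 have Y0: "0 <= Y $ i" for i unfolding Y_def mat_vec_nth using g y0
  by (intro sum_nonneg mult_nonneg_nonneg) (auto simp: pos_mat_def less_imp_le)
 have XY: "p * (X $ k * Y $ i) <= X $ i * Y $ k" for i k
  unfolding X_def Y_def by (rule cross_ratio_vec[OF p(1) x0 y0])
 have gu: "(1 - q) *\<^sub>R (g *v u) = X + m *\<^sub>R Y"
  unfolding X_def Y_def q
  by (simp add: matrix_vector_mult_diff_distrib matrix_vector_mult_scaleR algebra_simps)
 have gv: "(1 - q) *\<^sub>R (g *v v) = Y + m' *\<^sub>R X"
  unfolding X_def Y_def q
  by (simp add: matrix_vector_mult_diff_distrib matrix_vector_mult_scaleR algebra_simps)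
 \<comment> \<open>The addition theorem of \<open>tanh\<close>: for this \<open>R\<close>,
   \<open>(1 - R) / (1 + R)\<close> is the product of \<open>(1 - p) / (1 + p)\<close> and
   \<open>(1 - q) / (1 + q)\<close>.\<close>
 define R where "R = (p + q) / (1 + p * q)"
 have pq: "0 < 1 + p * q" using p q01 by (simp add: add_pos_nonneg)
 \<comment> \<open>By \<open>q = m * m'\<close> the mixed products collect into the inequality
   \<open>XY\<close> with coefficient \<open>1 - q^2\<close>; the remaining terms are
   non-negative.\<close>
 have key: "(p + q) * ((Y $ i + m' * X $ i) * (X $ k + m * Y $ k)) <= (1 + p * q) * ((X $ i + m * Y $ i) * (Y $ k + m' * X $ k))" for i k
 proof -
  have "(1 + p * q) * ((X $ i + m * Y $ i) * (Y $ k + m' * X $ k)) - (p + q) * ((Y $ i + m' * X $ i) * (X $ k + m * Y $ k))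
   = (1 - q * q) * (X $ i * Y $ k - p * (X $ k * Y $ i)) + (1 - p) * (1 - q) * (m * (Y $ i * Y $ k) + m' * (X $ i * X $ k))"
   unfolding q by (simp add: algebra_simps)
  also have "... >= 0"
   using XY[of k i] X0 Y0 p q01 m by (intro add_nonneg_nonneg mult_nonneg_nonneg) (auto intro: mult_le_one)
  finally show ?thesis by simp
 qed
 have "R <= cr (act g u) (act g v)"
 proof (rule cr_ge)
  fix i k
  define a where "a = inverse (l1norm (g *v u))"
  define b where "b = inverse (l1norm (g *v v))"
  have ab: "0 <= a" "0 <= b" by (auto simp: a_def b_def l1norm_ge_0)
  have "(p + q) * (((1 - q) *\<^sub>R (g *v v)) $ i * ((1 - q) *\<^sub>R (g *v u)) $ k)
    <= (1 + p * q) * (((1 - q) *\<^sub>R (g *v u)) $ i * ((1 - q) *\<^sub>R (g *v v)) $ k)"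
   unfolding gu gv using key[of i k] by simp
  then have "((1 - q) * (1 - q)) * ((p + q) * ((g *v v) $ i * (g *v u) $ k))
   <= ((1 - q) * (1 - q)) * ((1 + p * q) * ((g *v u) $ i * (g *v v) $ k))" by (simp add: mult_ac)
  then have "(p + q) * ((g *v v) $ i * (g *v u) $ k) <= (1 + p * q) * ((g *v u) $ i * (g *v v) $ k)"
   using q01 by (subst (asm) mult_le_cancel_left_pos) auto
  then have "R * ((g *v v) $ i * (g *v u) $ k) <= (g *v u) $ i * (g *v v) $ k"
   unfolding R_def using pq by (simp add: field_simps)
  then have "(a * b) * (R * ((g *v v) $ i * (g *v u) $ k)) <= (a * b) * ((g *v u) $ i * (g *v v) $ k)"
   using ab by (intro mult_left_mono) auto
  then show "R * (act g v $ i * act g u $ k) <= act g u $ i * act g v $ k"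
   unfolding act_def a_def[symmetric] b_def[symmetric] by (simp add: mult_ac)
 qed (use pos_mat_act[OF g] u v in auto)
 moreover have "0 <= R" unfolding R_def using p q01 pq by auto
 ultimately have "d_hilbert (act g u) (act g v) <= (1 - R) / (1 + R)"
  unfolding d_hilbert_cr by (intro frac_le) (use cr_bounds[OF pos_mat_act(1)[OF g u] pos_mat_act(1)[OF g v]] in auto)
 also have "... = (1 - p) / (1 + p) * ((1 - q) / (1 + q))"
 proof -
  have "1 - R = (1 - p) * (1 - q) / (1 + p * q)" "1 + R = (1 + p) * (1 + q) / (1 + p * q)"
   unfolding R_def using pq by (auto simp: field_simps)
  then show ?thesis using pq by simp
 qed
 finally show ?thesis by (simp add: d_hilbert_cr q_def)
qed

subsection \<open>The function spaces and their operators\<close>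

context
 fixes \<gamma> :: real
begin

private abbreviation "V \<equiv> space_B \<gamma>"
private abbreviation "nB \<equiv> norm_B \<gamma>"

text \<open>Separate constants for the supremum and the Hoelder seminorm; with its converse
  \<open>space_B_D\<close> it keeps the extended-real suprema of \<open>ext_norm_B\<close> out of
  the later estimates.\<close>

lemma space_B_I:
 assumes "continuous_on \<S> f" "!!v. v \<notin> \<S> ==> f v = 0"
  and a: "!!v. v \<in> \<S> ==> cmod (f v) <= a" "0 <= a"
  and b: "!!u v. u \<in> \<S> ==> v \<in> \<S> ==> cmod (f u - f v) <= b * d_hilbert u v powr \<gamma>" "0 <= b"
 shows "f \<in> V" "nB f <= a + b"
proof -
 have A: "(SUP v\<in>\<S>. ennreal (cmod (f v))) <= ennreal a"
  using a by (intro SUP_least ennreal_leI)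
 have B: "(SUP (u, v)\<in>{(u, v). u \<in> \<S> & v \<in> \<S> & u ~= v}.
    ennreal (cmod (f u - f v) / d_hilbert u v powr \<gamma>)) <= ennreal b"
 proof (intro SUP_least, clarify, intro ennreal_leI)
  fix u v :: "real ^ 'a" assume uv: "u \<in> \<S>" "v \<in> \<S>" "u ~= v"
  then have "0 < d_hilbert u v powr \<gamma>" using d_hilbert_pos by force
  then show "cmod (f u - f v) / d_hilbert u v powr \<gamma> <= b" using b(1)[OF uv(1,2)] by (simp add: field_simps)
 qed
 have E: "ext_norm_B \<gamma> f <= ennreal (a + b)"
  unfolding ext_norm_B_def using add_mono[OF A B] a(2) b(2) by simp
 then show "f \<in> V" using assms by (auto simp: space_B_def intro: le_less_trans)
 show "nB f <= a + b" unfolding norm_B_def using E a(2) b(2) by (intro enn2real_leI) auto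
qed

lemma space_B_D:
 assumes "f \<in> V"
 obtains a b where "0 <= a" "0 <= b" "nB f = a + b"
  "!!v. v \<in> \<S> ==> cmod (f v) <= a"
  "!!u v. u \<in> \<S> ==> v \<in> \<S> ==> cmod (f u - f v) <= b * d_hilbert u v powr \<gamma>"
proof -
 define A where "A = (SUP v\<in>\<S>. ennreal (cmod (f v)))"
 define B where "B = (SUP (u, v)\<in>{(u, v). u \<in> \<S> & v \<in> \<S> & u ~= v}.
    ennreal (cmod (f u - f v) / d_hilbert u v powr \<gamma>))"
 have AB: "A + B < \<infinity>" using assms by (simp add: space_B_def ext_norm_B_def A_def B_def)
 then have fin: "A < \<infinity>" "B < \<infinity>" by auto
 show thesis
 proof (rule that[of "enn2real A" "enn2real B"])
  show "nB f = enn2real A + enn2real B"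
   unfolding norm_B_def ext_norm_B_def A_def[symmetric] B_def[symmetric] using fin by (simp add: enn2real_plus)
  fix v :: "real ^ 'a" assume v: "v \<in> \<S>"
  have "ennreal (cmod (f v)) <= A" unfolding A_def using v by (rule SUP_upper)
  then show "cmod (f v) <= enn2real A" using fin(1) enn2real_mono[of "ennreal (cmod (f v))" A] by simp
  fix u :: "real ^ 'a" assume u: "u \<in> \<S>"
  show "cmod (f u - f v) <= enn2real B * d_hilbert u v powr \<gamma>"
  proof (cases "u = v")
   case False
   then have d: "0 < d_hilbert u v powr \<gamma>" using d_hilbert_pos[OF u v] by simp
   have "ennreal (cmod (f u - f v) / d_hilbert u v powr \<gamma>) <= B"
    unfolding B_def using u v False by (intro SUP_upper2[of "(u, v)"]) auto
   then have "cmod (f u - f v) / d_hilbert u v powr \<gamma> <= enn2real B"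
    using fin(2) enn2real_mono[of "ennreal (cmod (f u - f v) / d_hilbert u v powr \<gamma>)" B] by simp
   then show ?thesis using d by (simp add: field_simps)
  qed simp
 qed simp_all
qed

lemma space_B_cont: "f \<in> V ==> continuous_on \<S> f"
 and space_B_outside: "f \<in> V ==> v \<notin> \<S> ==> f v = 0"
 by (auto simp: space_B_def)

lemma norm_B_nonneg [simp]: "0 <= nB f" by (simp add: norm_B_def)

lemma space_B_bound: "f \<in> V ==> cmod (f v) <= nB f"
proof (cases "v \<in> \<S>")
 case True assume "f \<in> V"
 then show ?thesis by (rule space_B_D) (use True in fastforce)
qed (use space_B_outside norm_B_nonneg in fastforce)

lemma space_B_holder: "f \<in> V ==> u \<in> \<S> ==> v \<in> \<S> ==>
  cmod (f u - f v) <= nB f * d_hilbert u v powr \<gamma>"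
proof -
 assume "f \<in> V" and uv: "u \<in> \<S>" "v \<in> \<S>"
 then obtain a b where ab: "0 <= a" "nB f = a + b" "cmod (f u - f v) <= b * d_hilbert u v powr \<gamma>"
  by (metis space_B_D)
 then have "b * d_hilbert u v powr \<gamma> <= (a + b) * d_hilbert u v powr \<gamma>" by (intro mult_right_mono) auto
 with ab(3) show ?thesis unfolding ab(2) by (rule order_trans)
qed

lemma space_B_0: "(%v. 0) \<in> V" "nB (%v. 0) = 0"
 using space_B_I[of "%v. 0" 0 0] norm_B_nonneg[of "%v. 0"] by (auto intro: antisym)

lemma space_B_add:
 assumes "f \<in> V" "\<psi> \<in> V"
 shows "f + \<psi> \<in> V" "nB (f + \<psi>) <= nB f + nB \<psi>"
proof -
 obtain a b where 1: "0 <= a" "0 <= b" "nB f = a + b"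
  "!!v. v \<in> \<S> ==> cmod (f v) <= a"
  "!!u v. u \<in> \<S> ==> v \<in> \<S> ==> cmod (f u - f v) <= b * d_hilbert u v powr \<gamma>"
  using space_B_D[OF assms(1)] by blast
 obtain a' b' where 2: "0 <= a'" "0 <= b'" "nB \<psi> = a' + b'"
  "!!v. v \<in> \<S> ==> cmod (\<psi> v) <= a'"
  "!!u v. u \<in> \<S> ==> v \<in> \<S> ==> cmod (\<psi> u - \<psi> v) <= b' * d_hilbert u v powr \<gamma>"
  using space_B_D[OF assms(2)] by blast
 have c: "continuous_on \<S> (f + \<psi>)"
  unfolding plus_fun_def using assms by (intro continuous_intros space_B_cont)
 have h: "cmod ((f + \<psi>) u - (f + \<psi>) v) <= (b + b') * d_hilbert u v powr \<gamma>"
  if "u \<in> \<S>" "v \<in> \<S>" for u v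
  using 1(5)[OF that] 2(5)[OF that] norm_triangle_ineq[of "f u - f v" "\<psi> u - \<psi> v"]
  by (simp add: algebra_simps)
 have bd: "cmod ((f + \<psi>) v) <= a + a'" if "v \<in> \<S>" for v
  using 1(4)[OF that] 2(4)[OF that] norm_triangle_ineq[of "f v" "\<psi> v"] by simp
 note I = space_B_I[OF c _ bd _ h] 
 show "f + \<psi> \<in> V" using 1 2 assms by (intro I(1)) (auto simp: space_B_outside)
 have "nB (f + \<psi>) <= (a + a') + (b + b')" using 1 2 assms by (intro I(2)) (auto simp: space_B_outside)
 then show "nB (f + \<psi>) <= nB f + nB \<psi>" using 1 2 by simp
qed

lemma space_B_sc_le:
 assumes "f \<in> V"
 shows "sc c f \<in> V" "nB (sc c f) <= cmod c * nB f"
proof -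
 obtain a b where 1: "0 <= a" "0 <= b" "nB f = a + b"
  "!!v. v \<in> \<S> ==> cmod (f v) <= a"
  "!!u v. u \<in> \<S> ==> v \<in> \<S> ==> cmod (f u - f v) <= b * d_hilbert u v powr \<gamma>"
  using space_B_D[OF assms(1)] by blast
 have cc: "continuous_on \<S> (sc c f)"
  unfolding sc_def using assms by (intro continuous_intros space_B_cont)
 have h: "cmod (sc c f u - sc c f v) <= (cmod c * b) * d_hilbert u v powr \<gamma>"
  if "u \<in> \<S>" "v \<in> \<S>" for u v
  using mult_left_mono[OF 1(5)[OF that], of "cmod c"]
  by (simp add: right_diff_distrib[symmetric] norm_mult mult.assoc)
 have bd: "cmod (sc c f v) <= cmod c * a" if "v \<in> \<S>" for v
  using 1(4)[OF that] by (simp add: norm_mult mult_left_mono)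
 note I = space_B_I[OF cc _ bd _ h]
 show "sc c f \<in> V" using 1 assms by (intro I(1)) (auto simp: space_B_outside)
 have "nB (sc c f) <= cmod c * a + cmod c * b" using 1 assms by (intro I(2)) (auto simp: space_B_outside)
 then show "nB (sc c f) <= cmod c * nB f" using 1 by (simp add: algebra_simps)
qed

lemma norm_B_sc: "f \<in> V ==> nB (sc c f) = cmod c * nB f"
proof (cases "c = 0")
 case True
 then have "sc c f = (%v. 0)" by (simp add: fun_eq_iff)
 then show ?thesis using True by (simp add: space_B_0)
next
 case False
 assume f: "f \<in> V"
 have "sc (1 / c) (sc c f) = f" using False by (simp add: fun_eq_iff)
 then have "nB f <= (1 / cmod c) * nB (sc c f)"
  using space_B_sc_le(2)[OF space_B_sc_le(1)[OF f], of "1 / c" c] by (simp add: norm_divide)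
 then show ?thesis using False space_B_sc_le(2)[OF f, of c] by (simp add: field_simps)
qed

text \<open>The constant 3 is one unit for the supremum and two for the product rule in the Hoelder
  seminorm.\<close>

lemma space_B_mult:
 assumes "f \<in> V" "\<psi> \<in> V"
 shows "(%v. f v * \<psi> v) \<in> V" "nB (%v. f v * \<psi> v) <= 3 * nB f * nB \<psi>"
proof -
 let ?a = "nB f" and ?b = "nB \<psi>"
 have c: "continuous_on \<S> (%v. f v * \<psi> v)"
  using assms by (intro continuous_intros space_B_cont)
 have bd: "cmod (f v * \<psi> v) <= ?a * ?b" for v
  unfolding norm_mult using space_B_bound assms norm_B_nonneg by (intro mult_mono) auto
 have h: "cmod (f u * \<psi> u - f v * \<psi> v) <= (2 * ?a * ?b) * d_hilbert u v powr \<gamma>"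
  if uv: "u \<in> \<S>" "v \<in> \<S>" for u v
 proof -
  have "f u * \<psi> u - f v * \<psi> v = f u * (\<psi> u - \<psi> v) + (f u - f v) * \<psi> v" by (simp add: algebra_simps)
  then have "cmod (f u * \<psi> u - f v * \<psi> v) <= cmod (f u) * cmod (\<psi> u - \<psi> v) + cmod (f u - f v) * cmod (\<psi> v)"
   by (metis norm_mult norm_triangle_ineq)
  also have "... <= ?a * (?b * d_hilbert u v powr \<gamma>) + (?a * d_hilbert u v powr \<gamma>) * ?b"
   using space_B_bound assms norm_B_nonneg space_B_holder uv by (intro add_mono mult_mono) auto
  finally show ?thesis by (simp add: algebra_simps)
 qed
 note I = space_B_I[OF c _ bd _ h]
 show "(%v. f v * \<psi> v) \<in> V" using assms by (intro I(1)) (auto simp: space_B_outside norm_B_nonneg)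
 have "nB (%v. f v * \<psi> v) <= ?a * ?b + 2 * ?a * ?b"
  using assms by (intro I(2)) (auto simp: space_B_outside norm_B_nonneg)
 then show "nB (%v. f v * \<psi> v) <= 3 * nB f * nB \<psi>" by (simp add: mult_ac)
qed

lemma space_B_complete:
 assumes F: "!!n. F n \<in> V"
  and C: "!!e. 0 < e ==> \<exists>N. \<forall>n\<ge>N. \<forall>m\<ge>N. nB (F n - F m) < e"
 shows "\<exists>\<phi>\<in>V. (%n. nB (F n - \<phi>)) \<longlonglongrightarrow> 0"
proof -
 have minus: "f - g = f + sc (-1) g" for f g :: "real ^ 'a => complex" by (simp add: fun_eq_iff)
 have dV: "F n - F m \<in> V" for n m unfolding minus by (intro space_B_add space_B_sc_le F)
 have "Cauchy (%n. F n v)" for v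
 proof (rule metric_CauchyI)
  fix e :: real assume "0 < e"
  then obtain N where "\<forall>n\<ge>N. \<forall>m\<ge>N. nB (F n - F m) < e" using C by blast
  then show "\<exists>M. \<forall>m\<ge>M. \<forall>n\<ge>M. dist (F m v) (F n v) < e"
   using space_B_bound[OF dV, of _ _ v] unfolding dist_norm minus_apply by (metis le_less_trans)
 qed
 then have lim: "(%n. F n v) \<longlonglongrightarrow> lim (%n. F n v)" for v
  by (simp add: Cauchy_convergent_iff convergent_LIMSEQ_iff)
 define \<phi> where "\<phi> v = lim (%n. F n v)" for v
 have lim: "(%n. F n v) \<longlonglongrightarrow> \<phi> v" for v using lim by (simp add: \<phi>_def)
 have outside: "\<phi> v = 0" if "v \<notin> \<S>" for v
  using lim[of v] space_B_outside[OF F that] by (simp add: LIMSEQ_const_iff)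
 have est: "\<exists>N. \<forall>n\<ge>N. (\<forall>v. cmod (F n v - \<phi> v) <= e) &
   (\<forall>u\<in>\<S>. \<forall>v\<in>\<S>. cmod ((F n u - \<phi> u) - (F n v - \<phi> v)) <= e * d_hilbert u v powr \<gamma>)" if "0 < e" for e
 proof -
  obtain N where N: "!!n m. n >= N ==> m >= N ==> nB (F n - F m) < e" using C[OF \<open>0 < e\<close>] by blast
  have "cmod (F n v - \<phi> v) <= e" if n: "n >= N" for n v
  proof (rule LIMSEQ_le_const2)
   show "(%m. cmod (F n v - F m v)) \<longlonglongrightarrow> cmod (F n v - \<phi> v)" by (intro tendsto_intros lim)
   have "cmod (F n v - F m v) <= e" if "m >= N" for m
    using space_B_bound[OF dV, of n m v] N[OF n that] by simp
   then show "\<exists>M. \<forall>m\<ge>M. cmod (F n v - F m v) <= e" by blast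
  qed
  moreover have "cmod ((F n u - \<phi> u) - (F n v - \<phi> v)) <= e * d_hilbert u v powr \<gamma>"
   if n: "n >= N" and uv: "u \<in> \<S>" "v \<in> \<S>" for n u v
  proof (rule LIMSEQ_le_const2)
   show "(%m. cmod ((F n u - F m u) - (F n v - F m v))) \<longlonglongrightarrow> cmod ((F n u - \<phi> u) - (F n v - \<phi> v))"
    by (intro tendsto_intros lim)
   have "cmod ((F n u - F m u) - (F n v - F m v)) <= e * d_hilbert u v powr \<gamma>" if "m >= N" for m
    using space_B_holder[OF dV uv, of n m] N[OF n that]
     mult_right_mono[of "nB (F n - F m)" e "d_hilbert u v powr \<gamma>"] by simp
   then show "\<exists>M. \<forall>m\<ge>M. cmod ((F n u - F m u) - (F n v - F m v)) <= e * d_hilbert u v powr \<gamma>" by blast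
  qed
  ultimately show ?thesis by blast
 qed
 have "uniform_limit \<S> F \<phi> sequentially"
 proof (rule uniform_limitI)
  fix e :: real assume e: "0 < e"
  then obtain N where "\<forall>n\<ge>N. \<forall>v. cmod (F n v - \<phi> v) <= e/2" using est[of "e/2"] by auto
  then show "\<forall>\<^sub>F n in sequentially. \<forall>x\<in>\<S>. dist (F n x) (\<phi> x) < e"
   unfolding eventually_sequentially dist_norm using e by (smt (verit) field_sum_of_halves)
 qed
 then have cont: "continuous_on \<S> \<phi>"
  by (rule uniform_limit_theorem[rotated]) (auto simp: space_B_cont[OF F])
 have small: "F n - \<phi> \<in> V & nB (F n - \<phi>) <= e + e"
  if "0 < e" "(\<forall>v. cmod (F n v - \<phi> v) <= e) &
   (\<forall>u\<in>\<S>. \<forall>v\<in>\<S>. cmod ((F n u - \<phi> u) - (F n v - \<phi> v)) <= e * d_hilbert u v powr \<gamma>)" for n e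
 proof -
  have c: "continuous_on \<S> (F n - \<phi>)"
   unfolding fun_diff_def by (intro continuous_intros space_B_cont[OF F] cont)
  show ?thesis using that outside space_B_outside[OF F] by (intro conjI space_B_I[OF c]) auto
 qed
 obtain N where "\<forall>n\<ge>N. (\<forall>v. cmod (F n v - \<phi> v) <= 1) &
   (\<forall>u\<in>\<S>. \<forall>v\<in>\<S>. cmod ((F n u - \<phi> u) - (F n v - \<phi> v)) <= 1 * d_hilbert u v powr \<gamma>)"
  using est[of 1] by auto
 then have N: "F N - \<phi> \<in> V" using small[OF zero_less_one, of N] by blast
 have "\<phi> = F N + sc (-1) (F N - \<phi>)" by (simp add: fun_eq_iff)
 then have \<phi>V: "\<phi> \<in> V" using space_B_add(1)[OF F space_B_sc_le(1)[OF N]] by metis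
 moreover have "(%n. nB (F n - \<phi>)) \<longlonglongrightarrow> 0"
 proof (rule LIMSEQ_I)
  fix r :: real assume r: "0 < r"
  then obtain N where "\<forall>n\<ge>N. (\<forall>v. cmod (F n v - \<phi> v) <= r/3) &
   (\<forall>u\<in>\<S>. \<forall>v\<in>\<S>. cmod ((F n u - \<phi> u) - (F n v - \<phi> v)) <= r/3 * d_hilbert u v powr \<gamma>)"
   using est[of "r/3"] by auto
  then have "\<forall>n\<ge>N. nB (F n - \<phi>) <= r/3 + r/3" using small[of "r/3"] r by auto
  then show "\<exists>N. \<forall>n\<ge>N. norm (nB (F n - \<phi>) - 0) < r"
   using r norm_B_nonneg by (intro exI[of _ N]) (fastforce)
 qed
 ultimately show ?thesis by blast
qed

lemma fspace_B: "fspace (V) (nB)"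
proof
 show "0 \<in> V" using space_B_0(1) by (simp add: zero_fun_def)
qed (auto intro: space_B_add space_B_sc_le norm_B_sc space_B_bound space_B_complete)

section \<open>Operators on the Hoelder space: analyticity and spectrum\<close>

lemma bounded_ops_iff:
 "T \<in> bounded_ops \<gamma> \<longleftrightarrow> (\<forall>f\<in>V. T f \<in> V) &
   (\<forall>f\<in>V. \<forall>h\<in>V. T (f + h) = T f + T h) &
   (\<forall>c. \<forall>f\<in>V. T (sc c f) = sc c (T f)) &
   (\<exists>C. \<forall>f\<in>V. nB (T f) <= C * nB f)"
 by (simp add: bounded_ops_def plus_fun_def sc_def)

lemma op_norm_B_le:
 assumes "!!f. f \<in> V ==> nB (T f) <= C * nB f" "0 <= C"
 shows "op_norm_B \<gamma> T <= C" "0 <= op_norm_B \<gamma> T"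
proof -
 let ?A = "{nB (T f) |f. f \<in> V & nB f <= 1}"
 have ub: "x <= C" if "x \<in> ?A" for x
  using that assms by (auto intro: order_trans mult_left_le)
 have ne: "nB (T (%v. 0)) \<in> ?A" by (intro CollectI exI[of _ "%v. 0"]) (simp add: space_B_0)
 show "op_norm_B \<gamma> T <= C" unfolding op_norm_B_def using ub ne by (intro cSup_least) auto
 have "nB (T (%v. 0)) <= op_norm_B \<gamma> T"
  unfolding op_norm_B_def by (intro cSup_upper ne bdd_aboveI[of _ C] ub)
 then show "0 <= op_norm_B \<gamma> T" using norm_B_nonneg order_trans by blast
qed

text \<open>Cauchy's inequalities on discs of radius \<open>r/4\<close> give
  \<open>2 B / (r/4)^2 = 32 B / r^2\<close> for the second derivative and \<open>4 B / r\<close> for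
  the first. The bounds are linear in \<open>B\<close>, so \<open>B\<close> may carry a Hoelder
  weight or be integrated over matrices.\<close>

lemma second_order_estimate:
 assumes hol: "f holomorphic_on ball z r" and r: "0 < r"
  and B: "!!w. w \<in> ball z r ==> cmod (f w) <= B"
  and w: "cmod (w - z) <= r / 2"
 shows "cmod (f w - f z - (w - z) * deriv f z) <= 32 * B / r\<^sup>2 * (cmod (w - z))\<^sup>2"
  and "cmod (deriv f z) <= 4 * B / r"
proof -
 have cauchy: "cmod ((deriv ^^ n) f x) <= fact n * B / (r/4) ^ n" if x: "x \<in> cball z (r/2)" for n x
 proof (rule Cauchy_inequality)
  have sub: "cball x (r/4) \<subseteq> ball z r"
  proof
   fix y assume "y \<in> cball x (r/4)"
   then show "y \<in> ball z r" using x r dist_triangle[of z y x] by auto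
  qed
  show "f holomorphic_on ball x (r/4)" using sub by (intro holomorphic_on_subset[OF hol]) auto
  show "continuous_on (cball x (r/4)) f"
   using continuous_on_subset[OF holomorphic_on_imp_continuous_on[OF hol] sub] .
  show "0 < r/4" using r by simp
  fix y assume "cmod (x - y) = r/4"
  then have "y \<in> cball x (r/4)" by (simp add: dist_norm)
  then show "cmod (f y) <= B" using sub B by blast
 qed
 show "cmod (deriv f z) <= 4 * B / r" using cauchy[of z 1] r by (simp add: mult.commute)
 have der: "(f has_field_derivative deriv f x) (at x within cball z (r/2))"
  "(deriv f has_field_derivative deriv (deriv f) x) (at x within cball z (r/2))" if "x \<in> cball z (r/2)" for x
 proof -
  have xb: "x \<in> ball z r" using that r by auto
  have "deriv f holomorphic_on ball z r" by (intro holomorphic_deriv hol) auto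
  then show "(f has_field_derivative deriv f x) (at x within cball z (r/2))"
   "(deriv f has_field_derivative deriv (deriv f) x) (at x within cball z (r/2))"
   using holomorphic_derivI[OF hol _ xb] holomorphic_derivI[OF _ _ xb, of "deriv f"]
   by (auto intro: has_field_derivative_at_within)
 qed
 have "cmod ((deriv ^^ 0) f w - (\<Sum>i\<le>1. (deriv ^^ i) f z * (w - z) ^ i / fact i)) <= (32 * B / r\<^sup>2) * cmod (w - z) ^ Suc 1 / fact 1"
 proof (rule complex_Taylor[of "cball z (r/2)" 1 "%i. (deriv ^^ i) f"])
  show "((deriv ^^ i) f has_field_derivative (deriv ^^ Suc i) f x) (at x within cball z (r/2))"
   if "x \<in> cball z (r/2)" "i <= 1" for i x
   using that der[OF that(1)] by (cases i) auto
  show "cmod ((deriv ^^ Suc 1) f x) <= 32 * B / r\<^sup>2" if "x \<in> cball z (r/2)" for x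
   using cauchy[OF that, of 2] by (simp add: power2_eq_square numeral_2_eq_2 field_simps)
 qed (use w r in \<open>auto simp: dist_norm norm_minus_commute\<close>)
 then show "cmod (f w - f z - (w - z) * deriv f z) <= 32 * B / r\<^sup>2 * (cmod (w - z))\<^sup>2"
  by (simp add: power2_eq_square mult_ac diff_diff_eq)
qed

text \<open>For a bounded family of operators on \<open>V\<close>, pointwise holomorphy already gives
 analyticity in the operator norm: Cauchy's estimates are applied to the scalar functions
 \<open>z \<mapsto> F z f v\<close> and \<open>z \<mapsto> F z f u - F z f v\<close>.\<close>

lemma op_analytic_onI:
 fixes F :: "complex => 'n::finite operator"
 assumes D: "open D" and F: "!!z. z \<in> D ==> F z \<in> bounded_ops \<gamma>"
  and C: "!!z f. z \<in> D ==> f \<in> V ==> nB (F z f) <= C * nB f"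
  and hol: "!!f v. f \<in> V ==> (%z. F z f v) holomorphic_on D"
 shows "op_analytic_on \<gamma> F D"
 unfolding op_analytic_on_def
proof (intro conjI ballI D F)
 fix z assume z: "z \<in> D"
 obtain r where r: "0 < r" "ball z r \<subseteq> D" using D z open_contains_ball by blast
 define T where "T = (%f v. deriv (%z. F z f v) z)"
 have holr: "(%z. F z f v) holomorphic_on ball z r" if "f \<in> V" for f v
  using hol[OF that] r(2) holomorphic_on_subset by blast
 have FV: "F w f \<in> V" if "w \<in> ball z r" "f \<in> V" for w f
  using F[of w] that r(2) by (auto simp: bounded_ops_iff)
 have diffable: "(%z. F z f v) field_differentiable at z" if "f \<in> V" for f v
  using holr[OF that] r(1) holomorphic_on_imp_differentiable_at[of _ "ball z r" z] by auto
 define C' where "C' = max C 0"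
 have CC: "nB (F w f) <= C' * nB f" if "w \<in> ball z r" "f \<in> V" for w f
  using C[of w f] that r(2) mult_right_mono[of C C' "nB f"] norm_B_nonneg by (force simp: C'_def)
 have C'0: "0 <= C'" by (simp add: C'_def)
 have b1: "cmod (F w f v) <= C' * nB f" if "w \<in> ball z r" "f \<in> V" for w f v
  using space_B_bound[OF FV[OF that], of v] CC[OF that] by linarith
 have b2: "cmod (F w f u - F w f v) <= C' * nB f * d_hilbert u v powr \<gamma>"
  if "w \<in> ball z r" "f \<in> V" "u \<in> \<S>" "v \<in> \<S>" for w f u v
  using space_B_holder[OF FV[OF that(1,2)] that(3,4)] CC[OF that(1,2)]
   mult_right_mono[OF CC[OF that(1,2)], of "d_hilbert u v powr \<gamma>"] by simp
 have derdiff: "deriv (%z. F z f u - F z f v) z = T f u - T f v" if "f \<in> V" for f u v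
  unfolding T_def using diffable[OF that] by (rule deriv_diff) (rule diffable[OF that])
 define Q where "Q w f = (%v. (F w f v - F z f v) / (w - z) - T f v)" for w f
 define c where "c = 32 * C' / r\<^sup>2"
 have c0: "0 <= c" using C'0 by (simp add: c_def)
 have est: "cmod (X / h - Y) <= k * cmod h" if "cmod (X - h * Y) <= k * (cmod h)\<^sup>2" "h ~= 0" for X Y h k
 proof -
  have "cmod (X / h - Y) = cmod (X - h * Y) / cmod h" using that(2) by (simp add: norm_divide[symmetric] diff_divide_distrib)
  also have "... <= k * (cmod h)\<^sup>2 / cmod h" using that by (intro divide_right_mono) auto
  finally show ?thesis using that(2) by (simp add: power2_eq_square)
 qed
 have Q1: "cmod (Q w f v) <= (c * nB f) * cmod (w - z)"
  if "f \<in> V" "cmod (w - z) <= r/2" "w ~= z" for w f v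
  unfolding Q_def using second_order_estimate(1)[OF holr[OF that(1), of v] r(1) b1[OF _ that(1)] that(2)] that(3)
  by (intro est) (auto simp: T_def c_def mult_ac)
 have Q2: "cmod (Q w f u - Q w f v) <= (c * nB f * cmod (w - z)) * d_hilbert u v powr \<gamma>"
  if "f \<in> V" "cmod (w - z) <= r/2" "w ~= z" "u \<in> \<S>" "v \<in> \<S>" for w f u v
 proof -
  have "cmod (((F w f u - F w f v) - (F z f u - F z f v)) / (w - z) - (T f u - T f v))
   <= (c * nB f * d_hilbert u v powr \<gamma>) * cmod (w - z)"
   using second_order_estimate(1)[OF holomorphic_on_diff[OF holr[OF that(1)] holr[OF that(1)]] r(1) b2[OF _ that(1,4,5)] that(2)] that(3)
   unfolding derdiff[OF that(1)] by (intro est) (auto simp: c_def mult_ac)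
  moreover have "Q w f u - Q w f v = ((F w f u - F w f v) - (F z f u - F z f v)) / (w - z) - (T f u - T f v)"
   unfolding Q_def by (simp add: diff_divide_distrib)
  ultimately show ?thesis by (simp add: mult_ac)
 qed
 have T1: "cmod (T f v) <= 4 * C' / r * nB f" if "f \<in> V" for f v
  using second_order_estimate(2)[OF holr[OF that, of v] r(1) b1[OF _ that], of z] r(1) by (simp add: T_def)
 have T2: "cmod (T f u - T f v) <= (4 * C' / r * nB f) * d_hilbert u v powr \<gamma>"
  if "f \<in> V" "u \<in> \<S>" "v \<in> \<S>" for f u v
  using second_order_estimate(2)[OF holomorphic_on_diff[OF holr[OF that(1), of u] holr[OF that(1), of v]] r(1) b2[OF _ that], of z] r(1)
  unfolding derdiff[OF that(1)] by simp
 have Tout: "T f v = 0" if "f \<in> V" "v \<notin> \<S>" for f v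
 proof -
  have "((%z. F z f v) has_field_derivative 0) (at z)"
  proof (rule has_field_derivative_transform_within_open[of "%_. 0" 0 z "ball z r"])
   show "0 = F w f v" if "w \<in> ball z r" for w
    using space_B_outside[OF FV[OF that \<open>f \<in> V\<close>] \<open>v \<notin> \<S>\<close>] by simp
  qed (use r in auto)
  then show ?thesis unfolding T_def by (rule DERIV_imp_deriv)
 qed
 \<comment> \<open>A Hoelder bound in \<open>d_hilbert\<close> does not imply Euclidean continuity,
   because boundary points are at distance 1 from the interior. Continuity of the derivative is
   obtained instead from uniform convergence of difference quotients along a sequence.\<close>
 have Tcont: "continuous_on \<S> (T f)" if f: "f \<in> V" for f
 proof -
  define W where "W n = z + of_real (r / 2 / real (Suc n))" for n
  have W: "cmod (W n - z) = r / 2 / real (Suc n)" "W n ~= z" for n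
   using r(1) unfolding W_def by (auto simp: norm_divide simp del: of_nat_Suc of_real_divide)
  have Wr: "cmod (W n - z) <= r/2" for n unfolding W(1) using r(1) by (simp add: field_simps)
  have "uniform_limit \<S> (%n v. (F (W n) f v - F z f v) / (W n - z)) (T f) sequentially"
  proof (rule uniform_limitI)
   fix e :: real assume e: "0 < e"
   have "(%n. (c * nB f) * (r / 2 / real (Suc n))) \<longlonglongrightarrow> (c * nB f) * 0"
    by (intro tendsto_mult_left LIMSEQ_Suc[OF lim_const_over_n])
   then have "\<forall>\<^sub>F n in sequentially. (c * nB f) * (r / 2 / real (Suc n)) < e"
    using e by (intro order_tendstoD(2)) auto
   then show "\<forall>\<^sub>F n in sequentially. \<forall>v\<in>\<S>. dist ((F (W n) f v - F z f v) / (W n - z)) (T f v) < e"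
   proof eventually_elim
    case (elim n)
    then show ?case using Q1[OF f Wr W(2), of n] unfolding W(1) Q_def dist_norm by (auto intro: le_less_trans)
   qed
  qed
  then show ?thesis
  proof (rule uniform_limit_theorem[rotated])
   have "W n \<in> ball z r" for n using Wr[of n] r(1) by (simp add: dist_norm norm_minus_commute)
   then show "\<forall>\<^sub>F n in sequentially. continuous_on \<S> (%v. (F (W n) f v - F z f v) / (W n - z))"
    using W(2) f r(1) by (intro always_eventually allI continuous_intros space_B_cont[OF FV]) auto
  qed simp
 qed
 have T0: "0 <= 4 * C' / r * nB f" for f using C'0 r(1) norm_B_nonneg[of f] by simp
 have TV: "T f \<in> V" "nB (T f) <= (8 * C' / r) * nB f" if "f \<in> V" for f
  using space_B_I[OF Tcont[OF that] Tout[OF that] T1[OF that] T0 T2[OF that] T0] by auto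
 show "\<exists>T\<in>bounded_ops \<gamma>. ((%w. op_norm_B \<gamma> (%f v. (F w f v - F z f v) / (w - z) - T f v)) \<longlongrightarrow> 0) (at z)"
 proof (rule bexI[of _ T])
  have Fadd: "F w (f + \<psi>) = F w f + F w \<psi>" "F w (sc k f) = sc k (F w f)"
   if "w \<in> ball z r" "f \<in> V" "\<psi> \<in> V" for w f \<psi> k
   using F[of w] that r(2) by (auto simp: bounded_ops_iff)
  have "T (f + \<psi>) = T f + T \<psi>" if "f \<in> V" "\<psi> \<in> V" for f \<psi>
  proof
   fix v
   have "((%z. F z f v + F z \<psi> v) has_field_derivative (T f v + T \<psi> v)) (at z)"
    unfolding T_def using diffable that by (intro DERIV_add) (auto simp: DERIV_deriv_iff_field_differentiable)
   then have "((%z. F z (f + \<psi>) v) has_field_derivative (T f v + T \<psi> v)) (at z)"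
    by (rule has_field_derivative_transform_within_open[of _ _ _ "ball z r"]) (use r that Fadd in auto)
   then have "deriv (%z. F z (f + \<psi>) v) z = T f v + T \<psi> v" by (rule DERIV_imp_deriv)
   then show "T (f + \<psi>) v = (T f + T \<psi>) v" by (simp add: T_def)
  qed
  moreover have "T (sc k f) = sc k (T f)" if "f \<in> V" for f k
  proof
   fix v
   have "((%z. k * F z f v) has_field_derivative (k * T f v)) (at z)"
    unfolding T_def using diffable that by (intro DERIV_cmult) (auto simp: DERIV_deriv_iff_field_differentiable)
   then have "((%z. F z (sc k f) v) has_field_derivative (k * T f v)) (at z)"
    by (rule has_field_derivative_transform_within_open[of _ _ _ "ball z r"]) (use r that Fadd in auto)
   then show "T (sc k f) v = sc k (T f) v" unfolding T_def by (simp add: DERIV_imp_deriv)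
  qed
  ultimately show "T \<in> bounded_ops \<gamma>" unfolding bounded_ops_iff using TV by blast
  have QV: "nB (Q w f) <= (2 * c * cmod (w - z)) * nB f"
   if w: "cmod (w - z) <= r/2" "w ~= z" and f: "f \<in> V" for w f
  proof -
   have wb: "w \<in> ball z r" using w r(1) by (simp add: dist_norm norm_minus_commute)
   have cont: "continuous_on \<S> (Q w f)"
    unfolding Q_def using w r(1) by (intro continuous_intros space_B_cont[OF FV] Tcont wb f) auto
   have out: "Q w f v = 0" if "v \<notin> \<S>" for v
    unfolding Q_def using space_B_outside[OF FV[OF wb f] that] space_B_outside[OF FV[of z, OF _ f] that] Tout[OF f that] r(1) by simp
   have "0 <= c * nB f * cmod (w - z)" using c0 norm_B_nonneg by simp
   from space_B_I(2)[OF cont out Q1[OF f w] this Q2[OF f w] this] show ?thesis by (simp add: mult_ac)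
  qed
  show "((%w. op_norm_B \<gamma> (%f v. (F w f v - F z f v) / (w - z) - T f v)) \<longlongrightarrow> 0) (at z)"
  proof (rule Lim_null_comparison)
   have "\<forall>\<^sub>F w in at z. cmod (w - z) <= r/2 & w ~= z"
    unfolding eventually_at using r(1) by (intro exI[of _ "r/2"]) (auto simp: dist_norm)
   then show "\<forall>\<^sub>F w in at z. norm (op_norm_B \<gamma> (%f v. (F w f v - F z f v) / (w - z) - T f v)) <= 2 * c * cmod (w - z)"
   proof eventually_elim
    case (elim w)
    then show ?case using op_norm_B_le[of "Q w" "2 * c * cmod (w - z)"] QV[of w] c0 unfolding Q_def by auto
   qed
   have "((%w. 2 * c * cmod (w - z)) \<longlongrightarrow> 2 * c * cmod (z - z)) (at z)" by (intro tendsto_intros)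
   then show "((%w. 2 * c * cmod (w - z)) \<longlongrightarrow> 0) (at z)" by simp
  qed
 qed
qed

lemma bounded_ops_diff:
 assumes "A \<in> bounded_ops \<gamma>" "f \<in> V" "h \<in> V"
 shows "A (f - h) = A f - A h"
proof -
 interpret fspace "V" "nB" by (rule fspace_B)
 show ?thesis using assms V_sc unfolding minus_sc bounded_ops_iff by metis
qed

text \<open>For \<open>cmod l > \<rho>\<close> the resolvent is the Neumann series with partial sums
  \<open>F f n\<close>. Injectivity of \<open>T\<close> holds because \<open>A f = l f\<close>
  forces \<open>f = l^(-n) A^n f\<close>, which tends to 0; linearity of the inverse then follows
  from injectivity.\<close>

lemma spectrum_bound:
 fixes A :: "'n::finite operator"
 assumes A: "A \<in> bounded_ops \<gamma>" and C: "!!f n. f \<in> V ==> nB ((A ^^ n) f) <= C * \<rho> ^ n * nB f"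
  and \<rho>: "0 <= \<rho>" and l: "l \<in> spectrum_B \<gamma> A"
 shows "cmod l <= \<rho>"
proof (rule ccontr)
 assume "\<not> cmod l <= \<rho>"
 then have l0: "l ~= 0" "0 < cmod l" using \<rho> by auto
 interpret fspace V nB by (rule fspace_B)
 define q where "q = \<rho> / cmod l"
 have q: "0 <= q" "q < 1" using \<open>\<not> cmod l <= \<rho>\<close> l0 \<rho> by (auto simp: q_def)
 define T where "T f = sc l f - A f" for f
 define F where "F f n = (%v. \<Sum>k<n. (1 / l) ^ Suc k * (A ^^ k) f v)" for f n
 have Aadd: "A (f + h) = A f + A h" if "f \<in> V" "h \<in> V" for f h using A that by (auto simp: bounded_ops_iff)
 have Asc: "A (sc c f) = sc c (A f)" and AV: "A f \<in> V" if "f \<in> V" for f c using A that by (auto simp: bounded_ops_iff)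
 obtain CA where CA: "!!f. f \<in> V ==> nB (A f) <= CA * nB f" using A unfolding bounded_ops_iff by blast
 have ApV: "(A ^^ n) f \<in> V" if "f \<in> V" for f n using that AV by (induction n) auto
 have FS: "F f (Suc n) = F f n + sc ((1 / l) ^ Suc n) ((A ^^ n) f)" and F0: "F f 0 = 0" for f n
  by (simp_all add: F_def fun_eq_iff)
 have FV: "F f n \<in> V" if "f \<in> V" for f n
 proof (induction n)
  case 0
  show ?case unfolding F0 by (rule V_0)
 qed (unfold FS, intro V_add V_sc ApV that)
 have T_diff: "T (f - h) = T f - T h" if "f \<in> V" "h \<in> V" for f h
  unfolding T_def bounded_ops_diff[OF A that] by (simp add: fun_eq_iff algebra_simps)
 have T_add: "T (f + h) = T f + T h" if "f \<in> V" "h \<in> V" for f h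
  unfolding T_def Aadd[OF that] by (simp add: fun_eq_iff algebra_simps)
 have T_sc: "T (sc c f) = sc c (T f)" if "f \<in> V" for f c
  unfolding T_def Asc[OF that] by (simp add: fun_eq_iff algebra_simps)
 have TV: "T f \<in> V" if "f \<in> V" for f unfolding T_def by (intro V_diff V_sc AV that)
 have small: "cmod ((1 / l) ^ n * (A ^^ n) f v) <= C * nB f * q ^ n" if f: "f \<in> V" for f n v
 proof -
  have "cmod ((1 / l) ^ n * (A ^^ n) f v) <= (1 / cmod l) ^ n * (C * \<rho> ^ n * nB f)"
   unfolding norm_mult norm_power norm_divide using nm_ev[where x=v, OF ApV[OF f, of n]] C[OF f, of n]
   by (intro mult_mono) auto
  then show ?thesis by (simp add: q_def power_divide mult_ac)
 qed
 have q0: "(%n. B * q ^ n) \<longlonglongrightarrow> 0" for B using tendsto_mult_right_zero[OF LIMSEQ_power_zero[of q]] q by simp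
 have null: "(%n. (1 / l) ^ n * (A ^^ n) f v) \<longlonglongrightarrow> 0" if "f \<in> V" for f v
  by (rule Lim_null_comparison[OF always_eventually[OF allI[OF small[OF that]]] q0])
 have inj: "f = h" if "f \<in> V" "h \<in> V" "T f = T h" for f h
 proof -
  have V: "f - h \<in> V" by (intro V_diff that)
  have A1: "A (f - h) = sc l (f - h)" using T_diff[OF that(1,2)] that(3) by (simp add: T_def fun_eq_iff)
  have An: "(A ^^ n) (f - h) = sc (l ^ n) (f - h)" for n
  proof (induction n)
   case (Suc n)
   have "(A ^^ Suc n) (f - h) = A (sc (l ^ n) (f - h))" unfolding Suc.IH[symmetric] by simp
   also have "... = sc (l ^ Suc n) (f - h)" unfolding Asc[OF V] A1 by (simp add: fun_eq_iff)
   finally show ?case .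
  qed (simp add: fun_eq_iff)
  have "(%n. (f - h) v) \<longlonglongrightarrow> 0" for v
   using null[OF V, of v] l0(1) unfolding An by (simp add: power_divide)
  then show ?thesis by (simp add: LIMSEQ_const_iff fun_eq_iff)
 qed
 have "\<exists>h\<in>V. T h = f & nB h <= C / cmod l / (1 - q) * nB f" if f: "f \<in> V" for f
 proof -
  have inc: "nB (F f (Suc n) - F f n) <= (C / cmod l * nB f) * q ^ n" for n
  proof -
   have "F f (Suc n) - F f n = sc ((1 / l) ^ Suc n) ((A ^^ n) f)" unfolding FS by (simp add: fun_eq_iff)
   then have "nB (F f (Suc n) - F f n) = (1 / cmod l) ^ Suc n * nB ((A ^^ n) f)"
    by (simp only: nm_sc ApV f) (simp add: norm_power norm_divide norm_mult)
   also have "... <= (1 / cmod l) ^ Suc n * (C * \<rho> ^ n * nB f)" by (intro mult_left_mono C f) auto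
   finally show ?thesis by (simp add: q_def power_divide mult_ac)
  qed
  obtain h where h: "h \<in> V" and lim: "!!x. (%n. F f n x) \<longlonglongrightarrow> h x"
   and est: "!!n. nB (F f n - h) <= (C / cmod l * nB f) * q ^ n / (1 - q)"
   using geometric_limit[of "F f", OF FV[OF f] inc q] by blast
  have TF: "T (F f n) v = f v - (1 / l) ^ n * (A ^^ n) f v" for n v
  proof (induction n)
   case 0
   have "T 0 = sc 0 (T 0)" using T_sc[OF V_0, of 0] by (simp add: fun_eq_iff sc_def zero_fun_def)
   then show ?case unfolding F0 by (simp add: fun_eq_iff zero_fun_def)
  next
   case (Suc n)
   have "T (F f (Suc n)) v = T (F f n) v + (1 / l) ^ Suc n * T ((A ^^ n) f) v"
    unfolding FS T_add[OF FV[OF f] V_sc[OF ApV[OF f]]] T_sc[OF ApV[OF f]] by simp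
   also have "... = f v - (1 / l) ^ n * (A ^^ n) f v + (1 / l) ^ Suc n * (l * (A ^^ n) f v - A ((A ^^ n) f) v)"
    unfolding Suc.IH by (simp add: T_def)
   finally show ?case using l0 by (simp add: right_diff_distrib)
  qed
  have "T h v = f v" for v
  proof -
   have "(%n. A (F f n) v) \<longlonglongrightarrow> A h v"
   proof (rule LIM_zero_cancel, rule Lim_null_comparison[OF always_eventually[OF allI] q0])
    show "cmod (A (F f n) v - A h v) <= (\<bar>CA\<bar> * ((C / cmod l * nB f) / (1 - q))) * q ^ n" for n
    proof -
     have V: "F f n - h \<in> V" by (intro V_diff FV f h)
     have "cmod (A (F f n) v - A h v) <= nB (A (F f n - h))"
      using nm_ev[where x=v, OF AV[OF V]] bounded_ops_diff[OF A FV[OF f] h] by simp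
     also have "... <= \<bar>CA\<bar> * nB (F f n - h)" using CA[OF V] by (rule order_trans) (intro mult_right_mono, auto)
     also have "... <= \<bar>CA\<bar> * ((C / cmod l * nB f) * q ^ n / (1 - q))" by (intro mult_left_mono est) auto
     finally show ?thesis by (simp add: mult_ac)
    qed
   qed
   then have "(%n. T (F f n) v) \<longlonglongrightarrow> T h v" unfolding T_def by (simp add: tendsto_diff tendsto_mult_left lim)
   moreover have "(%n. T (F f n) v) \<longlonglongrightarrow> f v - 0" unfolding TF by (intro tendsto_diff tendsto_const null f)
   ultimately show ?thesis using LIMSEQ_unique by fastforce
  qed
  moreover have "nB h <= C / cmod l / (1 - q) * nB f"
   using est[of 0] nm_diff_commute[OF FV[OF f, of 0] h] by (simp add: F0 zero_fun_def fun_diff_def)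
  ultimately show ?thesis using h by (auto simp: fun_eq_iff)
 qed
 then obtain S where S: "!!f. f \<in> V ==> S f \<in> V & T (S f) = f & nB (S f) <= C / cmod l / (1 - q) * nB f" by metis
 note SV = S[THEN conjunct1] and TS = S[THEN conjunct2, THEN conjunct1] and Sb = S[THEN conjunct2, THEN conjunct2]
 have "S (f + h) = S f + S h" if "f \<in> V" "h \<in> V" for f h
  by (rule inj) (simp_all only: T_add SV TS V_add that)
 moreover have "S (sc c f) = sc c (S f)" if "f \<in> V" for f c
  by (rule inj) (simp_all only: T_sc SV TS V_sc that)
 ultimately have "S \<in> bounded_ops \<gamma>" unfolding bounded_ops_iff
  by (intro conjI ballI allI exI[of _ "C / cmod l / (1 - q)"] SV Sb)
 moreover have "S (T f) = f" if "f \<in> V" for f by (rule inj) (simp_all only: SV TV that TS)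
 ultimately have "\<exists>S\<in>bounded_ops \<gamma>. \<forall>f\<in>V. S (T f) = f & T (S f) = f" using TS by blast
 then show False using l unfolding spectrum_B_def mem_Collect_eq T_def sc_def fun_diff_def by blast
qed

text \<open>\<open>spec_radius_B\<close> is a supremum of reals and needs a non-empty spectrum to be
  meaningful. The non-zero vector in the kernel puts 0 into the spectrum.\<close>

lemma spec_radius_le:
 fixes A :: "'n::finite operator"
 assumes A: "A \<in> bounded_ops \<gamma>" and C: "!!f n. f \<in> V ==> nB ((A ^^ n) f) <= C * \<rho> ^ n * nB f"
  and \<rho>: "0 <= \<rho>" and ker: "f \<in> V" "f ~= (%v. 0)" "A f = (%v. 0)"
 shows "spec_radius_B \<gamma> A <= \<rho>"
proof -
 have "0 \<in> spectrum_B \<gamma> A"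
 proof (rule ccontr)
  assume "0 \<notin> spectrum_B \<gamma> A"
  then obtain S where S: "S \<in> bounded_ops \<gamma>" "!!f. f \<in> V ==> S (%v. 0 * f v - A f v) = f"
   by (auto simp: spectrum_B_def)
  have "S (sc 0 f) = sc 0 (S f)" using S(1) ker(1) by (auto simp: bounded_ops_iff)
  then have "S (%v. 0) = (%v. 0)" by (simp add: sc_def)
  then show False using S(2)[OF ker(1)] ker(2,3) by simp
 qed
 then show ?thesis unfolding spec_radius_B_def using spectrum_bound[OF A C \<rho>] by (intro cSup_least) auto
qed

end

subsection \<open>Integrals depending on a parameter\<close>

text \<open>The difference quotients are compared with the derivative by
  \<open>second_order_estimate\<close>, whose constant is proportional to \<open>B g\<close> and
  therefore integrable.\<close>

lemma holomorphic_integral: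
 fixes F :: "complex => 'a => complex"
 assumes D: "open D" and meas: "!!w. w \<in> D ==> F w \<in> borel_measurable M"
  and B: "integrable M B" and ae: "AE g in M. (%w. F w g) holomorphic_on D & (\<forall>w\<in>D. cmod (F w g) <= B g)"
 shows "(%w. \<integral>g. F w g \<partial>M) holomorphic_on D"
proof (rule holomorphic_onI)
 fix z assume z: "z \<in> D"
 obtain r where r: "0 < r" "ball z r \<subseteq> D" using D z open_contains_ball by blast
 have int: "integrable M (F w)" if "w \<in> D" for w
 proof (rule Bochner_Integration.integrable_bound[OF B meas[OF that]])
  show "AE g in M. norm (F w g) <= norm (B g)"
   using ae by eventually_elim (use that in force)
 qed
 define W where "W n = z + of_real (r / 2 / real (Suc n))" for n
 have W: "cmod (W n - z) = r / 2 / real (Suc n)" "W n ~= z" for n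
  using r(1) unfolding W_def by (auto simp: norm_divide simp del: of_nat_Suc of_real_divide)
 have Wr: "cmod (W n - z) <= r/2" for n unfolding W(1) using r(1) by (simp add: field_simps)
 have WD: "W n \<in> D" for n using Wr[of n] r by (auto simp: dist_norm norm_minus_commute subset_iff)
 have W0: "(%n. W n - z) \<longlonglongrightarrow> 0"
  by (rule tendsto_norm_zero_cancel) (simp only: W(1), rule LIMSEQ_Suc[OF lim_const_over_n])
 \<comment> \<open>The derivative with respect to \<open>w\<close>, written as a limit along one
   fixed sequence so that it is measurable in \<open>g\<close>.\<close>
 define G where "G g = lim (%n. (F (W n) g - F z g) / (W n - z))" for g
 have Gm: "G \<in> borel_measurable M"
  unfolding G_def using meas[OF WD] meas[OF z] by (intro borel_measurable_lim_metric borel_measurable_divide borel_measurable_diff borel_measurable_const WD z)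
 have est: "AE g in M. cmod (G g) <= 4 / r * B g &
   (\<forall>w. cmod (w - z) <= r/2 --> cmod (F w g - F z g - (w - z) * G g) <= 32 / r\<^sup>2 * (cmod (w - z))\<^sup>2 * B g)"
  using ae
 proof eventually_elim
  case (elim g)
  have hol: "(%w. F w g) holomorphic_on ball z r" using elim r(2) holomorphic_on_subset by blast
  have bd: "!!w. w \<in> ball z r ==> cmod (F w g) <= B g" using elim r(2) by auto
  have "((%w. F w g) has_field_derivative deriv (%w. F w g) z) (at z)"
   using holomorphic_derivI[OF hol] r(1) by auto
  then have "((%w. (F w g - F z g) / (w - z)) \<longlongrightarrow> deriv (%w. F w g) z) (at z)"
   by (simp add: has_field_derivative_iff)
  moreover have "filterlim W (at z) sequentially"
   unfolding filterlim_at using W(2) W0 LIM_zero_cancel by auto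
  ultimately have "(%n. (F (W n) g - F z g) / (W n - z)) \<longlonglongrightarrow> deriv (%w. F w g) z"
   by (rule filterlim_compose)
  then have "G g = deriv (%w. F w g) z" unfolding G_def by (rule limI)
  then show ?case
   using second_order_estimate(1)[OF hol r(1) bd] second_order_estimate(2)[OF hol r(1) bd, of z] r(1)
   by (auto simp: mult_ac)
 qed
 have intG: "integrable M G"
 proof (rule Bochner_Integration.integrable_bound[OF integrable_mult_right[OF B, of "4 / r"] Gm])
  show "AE g in M. norm (G g) <= norm (4 / r * B g)"
   using est by eventually_elim (elim conjE, erule order_trans, simp only: real_norm_def abs_ge_self)
 qed
 have "((%w. \<integral>g. F w g \<partial>M) has_field_derivative (\<integral>g. G g \<partial>M)) (at z)"
  unfolding has_field_derivative_iff
 proof (rule LIM_zero_cancel, rule Lim_null_comparison)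
  define c where "c = 32 / r\<^sup>2 * (\<integral>g. B g \<partial>M)"
  have "\<forall>\<^sub>F w in at z. cmod (w - z) <= r/2 & w ~= z"
   unfolding eventually_at using r(1) by (intro exI[of _ "r/2"]) (auto simp: dist_norm)
  then show "\<forall>\<^sub>F w in at z. norm (((\<integral>g. F w g \<partial>M) - (\<integral>g. F z g \<partial>M)) / (w - z) - (\<integral>g. G g \<partial>M)) <= c * cmod (w - z)"
  proof eventually_elim
   case (elim w)
   have wD: "w \<in> D" using elim r by (auto simp: dist_norm norm_minus_commute subset_iff)
   have "(\<integral>g. F w g - F z g - (w - z) * G g \<partial>M) = (\<integral>g. F w g \<partial>M) - (\<integral>g. F z g \<partial>M) - (w - z) * (\<integral>g. G g \<partial>M)"
    using int[OF wD] int[OF z] intG by simp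
   moreover have "cmod (\<integral>g. F w g - F z g - (w - z) * G g \<partial>M) <= (\<integral>g. 32 / r\<^sup>2 * (cmod (w - z))\<^sup>2 * B g \<partial>M)"
   proof (rule order_trans[OF integral_norm_bound integral_mono_AE])
    show "integrable M (%g. norm (F w g - F z g - (w - z) * G g))" using int[OF wD] int[OF z] intG by simp
    show "AE g in M. norm (F w g - F z g - (w - z) * G g) <= 32 / r\<^sup>2 * (cmod (w - z))\<^sup>2 * B g"
     using est by eventually_elim (use elim in blast)
   qed (use B in simp)
   ultimately have "cmod ((\<integral>g. F w g \<partial>M) - (\<integral>g. F z g \<partial>M) - (w - z) * (\<integral>g. G g \<partial>M)) <= c * (cmod (w - z))\<^sup>2"
    by (simp add: c_def mult_ac)
   moreover have "((\<integral>g. F w g \<partial>M) - (\<integral>g. F z g \<partial>M)) / (w - z) - (\<integral>g. G g \<partial>M)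
     = ((\<integral>g. F w g \<partial>M) - (\<integral>g. F z g \<partial>M) - (w - z) * (\<integral>g. G g \<partial>M)) / (w - z)"
    using elim by (simp add: diff_divide_distrib)
   ultimately show ?case using elim by (simp add: norm_divide divide_le_eq power2_eq_square mult_ac)
  qed
  have "((%w. c * cmod (w - z)) \<longlongrightarrow> c * cmod (z - z)) (at z)" by (intro tendsto_intros)
  then show "((%w. c * cmod (w - z)) \<longlongrightarrow> 0) (at z)" by simp
 qed
 then show "(%w. \<integral>g. F w g \<partial>M) field_differentiable at z within D"
  using field_differentiable_at_within field_differentiable_def by blast
qed

lemma continuous_on_integral:
 fixes F :: "'b::metric_space => 'a => 'c::{banach, second_countable_topology}"
 assumes meas: "!!x. x \<in> S ==> F x \<in> borel_measurable M"
  and B: "integrable M B" and ae: "AE g in M. continuous_on S (%x. F x g) & (\<forall>x\<in>S. norm (F x g) <= B g)"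
 shows "continuous_on S (%x. \<integral>g. F x g \<partial>M)"
 unfolding continuous_on_sequentially
proof (intro allI ballI impI, elim conjE)
 fix X x assume x: "x \<in> S" "\<forall>n. X n \<in> S" "X \<longlonglongrightarrow> x"
 have "(%n. \<integral>g. F (X n) g \<partial>M) \<longlonglongrightarrow> (\<integral>g. F x g \<partial>M)"
 proof (rule integral_dominated_convergence[OF meas meas B])
  show "AE g in M. (%n. F (X n) g) \<longlonglongrightarrow> F x g"
   using ae by eventually_elim (use x in \<open>auto simp: continuous_on_sequentially o_def\<close>)
  show "AE g in M. norm (F (X n) g) <= B g" for n
   using ae by eventually_elim (use x in auto)
 qed (use x in auto)
 then show "((%x. \<integral>g. F x g \<partial>M) \<circ> X) \<longlonglongrightarrow> (\<integral>g. F x g \<partial>M)" by (simp add: o_def)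
qed

subsection \<open>Laws of positive matrices acting on homogeneous functions\<close>

definition pcone :: "(real ^ 'n) set" where "pcone = {x. nonneg_vec x & x ~= 0}"

lemma cone_scale: "x \<in> pcone ==> 0 < t ==> t *\<^sub>R x \<in> pcone" by (auto simp: pcone_def)
lemma simplex_cone: "v \<in> \<S> ==> v \<in> pcone" using simplex_D[of v] by (auto simp: pcone_def)
lemma cone_l1norm: "x \<in> pcone ==> 0 < l1norm x" by (auto simp: pcone_def l1norm_pos)
lemma cone_normalize: "x \<in> pcone ==> x /\<^sub>R l1norm x \<in> \<S>"
 using normalize_simplex by (auto simp: pcone_def)
lemma pos_mat_cone:
 fixes g :: "real ^ 'n ^ 'n"
 assumes "pos_mat g" "x \<in> pcone"
 shows "g *v x \<in> pcone"
proof -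
 have p: "0 < (g *v x) $ i" for i
  using assms by (intro pos_mat_vec_pos) (auto simp: pcone_def)
 then have "g *v x ~= 0" by (metis less_irrefl zero_index)
 then show ?thesis using p by (auto simp: pcone_def less_imp_le)
qed

lemma borel_cone [measurable]: "pcone \<in> sets borel"
proof -
 have "pcone = (\<Inter>i. {x::real^'n. 0 <= x $ i}) \<inter> - {0}" by (auto simp: pcone_def)
 moreover have "closed (\<Inter>i. {x::real^'n. 0 <= x $ i})"
  by (intro closed_INT ballI closed_Collect_le continuous_intros)
 ultimately show ?thesis by (metis borel_closed borel_comp closed_singleton sets.Int)
qed

lemma borel_simplex [measurable]: "\<S> \<in> sets borel"
 by (rule borel_closed[OF closed_simplex])

lemma continuous_on_mat_vec [continuous_intros]:
 fixes f :: "'a::topological_space => real ^ 'n ^ 'm"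
 shows "continuous_on S f ==> continuous_on S h ==> continuous_on S (%x. f x *v h x)"
 unfolding matrix_vector_mult_def by (intro continuous_intros)

lemma measurable_mat_vec [measurable]: "(%g. g *v x) \<in> borel \<rightarrow>\<^sub>M borel" for x :: "real ^ 'n"
 by (intro borel_measurable_continuous_onI continuous_intros)

lemma measurable_mat_vec_pair:
 "(%(x, g). g *v x) \<in> (borel :: (real ^ 'n) measure) \<Otimes>\<^sub>M (borel :: (real ^ 'n ^ 'm) measure) \<rightarrow>\<^sub>M borel"
 unfolding borel_prod case_prod_beta by (intro borel_measurable_continuous_onI continuous_intros)

lemma measurable_l1norm [measurable]: "l1norm \<in> borel_measurable borel"
 by (intro borel_measurable_continuous_onI continuous_intros)

text \<open>\<open>K\<close> is the part of the simplex that receives all images. It will be the set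
  of balanced vectors for matrices with comparable columns and the whole simplex for matrices with
  comparable rows.\<close>

definition good_mat :: "(real ^ 'n) set => real => real => real ^ 'n ^ 'n => bool" where
 "good_mat K C p g \<longleftrightarrow> pos_mat g & (\<forall>v\<in>\<S>. act g v \<in> K) &
   (\<forall>u\<in>K. \<forall>v\<in>K. \<forall>i. (g *v v) $ i <= C * (g *v u) $ i) & cross_ratio_bound p g"

text \<open>Bernoulli's inequality for \<open>t\<close> rounded up to an integer; lowering the
  exponent only increases a power of a number below 1.\<close>

lemma powr_ge_linear:
 fixes x t :: real
 assumes "0 <= x" "x <= 1" "0 < t"
 shows "1 - x powr t <= (t + 1) * (1 - x)"
proof (cases "x = 0")
 case False
 define n where "n = nat \<lceil>t\<rceil>"
 have n: "t <= real n" "real n <= t + 1" using assms(3) unfolding n_def by linarith+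
 have "1 + real n * (x - 1) <= (1 + (x - 1)) ^ n" using assms by (intro Bernoulli_inequality) auto
 also have "... = x powr real n" using False assms by (simp add: powr_realpow)
 also have "... <= x powr t" using n(1) assms False by (intro powr_mono') auto
 finally have "1 - x powr t <= real n * (1 - x)" by (simp add: algebra_simps)
 also have "... <= (t + 1) * (1 - x)" using n assms by (intro mult_right_mono) auto
 finally show ?thesis .
qed (use assms in simp)

text \<open>\<open>M\<close> lives on all matrices with the plain Borel sigma-algebra; the given law
  is pushed forward to it, directly or after transposition. \<open>dom\<close> lets
  \<open>int_s\<close> dominate all integrals; for a negative exponent it is a lower bound on the
  norms of images.\<close>

locale matrix_law = prob_space M for M :: "(real ^ 'n ^ 'n) measure" +
 fixes K :: "(real ^ 'n) set" and C p c1 s :: real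
 assumes sets_M [measurable_cong]: "sets M = sets borel"
  and K_sub: "K \<subseteq> \<S>" and K_closed: "closed K"
  and C: "1 <= C" and p: "0 < p" "p <= 1" and s: "s ~= 0"
  and good_AE: "AE g in M. good_mat K C p g"
  and dom: "AE g in M. \<forall>v\<in>\<S>. l1norm (g *v v) powr s <= c1 * mnorm g powr s"
  and int_s: "integrable M (%g. mnorm g powr s)"
begin

abbreviation "good \<equiv> good_mat K C p"

lemma space_M [simp]: "space M = UNIV" using sets_eq_imp_space_eq[OF sets_M] by simp

lemma good_pos: "good g ==> pos_mat g" by (simp add: good_mat_def)
lemma good_K: "good g ==> v \<in> \<S> ==> act g v \<in> K" by (simp add: good_mat_def)

lemma good_ex: "\<exists>g. good g"
proof (rule ccontr)
 assume "\<not> ?thesis"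
 then have "AE g in M. False" using good_AE by simp
 then show False by simp
qed

lemma K_nonempty: "K ~= {}" using good_ex good_K center_simplex by blast

definition A :: "(real ^ 'n => real) => real ^ 'n => real" where
 "A F x = (\<integral>g. F (g *v x) \<partial>M)"

text \<open>Given \<open>a y <= x\<close> and \<open>b x <= y\<close>, a positive exponent uses the
  first inequality and a negative one the second. Carrying both makes
  \<open>ca a b * ca b a = (a b) powr \<bar>s\<bar>\<close> independent of the sign.\<close>

definition ca :: "real => real => real" where
 "ca a b = (if 0 < s then a powr s else b powr (- s))"

lemma ca_mult: "0 <= a ==> 0 <= b ==> ca a b * ca b a = (a * b) powr \<bar>s\<bar>"
 using s by (auto simp: ca_def powr_mult)

lemma ca_nonneg: "0 <= ca a b" by (simp add: ca_def)
definition homog :: "(real ^ 'n => real) => bool" where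
 "homog F \<longleftrightarrow> F \<in> borel_measurable borel & (\<forall>x\<in>pcone. \<forall>t>0. F (t *\<^sub>R x) = t powr s * F x)"

text \<open>The positive functions that respect the order of the cone up to the factor \<open>ca\<close>; examples are
 \<open>x \<mapsto> l1norm x powr s\<close> and \<open>x \<mapsto> (x \<bullet> u) powr s\<close>.\<close>

definition cls :: "(real ^ 'n => real) => bool" where
 "cls F \<longleftrightarrow> homog F & (\<forall>x\<in>pcone. 0 < F x) &
   (\<forall>x\<in>pcone. \<forall>y\<in>pcone. \<forall>a>0. \<forall>b>0. (\<forall>i. a * y $ i <= x $ i) --> (\<forall>i. b * x $ i <= y $ i) --> ca a b * F y <= F x) &
   (\<exists>B. \<forall>x\<in>\<S>. F x <= B)"

text \<open>The signed functions that serve as numerators; the denominators of ratios come from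
  \<open>cls\<close>.\<close>

definition hcls :: "(real ^ 'n => real) => bool" where
 "hcls F \<longleftrightarrow> homog F & (\<exists>B. \<forall>x\<in>\<S>. \<bar>F x\<bar> <= B)"

lemma homogD: "homog F ==> x \<in> pcone ==> 0 < t ==> F (t *\<^sub>R x) = t powr s * F x"
 by (simp add: homog_def)

lemma homog_normalize: "homog F ==> x \<in> pcone ==> F x = l1norm x powr s * F (x /\<^sub>R l1norm x)"
 using homogD[of F "x /\<^sub>R l1norm x" "l1norm x"] cone_l1norm[of x] simplex_cone[OF cone_normalize, of x] by simp

lemma homog_act: "homog F ==> pos_mat g ==> v \<in> pcone ==> F (g *v v) = l1norm (g *v v) powr s * F (act g v)"
 unfolding act_def by (rule homog_normalize[OF _ pos_mat_cone])

lemma homog_measurable: "homog F ==> F \<in> borel_measurable borel" by (simp add: homog_def)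

lemma homog_M: "homog F ==> (%g. F (g *v x)) \<in> borel_measurable M"
 by (rule measurable_compose[OF _ homog_measurable]) measurable

lemma cls_hcls: "cls F ==> hcls F"
proof -
 assume F: "cls F"
 then obtain B where B: "!!x. x \<in> \<S> ==> F x <= B" unfolding cls_def by blast
 have "\<bar>F x\<bar> <= B" if "x \<in> \<S>" for x
  using B[OF that] F simplex_cone[OF that] by (simp add: cls_def abs_of_pos)
 then show ?thesis using F by (auto simp: cls_def hcls_def)
qed

lemma hcls_homog: "hcls F ==> homog F" by (simp add: hcls_def)

lemma hcls_lin: "hcls F ==> hcls G ==> hcls (%x. a * F x + b * G x)"
proof -
 assume F: "hcls F" and G: "hcls G"
 obtain B where B: "!!x. x \<in> \<S> ==> \<bar>F x\<bar> <= B" using F by (auto simp: hcls_def)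
 obtain B' where B': "!!x. x \<in> \<S> ==> \<bar>G x\<bar> <= B'" using G by (auto simp: hcls_def)
 have "\<bar>a * F x + b * G x\<bar> <= \<bar>a\<bar> * B + \<bar>b\<bar> * B'" if "x \<in> \<S>" for x
  using mult_left_mono[OF B[OF that], of "\<bar>a\<bar>"] mult_left_mono[OF B'[OF that], of "\<bar>b\<bar>"]
   abs_triangle_ineq[of "a * F x" "b * G x"] by (simp add: abs_mult)
 then show ?thesis using F G unfolding hcls_def homog_def
  by (auto simp: algebra_simps)
qed

lemma hcls_bound_cone:
 assumes "hcls F"
 obtains B where "0 <= B" "!!x. x \<in> pcone ==> \<bar>F x\<bar> <= B * l1norm x powr s"
proof -
 obtain B where B: "!!x. x \<in> \<S> ==> \<bar>F x\<bar> <= B" using assms by (auto simp: hcls_def)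
 have "0 <= B" using B[OF center_simplex] by linarith
 moreover have "\<bar>F x\<bar> <= B * l1norm x powr s" if "x \<in> pcone" for x
  unfolding homog_normalize[OF hcls_homog[OF assms] that] abs_mult
  using mult_left_mono[OF B[OF cone_normalize[OF that]], of "l1norm x powr s"] by (simp add: mult_ac)
 ultimately show thesis using that by blast
qed

lemma dom_cone: "AE g in M. \<forall>x\<in>pcone. l1norm (g *v x) powr s <= c1 * l1norm x powr s * mnorm g powr s"
 using dom
proof eventually_elim
 case (elim g)
 show ?case
 proof
  fix x :: "real ^ 'n" assume x: "x \<in> pcone"
  have "g *v x = l1norm x *\<^sub>R (g *v (x /\<^sub>R l1norm x))"
   using cone_l1norm[OF x] by (simp add: matrix_vector_mult_scaleR)
  then have "l1norm (g *v x) = l1norm x * l1norm (g *v (x /\<^sub>R l1norm x))"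
   by (metis l1norm_scaleR abs_of_nonneg l1norm_ge_0)
  then have "l1norm (g *v x) powr s = l1norm x powr s * l1norm (g *v (x /\<^sub>R l1norm x)) powr s"
   by (simp add: powr_mult l1norm_ge_0)
  also have "... <= l1norm x powr s * (c1 * mnorm g powr s)"
   using elim cone_normalize[OF x] by (intro mult_left_mono) auto
  finally show "l1norm (g *v x) powr s <= c1 * l1norm x powr s * mnorm g powr s" by (simp add: mult_ac)
 qed
qed

lemma hcls_AE_bound:
 assumes F: "hcls F"
 obtains B where "0 <= B" "AE g in M. \<forall>x\<in>pcone. \<bar>F (g *v x)\<bar> <= B * l1norm x powr s * mnorm g powr s"
proof -
 obtain B where B: "0 <= B" "!!x. x \<in> pcone ==> \<bar>F x\<bar> <= B * l1norm x powr s" using hcls_bound_cone[OF F] by blast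
 have "AE g in M. \<forall>x\<in>pcone. \<bar>F (g *v x)\<bar> <= (B * \<bar>c1\<bar>) * l1norm x powr s * mnorm g powr s"
  using good_AE dom_cone
 proof eventually_elim
  case (elim g)
  show ?case
  proof
   fix x :: "real ^ 'n" assume x: "x \<in> pcone"
   have "\<bar>F (g *v x)\<bar> <= B * l1norm (g *v x) powr s" using B(2) pos_mat_cone[OF good_pos x] elim by blast
   also have "... <= B * (\<bar>c1\<bar> * l1norm x powr s * mnorm g powr s)"
   proof (intro mult_left_mono B(1))
    have "l1norm (g *v x) powr s <= c1 * l1norm x powr s * mnorm g powr s" using elim x by blast
    also have "... <= \<bar>c1\<bar> * l1norm x powr s * mnorm g powr s" by (intro mult_right_mono) auto
    finally show "l1norm (g *v x) powr s <= \<bar>c1\<bar> * l1norm x powr s * mnorm g powr s" .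
   qed
   finally show "\<bar>F (g *v x)\<bar> <= (B * \<bar>c1\<bar>) * l1norm x powr s * mnorm g powr s" by (simp add: mult_ac)
  qed
 qed
 then show thesis using that[of "B * \<bar>c1\<bar>"] B(1) by simp
qed

lemma hcls_integrable:
 assumes F: "hcls F" and x: "x \<in> pcone"
 shows "integrable M (%g. F (g *v x))"
proof -
 obtain B where B: "0 <= B" "AE g in M. \<forall>x\<in>pcone. \<bar>F (g *v x)\<bar> <= B * l1norm x powr s * mnorm g powr s"
  using hcls_AE_bound[OF F] by blast
 show ?thesis
 proof (rule Bochner_Integration.integrable_bound[OF integrable_mult_right[OF int_s, of "B * l1norm x powr s"]])
  show "AE g in M. norm (F (g *v x)) <= norm (B * l1norm x powr s * mnorm g powr s)"
   using B(2) by eventually_elim (use x B(1) in \<open>auto simp: abs_mult\<close>)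
 qed (rule homog_M[OF hcls_homog[OF F]])
qed

lemma A_homog: "hcls F ==> homog (A F)"
 unfolding homog_def
proof (intro conjI ballI allI impI)
 assume F: "hcls F"
 have [measurable]: "F \<in> borel_measurable borel" using F by (simp add: hcls_def homog_def)
 have "(%(x, g). F (g *v x)) \<in> borel_measurable (borel \<Otimes>\<^sub>M M)"
  using measurable_compose[OF measurable_mat_vec_pair, of F borel]
  by (simp add: case_prod_unfold measurable_cong_sets[OF sets_pair_measure_cong[OF refl sets_M] refl])
 then show "A F \<in> borel_measurable borel" unfolding A_def[abs_def] by (rule borel_measurable_lebesgue_integral)
 fix x :: "real ^ 'n" and t :: real assume x: "x \<in> pcone" and t: "0 < t"
 have "A F (t *\<^sub>R x) = (\<integral>g. t powr s * F (g *v x) \<partial>M)"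
  unfolding A_def
 proof (rule integral_cong_AE)
  show "AE g in M. F (g *v (t *\<^sub>R x)) = t powr s * F (g *v x)"
   using good_AE
  proof eventually_elim
   case (elim g)
   then show ?case using homogD[OF hcls_homog[OF F] pos_mat_cone[OF good_pos x] t]
    by (simp add: matrix_vector_mult_scaleR)
  qed
 qed (use homog_M[OF hcls_homog[OF F]] in auto)
 then show "A F (t *\<^sub>R x) = t powr s * A F x" by (simp add: A_def)
qed

lemma A_hcls: assumes F: "hcls F" shows "hcls (A F)"
proof -
 obtain B where B: "0 <= B" "AE g in M. \<forall>x\<in>pcone. \<bar>F (g *v x)\<bar> <= B * l1norm x powr s * mnorm g powr s"
  using hcls_AE_bound[OF F] by blast
 have "\<bar>A F x\<bar> <= B * (\<integral>g. mnorm g powr s \<partial>M)" if x: "x \<in> \<S>" for x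
 proof -
  have "\<bar>A F x\<bar> <= (\<integral>g. \<bar>F (g *v x)\<bar> \<partial>M)" unfolding A_def by (rule integral_abs_bound)
  also have "... <= (\<integral>g. B * mnorm g powr s \<partial>M)"
  proof (rule integral_mono_AE)
   show "AE g in M. \<bar>F (g *v x)\<bar> <= B * mnorm g powr s"
    using B(2) by eventually_elim (use simplex_cone[OF x] simplex_D(4)[OF x] in force)
  qed (use hcls_integrable[OF F simplex_cone[OF x]] int_s in auto)
  finally show ?thesis by simp
 qed
 then show ?thesis unfolding hcls_def using A_homog[OF F] by blast
qed

lemma A_mono_AE: "hcls F ==> hcls G ==> x \<in> pcone ==> y \<in> pcone ==>
  (!!g. good g ==> k * F (g *v x) <= G (g *v y)) ==> k * A F x <= A G y"
 unfolding A_def integral_mult_right_zero[symmetric]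
 by (rule integral_mono_AE) (use hcls_integrable good_AE in \<open>auto elim!: eventually_mono\<close>)

lemma A_cls: assumes F: "cls F" shows "cls (A F)"
proof -
 have h: "hcls F" by (rule cls_hcls[OF F])
 have pos: "0 < A F x" if x: "x \<in> pcone" for x
 proof -
  have ae: "AE g in M. 0 < F (g *v x)"
   using good_AE by eventually_elim (use F pos_mat_cone[OF good_pos x] in \<open>auto simp: cls_def\<close>)
  then have "0 <= A F x" unfolding A_def by (intro integral_nonneg_AE) (auto elim!: eventually_mono)
  moreover have "A F x ~= 0"
  proof
   assume "A F x = 0"
   then have "AE g in M. F (g *v x) = 0"
    unfolding A_def using ae hcls_integrable[OF h x]
    by (subst (asm) integral_nonneg_eq_0_iff_AE) (auto elim!: eventually_mono)
   with ae have "AE g in M. False" by eventually_elim simp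
   then show False by simp
  qed
  ultimately show ?thesis by simp
 qed
 have cmp: "ca a b * A F y <= A F x"
  if x: "x \<in> pcone" and y: "y \<in> pcone" and ab: "0 < a" "0 < b" "\<forall>i. a * y $ i <= x $ i" "\<forall>i. b * x $ i <= y $ i" for x y a b
 proof (rule A_mono_AE[OF h h y x])
  fix g assume g: "good g"
  have mono: "(g *v u) $ i <= (g *v v) $ i" if "\<forall>i. u $ i <= v $ i" for u v i
   unfolding mat_vec_nth using good_pos[OF g] that
   by (intro sum_mono mult_left_mono) (auto simp: pos_mat_def less_imp_le)
  have "\<forall>i. a * (g *v y) $ i <= (g *v x) $ i" "\<forall>i. b * (g *v x) $ i <= (g *v y) $ i"
   using mono[of "a *\<^sub>R y" x] mono[of "b *\<^sub>R x" y] ab by (auto simp: matrix_vector_mult_scaleR)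
  then show "ca a b * F (g *v y) <= F (g *v x)"
   using F ab(1,2) pos_mat_cone[OF good_pos[OF g]] x y unfolding cls_def by blast
 qed
 have "\<exists>B. \<forall>x\<in>\<S>. A F x <= B" using A_hcls[OF h] unfolding hcls_def by (meson abs_le_D1)
 then show ?thesis unfolding cls_def using A_homog[OF h] pos cmp by blast
qed

lemma Apow_cls: "cls F ==> cls ((A ^^ n) F)" by (induction n) (auto intro: A_cls)
lemma Apow_hcls: "hcls F ==> hcls ((A ^^ n) F)" by (induction n) (auto intro: A_hcls)

lemma clsD: assumes "cls F" shows "x \<in> pcone ==> 0 < F x"
 "[|x \<in> pcone; y \<in> pcone; 0 < a; 0 < b; !!i. a * y $ i <= x $ i; !!i. b * x $ i <= y $ i|] ==> ca a b * F y <= F x"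
 using assms unfolding cls_def by blast+

lemma A_lin: "hcls F ==> hcls G ==> x \<in> pcone ==> A (%x. a * F x + b * G x) x = a * A F x + b * A G x"
 unfolding A_def using hcls_integrable by simp

lemma A_cong: "homog F ==> homog G ==> x \<in> pcone ==> (!!y. y \<in> pcone ==> F y = G y) ==> A F x = A G x"
 unfolding A_def
 by (rule integral_cong_AE) (use homog_M good_AE pos_mat_cone[OF good_pos] in \<open>auto elim!: eventually_mono\<close>)

lemma Apow_cong: "hcls F ==> hcls G ==> (!!y. y \<in> pcone ==> F y = G y) ==> x \<in> pcone ==> (A ^^ n) F x = (A ^^ n) G x"
 by (induction n arbitrary: x) (auto intro!: A_cong intro: hcls_homog Apow_hcls)

lemma Apow_lin: "hcls F ==> hcls G ==> x \<in> pcone ==> (A ^^ n) (%x. a * F x + b * G x) x = a * (A ^^ n) F x + b * (A ^^ n) G x"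
proof (induction n arbitrary: x)
 case (Suc n)
 have "(A ^^ Suc n) (%x. a * F x + b * G x) x = A ((A ^^ n) (%x. a * F x + b * G x)) x" by simp
 also have "... = A (%x. a * (A ^^ n) F x + b * (A ^^ n) G x) x"
  using Suc by (intro A_cong hcls_homog Apow_hcls hcls_lin) auto
 also have "... = a * (A ^^ Suc n) F x + b * (A ^^ Suc n) G x"
  using Suc by (subst A_lin) (auto intro: Apow_hcls)
 finally show ?case .
qed simp

text \<open>The factors appear in the order in which \<open>A ^^ m\<close> applies them: the last
  matrix in the product acts first.\<close>

primrec gp :: "nat => (real ^ 'n ^ 'n) set" where
 "gp 0 = {mat 1}"
| "gp (Suc m) = {G ** g |G g. G \<in> gp m & good g}"

text \<open>The two starting points are driven by the same random product, which is a coupling: an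
  inequality between \<open>\<Phi>\<close> at \<open>G x\<close> and \<open>\<Psi>\<close> at
  \<open>G y\<close> is checked for one \<open>G\<close> at a time and then passes to the
  iterates.\<close>

lemma mono_pow:
 assumes "hcls \<Phi>" "hcls \<Psi>" "x \<in> pcone" "y \<in> pcone" "!!G. G \<in> gp m ==> 0 <= \<Phi> (G *v x) + \<Psi> (G *v y)"
 shows "0 <= (A ^^ m) \<Phi> x + (A ^^ m) \<Psi> y"
 using assms(3-5)
proof (induction m arbitrary: x y)
 case 0 then show ?case by simp
next
 case (Suc m)
 have "0 <= (A ^^ m) \<Phi> (g *v x) + (A ^^ m) \<Psi> (g *v y)" if g: "good g" for g
 proof (rule Suc.IH)
  fix G assume "G \<in> gp m"
  then have "G ** g \<in> gp (Suc m)" using g by auto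
  from Suc.prems(3)[OF this] show "0 <= \<Phi> (G *v (g *v x)) + \<Psi> (G *v (g *v y))"
   by (simp add: matrix_vector_mul_assoc)
 qed (use pos_mat_cone[OF good_pos[OF g]] Suc.prems in auto)
 then have "-1 * A ((A ^^ m) \<Phi>) x <= A ((A ^^ m) \<Psi>) y"
  using Suc.prems assms(1,2) by (intro A_mono_AE Apow_hcls) fastforce+
 then show ?case by simp
qed

definition c where "c = (1 - p) / (1 + p)"
lemma c: "0 <= c" "c < 1" using p by (auto simp: c_def)

lemma gp_props:
 assumes "G \<in> gp m"
 shows "x \<in> pcone ==> G *v x \<in> pcone"
  and "u \<in> \<S> ==> v \<in> \<S> ==> d_hilbert (act G u) (act G v) <= c ^ m * d_hilbert u v"
  and "0 < m ==> v \<in> \<S> ==> act G v \<in> K"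
  and "v \<in> \<S> ==> act G v \<in> \<S>"
  and "(\<forall>i. x $ i <= y $ i) ==> \<forall>i. (G *v x) $ i <= (G *v y) $ i"
  and "0 < m ==> u \<in> K ==> v \<in> K ==> (G *v v) $ i <= C * (G *v u) $ i"
proof -
 have act_comp: "act (H ** g) v = act H (act g v)" if "good g" "v \<in> \<S>" for H g v
 proof -
  have l: "0 < l1norm (g *v v)" using pos_mat_act[OF good_pos[OF that(1)] that(2)] by simp
  have "H *v (act g v) = (H *v (g *v v)) /\<^sub>R l1norm (g *v v)"
   unfolding act_def by (simp add: matrix_vector_mult_scaleR)
  then show ?thesis using l unfolding act_def[of "H ** g"] act_def[of H]
   by (simp add: l1norm_scaleR matrix_vector_mul_assoc[symmetric])
 qed
 have "(\<forall>x\<in>pcone. G *v x \<in> pcone) &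
  (\<forall>u\<in>\<S>. \<forall>v\<in>\<S>. d_hilbert (act G u) (act G v) <= c ^ m * d_hilbert u v) &
  (\<forall>v\<in>\<S>. act G v \<in> \<S>) & (0 < m --> (\<forall>v\<in>\<S>. act G v \<in> K)) &
  (\<forall>x y. (\<forall>i. x $ i <= y $ i) --> (\<forall>i. (G *v x) $ i <= (G *v y) $ i))"
  using assms
 proof (induction m arbitrary: G)
  case 0
  have "act (mat 1 :: real^'n^'n) v = v" if "v \<in> \<S>" for v
   using simplex_D(4)[OF that] by (simp add: act_def)
  then show ?case using 0 by simp
 next
  case (Suc m)
  then obtain H g where H: "G = H ** g" "H \<in> gp m" "good g" by auto
  note IH = Suc.IH[OF H(2)]
  have act: "act G v = act H (act g v)" if "v \<in> \<S>" for v using act_comp H that by simp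
  have gS: "act g v \<in> \<S>" if "v \<in> \<S>" for v using pos_mat_act[OF good_pos[OF H(3)] that] by simp
  have gd: "d_hilbert (act g u) (act g v) <= c * d_hilbert u v" if "u \<in> \<S>" "v \<in> \<S>" for u v
   unfolding c_def using birkhoff_contraction[OF good_pos[OF H(3)] _ _ _ that, of p] H(3) p by (simp add: good_mat_def)
  have "d_hilbert (act G u) (act G v) <= c ^ Suc m * d_hilbert u v" if "u \<in> \<S>" "v \<in> \<S>" for u v
  proof -
   have "d_hilbert (act G u) (act G v) <= c ^ m * d_hilbert (act g u) (act g v)"
    using IH gS act that by simp
   also have "... <= c ^ m * (c * d_hilbert u v)" using gd[OF that] c by (intro mult_left_mono) auto
   finally show ?thesis by (simp add: mult_ac)
  qed
  moreover have "act G v \<in> K" if "v \<in> \<S>" for v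
  proof (cases "m = 0")
   case True
   then have "H = mat 1" using H by simp
   then show ?thesis using good_K[OF H(3) that] H(1) by simp
  next
   case False
   then show ?thesis using IH gS act that by simp
  qed
  moreover have "(G *v x) $ i <= (G *v y) $ i" if "\<forall>i. x $ i <= y $ i" for x y i
  proof -
   have "\<forall>i. (g *v x) $ i <= (g *v y) $ i"
    unfolding mat_vec_nth using good_pos[OF H(3)] that
    by (intro allI sum_mono mult_left_mono) (auto simp: pos_mat_def less_imp_le)
   then show ?thesis using IH unfolding H(1) matrix_vector_mul_assoc[symmetric] by blast
  qed
  moreover have "G *v x \<in> pcone" if "x \<in> pcone" for x
   using IH pos_mat_cone[OF good_pos[OF H(3)] that] unfolding H(1) matrix_vector_mul_assoc[symmetric] by blast
  ultimately show ?case using IH gS act by auto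
 qed
 note all = this
 show "x \<in> pcone ==> G *v x \<in> pcone" using all by blast
 show "u \<in> \<S> ==> v \<in> \<S> ==> d_hilbert (act G u) (act G v) <= c ^ m * d_hilbert u v" using all by blast
 show "0 < m ==> v \<in> \<S> ==> act G v \<in> K" using all by blast
 show "v \<in> \<S> ==> act G v \<in> \<S>" using all by blast
 show "(\<forall>i. x $ i <= y $ i) ==> \<forall>i. (G *v x) $ i <= (G *v y) $ i" using all by blast
 show "0 < m ==> u \<in> K ==> v \<in> K ==> (G *v v) $ i <= C * (G *v u) $ i"
  using assms
 proof (induction m arbitrary: G i)
  case (Suc m)
  then obtain H g where H: "G = H ** g" "H \<in> gp m" "good g" by auto
  \<comment> \<open>Only the factor that acts first has to compare \<open>u\<close> and
    \<open>v\<close>; the remaining product is monotone.\<close>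
  have *: "\<forall>i. (g *v v) $ i <= (C *\<^sub>R (g *v u)) $ i" using H(3) Suc.prems by (auto simp: good_mat_def)
  have "\<forall>x y. (\<forall>i. x $ i <= y $ i) --> (\<forall>i. (H *v x) $ i <= (H *v y) $ i)" using H(2)
  proof (induction m arbitrary: H)
   case (Suc m)
   then obtain H' g where H': "H = H' ** g" "H' \<in> gp m" "good g" by auto
   have "\<forall>i. (g *v x) $ i <= (g *v y) $ i" if "\<forall>i. x $ i <= y $ i" for x y
    unfolding mat_vec_nth using good_pos[OF H'(3)] that
    by (intro allI sum_mono mult_left_mono) (auto simp: pos_mat_def less_imp_le)
   then show ?case using Suc.IH[OF H'(2)] unfolding H'(1) matrix_vector_mul_assoc[symmetric] by blast
  qed simp
  then have "(H *v (g *v v)) $ i <= (H *v (C *\<^sub>R (g *v u))) $ i" using * by blast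
  then show ?case unfolding H(1) by (simp add: matrix_vector_mult_scaleR matrix_vector_mul_assoc)
 qed simp
qed

text \<open>With weights \<open>F (G u) / (A ^^ m) F u\<close> the ratio at \<open>u\<close> is the
  mean of \<open>\<Phi> / F\<close> over the points \<open>act G u\<close>. By \<open>ker\<close>
  the weights from \<open>u\<close> dominate \<open>e\<close> times those from \<open>v\<close>. On
  this common part the means differ only through the distance of \<open>act G u\<close> and
  \<open>act G v\<close>; the rest contributes at most \<open>(1 - e) * os\<close>.\<close>

lemma one_step:
 assumes F: "cls F" and \<Phi>: "hcls \<Phi>" and m: "0 < m"
  and K: "!!x. x \<in> K ==> a <= \<Phi> x / F x & \<Phi> x / F x <= a + os"
  and H: "!!x y. x \<in> \<S> ==> y \<in> \<S> ==> \<bar>\<Phi> x / F x - \<Phi> y / F y\<bar> <= h * d_hilbert x y powr \<gamma>"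
  and h: "0 <= h" and \<gamma>: "0 <= \<gamma>" and u: "u \<in> \<S>" and v: "v \<in> \<S>" and e: "0 <= e" "e <= 1"
  and ker: "!!G. G \<in> gp m ==> e * (F (G *v v) / (A ^^ m) F v) <= F (G *v u) / (A ^^ m) F u"
 shows "(A ^^ m) \<Phi> u / (A ^^ m) F u - (A ^^ m) \<Phi> v / (A ^^ m) F v <= (1 - e) * os + h * (c ^ m * d_hilbert u v) powr \<gamma>"
  and "a <= (A ^^ m) \<Phi> v / (A ^^ m) F v"
proof -
 have Fh: "hcls F" by (rule cls_hcls[OF F])
 have uc: "u \<in> pcone" and vc: "v \<in> pcone" using simplex_cone u v by auto
 define Zu where "Zu = (A ^^ m) F u"
 define Zv where "Zv = (A ^^ m) F v"
 have Z: "0 < Zu" "0 < Zv" using clsD(1)[OF Apow_cls[OF F]] uc vc by (auto simp: Zu_def Zv_def)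
 have \<Phi>_act: "\<Phi> (G *v x) = F (G *v x) * (\<Phi> (act G x) / F (act G x))" and F_pos: "0 < F (G *v x)"
  if G: "G \<in> gp m" and x: "x \<in> \<S>" for G x
 proof -
  have Gx: "G *v x \<in> pcone" using gp_props(1)[OF G simplex_cone[OF x]] .
  show "0 < F (G *v x)" by (rule clsD(1)[OF F Gx])
  have "0 < F (act G x)" using gp_props(4)[OF G x] simplex_cone clsD(1)[OF F] by blast
  then show "\<Phi> (G *v x) = F (G *v x) * (\<Phi> (act G x) / F (act G x))"
   using homog_normalize[OF hcls_homog[OF \<Phi>] Gx] homog_normalize[OF hcls_homog[OF Fh] Gx]
   by (simp add: act_def)
 qed
 define D where "D = h * (c ^ m * d_hilbert u v) powr \<gamma>"
 have low: "a <= (A ^^ m) \<Phi> v / Zv"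
 proof -
  have "0 <= (A ^^ m) (%x. 1 * \<Phi> x + (-a) * F x) v + (A ^^ m) (%x. 0 * \<Phi> x + 0 * F x) v"
  proof (rule mono_pow[OF hcls_lin[OF \<Phi> Fh] hcls_lin[OF \<Phi> Fh] vc vc])
   fix G assume G: "G \<in> gp m"
   have "a * F (G *v v) <= \<Phi> (G *v v)"
    unfolding \<Phi>_act[OF G v] using K[OF gp_props(3)[OF G m v]] F_pos[OF G v]
    by (subst mult.commute) (intro mult_left_mono, auto intro: less_imp_le)
   then show "0 <= 1 * \<Phi> (G *v v) + - a * F (G *v v) + (0 * \<Phi> (G *v v) + 0 * F (G *v v))" by simp
  qed
  then show ?thesis using Z vc by (simp only: Apow_lin[OF \<Phi> Fh]) (simp add: Zv_def field_simps)
 qed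
 then show "a <= (A ^^ m) \<Phi> v / (A ^^ m) F v" by (simp add: Zv_def)
 \<comment> \<open>At each \<open>G\<close> the two integrands add up to
   \<open>(pu - e pv) (os + a - x) + e pv (y - x + D)\<close>, in which every factor is
   non-negative.\<close>
 have "0 <= (A ^^ m) (%x. ((os + a) / Zu) * F x + (- 1 / Zu) * \<Phi> x) u
   + (A ^^ m) (%x. (e / Zv) * \<Phi> x + (e * (D - a - os) / Zv) * F x) v"
 proof (rule mono_pow[OF hcls_lin[OF Fh \<Phi>] hcls_lin[OF \<Phi> Fh] uc vc])
  fix G assume G: "G \<in> gp m"
  define pu where "pu = F (G *v u) / Zu"
  define pv where "pv = F (G *v v) / Zv"
  define x where "x = \<Phi> (act G u) / F (act G u)"
  define y where "y = \<Phi> (act G v) / F (act G v)"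
  have pp: "e * pv <= pu" "0 <= pv" using ker[OF G] F_pos[OF G v] Z by (auto simp: pu_def pv_def Zu_def Zv_def)
  have xo: "0 <= os + a - x" using K[OF gp_props(3)[OF G m u]] by (simp add: x_def)
  have "\<bar>x - y\<bar> <= h * d_hilbert (act G u) (act G v) powr \<gamma>"
   unfolding x_def y_def by (intro H gp_props(4)[OF G] u v)
  also have "... <= D" unfolding D_def
   using gp_props(2)[OF G u v] d_hilbert_bounds(1)[OF gp_props(4)[OF G u] gp_props(4)[OF G v]] h \<gamma>
   by (intro mult_left_mono powr_mono2) auto
  finally have xy: "0 <= y - x + D" by linarith
  have "(e * pv) * (os + a - x) <= pu * (os + a - x)" using pp xo by (intro mult_right_mono)
  moreover have "0 <= (e * pv) * (y - x + D)" using xy pp e by (intro mult_nonneg_nonneg) auto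
  ultimately have "0 <= pu * (os + a - x) + e * pv * (y + D - a - os)" by (simp add: algebra_simps)
  also have "... = ((os + a) / Zu) * F (G *v u) + (- 1 / Zu) * \<Phi> (G *v u) + ((e / Zv) * \<Phi> (G *v v) + (e * (D - a - os) / Zv) * F (G *v v))"
   unfolding \<Phi>_act[OF G u] \<Phi>_act[OF G v] x_def[symmetric] y_def[symmetric] pu_def pv_def
   by (simp add: algebra_simps diff_divide_distrib add_divide_distrib)
  finally show "0 <= ((os + a) / Zu) * F (G *v u) + (- 1 / Zu) * \<Phi> (G *v u) + ((e / Zv) * \<Phi> (G *v v) + (e * (D - a - os) / Zv) * F (G *v v))" .
 qed
 then have "0 <= (os + a) / Zu * Zu + - 1 / Zu * (A ^^ m) \<Phi> u + (e / Zv * (A ^^ m) \<Phi> v + e * (D - a - os) / Zv * Zv)"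
  unfolding Apow_lin[OF Fh \<Phi> uc] Apow_lin[OF \<Phi> Fh vc] Zu_def[symmetric] Zv_def[symmetric] .
 then have "(A ^^ m) \<Phi> u / Zu <= (os + a) + e * ((A ^^ m) \<Phi> v / Zv) + e * (D - a - os)" using Z by simp
 moreover have "e * ((A ^^ m) \<Phi> v / Zv - a) <= (A ^^ m) \<Phi> v / Zv - a" using low e by (intro mult_left_le_one_le) auto
 moreover have "e * D <= D" using e h unfolding D_def by (intro mult_left_le_one_le) auto
 ultimately show "(A ^^ m) \<Phi> u / (A ^^ m) F u - (A ^^ m) \<Phi> v / (A ^^ m) F v <= (1 - e) * os + h * (c ^ m * d_hilbert u v) powr \<gamma>"
  unfolding D_def[symmetric] Zu_def[symmetric] Zv_def[symmetric] by (simp add: algebra_simps)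
qed

text \<open>Minorization constant on \<open>K\<close>: one factor compares the numerators
  \<open>F (G v)\<close> and \<open>F (G u)\<close>, the other the normalizations.\<close>

definition \<beta> where "\<beta> = (C powr - \<bar>s\<bar>)\<^sup>2"

lemma \<beta>: "0 < \<beta>" "\<beta> <= 1"
proof -
 have "C powr - \<bar>s\<bar> <= 1" using C powr_mono[of "- \<bar>s\<bar>" 0 C] by simp
 then show "0 < \<beta>" "\<beta> <= 1" using C by (auto simp: \<beta>_def power_le_one)
qed

lemma ca_C: "ca (1 / C) (1 / C) = C powr - \<bar>s\<bar>"
 using C by (auto simp: ca_def powr_divide powr_minus field_simps)

lemma K_compare:
 assumes F: "cls F" and m: "0 < m" and u: "u \<in> K" and v: "v \<in> K"
 shows "G \<in> gp m ==> C powr - \<bar>s\<bar> * F (G *v v) <= F (G *v u)"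
  and "C powr - \<bar>s\<bar> * (A ^^ m) F v <= (A ^^ m) F u"
proof -
 have uc: "u \<in> pcone" and vc: "v \<in> pcone" using simplex_cone K_sub u v by auto
 show *: "C powr - \<bar>s\<bar> * F (G *v v) <= F (G *v u)" if G: "G \<in> gp m" for G
  unfolding ca_C[symmetric]
 proof (rule clsD(2)[OF F])
  show "1 / C * (G *v v) $ i <= (G *v u) $ i" for i
   using gp_props(6)[OF G m u v, of i] C by (simp add: field_simps)
  show "1 / C * (G *v u) $ i <= (G *v v) $ i" for i
   using gp_props(6)[OF G m v u, of i] C by (simp add: field_simps)
 qed (use gp_props(1)[OF G] uc vc C in auto)
 have Fh: "hcls F" by (rule cls_hcls[OF F])
 have "0 <= (A ^^ m) (%x. 1 * F x + 0 * F x) u + (A ^^ m) (%x. (- (C powr - \<bar>s\<bar>)) * F x + 0 * F x) v"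
  by (rule mono_pow[OF hcls_lin[OF Fh Fh] hcls_lin[OF Fh Fh] uc vc]) (use * in simp)
 then show "C powr - \<bar>s\<bar> * (A ^^ m) F v <= (A ^^ m) F u"
  unfolding Apow_lin[OF Fh Fh uc] Apow_lin[OF Fh Fh vc] by simp
qed

lemma K_kernel:
 assumes F: "cls F" and m: "0 < m" and u: "u \<in> K" and v: "v \<in> K" and G: "G \<in> gp m"
 shows "\<beta> * (F (G *v v) / (A ^^ m) F v) <= F (G *v u) / (A ^^ m) F u"
proof -
 have uc: "u \<in> pcone" and vc: "v \<in> pcone" using simplex_cone K_sub u v by auto
 have Z: "0 < (A ^^ m) F u" "0 < (A ^^ m) F v" using clsD(1)[OF Apow_cls[OF F]] uc vc by auto
 have "(C powr - \<bar>s\<bar> * F (G *v v)) * (C powr - \<bar>s\<bar> * (A ^^ m) F u) <= F (G *v u) * (A ^^ m) F v"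
  using K_compare(1)[OF F m u v G] K_compare(2)[OF F m v u] clsD(1)[OF F gp_props(1)[OF G]] uc vc Z
  by (intro mult_mono) (auto intro: less_imp_le)
 then show ?thesis using Z by (simp add: \<beta>_def power2_eq_square field_simps)
qed

text \<open>Valid on the whole simplex, with a constant close to 1 for nearby points. The two
  \<open>ca\<close> factors, from the numerators and from the normalizations, combine by
  \<open>ca_mult\<close> to \<open>cr u v powr \<bar>s\<bar>\<close>.\<close>

lemma S_kernel:
 assumes F: "cls F" and u: "u \<in> \<S>" and v: "v \<in> \<S>" and G: "G \<in> gp m"
 shows "cr u v powr \<bar>s\<bar> * (F (G *v v) / (A ^^ m) F v) <= F (G *v u) / (A ^^ m) F u"
proof -
 have uc: "u \<in> pcone" and vc: "v \<in> pcone" using simplex_cone u v by auto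
 have Gc: "G *v u \<in> pcone" "G *v v \<in> pcone" using gp_props(1)[OF G] uc vc by auto
 have Z: "0 < (A ^^ m) F u" "0 < (A ^^ m) F v" using clsD(1)[OF Apow_cls[OF F]] uc vc by auto
 have FG: "0 < F (G *v u)" "0 < F (G *v v)" using clsD(1)[OF F] Gc by auto
 show ?thesis
 proof (cases "cr u v = 0")
  case True
  then show ?thesis using Z FG by simp
 next
  case False
  define a where "a = m_ratio u v"
  define b where "b = m_ratio v u"
  have "a ~= 0" "b ~= 0" using False by (auto simp: cr_def a_def b_def)
  then have ab: "0 < a" "0 < b" using m_ratio_0[OF u v] m_ratio_0[OF v u] by (auto simp: a_def b_def less_le)
  have le: "a * v $ i <= u $ i" "b * u $ i <= v $ i" for i
   using m_ratio_le[OF u v] m_ratio_le[OF v u] by (auto simp: a_def b_def)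
  have leG: "a * (G *v v) $ i <= (G *v u) $ i" "b * (G *v u) $ i <= (G *v v) $ i" for i
   using gp_props(5)[OF G, of "a *\<^sub>R v" u] gp_props(5)[OF G, of "b *\<^sub>R u" v] le
   by (auto simp: matrix_vector_mult_scaleR)
  have "(ca a b * F (G *v v)) * (ca b a * (A ^^ m) F u) <= F (G *v u) * (A ^^ m) F v"
   using clsD(2)[OF F Gc ab leG] clsD(2)[OF Apow_cls[OF F] vc uc ab(2,1) le(2,1)] FG Z ca_nonneg
   by (intro mult_mono) (auto intro: less_imp_le mult_nonneg_nonneg)
  moreover have "ca a b * ca b a = cr u v powr \<bar>s\<bar>" using ca_mult[of a b] ab by (simp add: cr_def a_def b_def)
  ultimately have "cr u v powr \<bar>s\<bar> * (F (G *v v) * (A ^^ m) F u) <= F (G *v u) * (A ^^ m) F v"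
   by (metis mult.assoc mult.left_commute)
  then show ?thesis using Z by (simp add: field_simps)
 qed
qed

text \<open>The two quantities of a Lasota-Yorke inequality. Oscillation is measured only on
  \<open>K\<close>, which contains all images, while the Hoelder constant refers to the whole
  simplex.\<close>

definition reg :: "real => real => real => (real ^ 'n => real) => bool" where
 "reg \<gamma> os h \<psi> \<longleftrightarrow> (\<exists>a. \<forall>x\<in>K. a <= \<psi> x & \<psi> x <= a + os) &
   (\<forall>x\<in>\<S>. \<forall>y\<in>\<S>. \<bar>\<psi> x - \<psi> y\<bar> <= h * d_hilbert x y powr \<gamma>)"

definition C2 where "C2 = 2 * (\<bar>s\<bar> + 1)"

lemma one_minus_cr_powr:
 assumes "u \<in> \<S>" "v \<in> \<S>" "0 < \<gamma>" "\<gamma> <= 1"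
 shows "1 - cr u v powr \<bar>s\<bar> <= C2 * d_hilbert u v powr \<gamma>"
proof -
 let ?d = "d_hilbert u v"
 have d: "0 <= ?d" "?d <= 1" using d_hilbert_bounds assms by auto
 have "1 - cr u v powr \<bar>s\<bar> <= (\<bar>s\<bar> + 1) * (1 - cr u v)"
  using cr_bounds[OF assms(1,2)] s by (intro powr_ge_linear) auto
 also have "... <= (\<bar>s\<bar> + 1) * (2 * ?d powr \<gamma>)"
 proof (intro mult_left_mono)
  have "1 - cr u v <= 2 * ?d"
   unfolding d_hilbert_bounds(3)[OF assms(1,2)] using d by (simp add: field_simps)
  also have "... <= 2 * ?d powr \<gamma>" using d assms(3,4) powr_mono'[of \<gamma> 1 ?d] by simp
  finally show "1 - cr u v <= 2 * ?d powr \<gamma>" .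
 qed simp
 finally show ?thesis by (simp add: C2_def algebra_simps)
qed

text \<open>The oscillation on \<open>K\<close> uses \<open>one_step\<close> with
  \<open>e = \<beta>\<close>. The Hoelder bound uses it with
  \<open>e = cr u v powr \<bar>s\<bar>\<close>, for which \<open>1 - e\<close> is at most
  \<open>C2\<close> times the distance to the power \<open>\<gamma>\<close>.\<close>

lemma reg_step:
 assumes F: "cls F" and \<Phi>: "hcls \<Phi>" and m: "0 < m" and \<gamma>: "0 < \<gamma>" "\<gamma> <= 1" and oh: "0 <= os" "0 <= h"
  and r: "reg \<gamma> os h (%x. \<Phi> x / F x)"
 shows "reg \<gamma> ((1 - \<beta>) * os + (c ^ m) powr \<gamma> * h) (C2 * os + (c ^ m) powr \<gamma> * h) (%x. (A ^^ m) \<Phi> x / (A ^^ m) F x)"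
proof -
 let ?Q = "%x. (A ^^ m) \<Phi> x / (A ^^ m) F x"
 obtain a where a: "!!x. x \<in> K ==> a <= \<Phi> x / F x & \<Phi> x / F x <= a + os" using r by (auto simp: reg_def)
 have H: "!!x y. x \<in> \<S> ==> y \<in> \<S> ==> \<bar>\<Phi> x / F x - \<Phi> y / F y\<bar> <= h * d_hilbert x y powr \<gamma>"
  using r by (auto simp: reg_def)
 have cm: "0 <= c ^ m" using c by simp
 have dp: "h * (c ^ m * d_hilbert u v) powr \<gamma> = (c ^ m) powr \<gamma> * h * d_hilbert u v powr \<gamma>"
  if "u \<in> \<S>" "v \<in> \<S>" for u v
  using cm d_hilbert_bounds(1)[OF that] by (simp add: powr_mult mult_ac)
 have 1: "?Q u - ?Q v <= (1 - \<beta>) * os + (c ^ m) powr \<gamma> * h" if u: "u \<in> K" and v: "v \<in> K" for u v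
 proof -
  have uv: "u \<in> \<S>" "v \<in> \<S>" using u v K_sub by auto
  have "?Q u - ?Q v <= (1 - \<beta>) * os + h * (c ^ m * d_hilbert u v) powr \<gamma>"
   using K_kernel[OF F m u v] \<beta> \<gamma> uv by (intro one_step(1)[OF F \<Phi> m a H oh(2)]) auto
  also have "h * (c ^ m * d_hilbert u v) powr \<gamma> <= (c ^ m) powr \<gamma> * h * 1"
   unfolding dp[OF uv] using d_hilbert_bounds[OF uv] oh \<gamma> by (intro mult_left_mono powr_le1) auto
  finally show ?thesis by simp
 qed
 have 2: "?Q u - ?Q v <= (C2 * os + (c ^ m) powr \<gamma> * h) * d_hilbert u v powr \<gamma>"
  if u: "u \<in> \<S>" and v: "v \<in> \<S>" for u v
 proof -
  have "?Q u - ?Q v <= (1 - cr u v powr \<bar>s\<bar>) * os + h * (c ^ m * d_hilbert u v) powr \<gamma>"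
   using S_kernel[OF F u v] \<gamma> u v cr_bounds[OF u v] s
   by (intro one_step(1)[OF F \<Phi> m a H oh(2)]) (auto simp: powr_le1)
  also have "... <= (C2 * d_hilbert u v powr \<gamma>) * os + (c ^ m) powr \<gamma> * h * d_hilbert u v powr \<gamma>"
   unfolding dp[OF u v] using one_minus_cr_powr[OF u v \<gamma>] oh by (intro add_mono mult_right_mono) auto
  finally show ?thesis by (simp add: algebra_simps)
 qed
 have low: "a <= ?Q v" if v: "v \<in> K" for v
 proof -
  have vS: "v \<in> \<S>" using v K_sub by auto
  show ?thesis
  proof (rule one_step(2)[where e=0 and \<gamma>=\<gamma> and u=v, OF F \<Phi> m a H oh(2) _ vS vS])
   fix G assume "G \<in> gp m"
   then have "0 < F (G *v v)" "0 < (A ^^ m) F v"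
    using clsD(1)[OF F gp_props(1)] clsD(1)[OF Apow_cls[OF F]] simplex_cone[OF vS] by auto
   then show "0 * (F (G *v v) / (A ^^ m) F v) <= F (G *v v) / (A ^^ m) F v" by simp
  qed (use \<gamma> in auto)
 qed
 define i where "i = Inf (?Q ` K)"
 have bdd: "bdd_below (?Q ` K)" using low by (intro bdd_belowI[of _ a]) auto
 have "i <= ?Q x & ?Q x <= i + ((1 - \<beta>) * os + (c ^ m) powr \<gamma> * h)" if x: "x \<in> K" for x
 proof
  show "i <= ?Q x" unfolding i_def using x by (intro cInf_lower bdd) auto
  have "?Q x - ((1 - \<beta>) * os + (c ^ m) powr \<gamma> * h) <= i"
   unfolding i_def using K_nonempty 1[OF x] by (intro cInf_greatest) (auto simp: algebra_simps)
  then show "?Q x <= i + ((1 - \<beta>) * os + (c ^ m) powr \<gamma> * h)" by simp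
 qed
 moreover have "\<bar>?Q u - ?Q v\<bar> <= (C2 * os + (c ^ m) powr \<gamma> * h) * d_hilbert u v powr \<gamma>"
  if "u \<in> \<S>" "v \<in> \<S>" for u v
  using 2[OF that] 2[OF that(2,1)] by (simp add: d_hilbert_commute abs_le_iff)
 ultimately show ?thesis unfolding reg_def by blast
qed

text \<open>The bounds of \<open>reg_step\<close> contract in the weighted sum
  \<open>A1 * os + h\<close>: the choice \<open>A1 = 2 C2 / \<beta>\<close> makes the loss
  \<open>C2 * os\<close> half of the gain \<open>\<beta> * A1 * os\<close>, and \<open>m\<close> is
  so large that \<open>(A1 + 1) * cm <= 1/2\<close>. A remainder of fewer than \<open>m\<close>
  factors costs one further \<open>reg_step\<close>.\<close>

theorem decay:
 assumes \<gamma>: "0 < \<gamma>" "\<gamma> <= 1"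
 shows "\<exists>\<theta> C3. 0 < \<theta> & \<theta> < 1 & 0 <= C3 & (\<forall>F \<Phi> os h n u v. cls F --> hcls \<Phi> --> 0 <= os --> 0 <= h -->
   reg \<gamma> os h (%x. \<Phi> x / F x) --> u \<in> \<S> --> v \<in> \<S> -->
   \<bar>(A ^^ n) \<Phi> u / (A ^^ n) F u - (A ^^ n) \<Phi> v / (A ^^ n) F v\<bar> <= C3 * \<theta> ^ n * (os + h) * d_hilbert u v powr \<gamma>)"
proof -
 define A1 where "A1 = 2 * C2 / \<beta>"
 have C2: "2 <= C2" by (simp add: C2_def)
 have A1: "2 <= A1" using C2 \<beta> by (simp add: A1_def field_simps)
 have "(%m. (c ^ m) powr \<gamma>) \<longlonglongrightarrow> 0"
 proof (rule tendsto_zero_powrI[OF LIMSEQ_power_zero tendsto_const])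
 qed (use c \<gamma> in auto)
 then have "\<forall>\<^sub>F m in sequentially. (c ^ m) powr \<gamma> < 1 / (2 * (A1 + 1)) & 0 < m"
  using A1 by (intro eventually_conj order_tendstoD(2)) (auto simp: eventually_gt_at_top)
 then obtain m where m: "(c ^ m) powr \<gamma> < 1 / (2 * (A1 + 1))" "0 < m" by (auto simp: eventually_sequentially)
 define cm where "cm = (c ^ m) powr \<gamma>"
 have cm: "0 <= cm" "(A1 + 1) * cm <= 1/2" using m A1 by (auto simp: cm_def field_simps)
 define \<theta>0 where "\<theta>0 = max (1 - \<beta> / 2) (1 / 2)"
 have \<theta>0: "0 < \<theta>0" "\<theta>0 < 1" "1 - \<beta> / 2 <= \<theta>0" "1/2 <= \<theta>0" using \<beta> by (auto simp: \<theta>0_def)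
 define \<theta> where "\<theta> = \<theta>0 powr (1 / m)"
 have \<theta>: "0 < \<theta>" "\<theta> < 1" "\<theta> ^ m = \<theta>0"
  using \<theta>0 m(2) powr_less_mono2[of "1 / m" \<theta>0 1] unfolding \<theta>_def by (auto simp: powr_realpow[symmetric] powr_powr)
 define C3 where "C3 = (C2 + 1) * (A1 + 1) / \<theta>0"
 have blocks: "\<exists>os' h'. 0 <= os' & 0 <= h' & A1 * os' + h' <= \<theta>0 ^ j * (A1 * os + h) &
   reg \<gamma> os' h' (%x. (A ^^ (j * m)) \<Phi> x / (A ^^ (j * m)) F x)"
  if F: "cls F" and \<Phi>: "hcls \<Phi>" and oh: "0 <= os" "0 <= h" and r: "reg \<gamma> os h (%x. \<Phi> x / F x)" for F \<Phi> os h j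
 proof (induction j)
  case 0 then show ?case using oh r by (intro exI[of _ os] exI[of _ h]) simp
 next
  case (Suc j)
  then obtain o' h' where *: "0 <= o'" "0 <= h'" "A1 * o' + h' <= \<theta>0 ^ j * (A1 * os + h)"
   "reg \<gamma> o' h' (%x. (A ^^ (j * m)) \<Phi> x / (A ^^ (j * m)) F x)" by blast
  have st: "reg \<gamma> ((1 - \<beta>) * o' + cm * h') (C2 * o' + cm * h') (%x. (A ^^ (Suc j * m)) \<Phi> x / (A ^^ (Suc j * m)) F x)"
   using reg_step[OF Apow_cls[OF F] Apow_hcls[OF \<Phi>] m(2) \<gamma> *(1,2,4)]
   by (simp add: cm_def funpow_add o_def)
  have "A1 * ((1 - \<beta>) * o' + cm * h') + (C2 * o' + cm * h') = (A1 * (1 - \<beta>) + C2) * o' + ((A1 + 1) * cm) * h'"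
   by (simp add: algebra_simps)
  also have "A1 * (1 - \<beta>) + C2 = (1 - \<beta> / 2) * A1" using \<beta> by (simp add: A1_def field_simps)
  also have "(1 - \<beta> / 2) * A1 * o' + ((A1 + 1) * cm) * h' <= \<theta>0 * A1 * o' + \<theta>0 * h'"
   using \<theta>0 * A1 cm by (intro add_mono mult_right_mono) auto
  also have "... = \<theta>0 * (A1 * o' + h')" by (simp add: algebra_simps)
  also have "... <= \<theta>0 * (\<theta>0 ^ j * (A1 * os + h))" using *(3) \<theta>0 by (intro mult_left_mono) auto
  finally have "A1 * ((1 - \<beta>) * o' + cm * h') + (C2 * o' + cm * h') <= \<theta>0 ^ Suc j * (A1 * os + h)"
   by (simp add: mult.assoc)
  moreover have "0 <= (1 - \<beta>) * o' + cm * h'" "0 <= C2 * o' + cm * h'" using * \<beta> cm C2 by auto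
  ultimately show ?case using st by blast
 qed
 have main: "\<bar>(A ^^ n) \<Phi> u / (A ^^ n) F u - (A ^^ n) \<Phi> v / (A ^^ n) F v\<bar> <= C3 * \<theta> ^ n * (os + h) * d_hilbert u v powr \<gamma>"
  if F: "cls F" and \<Phi>: "hcls \<Phi>" and oh: "0 <= os" "0 <= h" and r: "reg \<gamma> os h (%x. \<Phi> x / F x)"
   and uv: "u \<in> \<S>" "v \<in> \<S>" for F \<Phi> os h n u v
 proof -
  define j where "j = n div m"
  define i where "i = n mod m"
  have "i < m" using m(2) by (simp add: i_def)
  moreover have "n = i + j * m" by (simp add: i_def j_def)
  ultimately have n: "n = i + j * m" "n < (j + 1) * m" by auto
  obtain o' h' where *: "0 <= o'" "0 <= h'" "A1 * o' + h' <= \<theta>0 ^ j * (A1 * os + h)"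
   "reg \<gamma> o' h' (%x. (A ^^ (j * m)) \<Phi> x / (A ^^ (j * m)) F x)" using blocks[OF F \<Phi> oh r] by blast
  have le: "C2 * o' + h' <= (C2 + 1) * (A1 * o' + h')"
  proof -
   have "C2 * o' <= (C2 + 1) * (A1 * o')" using * C2 A1 mult_mono[of C2 "C2 + 1" o' "A1 * o'"]
     mult_right_mono[of 1 A1 o'] by simp
   moreover have "h' <= (C2 + 1) * h'" using * C2 mult_right_mono[of 1 "C2 + 1" h'] by simp
   ultimately show ?thesis by (simp add: algebra_simps)
  qed
  have "\<exists>k\<le>C2 * o' + h'. \<bar>(A ^^ n) \<Phi> u / (A ^^ n) F u - (A ^^ n) \<Phi> v / (A ^^ n) F v\<bar> <= k * d_hilbert u v powr \<gamma>"
  \<comment> \<open>\<open>reg_step\<close> needs at least one factor, so a vanishing remainder is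
    treated apart.\<close>
  proof (cases "i = 0")
   case True
   then show ?thesis using *(4) uv n(1) * C2 by (intro exI[of _ h']) (auto simp: reg_def)
  next
   case False
   have "c ^ i <= 1" using c by (simp add: power_le_one)
   then have "(c ^ i) powr \<gamma> <= 1" using c \<gamma> by (intro powr_le1) auto
   then have "(c ^ i) powr \<gamma> * h' <= h'" using * by (intro mult_left_le_one_le) auto
   moreover have "reg \<gamma> ((1 - \<beta>) * o' + (c ^ i) powr \<gamma> * h') (C2 * o' + (c ^ i) powr \<gamma> * h') (%x. (A ^^ n) \<Phi> x / (A ^^ n) F x)"
    using reg_step[OF Apow_cls[OF F] Apow_hcls[OF \<Phi>] _ \<gamma> *(1,2,4), of i] False
    by (simp add: n(1) funpow_add o_def)
   ultimately show ?thesis using uv by (intro exI[of _ "C2 * o' + (c ^ i) powr \<gamma> * h'"]) (auto simp: reg_def)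
  qed
  then obtain k where k: "k <= C2 * o' + h'" "\<bar>(A ^^ n) \<Phi> u / (A ^^ n) F u - (A ^^ n) \<Phi> v / (A ^^ n) F v\<bar> <= k * d_hilbert u v powr \<gamma>" by blast
  have "k <= (C2 + 1) * (A1 * o' + h')" using k(1) le by linarith
  also have "... <= (C2 + 1) * (\<theta>0 ^ j * (A1 * os + h))" using *(3) C2 by (intro mult_left_mono) auto
  also have "... <= (C2 + 1) * (\<theta> ^ n / \<theta>0 * ((A1 + 1) * (os + h)))"
  proof (intro mult_left_mono mult_mono)
   have "\<theta>0 ^ j * \<theta>0 = \<theta> ^ (m * (j + 1))" unfolding \<theta>(3)[symmetric] by (simp add: power_mult power_add)
   also have "... <= \<theta> ^ n" using n(2) \<theta> by (intro power_decreasing) (auto simp: mult.commute)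
   finally show "\<theta>0 ^ j <= \<theta> ^ n / \<theta>0" using \<theta>0 by (simp add: field_simps)
   show "A1 * os + h <= (A1 + 1) * (os + h)" using oh A1 by (simp add: algebra_simps)
  qed (use \<theta>0 \<theta> C2 A1 oh in auto)
  also have "... = C3 * \<theta> ^ n * (os + h)" by (simp add: C3_def)
  finally have "k * d_hilbert u v powr \<gamma> <= C3 * \<theta> ^ n * (os + h) * d_hilbert u v powr \<gamma>"
   by (intro mult_right_mono) auto
  then show ?thesis using k(2) by linarith
 qed
 have "0 <= C3" unfolding C3_def using C2 A1 \<theta>0 by auto
 then show ?thesis using main \<theta> by (intro exI[of _ \<theta>] exI[of _ C3]) blast
qed

end

section \<open>Lipschitz polynomials and uniqueness of measures\<close>

lemma real_polynomial_function_lipschitz: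
 fixes S :: "'a::euclidean_space set"
 assumes "real_polynomial_function f" "compact S"
 shows "\<exists>L. \<forall>x\<in>S. \<forall>y\<in>S. \<bar>f x - f y\<bar> <= L * dist x y"
 using assms(1)
proof (induction rule: real_polynomial_function.induct)
 case (linear f)
 then obtain B where "!!x. norm (f x) <= norm x * B" using bounded_linear.bounded by blast
 then show ?case using linear by (intro exI[of _ B]) (auto simp: dist_norm bounded_linear.linear[THEN linear_diff, symmetric] mult.commute)
next
 case (const c)
 then show ?case by (intro exI[of _ 0]) auto
next
 case (add f g)
 then obtain L L' where "\<forall>x\<in>S. \<forall>y\<in>S. \<bar>f x - f y\<bar> <= L * dist x y" "\<forall>x\<in>S. \<forall>y\<in>S. \<bar>g x - g y\<bar> <= L' * dist x y"
  by blast
 then have "\<bar>(f x + g x) - (f y + g y)\<bar> <= (L + L') * dist x y" if "x \<in> S" "y \<in> S" for x y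
  using that abs_triangle_ineq[of "f x - f y" "g x - g y"] by (force simp: algebra_simps)
 then show ?case by blast
next
 case (mult f g)
 then obtain L L' where L: "!!x y. x \<in> S ==> y \<in> S ==> \<bar>f x - f y\<bar> <= L * dist x y"
  "!!x y. x \<in> S ==> y \<in> S ==> \<bar>g x - g y\<bar> <= L' * dist x y" by blast
 have bd: "\<exists>B\<ge>0. \<forall>x\<in>S. \<bar>h x\<bar> <= B" if "real_polynomial_function h" for h :: "'a => real"
 proof -
  have "continuous_on S h"
   using that by (simp add: continuous_on_polymonial_function real_polynomial_function_eq)
  then have "bounded (h ` S)" using assms(2) compact_continuous_image compact_imp_bounded by blast
  then show ?thesis by (auto simp: bounded_pos intro: less_imp_le)
 qed
 obtain B B' where B: "0 <= B" "!!x. x \<in> S ==> \<bar>f x\<bar> <= B" "0 <= B'" "!!x. x \<in> S ==> \<bar>g x\<bar> <= B'"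
  using bd[OF mult.hyps(1)] bd[OF mult.hyps(2)] by blast
 have "\<bar>f x * g x - f y * g y\<bar> <= (B * L' + L * B') * dist x y" if "x \<in> S" "y \<in> S" for x y
 proof -
  have "f x * g x - f y * g y = f x * (g x - g y) + (f x - f y) * g y" by (simp add: algebra_simps)
  then have "\<bar>f x * g x - f y * g y\<bar> <= \<bar>f x\<bar> * \<bar>g x - g y\<bar> + \<bar>f x - f y\<bar> * \<bar>g y\<bar>"
   by (metis abs_mult abs_triangle_ineq)
  also have "... <= B * (L' * dist x y) + (L * dist x y) * B'"
   using B that L(1)[OF that] L(2)[OF that] order_trans[OF abs_ge_zero L(1)[OF that]]
   by (intro add_mono mult_mono) auto
  finally show ?thesis by (simp add: algebra_simps)
 qed
 then show ?case by blast
qed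

text \<open>The indicator of a closed set is the limit of \<open>1 - n * infdist\<close> cut off at
  0, and traces of closed sets form an intersection-stable generator.\<close>

lemma measure_eqI_continuous:
 fixes S :: "'a::metric_space set"
 assumes P: "prob_space M" "prob_space N"
  and sets: "sets M = sets (restrict_space borel S)" "sets N = sets (restrict_space borel S)"
  and eq: "!!f :: 'a => real. continuous_on S f ==> (\<integral>x. f x \<partial>M) = (\<integral>x. f x \<partial>N)"
  and S: "S \<in> sets borel"
 shows "M = N"
proof -
 interpret M: prob_space M by fact
 interpret N: prob_space N by fact
 have space: "space M = S" "space N = S"
  using sets_eq_imp_space_eq[OF sets(1)] sets_eq_imp_space_eq[OF sets(2)] by (simp_all add: space_restrict_space)
 let ?E = "(\<inter>) S ` {F. closed F}"
 have sig: "sets (restrict_space borel S) = sigma_sets S ?E"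
 proof -
  have b: "sets borel = sigma_sets UNIV {F::'a set. closed F}"
   unfolding borel_eq_closed by (simp add: sets_measure_of_conv)
  have "sets (restrict_space borel S) = (\<inter>) S ` sigma_sets UNIV {F. closed F}"
   unfolding sets_restrict_space b ..
  also have "... = sigma_sets S ?E" using S unfolding b by (intro sigma_sets_Int) auto
  finally show ?thesis .
 qed
 have meas: "measure M (S \<inter> F) = measure N (S \<inter> F)" if F: "closed F" for F
 proof (cases "F = {}")
  case False
  define f where "f n x = max 0 (1 - real n * infdist x F)" for n x
  have fc: "continuous_on S (f n)" for n unfolding f_def by (intro continuous_intros)
  have f01: "\<bar>f n x\<bar> <= 1" for n x unfolding f_def using infdist_nonneg[of x F] by auto
  have lim: "(%n. f n x) \<longlonglongrightarrow> indicator (S \<inter> F) x" if "x \<in> S" for x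
  proof (cases "x \<in> F")
   case True
   then show ?thesis using that by (simp add: f_def)
  next
   case out: False
   then have pos: "0 < infdist x F" using in_closed_iff_infdist_zero[OF F False] infdist_nonneg[of x F] by (auto simp: less_le)
   then obtain m where m: "1 < real m * infdist x F" using reals_Archimedean3 by blast
   have "eventually (%n. f n x = 0) sequentially"
    using eventually_ge_at_top[of m]
   proof eventually_elim
    case (elim n)
    then have "real m * infdist x F <= real n * infdist x F" using pos by (intro mult_right_mono) auto
    then show ?case using m by (simp add: f_def)
   qed
   then show ?thesis using out that by (simp add: tendsto_eventually)
  qed
  have conv: "(%n. \<integral>x. f n x \<partial>Q) \<longlonglongrightarrow> measure Q (S \<inter> F)"
   if Q: "prob_space Q" "sets Q = sets (restrict_space borel S)" "space Q = S" for Q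
  proof -
   interpret Q: prob_space Q by fact
   have m: "f n \<in> borel_measurable Q" for n
    using borel_measurable_continuous_on_restrict[OF fc[of n]] by (simp add: measurable_cong_sets[OF Q(2) refl])
   have SF: "S \<inter> F \<in> sets Q" unfolding Q(2) sets_restrict_space using F by (auto intro: borel_closed)
   have "(%n. \<integral>x. f n x \<partial>Q) \<longlonglongrightarrow> (\<integral>x. indicator (S \<inter> F) x \<partial>Q)"
   proof (rule integral_dominated_convergence[where w="%_. 1"])
    show "AE x in Q. (%n. f n x) \<longlonglongrightarrow> indicator (S \<inter> F) x" using lim by (intro AE_I2) (simp add: Q(3))
    show "(indicator (S \<inter> F) :: _ => real) \<in> borel_measurable Q" using SF by simp
   qed (use m f01 in auto)
   then show ?thesis using SF sets.sets_into_space[OF SF] by (simp add: Int_absorb1 Int_absorb2)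
  qed
  have "(%n. \<integral>x. f n x \<partial>M) \<longlonglongrightarrow> measure N (S \<inter> F)"
   using conv[OF P(2) sets(2) space(2)] eq[OF fc] by simp
  then show ?thesis using conv[OF P(1) sets(1) space(1)] LIMSEQ_unique by blast
 qed simp
 show ?thesis
 proof (rule measure_eqI_generator_eq[of ?E S M N "%_. S"])
  show "Int_stable ?E"
  proof (rule Int_stableI)
   fix a b assume "a \<in> ?E" "b \<in> ?E"
   then obtain F G where "closed F" "closed G" "a = S \<inter> F" "b = S \<inter> G" by auto
   then have "a \<inter> b = S \<inter> (F \<inter> G)" "closed (F \<inter> G)" by auto
   then show "a \<inter> b \<in> ?E" by blast
  qed
  show "range (%_. S) \<subseteq> ?E" using image_eqI[of S "(\<inter>) S" UNIV] by auto
 qed (use sets sig meas in \<open>auto simp: M.emeasure_eq_measure N.emeasure_eq_measure\<close>)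
qed

lemma borel_measurable_extend_0:
 fixes f :: "real ^ 'n => 'b::real_normed_vector"
 assumes "continuous_on \<S> f"
 shows "(%v. if v \<in> \<S> then f v else 0) \<in> borel_measurable borel"
 using assms by (intro borel_measurable_continuous_on_if) auto

lemma simplex_bounded:
 fixes f :: "real ^ 'n => 'b::real_normed_vector"
 assumes "continuous_on \<S> f"
 obtains B where "0 <= B" "!!v. v \<in> \<S> ==> norm (f v) <= B"
 using compact_imp_bounded[OF compact_continuous_image[OF assms compact_simplex]]
 by (auto simp: bounded_pos intro: less_imp_le)

section \<open>The eigenmeasure as a limit of ratios of iterates\<close>

context matrix_law
begin

definition hom :: "(real ^ 'n => real) => real ^ 'n => real" where
 "hom f x = (if x \<in> pcone then l1norm x powr s * f (x /\<^sub>R l1norm x) else 0)"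

lemma hom_S: "v \<in> \<S> ==> hom f v = f v"
 using simplex_cone[of v] simplex_D(4)[of v] by (simp add: hom_def)

lemma hom_hcls: assumes "continuous_on \<S> f" shows "hcls (hom f)"
proof -
 have [measurable]: "(%v. if v \<in> \<S> then f v else 0) \<in> borel_measurable borel"
  by (rule borel_measurable_extend_0[OF assms])
 have "(%x. if x \<in> pcone then l1norm x powr s * (%v. if v \<in> \<S> then f v else 0) (x /\<^sub>R l1norm x) else 0) \<in> borel_measurable borel"
  by measurable
 also have "(%x. if x \<in> pcone then l1norm x powr s * (%v. if v \<in> \<S> then f v else 0) (x /\<^sub>R l1norm x) else 0) = hom f"
  using cone_normalize by (auto simp: hom_def fun_eq_iff)
 finally have m: "hom f \<in> borel_measurable borel" .
 have h: "hom f (t *\<^sub>R x) = t powr s * hom f x" if "x \<in> pcone" "0 < t" for x t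
 proof -
  have "(t *\<^sub>R x) /\<^sub>R l1norm (t *\<^sub>R x) = x /\<^sub>R l1norm x" using that by (simp add: l1norm_scaleR)
  then have "hom f (t *\<^sub>R x) = l1norm (t *\<^sub>R x) powr s * f (x /\<^sub>R l1norm x)"
   using cone_scale[OF that] by (simp only: hom_def if_True)
  then show ?thesis using that by (simp add: hom_def l1norm_scaleR powr_mult l1norm_ge_0)
 qed
 obtain B where "!!v. v \<in> \<S> ==> norm (f v) <= B" using simplex_bounded[OF assms] by blast
 then show ?thesis unfolding hcls_def homog_def using m h hom_S by auto
qed

lemma homog_hom: "homog F ==> x \<in> pcone ==> hom F x = F x"
 using homog_normalize[of F x] by (simp add: hom_def)

definition N where "N = hom (%_. 1)"

lemma N_cone: "x \<in> pcone ==> N x = l1norm x powr s" by (simp add: N_def hom_def)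
lemma N_S: "v \<in> \<S> ==> N v = 1" by (simp add: N_def hom_S)

lemma N_cls: "cls N"
proof -
 have h: "hcls N" unfolding N_def by (intro hom_hcls continuous_intros)
 have "ca a b * N y <= N x" if xy: "x \<in> pcone" "y \<in> pcone" and ab: "0 < a" "0 < b"
  and le: "\<forall>i. a * y $ i <= x $ i" "\<forall>i. b * x $ i <= y $ i" for x y a b
 proof -
  have nn: "nonneg_vec x" "nonneg_vec y" using xy by (auto simp: pcone_def)
  have 1: "a * l1norm y <= l1norm x" "b * l1norm x <= l1norm y"
   unfolding l1norm_nonneg_vec[OF nn(1)] l1norm_nonneg_vec[OF nn(2)] using le
   by (auto simp: sum_distrib_left intro!: sum_mono)
  have p: "0 < l1norm x" "0 < l1norm y" using cone_l1norm xy by auto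
  show ?thesis
  proof (cases "0 < s")
   case True
   have "(a * l1norm y) powr s <= l1norm x powr s" using 1 True ab p by (intro powr_mono2) auto
   then show ?thesis using True ab p xy by (simp add: N_cone ca_def powr_mult)
  next
   case False
   have "l1norm y powr s <= (b * l1norm x) powr s" using 1 False ab p by (intro powr_mono2') auto
   then have "b powr - s * l1norm y powr s <= b powr - s * (b powr s * l1norm x powr s)"
    using ab p by (intro mult_left_mono) (auto simp: powr_mult)
   also have "... = l1norm x powr s" using ab by (simp add: powr_add[symmetric] mult.assoc[symmetric])
   finally show ?thesis using False xy by (simp add: N_cone ca_def)
  qed
 qed
 moreover have "0 < N x" if "x \<in> pcone" for x using cone_l1norm[OF that] that by (simp add: N_cone)
 ultimately show ?thesis unfolding cls_def using hcls_homog[OF h] N_S by auto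
qed

lemma N_hcls: "hcls N" by (rule cls_hcls[OF N_cls])

lemma A_continuous:
 assumes "hcls \<Phi>" "continuous_on \<S> \<Phi>"
 shows "continuous_on \<S> (A \<Phi>)"
proof -
 obtain B where B: "0 <= B" "AE g in M. \<forall>x\<in>pcone. \<bar>\<Phi> (g *v x)\<bar> <= B * l1norm x powr s * mnorm g powr s"
  using hcls_AE_bound[OF assms(1)] by blast
 show ?thesis unfolding A_def[abs_def]
 proof (rule continuous_on_integral[OF homog_M[OF hcls_homog[OF assms(1)]] integrable_mult_right[OF int_s, of B]])
  show "AE g in M. continuous_on \<S> (%x. \<Phi> (g *v x)) & (\<forall>x\<in>\<S>. norm (\<Phi> (g *v x)) <= B * mnorm g powr s)"
   using good_AE B(2)
  proof eventually_elim
   case (elim g)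
   have pg: "pos_mat g" by (rule good_pos[OF elim(1)])
   have "continuous_on \<S> (%v. l1norm (g *v v) powr s * \<Phi> (act g v))"
   proof (intro continuous_intros continuous_on_compose2[OF assms(2)])
    show "continuous_on \<S> (act g)" unfolding act_def
     using pos_mat_act(3)[OF pg] by (intro continuous_intros) force
    show "act g ` \<S> \<subseteq> \<S>" using pos_mat_act(1)[OF pg] by auto
    show "\<forall>v\<in>\<S>. l1norm (g *v v) ~= 0" using pos_mat_act(3)[OF pg] by force
   qed
   then have "continuous_on \<S> (%x. \<Phi> (g *v x))"
    by (rule continuous_on_eq) (simp add: homog_act[OF hcls_homog[OF assms(1)] pg] simplex_cone)
   moreover have "norm (\<Phi> (g *v x)) <= B * mnorm g powr s" if "x \<in> \<S>" for x
    using elim(2) simplex_cone[OF that] simplex_D(4)[OF that] by force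
   ultimately show ?case by blast
  qed
 qed
qed

lemma hom_continuous: "continuous_on \<S> f ==> continuous_on \<S> (hom f)"
 by (rule continuous_on_eq) (auto simp: hom_S)

lemma Apow_continuous: "hcls \<Phi> ==> continuous_on \<S> \<Phi> ==> continuous_on \<S> ((A ^^ n) \<Phi>)"
 by (induction n) (auto intro: A_continuous Apow_hcls)

lemma Apow_nonneg: "hcls \<Phi> ==> (!!x. x \<in> pcone ==> 0 <= \<Phi> x) ==> x \<in> pcone ==> 0 <= (A ^^ n) \<Phi> x"
proof -
 assume \<Phi>: "hcls \<Phi>" "!!x. x \<in> pcone ==> 0 <= \<Phi> x" and x: "x \<in> pcone"
 have "0 <= (A ^^ n) \<Phi> x + (A ^^ n) \<Phi> x"
  by (rule mono_pow[OF \<Phi>(1) \<Phi>(1) x x]) (use \<Phi>(2) gp_props(1)[OF _ x] in \<open>auto intro: add_nonneg_nonneg\<close>)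
 then show ?thesis by simp
qed

text \<open>The quotient cancels the still unknown eigenvalue; its uniform limit in \<open>v\<close>
  will be the integral of \<open>f\<close> against the eigenmeasure.\<close>

definition \<psi> where "\<psi> n f v = (A ^^ n) (hom f) v / (A ^^ n) N v"

lemma AN_pos: "x \<in> pcone ==> 0 < (A ^^ n) N x" by (rule clsD(1)[OF Apow_cls[OF N_cls]])

text \<open>Since \<open>A\<close> preserves inequalities, the range of a ratio can only shrink
  under iteration. A small oscillation at one time therefore controls all later times.\<close>

lemma ratio_bounds:
 assumes F: "cls F" and \<Phi>: "hcls \<Phi>" and b: "!!x. x \<in> \<S> ==> a <= \<Phi> x / F x & \<Phi> x / F x <= b" and v: "v \<in> pcone"
 shows "a <= (A ^^ n) \<Phi> v / (A ^^ n) F v" "(A ^^ n) \<Phi> v / (A ^^ n) F v <= b"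
proof -
 have Fh: "hcls F" by (rule cls_hcls[OF F])
 have r: "\<Phi> x / F x = \<Phi> (x /\<^sub>R l1norm x) / F (x /\<^sub>R l1norm x)" if "x \<in> pcone" for x
  using homog_normalize[OF hcls_homog[OF \<Phi>] that] homog_normalize[OF hcls_homog[OF Fh] that] cone_l1norm[OF that] by simp
 have bc: "a * F x <= \<Phi> x & \<Phi> x <= b * F x" if "x \<in> pcone" for x
  using b[OF cone_normalize[OF that]] clsD(1)[OF F that] unfolding r[OF that, symmetric] by (simp add: field_simps)
 have Z: "0 < (A ^^ n) F v" by (rule clsD(1)[OF Apow_cls[OF F] v])
 have "0 <= (A ^^ n) (%x. 1 * \<Phi> x + (-a) * F x) v" "0 <= (A ^^ n) (%x. (-1) * \<Phi> x + b * F x) v"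
  by (rule Apow_nonneg[OF hcls_lin[OF \<Phi> Fh] _ v], use bc in force)+
 then show "a <= (A ^^ n) \<Phi> v / (A ^^ n) F v" "(A ^^ n) \<Phi> v / (A ^^ n) F v <= b"
  unfolding Apow_lin[OF \<Phi> Fh v] using Z by (auto simp: field_simps)
qed

lemma \<psi>_nested:
 assumes f: "continuous_on \<S> f" and k: "k <= n" and b: "!!x. x \<in> \<S> ==> a <= \<psi> k f x & \<psi> k f x <= b" and v: "v \<in> \<S>"
 shows "a <= \<psi> n f v & \<psi> n f v <= b"
 using ratio_bounds[OF Apow_cls[OF N_cls, of k] Apow_hcls[OF hom_hcls[OF f], of k] b[unfolded \<psi>_def] simplex_cone[OF v], of "n - k"] k
 unfolding \<psi>_def by (simp add: funpow_add[symmetric] o_def flip: funpow_add) (metis comp_apply funpow_add le_add_diff_inverse2)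

lemma \<psi>_0: "v \<in> \<S> ==> \<psi> 0 f v = f v" by (simp add: \<psi>_def N_S hom_S)

lemma hom_lin: "hom (%x. a * f x + b * g x) = (%x. a * hom f x + b * hom g x)"
 by (auto simp: hom_def fun_eq_iff algebra_simps)

lemma \<psi>_lin: "continuous_on \<S> f ==> continuous_on \<S> g ==> v \<in> \<S> ==>
  \<psi> n (%x. a * f x + b * g x) v = a * \<psi> n f v + b * \<psi> n g v"
 unfolding \<psi>_def hom_lin by (simp add: Apow_lin hom_hcls simplex_cone add_divide_distrib)

lemma reg_holder:
 assumes "!!x y. x \<in> \<S> ==> y \<in> \<S> ==> \<bar>\<xi> x - \<xi> y\<bar> <= h * d_hilbert x y powr \<gamma>" "0 <= h" "0 <= \<gamma>"
 shows "reg \<gamma> (2 * h) h \<xi>"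
 unfolding reg_def
proof (intro conjI ballI assms(1))
 have "\<bar>\<xi> x - \<xi> center\<bar> <= h" if "x \<in> \<S>" for x
 proof -
  have "d_hilbert x center powr \<gamma> <= 1"
   using d_hilbert_bounds[OF that center_simplex] assms(3) by (intro powr_le1) auto
  then show ?thesis using assms(1)[OF that center_simplex] mult_left_mono[of _ 1 h] assms(2) by fastforce
 qed
 then show "\<exists>a. \<forall>x\<in>K. a <= \<xi> x & \<xi> x <= a + 2 * h"
  using K_sub by (intro exI[of _ "\<xi> center - h"]) (force simp: abs_le_iff)
qed auto

text \<open>\<open>decay\<close> requires Hoelder continuity, so \<open>f\<close> is replaced by a
  polynomial, which is Lipschitz also for \<open>d_hilbert\<close>. By \<open>\<psi>_nested\<close>
  the uniform error of this approximation does not grow under iteration.\<close>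

lemma osc_to_0:
 assumes f: "continuous_on \<S> f" and e: "0 < e"
 shows "\<exists>n. \<forall>u\<in>\<S>. \<forall>v\<in>\<S>. \<bar>\<psi> n f u - \<psi> n f v\<bar> <= e"
proof -
 obtain q where q: "real_polynomial_function q" "!!x. x \<in> \<S> ==> \<bar>f x - q x\<bar> < e / 3"
  using Stone_Weierstrass_real_polynomial_function[OF compact_simplex f, of "e / 3"] e by auto
 have qc: "continuous_on \<S> q"
  using q(1) by (simp add: continuous_on_polymonial_function real_polynomial_function_eq)
 obtain L where L: "!!x y. x \<in> \<S> ==> y \<in> \<S> ==> \<bar>q x - q y\<bar> <= L * dist x y"
  using real_polynomial_function_lipschitz[OF q(1) compact_simplex] by blast
 define h where "h = \<bar>L\<bar> * (2 * real CARD('n))"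
 have h: "\<bar>hom q x / N x - hom q y / N y\<bar> <= h * d_hilbert x y powr 1" if "x \<in> \<S>" "y \<in> \<S>" for x y
 proof -
  have "\<bar>q x - q y\<bar> <= \<bar>L\<bar> * dist x y" using L[OF that] by (rule order_trans) (intro mult_right_mono, auto)
  also have "... <= \<bar>L\<bar> * (2 * real CARD('n) * d_hilbert x y)" by (intro mult_left_mono dist_le_d_hilbert that) auto
  finally show ?thesis using that d_hilbert_bounds(1)[OF that] by (simp add: hom_S N_S h_def mult_ac)
 qed
 have h0: "0 <= h" by (simp add: h_def)
 obtain \<theta> C3 where \<theta>: "0 < \<theta>" "\<theta> < 1" and dec': "\<forall>F \<Phi> os h n u v. cls F --> hcls \<Phi> --> 0 <= os --> 0 <= h -->
   reg 1 os h (%x. \<Phi> x / F x) --> u \<in> \<S> --> v \<in> \<S> -->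
   \<bar>(A ^^ n) \<Phi> u / (A ^^ n) F u - (A ^^ n) \<Phi> v / (A ^^ n) F v\<bar> <= C3 * \<theta> ^ n * (os + h) * d_hilbert u v powr 1"
  using decay[OF zero_less_one order_refl] by (elim exE conjE) (rule that)
 have dec: "!!F \<Phi> os h n u v. cls F ==> hcls \<Phi> ==> 0 <= os ==> 0 <= h ==>
   reg 1 os h (%x. \<Phi> x / F x) ==> u \<in> \<S> ==> v \<in> \<S> ==>
   \<bar>(A ^^ n) \<Phi> u / (A ^^ n) F u - (A ^^ n) \<Phi> v / (A ^^ n) F v\<bar> <= C3 * \<theta> ^ n * (os + h) * d_hilbert u v powr 1"
  using dec' by blast
 have r: "reg 1 (2 * h) h (%x. hom q x / N x)" by (rule reg_holder[OF h h0]) auto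
 have "(%n. C3 * \<theta> ^ n * (2 * h + h)) \<longlonglongrightarrow> C3 * 0 * (2 * h + h)"
  using \<theta> by (intro tendsto_intros LIMSEQ_power_zero) auto
 then have "\<forall>\<^sub>F n in sequentially. \<bar>C3 * \<theta> ^ n * (2 * h + h)\<bar> < e / 3"
  using e tendsto_rabs_zero[of "%n. C3 * \<theta> ^ n * (2 * h + h)"] by (intro order_tendstoD(2)) auto
 then obtain n where n: "\<bar>C3 * \<theta> ^ n * (2 * h + h)\<bar> < e / 3" by (auto simp: eventually_sequentially)
 have "\<bar>\<psi> n f u - \<psi> n f v\<bar> <= e" if uv: "u \<in> \<S>" "v \<in> \<S>" for u v
 proof -
  have "\<bar>\<psi> n q u - \<psi> n q v\<bar> <= C3 * \<theta> ^ n * (2 * h + h) * d_hilbert u v powr 1"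
   unfolding \<psi>_def using dec[OF N_cls hom_hcls[OF qc] _ h0 r uv] h0 by simp
  also have "... <= \<bar>C3 * \<theta> ^ n * (2 * h + h)\<bar> * 1"
   using d_hilbert_bounds[OF uv] by (intro mult_mono) auto
  finally have 1: "\<bar>\<psi> n q u - \<psi> n q v\<bar> <= e / 3" using n by simp
  have 2: "\<bar>\<psi> n f w - \<psi> n q w\<bar> <= e / 3" if w: "w \<in> \<S>" for w
  proof -
   have "- (e / 3) <= \<psi> n (%x. 1 * f x + (-1) * q x) w & \<psi> n (%x. 1 * f x + (-1) * q x) w <= e / 3"
   proof (rule \<psi>_nested[of _ 0])
    show "- (e / 3) <= \<psi> 0 (%x. 1 * f x + (-1) * q x) x & \<psi> 0 (%x. 1 * f x + (-1) * q x) x <= e / 3" if "x \<in> \<S>" for x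
     using q(2)[OF that] unfolding \<psi>_0[OF that] abs_less_iff by linarith
   qed (use f qc w in \<open>auto intro!: continuous_intros\<close>)
   then show ?thesis unfolding \<psi>_lin[OF f qc w] abs_le_iff by linarith
  qed
  show ?thesis using 1 2[OF uv(1)] 2[OF uv(2)] by linarith
 qed
 then show ?thesis by blast
qed

definition L where "L f = lim (%n. \<psi> n f center)"

lemma \<psi>_near:
 assumes f: "continuous_on \<S> f" and e: "0 < e"
 shows "\<exists>k. \<forall>n\<ge>k. \<forall>v\<in>\<S>. \<bar>\<psi> n f v - L f\<bar> <= e"
proof -
 have ex: "\<exists>k. \<forall>n\<ge>k. \<forall>v\<in>\<S>. \<bar>\<psi> n f v - \<psi> k f center\<bar> <= e" if e: "0 < e" for e
 proof -
  obtain k where k: "\<forall>u\<in>\<S>. \<forall>v\<in>\<S>. \<bar>\<psi> k f u - \<psi> k f v\<bar> <= e" using osc_to_0[OF f e] by blast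
  have "\<psi> k f center - e <= \<psi> n f v & \<psi> n f v <= \<psi> k f center + e" if "k <= n" "v \<in> \<S>" for n v
   by (rule \<psi>_nested[OF f that(1) _ that(2)]) (use k center_simplex in \<open>fastforce simp: abs_le_iff\<close>)
  then show ?thesis by (intro exI[of _ k]) (force simp: abs_le_iff)
 qed
 have "Cauchy (%n. \<psi> n f center)"
 proof (rule metric_CauchyI)
  fix e :: real assume "0 < e"
  then obtain k where k: "\<forall>n\<ge>k. \<forall>v\<in>\<S>. \<bar>\<psi> n f v - \<psi> k f center\<bar> <= e / 3" using ex[of "e/3"] by auto
  have "dist (\<psi> m f center) (\<psi> n f center) < e" if "m >= k" "n >= k" for m n
  proof -
   have "\<bar>\<psi> m f center - \<psi> k f center\<bar> <= e / 3" "\<bar>\<psi> n f center - \<psi> k f center\<bar> <= e / 3"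
    using k that center_simplex by auto
   then show ?thesis using \<open>0 < e\<close> unfolding dist_real_def by linarith
  qed
  then show "\<exists>M. \<forall>m\<ge>M. \<forall>n\<ge>M. dist (\<psi> m f center) (\<psi> n f center) < e" by blast
 qed
 then have lim: "(%n. \<psi> n f center) \<longlonglongrightarrow> L f" by (simp add: L_def Cauchy_convergent_iff convergent_LIMSEQ_iff)
 obtain k where k: "\<forall>n\<ge>k. \<forall>v\<in>\<S>. \<bar>\<psi> n f v - \<psi> k f center\<bar> <= e / 2" using ex[of "e/2"] e by auto
 have "\<bar>L f - \<psi> k f center\<bar> <= e / 2"
  by (rule LIMSEQ_le_const2[OF tendsto_rabs[OF tendsto_diff[OF lim tendsto_const]]])
   (use k center_simplex in blast)
 then have "\<bar>\<psi> n f v - L f\<bar> <= e" if "k <= n" "v \<in> \<S>" for n v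
 proof -
  have "\<bar>\<psi> n f v - \<psi> k f center\<bar> <= e / 2" using k that by blast
  then show ?thesis using \<open>\<bar>L f - \<psi> k f center\<bar> <= e / 2\<close> by linarith
 qed
 then show ?thesis by blast
qed

lemma \<psi>_lim: "continuous_on \<S> f ==> v \<in> \<S> ==> (%n. \<psi> n f v) \<longlonglongrightarrow> L f"
proof (rule LIMSEQ_I)
 fix r :: real assume f: "continuous_on \<S> f" and v: "v \<in> \<S>" and r: "0 < r"
 then obtain k where "\<forall>n\<ge>k. \<bar>\<psi> n f v - L f\<bar> <= r / 2" using \<psi>_near[OF f, of "r/2"] by auto
 then show "\<exists>no. \<forall>n\<ge>no. norm (\<psi> n f v - L f) < r" using r by (intro exI[of _ k]) fastforce
qed

lemma L_positive_functional: "positive_functional \<S> L"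
proof
 note c = center_simplex
 show "compact (\<S> :: (real ^ 'n) set)" by (rule compact_simplex)
 show "L (%x. f x + g x) = L f + L g" if f: "continuous_on \<S> f" and g: "continuous_on \<S> g" for f g
 proof -
  have "continuous_on \<S> (%x. f x + g x)" by (intro continuous_intros f g)
  then have "(%n. \<psi> n (%x. f x + g x) center) \<longlonglongrightarrow> L (%x. f x + g x)" using \<psi>_lim c by blast
  moreover have "\<psi> n (%x. f x + g x) center = \<psi> n f center + \<psi> n g center" for n
   using \<psi>_lin[OF f g c, of n 1 1] by simp
  ultimately show ?thesis using tendsto_add[OF \<psi>_lim[OF f c] \<psi>_lim[OF g c]] LIMSEQ_unique by auto
 qed
 show "L (%x. a * f x) = a * L f" if f: "continuous_on \<S> f" for a f
 proof -
  have "continuous_on \<S> (%x. a * f x)" by (intro continuous_intros f)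
  then have "(%n. \<psi> n (%x. a * f x) center) \<longlonglongrightarrow> L (%x. a * f x)" using \<psi>_lim c by blast
  moreover have "\<psi> n (%x. a * f x) center = a * \<psi> n f center" for n
   using \<psi>_lin[OF f f c, of n a 0] by simp
  ultimately have "(%n. a * \<psi> n f center) \<longlonglongrightarrow> L (%x. a * f x)" by simp
  then show ?thesis by (rule LIMSEQ_unique[OF _ tendsto_mult_left[OF \<psi>_lim[OF f c]]])
 qed
 show "0 <= L f" if f: "continuous_on \<S> f" and pos: "!!x. x \<in> \<S> ==> 0 <= f x" for f
 proof -
  obtain B where B: "!!v. v \<in> \<S> ==> norm (f v) <= B" using simplex_bounded[OF f] by blast
  have "0 <= \<psi> n f center" for n
   using \<psi>_nested[OF f _ _ c, of 0 n 0 B] pos B by (force simp: \<psi>_0)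
  then show ?thesis by (intro LIMSEQ_le_const[OF \<psi>_lim[OF f c]]) auto
 qed
 have "\<psi> n (%x. 1) center = 1" for n
  unfolding \<psi>_def N_def[symmetric] using AN_pos[OF simplex_cone[OF c], of n] by simp
 then show "L (%x. 1) = 1" using \<psi>_lim[OF continuous_on_const c, of 1] by (simp add: LIMSEQ_const_iff)
qed

definition k where "k = L (A N)"

lemma A_hom_continuous: "continuous_on \<S> f ==> continuous_on \<S> (A (hom f))"
 by (intro A_continuous hom_hcls hom_continuous)

lemma AN_continuous: "continuous_on \<S> ((A ^^ n) N)"
 unfolding N_def by (intro Apow_continuous hom_hcls hom_continuous continuous_intros)

lemma Apow_hom_A: "hcls \<Phi> ==> continuous_on \<S> (A \<Phi>) ==> x \<in> pcone ==> (A ^^ n) (hom (A \<Phi>)) x = (A ^^ Suc n) \<Phi> x"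
 unfolding funpow_Suc_right o_def by (intro Apow_cong hom_hcls A_hcls homog_hom hcls_homog)

lemma AN_ratio: "v \<in> \<S> ==> (%n. (A ^^ Suc n) N v / (A ^^ n) N v) \<longlonglongrightarrow> k"
proof -
 assume v: "v \<in> \<S>"
 have c: "continuous_on \<S> (A N)" using AN_continuous[of 1] by simp
 have "\<psi> n (A N) v = (A ^^ Suc n) N v / (A ^^ n) N v" for n
  unfolding \<psi>_def using Apow_hom_A[OF N_hcls c simplex_cone[OF v]] by simp
 then show ?thesis using \<psi>_lim[OF c v] by (simp add: k_def)
qed

text \<open>\<open>\<psi> n (A (hom f))\<close> is \<open>\<psi> (Suc n) f\<close> times the ratio
  of consecutive iterates of \<open>N\<close>, and that ratio tends to \<open>k\<close>.\<close>

lemma L_eigen: assumes f: "continuous_on \<S> f" shows "L (A (hom f)) = k * L f"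
proof -
 note c = center_simplex
 have "\<psi> n (A (hom f)) center = \<psi> (Suc n) f center * ((A ^^ Suc n) N center / (A ^^ n) N center)" for n
  unfolding \<psi>_def using Apow_hom_A[OF hom_hcls[OF f] A_hom_continuous[OF f] simplex_cone[OF c]]
   AN_pos[OF simplex_cone[OF c], of "Suc n"] by (simp del: funpow.simps)
 then have "(%n. \<psi> n (A (hom f)) center) \<longlonglongrightarrow> L f * k"
  using tendsto_mult[OF LIMSEQ_Suc[OF \<psi>_lim[OF f c]] AN_ratio[OF c]] by simp
 then show ?thesis using \<psi>_lim[OF A_hom_continuous[OF f] c] LIMSEQ_unique by (simp add: mult.commute)
qed

lemma positive_min:
 assumes "continuous_on \<S> f" "!!v. v \<in> \<S> ==> (0::real) < f v"
 obtains \<delta> where "0 < \<delta>" "!!v. v \<in> \<S> ==> \<delta> <= f v"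
 using continuous_attains_inf[OF compact_simplex _ assms(1)] center_simplex assms(2) by blast

lemma k_pos: "0 < k"
proof -
 interpret pf: positive_functional \<S> L by (rule L_positive_functional)
 have c: "continuous_on \<S> (A N)" using AN_continuous[of 1] by simp
 obtain \<delta> where \<delta>: "0 < \<delta>" "!!v. v \<in> \<S> ==> \<delta> <= A N v"
  using positive_min[OF c] AN_pos[of _ 1] simplex_cone by auto
 have "L (%v. \<delta> * 1) <= k" unfolding k_def by (rule pf.L_mono) (use \<delta> c in \<open>auto intro: continuous_intros\<close>)
 then show ?thesis using pf.L_scale[of "%_. 1" \<delta>] pf.L_one \<delta>(1) by simp
qed

definition \<nu> where "\<nu> = positive_functional.rep \<S> L"

lemma prob_\<nu>: "prob_space \<nu>" and sets_\<nu>: "sets \<nu> = sets (restrict_space borel \<S>)"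
 and space_\<nu>: "space \<nu> = \<S>"
 and integral_\<nu>: "continuous_on \<S> f ==> (\<integral>v. f v \<partial>\<nu>) = L f"
 using positive_functional.prob_space_rep[OF L_positive_functional] positive_functional.sets_rep[OF L_positive_functional]
  positive_functional.space_rep[OF L_positive_functional] positive_functional.integral_rep[OF L_positive_functional]
 by (auto simp: \<nu>_def)

lemma Apow_hom_cong: "continuous_on \<S> f ==> x \<in> pcone ==> (A ^^ Suc n) (hom f) x = (A ^^ n) (hom (A (hom f))) x"
 using Apow_hom_A[OF hom_hcls A_hom_continuous] by metis

text \<open>Integrate the uniform estimate \<open>\<bar>(A ^^ n) (hom f) - L f * (A ^^ n) N\<bar> <=
  e * (A ^^ n) N\<close> against \<open>\<nu>'\<close>: every term carries the factor
  \<open>k' ^ n\<close>, which is positive and cancels. Eigenvalue and measure are thus determined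
  together.\<close>

lemma eigen_unique:
 assumes P: "prob_space \<nu>'" and sets: "sets \<nu>' = sets (restrict_space borel \<S>)"
  and eig: "!!f. continuous_on \<S> f ==> (\<integral>v. A (hom f) v \<partial>\<nu>') = k' * (\<integral>v. f v \<partial>\<nu>')"
 shows "\<nu>' = \<nu>" "k' = k"
proof -
 interpret nu: prob_space \<nu>' by fact
 have sp: "space \<nu>' = \<S>" using sets_eq_imp_space_eq[OF sets] by (simp add: space_restrict_space)
 have int: "integrable \<nu>' f" if f: "continuous_on \<S> f" for f :: "real ^ 'n => real"
 proof -
  obtain B where "!!v. v \<in> \<S> ==> norm (f v) <= B" using simplex_bounded[OF f] by blast
  moreover have "f \<in> borel_measurable \<nu>'"
   using borel_measurable_continuous_on_restrict[OF f] by (simp add: measurable_cong_sets[OF sets refl])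
  ultimately show ?thesis by (intro nu.integrable_const_bound[of _ B] AE_I2) (auto simp: sp)
 qed
 have pow: "(\<integral>v. (A ^^ n) (hom f) v \<partial>\<nu>') = k' ^ n * (\<integral>v. f v \<partial>\<nu>')" if "continuous_on \<S> f" for n f
  using that
 proof (induction n arbitrary: f)
  case 0
  have "(\<integral>v. hom f v \<partial>\<nu>') = (\<integral>v. f v \<partial>\<nu>')"
   by (intro Bochner_Integration.integral_cong refl) (simp add: hom_S sp)
  then show ?case by simp
 next
  case (Suc n)
  have "(\<integral>v. (A ^^ Suc n) (hom f) v \<partial>\<nu>') = (\<integral>v. (A ^^ n) (hom (A (hom f))) v \<partial>\<nu>')"
   by (intro Bochner_Integration.integral_cong refl Apow_hom_cong Suc.prems) (simp add: sp simplex_cone)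
  then show ?case using Suc.IH[OF A_hom_continuous[OF Suc.prems]] eig[OF Suc.prems] by simp
 qed
 have N: "(\<integral>v. (A ^^ n) N v \<partial>\<nu>') = k' ^ n" for n
  using pow[OF continuous_on_const, of n 1] by (simp add: N_def nu.prob_space)
 have pos: "0 < k' ^ n" for n
 proof -
  obtain \<delta> where \<delta>: "0 < \<delta>" "!!v. v \<in> \<S> ==> \<delta> <= (A ^^ n) N v"
   using positive_min[OF AN_continuous[of n]] AN_pos[of _ n] simplex_cone by blast
  have "(\<integral>v. \<delta> \<partial>\<nu>') <= (\<integral>v. (A ^^ n) N v \<partial>\<nu>')"
   using \<delta>(2) by (intro integral_mono int AN_continuous continuous_intros) (auto simp: sp)
  then show ?thesis using \<delta>(1) N[of n] by (simp add: nu.prob_space)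
 qed
 have eqL: "(\<integral>v. f v \<partial>\<nu>') = L f" if f: "continuous_on \<S> f" for f
 proof (rule dense_eq0_I[of "(\<integral>v. f v \<partial>\<nu>') - L f", THEN eq_iff_diff_eq_0[THEN iffD2]])
  fix e :: real assume e: "0 < e"
  obtain n where n: "!!v. v \<in> \<S> ==> \<bar>\<psi> n f v - L f\<bar> <= e" using \<psi>_near[OF f e] by blast
  have "\<bar>k' ^ n * (\<integral>v. f v \<partial>\<nu>') - L f * k' ^ n\<bar> = \<bar>\<integral>v. (A ^^ n) (hom f) v - L f * (A ^^ n) N v \<partial>\<nu>'\<bar>"
   using pow[OF f, of n] N[of n] int[OF AN_continuous[of n]] int[OF Apow_continuous[OF hom_hcls[OF f] hom_continuous[OF f]], of n]
   by simp
  also have "... <= (\<integral>v. \<bar>(A ^^ n) (hom f) v - L f * (A ^^ n) N v\<bar> \<partial>\<nu>')" by (rule integral_abs_bound)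
  also have "... <= (\<integral>v. e * (A ^^ n) N v \<partial>\<nu>')"
  proof (rule integral_mono)
   fix v assume "v \<in> space \<nu>'"
   then have v: "v \<in> \<S>" by (simp add: sp)
   have Z: "0 < (A ^^ n) N v" by (rule AN_pos[OF simplex_cone[OF v]])
   have "(A ^^ n) (hom f) v - L f * (A ^^ n) N v = (\<psi> n f v - L f) * (A ^^ n) N v"
    unfolding \<psi>_def using Z by (simp add: left_diff_distrib)
   then show "\<bar>(A ^^ n) (hom f) v - L f * (A ^^ n) N v\<bar> <= e * (A ^^ n) N v"
    using n[OF v] Z by (simp add: abs_mult)
  qed (intro int continuous_intros AN_continuous Apow_continuous hom_hcls hom_continuous f)+
  also have "... = e * k' ^ n" using N[of n] by simp
  finally have "\<bar>((\<integral>v. f v \<partial>\<nu>') - L f) * k' ^ n\<bar> <= e * k' ^ n" by (simp add: algebra_simps)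
  then show "\<bar>(\<integral>v. f v \<partial>\<nu>') - L f\<bar> <= e" using pos[of n] by (simp add: abs_mult)
 qed
 show "\<nu>' = \<nu>"
  using eqL integral_\<nu> by (intro measure_eqI_continuous[OF P prob_\<nu> sets sets_\<nu>]) auto
 have "(\<integral>v. A N v \<partial>\<nu>') = k'" using N[of 1] by simp
 then show "k' = k" using eqL[of "A N"] AN_continuous[of 1] by (simp add: k_def)
qed

lemma integrable_\<nu>: "continuous_on \<S> f ==> integrable \<nu> f" for f :: "real ^ 'n => 'b::{banach, second_countable_topology}"
proof -
 assume f: "continuous_on \<S> f"
 interpret nu: prob_space \<nu> by (rule prob_\<nu>)
 obtain B where "!!v. v \<in> \<S> ==> norm (f v) <= B" using simplex_bounded[OF f] by blast
 moreover have "f \<in> borel_measurable \<nu>"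
  using borel_measurable_continuous_on_restrict[OF f] by (simp add: measurable_cong_sets[OF sets_\<nu> refl])
 ultimately show ?thesis by (intro nu.integrable_const_bound[of _ B] AE_I2) (auto simp: space_\<nu>)
qed

text \<open>The distance to \<open>K\<close> extends to a homogeneous function that \<open>A\<close>
  annihilates on the simplex, because images lie in \<open>K\<close>; as \<open>k > 0\<close>, the
  eigenvalue equation makes its integral 0.\<close>

lemma \<nu>_K: "AE u in \<nu>. u \<in> K"
proof -
 interpret nu: prob_space \<nu> by (rule prob_\<nu>)
 define f where "f v = infdist v K" for v
 have f: "continuous_on \<S> f" unfolding f_def by (intro continuous_intros)
 have "A (hom f) v = 0" if v: "v \<in> \<S>" for v
 proof -
  have "A (hom f) v = (\<integral>g. 0 \<partial>M)" unfolding A_def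
  proof (rule integral_cong_AE)
   show "AE g in M. hom f (g *v v) = 0"
    using good_AE
   proof eventually_elim
    case (elim g)
    have "f (act g v) = 0" unfolding f_def using good_K[OF elim v] by simp
    then show ?case using homog_act[OF hcls_homog[OF hom_hcls[OF f]] good_pos[OF elim] simplex_cone[OF v]]
      hom_S[OF pos_mat_act(1)[OF good_pos[OF elim] v]] by simp
   qed
  qed (use homog_M[OF hcls_homog[OF hom_hcls[OF f]]] in auto)
  then show ?thesis by simp
 qed
 then have "(\<integral>v. A (hom f) v \<partial>\<nu>) = (\<integral>v. 0 \<partial>\<nu>)"
  by (intro Bochner_Integration.integral_cong refl) (simp add: space_\<nu>)
 then have "L f = 0" using integral_\<nu>[OF A_hom_continuous[OF f]] L_eigen[OF f] k_pos by simp
 then have "(\<integral>v. f v \<partial>\<nu>) = 0" using integral_\<nu>[OF f] by simp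
 then have "AE v in \<nu>. f v = 0"
  using integrable_\<nu>[OF f] by (subst (asm) integral_nonneg_eq_0_iff_AE) (auto simp: f_def infdist_nonneg)
 then show ?thesis
  by eventually_elim (use in_closed_iff_infdist_zero[OF K_closed K_nonempty] in \<open>simp add: f_def\<close>)
qed

lemma integral_AN_\<nu>: "(\<integral>v. (A ^^ n) N v \<partial>\<nu>) = k ^ n"
proof (induction n)
 case 0
 interpret nu: prob_space \<nu> by (rule prob_\<nu>)
 have "(\<integral>v. N v \<partial>\<nu>) = (\<integral>v. 1 \<partial>\<nu>)"
  by (intro Bochner_Integration.integral_cong refl) (simp add: N_S space_\<nu>)
 then show ?case by (simp add: nu.prob_space)
next
 case (Suc n)
 have "(\<integral>v. (A ^^ Suc n) N v \<partial>\<nu>) = (\<integral>v. A (hom ((A ^^ n) N)) v \<partial>\<nu>)"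
  using homog_hom[OF hcls_homog[OF Apow_hcls[OF N_hcls]]]
  by (intro Bochner_Integration.integral_cong refl)
   (auto simp: space_\<nu> intro!: A_cong hcls_homog Apow_hcls N_hcls hom_hcls AN_continuous simplex_cone)
 then show ?case using integral_\<nu>[OF A_hom_continuous[OF AN_continuous]] L_eigen[OF AN_continuous, of n]
   integral_\<nu>[OF AN_continuous, of n] Suc by simp
qed

lemma AN_K_bounds:
 assumes u: "u \<in> K"
 shows "C powr - \<bar>s\<bar> * k ^ n <= (A ^^ n) N u" "C powr - \<bar>s\<bar> * (A ^^ n) N u <= k ^ n"
proof -
 interpret nu: prob_space \<nu> by (rule prob_\<nu>)
 have uS: "u \<in> \<S>" using u K_sub by auto
 have cmp: "C powr - \<bar>s\<bar> * (A ^^ n) N v <= (A ^^ n) N u" if "u \<in> K" "v \<in> K" for u v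
 proof (cases "n = 0")
  case True
  have "C powr - \<bar>s\<bar> <= 1" using C powr_mono[of "- \<bar>s\<bar>" 0 C] by simp
  then show ?thesis using True that K_sub by (auto simp: N_S subset_iff)
 next
  case False
  then show ?thesis using K_compare(2)[OF N_cls _ that, of n] by simp
 qed
 have "(\<integral>v. C powr - \<bar>s\<bar> * (A ^^ n) N v \<partial>\<nu>) <= (\<integral>v. (A ^^ n) N u \<partial>\<nu>)"
  using \<nu>_K by (intro integral_mono_AE integrable_mult_right integrable_\<nu> AN_continuous) (auto elim!: eventually_mono intro: cmp[OF u])
 then show "C powr - \<bar>s\<bar> * k ^ n <= (A ^^ n) N u" by (simp add: integral_AN_\<nu> nu.prob_space)
 have "(\<integral>v. C powr - \<bar>s\<bar> * (A ^^ n) N u \<partial>\<nu>) <= (\<integral>v. (A ^^ n) N v \<partial>\<nu>)"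
  using \<nu>_K by (intro integral_mono_AE integrable_\<nu> AN_continuous) (auto elim!: eventually_mono intro: cmp[OF _ u])
 then show "C powr - \<bar>s\<bar> * (A ^^ n) N u <= k ^ n" by (simp add: integral_AN_\<nu> nu.prob_space)
qed

text \<open>One matrix moves \<open>x\<close> into \<open>K\<close>, where the iterates of
  \<open>N\<close> are comparable with \<open>k ^ n\<close>, their mean under \<open>\<nu>\<close>.
  So for each fixed \<open>x\<close> the iterates have the exact order \<open>k ^ n\<close>, which
  settles the root limit.\<close>

lemma AN_bounds:
 assumes x: "x \<in> pcone"
 shows "C powr - \<bar>s\<bar> * k ^ n * A N x <= (A ^^ Suc n) N x" "C powr - \<bar>s\<bar> * (A ^^ Suc n) N x <= k ^ n * A N x"
proof -
 have eq: "(A ^^ n) N (g *v x) = N (g *v x) * (A ^^ n) N (act g x')" and K: "act g x' \<in> K"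
  if g: "good g" and x': "x' = x /\<^sub>R l1norm x" for g x'
 proof -
  have gx: "g *v x \<in> pcone" by (rule pos_mat_cone[OF good_pos[OF g] x])
  have "act g x' = (g *v x) /\<^sub>R l1norm (g *v x)"
   using cone_l1norm[OF x] unfolding act_def x' by (simp add: matrix_vector_mult_scaleR l1norm_scaleR)
  then show "(A ^^ n) N (g *v x) = N (g *v x) * (A ^^ n) N (act g x')"
   using homog_normalize[OF hcls_homog[OF Apow_hcls[OF N_hcls]] gx] by (simp add: N_cone gx)
  show "act g x' \<in> K" using good_K[OF g] cone_normalize[OF x] x' by simp
 qed
 have pos: "0 < N (g *v x)" if "good g" for g using clsD(1)[OF N_cls pos_mat_cone[OF good_pos[OF that] x]] .
 have "(C powr - \<bar>s\<bar> * k ^ n) * A N x <= A ((A ^^ n) N) x"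
 proof (rule A_mono_AE[OF N_hcls Apow_hcls[OF N_hcls] x x])
  fix g assume g: "good g"
  show "(C powr - \<bar>s\<bar> * k ^ n) * N (g *v x) <= (A ^^ n) N (g *v x)"
   unfolding eq[OF g refl] using AN_K_bounds(1)[OF K[OF g refl], of n] pos[OF g] by (simp add: mult.commute)
 qed
 then show "C powr - \<bar>s\<bar> * k ^ n * A N x <= (A ^^ Suc n) N x" by simp
 have "C powr - \<bar>s\<bar> * A ((A ^^ n) N) x <= A (%x. k ^ n * N x + 0 * N x) x"
 proof (rule A_mono_AE[OF Apow_hcls[OF N_hcls] hcls_lin[OF N_hcls N_hcls] x x])
  fix g assume g: "good g"
  have "N (g *v x) * (C powr - \<bar>s\<bar> * (A ^^ n) N (act g (x /\<^sub>R l1norm x))) <= N (g *v x) * k ^ n"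
   using AN_K_bounds(2)[OF K[OF g refl], of n] pos[OF g] by (intro mult_left_mono) auto
  then show "C powr - \<bar>s\<bar> * (A ^^ n) N (g *v x) <= k ^ n * N (g *v x) + 0 * N (g *v x)"
   unfolding eq[OF g refl] by (simp add: mult_ac)
 qed
 then show "C powr - \<bar>s\<bar> * (A ^^ Suc n) N x <= k ^ n * A N x"
  unfolding A_lin[OF N_hcls N_hcls x] by simp
qed

lemma root_limit:
 assumes x: "x \<in> pcone"
 shows "(%n. ((A ^^ n) N x) powr (1 / real n)) \<longlonglongrightarrow> k"
proof (rule LIMSEQ_imp_Suc, rule tendsto_sandwich)
 define \<alpha> where "\<alpha> = C powr - \<bar>s\<bar> * A N x / k"
 define b where "b = A N x / (C powr - \<bar>s\<bar> * k)"
 have AN: "0 < A N x" using AN_pos[OF x, of 1] by simp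
 have Cs: "0 < C powr - \<bar>s\<bar>" using C by simp
 have pos: "0 < \<alpha>" "0 < b" unfolding \<alpha>_def b_def using AN Cs k_pos by auto
 have lim: "(%n. (y * k ^ Suc n) powr (1 / real (Suc n))) \<longlonglongrightarrow> k" if "0 < y" for y
 proof -
  have "(%n. y powr (1 / real (Suc n)) * k) \<longlonglongrightarrow> y powr 0 * k"
   using that by (intro tendsto_intros LIMSEQ_Suc[OF lim_1_over_n]) auto
  moreover have "(y * k ^ Suc n) powr (1 / real (Suc n)) = y powr (1 / real (Suc n)) * k" for n
   using that k_pos by (simp add: powr_mult powr_realpow[symmetric] powr_powr del: power_Suc of_nat_Suc)
  ultimately show ?thesis using that by simp
 qed
 show "(%n. (\<alpha> * k ^ Suc n) powr (1 / real (Suc n))) \<longlonglongrightarrow> k" "(%n. (b * k ^ Suc n) powr (1 / real (Suc n))) \<longlonglongrightarrow> k"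
  using lim pos by auto
 have "\<alpha> * k ^ Suc n <= (A ^^ Suc n) N x" for n
  using AN_bounds(1)[OF x, of n] k_pos by (simp add: \<alpha>_def mult_ac)
 then show "\<forall>\<^sub>F n in sequentially. (\<alpha> * k ^ Suc n) powr (1 / real (Suc n)) <= ((A ^^ Suc n) N x) powr (1 / real (Suc n))"
  using pos k_pos by (intro always_eventually allI powr_mono2) auto
 have "(A ^^ Suc n) N x <= b * k ^ Suc n" for n
  using AN_bounds(2)[OF x, of n] k_pos Cs by (simp add: b_def field_simps)
 then show "\<forall>\<^sub>F n in sequentially. ((A ^^ Suc n) N x) powr (1 / real (Suc n)) <= (b * k ^ Suc n) powr (1 / real (Suc n))"
  using AN_pos[OF x, of "Suc n" for n] by (intro always_eventually allI powr_mono2) (auto intro: less_imp_le)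
qed

end

subsection \<open>Transfer operators of a law and of its transpose\<close>

text \<open>With \<open>\<tau>\<close> the identity \<open>transfer\<close> is \<open>P_op\<close>,
  with \<open>\<tau>\<close> the transposition it is \<open>P_star_op\<close>; both obtain existence
  and uniqueness of the eigenmeasure from one argument.\<close>

locale matrix_law_image = matrix_law M K C p c1 s
 for M :: "(real ^ 'n ^ 'n) measure" and K C p c1 s +
 fixes \<mu> :: "(real ^ 'n ^ 'n) measure" and \<tau> :: "real ^ 'n ^ 'n => real ^ 'n ^ 'n"
 assumes \<tau> [measurable]: "\<tau> \<in> \<mu> \<rightarrow>\<^sub>M borel" and M_def: "M = distr \<mu> borel \<tau>"
  and \<tau>_nonneg: "g \<in> space \<mu> ==> 0 <= \<tau> g $ i $ j"
begin

definition transfer :: "(real ^ 'n => complex) => real ^ 'n => complex" where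
 "transfer f v = (\<integral>g. of_real (l1norm (\<tau> g *v v) powr s) * f (act (\<tau> g) v) \<partial>\<mu>)"

lemma A_eq: "homog F ==> A F x = (\<integral>g. F (\<tau> g *v x) \<partial>\<mu>)"
proof -
 assume F: "homog F"
 have "A F x = (\<integral>g. F (g *v x) \<partial>distr \<mu> borel \<tau>)" unfolding A_def M_def[symmetric] ..
 also have "... = (\<integral>g. F (\<tau> g *v x) \<partial>\<mu>)"
  by (rule integral_distr[OF \<tau> measurable_compose[OF measurable_mat_vec homog_measurable[OF F]]])
 finally show ?thesis .
qed

lemma hcls_integrable_\<mu>: "hcls F ==> x \<in> pcone ==> integrable \<mu> (%g. F (\<tau> g *v x))"
proof -
 assume F: "hcls F" and x: "x \<in> pcone"
 have "integrable (distr \<mu> borel \<tau>) (%g. F (g *v x))"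
  using hcls_integrable[OF F x] unfolding M_def[symmetric] .
 then show ?thesis
  by (subst (asm) integrable_distr_eq[OF \<tau> measurable_compose[OF measurable_mat_vec homog_measurable[OF hcls_homog[OF F]]]])
qed

lemma hom_\<tau>:
 assumes "g \<in> space \<mu>" "v \<in> \<S>"
 shows "hom f (\<tau> g *v v) = l1norm (\<tau> g *v v) powr s * f (act (\<tau> g) v)"
\<comment> \<open>For a vanishing image both sides are 0 by \<open>0 powr s = 0\<close>; the
  identity thus holds for every \<open>g\<close> and not just almost everywhere.\<close>
proof (cases "\<tau> g *v v = 0")
 case True
 then show ?thesis by (simp add: hom_def pcone_def l1norm_def)
next
 case False
 have "nonneg_vec (\<tau> g *v v)" unfolding mat_vec_nth
  using \<tau>_nonneg[OF assms(1)] simplex_D(1)[OF assms(2)] by (intro allI sum_nonneg mult_nonneg_nonneg) auto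
 then have "\<tau> g *v v \<in> pcone" using False by (simp add: pcone_def)
 then show ?thesis by (simp add: hom_def act_def)
qed

lemma transfer_eq:
 assumes f: "continuous_on \<S> f" and v: "v \<in> \<S>"
 shows "transfer f v = of_real (A (hom (%v. Re (f v))) v) + \<i> * of_real (A (hom (%v. Im (f v))) v)"
proof -
 have c: "continuous_on \<S> (%v. Re (f v))" "continuous_on \<S> (%v. Im (f v))"
  by (intro continuous_intros f)+
 have "transfer f v = (\<integral>g. of_real (hom (%v. Re (f v)) (\<tau> g *v v)) + \<i> * of_real (hom (%v. Im (f v)) (\<tau> g *v v)) \<partial>\<mu>)"
  unfolding transfer_def
  by (intro Bochner_Integration.integral_cong refl) (auto simp: hom_\<tau>[OF _ v] complex_eq_iff)
 also have "... = of_real (\<integral>g. hom (%v. Re (f v)) (\<tau> g *v v) \<partial>\<mu>) + \<i> * of_real (\<integral>g. hom (%v. Im (f v)) (\<tau> g *v v) \<partial>\<mu>)"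
  using hcls_integrable_\<mu>[OF hom_hcls[OF c(1)] simplex_cone[OF v]] hcls_integrable_\<mu>[OF hom_hcls[OF c(2)] simplex_cone[OF v]]
  by simp
 finally show ?thesis using A_eq[OF hcls_homog[OF hom_hcls[OF c(1)]]] A_eq[OF hcls_homog[OF hom_hcls[OF c(2)]]] by simp
qed

lemma integral_complex_parts:
 fixes Q :: "(real ^ 'n) measure" and a b :: "real ^ 'n => real"
 assumes "prob_space Q" "sets Q = sets (restrict_space borel \<S>)" "continuous_on \<S> a" "continuous_on \<S> b"
 shows "(\<integral>v. of_real (a v) + \<i> * of_real (b v) \<partial>Q) = of_real (\<integral>v. a v \<partial>Q) + \<i> * of_real (\<integral>v. b v \<partial>Q)"
proof -
 interpret Q: prob_space Q by fact
 have sp: "space Q = \<S>" using sets_eq_imp_space_eq[OF assms(2)] by (simp add: space_restrict_space)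
 have int: "integrable Q f" if f: "continuous_on \<S> f" for f :: "real ^ 'n => real"
 proof -
  obtain B where "!!v. v \<in> \<S> ==> norm (f v) <= B" using simplex_bounded[OF f] by blast
  moreover have "f \<in> borel_measurable Q"
   using borel_measurable_continuous_on_restrict[OF f] by (simp add: measurable_cong_sets[OF assms(2) refl])
  ultimately show ?thesis by (intro Q.integrable_const_bound[of _ B] AE_I2) (auto simp: sp)
 qed
 show ?thesis using int[OF assms(3)] int[OF assms(4)] by simp
qed

lemma eigenmeasure_\<nu>: "eigenmeasure transfer k \<nu>"
 unfolding eigenmeasure_def
proof (intro conjI allI impI prob_\<nu> sets_\<nu>)
 fix f :: "real ^ 'n => complex" assume f: "continuous_on \<S> f"
 have c: "continuous_on \<S> (%v. Re (f v))" "continuous_on \<S> (%v. Im (f v))"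
  by (intro continuous_intros f)+
 have "(\<integral>v. transfer f v \<partial>\<nu>) = (\<integral>v. of_real (A (hom (%v. Re (f v))) v) + \<i> * of_real (A (hom (%v. Im (f v))) v) \<partial>\<nu>)"
  by (intro Bochner_Integration.integral_cong refl) (simp add: transfer_eq[OF f] space_\<nu>)
 also have "... = of_real (k * L (%v. Re (f v))) + \<i> * of_real (k * L (%v. Im (f v)))"
  by (simp only: integral_complex_parts[OF prob_\<nu> sets_\<nu> A_hom_continuous[OF c(1)] A_hom_continuous[OF c(2)]]
    integral_\<nu>[OF A_hom_continuous[OF c(1)]] integral_\<nu>[OF A_hom_continuous[OF c(2)]] L_eigen c)
 also have "... = of_real k * (of_real (L (%v. Re (f v))) + \<i> * of_real (L (%v. Im (f v))))"
  by (simp add: algebra_simps)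
 also have "of_real (L (%v. Re (f v))) + \<i> * of_real (L (%v. Im (f v))) = (\<integral>v. f v \<partial>\<nu>)"
  using integral_complex_parts[OF prob_\<nu> sets_\<nu> c] by (simp add: integral_\<nu> c complex_eq[symmetric])
 finally show "(\<integral>v. transfer f v \<partial>\<nu>) = of_real k * (\<integral>v. f v \<partial>\<nu>)" .
qed

lemma eigenmeasure_unique: "eigenmeasure transfer k' \<nu>' ==> \<nu>' = \<nu>"
proof -
 assume e: "eigenmeasure transfer k' \<nu>'"
 show ?thesis
 proof (rule eigen_unique(1))
  show P: "prob_space \<nu>'" and S: "sets \<nu>' = sets (restrict_space borel \<S>)" using e by (auto simp: eigenmeasure_def)
  have sp: "space \<nu>' = \<S>" using sets_eq_imp_space_eq[OF S] by (simp add: space_restrict_space)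
  fix f :: "real ^ 'n => real" assume f: "continuous_on \<S> f"
  have c: "continuous_on \<S> (%v. complex_of_real (f v))" by (intro continuous_intros f)
  have z: "A (hom (%v. 0)) v = 0" for v
  proof -
   have "hom (%v. 0) = (%x. 0)" by (simp add: hom_def fun_eq_iff)
   then show ?thesis by (simp add: A_def)
  qed
  have "complex_of_real (\<integral>v. A (hom f) v \<partial>\<nu>') = (\<integral>v. transfer (%v. of_real (f v)) v \<partial>\<nu>')"
   unfolding integral_complex_of_real[symmetric]
   by (intro Bochner_Integration.integral_cong refl) (simp add: transfer_eq[OF c] sp z)
  also have "... = of_real k' * (\<integral>v. of_real (f v) \<partial>\<nu>')" using e c by (simp add: eigenmeasure_def)
  also have "... = of_real (k' * (\<integral>v. f v \<partial>\<nu>'))" by simp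
  finally show "(\<integral>v. A (hom f) v \<partial>\<nu>') = k' * (\<integral>v. f v \<partial>\<nu>')" by (simp only: of_real_eq_iff)
 qed
qed

lemma the_eigenmeasure: "(THE \<nu>'. eigenmeasure transfer k \<nu>') = \<nu>"
 using eigenmeasure_\<nu> eigenmeasure_unique by (rule the_equality)

end

section \<open>The law together with its transpose: moments and the eigenfunction\<close>

abbreviation ones :: "real ^ 'n" where "ones \<equiv> (\<chi> i. 1)"

lemma ones_cone: "ones \<in> pcone" by (auto simp: pcone_def vec_eq_iff)

lemma mnorm_ones: "mnorm g = ones \<bullet> (g *v ones)" for g :: "real ^ 'n ^ 'n"
 by (simp add: mnorm_def inner_vec_def mat_vec_nth)

lemma inner_mat_vec: "x \<bullet> (g *v y) = (transpose g *v x) \<bullet> y" for g :: "real ^ 'n ^ 'n"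
 by (simp add: transpose_matrix_vector dot_lmul_matrix)

lemma continuous_on_mat_mult [continuous_intros]:
 fixes f :: "'a::topological_space => real ^ 'n ^ 'm" and h :: "'a => real ^ 'k ^ 'n"
 shows "continuous_on S f ==> continuous_on S h ==> continuous_on S (%x. f x ** h x)"
 unfolding matrix_matrix_mult_def by (intro continuous_intros)

lemma continuous_on_transpose [continuous_intros]:
 fixes f :: "'a::topological_space => real ^ 'n ^ 'm"
 shows "continuous_on S f ==> continuous_on S (%x. transpose (f x))"
 unfolding transpose_def by (intro continuous_intros)

lemma measurable_mat_mult:
 assumes [measurable]: "f \<in> N \<rightarrow>\<^sub>M borel" "h \<in> N \<rightarrow>\<^sub>M borel"
 shows "(%x. (f x :: real ^ 'n ^ 'm) ** (h x :: real ^ 'k ^ 'n)) \<in> N \<rightarrow>\<^sub>M borel"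
proof -
 have "(%(a :: real ^ 'n ^ 'm, b :: real ^ 'k ^ 'n). a ** b) \<in> borel_measurable (borel \<Otimes>\<^sub>M borel)"
  unfolding borel_prod case_prod_beta by (intro borel_measurable_continuous_onI continuous_intros)
 then show ?thesis using measurable_compose[OF measurable_Pair[OF assms]] by fastforce
qed

lemma law_id_measurable:
 assumes "law_on_nonneg_mats \<mu>"
 shows "(%g. g) \<in> \<mu> \<rightarrow>\<^sub>M borel" "transpose \<in> \<mu> \<rightarrow>\<^sub>M borel" "space \<mu> = nonneg_mats"
proof -
 have s: "sets \<mu> = sets (restrict_space borel nonneg_mats)" using assms by (simp add: law_on_nonneg_mats_def)
 show "(%g. g) \<in> \<mu> \<rightarrow>\<^sub>M borel" "transpose \<in> \<mu> \<rightarrow>\<^sub>M borel"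
  unfolding measurable_cong_sets[OF s refl]
  by (intro measurable_restrict_space1 borel_measurable_continuous_onI continuous_intros)+
 show "space \<mu> = nonneg_mats" using sets_eq_imp_space_eq[OF s] by (simp add: space_restrict_space)
qed

text \<open>For \<open>s < 0\<close>, \<open>KT_pos\<close> keeps the set carrying the transposed
  eigenmeasure away from the boundary, so that \<open>(x \<bullet> u) powr s\<close> is bounded
  there for fixed \<open>x\<close> in the cone.\<close>

locale two_sided_law =
 M: matrix_law "distr \<mu> borel (%g. g)" K C p c1 s + T: matrix_law "distr \<mu> borel transpose" KT CT pT c1T s
 for \<mu> :: "(real ^ 'n ^ 'n) measure" and s K C p c1 KT CT pT c1T +
 assumes law: "law_on_nonneg_mats \<mu>"
  and KT_pos: "0 < s \<or> (\<exists>\<epsilon>>0. \<forall>x\<in>KT. \<forall>i. \<epsilon> <= x $ i)"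
begin

lemma prob_\<mu>: "prob_space \<mu>" using law by (simp add: law_on_nonneg_mats_def)

lemma M_image: "matrix_law_image (distr \<mu> borel (%g. g)) K C p c1 s \<mu> (%g. g)"
 by unfold_locales (use law_id_measurable[OF law] in \<open>auto simp: nonneg_mats_def\<close>)

lemma T_image: "matrix_law_image (distr \<mu> borel transpose) KT CT pT c1T s \<mu> transpose"
 by unfold_locales (use law_id_measurable[OF law] in \<open>auto simp: nonneg_mats_def transpose_def\<close>)

lemma measurable_mat_prod: "{1..n} \<subseteq> J ==> (%\<omega>. mat_prod \<omega> n) \<in> PiM J (%_. \<mu>) \<rightarrow>\<^sub>M borel"
proof (induction n)
 case (Suc n)
 have c: "(%\<omega>. \<omega> (Suc n)) \<in> PiM J (%_. \<mu>) \<rightarrow>\<^sub>M \<mu>"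
  by (rule measurable_component_singleton) (use Suc.prems in auto)
 have "(%\<omega>. \<omega> (Suc n)) \<in> PiM J (%_. \<mu>) \<rightarrow>\<^sub>M borel"
  using measurable_compose[OF c law_id_measurable(1)[OF law]] .
 moreover have "(%\<omega>. mat_prod \<omega> n) \<in> PiM J (%_. \<mu>) \<rightarrow>\<^sub>M borel" using Suc.prems by (intro Suc.IH) auto
 ultimately show ?case by (simp add: measurable_mat_mult)
qed simp

lemma mat_prod_cong: "(!!i. 1 <= i ==> i <= n ==> \<omega> i = \<omega>' i) ==> mat_prod \<omega> n = mat_prod \<omega>' n"
 by (induction n) auto

lemma T_A_eq: "T.homog F ==> T.A F x = (\<integral>g. F (transpose g *v x) \<partial>\<mu>)"
 by (rule matrix_law_image.A_eq[OF T_image])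

text \<open>The newest factor stands on the left of the product, so it can be moved to
  \<open>x\<close> as its transpose, which is one application of \<open>T.A\<close>. Non-negative
  integrals permit splitting off a coordinate before integrability is known.\<close>

lemma mat_prod_moment:
 assumes "x \<in> pcone"
 shows "(\<integral>\<^sup>+\<omega>. ennreal ((x \<bullet> (mat_prod \<omega> n *v ones)) powr s) \<partial>PiM {1..n} (%_. \<mu>)) = ennreal ((T.A ^^ n) T.N x)"
 using assms
proof (induction n arbitrary: x)
 case 0
 have "x \<bullet> (mat 1 *v ones) = l1norm x" using 0 by (simp add: pcone_def l1norm_nonneg_vec inner_vec_def)
 then show ?case using 0 by (simp add: T.N_cone PiM_empty)
next
 case (Suc n)
 interpret mu: prob_space \<mu> by (rule prob_\<mu>)
 interpret ps: product_sigma_finite "%_::nat. \<mu>" by unfold_locales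
 have ins: "{1..Suc n} = insert (Suc n) {1..n}" by auto
 have meas: "(%\<omega>. ennreal ((x \<bullet> (mat_prod \<omega> (Suc n) *v ones)) powr s)) \<in> borel_measurable (PiM (insert (Suc n) {1..n}) (%_. \<mu>))" for x :: "real ^ 'n"
 proof -
  have f: "(%g::real^'n^'n. x \<bullet> (g *v ones)) \<in> borel_measurable borel"
   by (intro borel_measurable_continuous_onI continuous_intros)
  have sub: "{1..Suc n} \<subseteq> insert (Suc n) {1..n}" by auto
  have "(%\<omega>. x \<bullet> (mat_prod \<omega> (Suc n) *v ones)) \<in> borel_measurable (PiM (insert (Suc n) {1..n}) (%_. \<mu>))"
   by (rule measurable_compose[OF measurable_mat_prod[OF sub] f])
  then show ?thesis by measurable
 qed
 have upd: "mat_prod (fun_upd \<omega> (Suc n) g) (Suc n) = g ** mat_prod \<omega> n" for \<omega> g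
  using mat_prod_cong[of n "fun_upd \<omega> (Suc n) g" \<omega>] by auto
 have "(\<integral>\<^sup>+\<omega>. ennreal ((x \<bullet> (mat_prod \<omega> (Suc n) *v ones)) powr s) \<partial>PiM {1..Suc n} (%_. \<mu>))
   = (\<integral>\<^sup>+g. (\<integral>\<^sup>+\<omega>. ennreal ((x \<bullet> (mat_prod (fun_upd \<omega> (Suc n) g) (Suc n) *v ones)) powr s) \<partial>PiM {1..n} (%_. \<mu>)) \<partial>\<mu>)"
  unfolding ins by (rule ps.product_nn_integral_insert_rev[OF _ _ meas]) auto
 also have "... = (\<integral>\<^sup>+g. (\<integral>\<^sup>+\<omega>. ennreal (((transpose g *v x) \<bullet> (mat_prod \<omega> n *v ones)) powr s) \<partial>PiM {1..n} (%_. \<mu>)) \<partial>\<mu>)"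
  by (simp only: upd inner_mat_vec[symmetric] matrix_vector_mul_assoc)
 also have "... = (\<integral>\<^sup>+g. ennreal ((T.A ^^ n) T.N (transpose g *v x)) \<partial>\<mu>)"
 proof (rule nn_integral_cong_AE)
  have "AE g in \<mu>. T.good (transpose g)"
   using T.good_AE by (rule AE_distrD[OF law_id_measurable(2)[OF law]])
  then show "AE g in \<mu>. (\<integral>\<^sup>+\<omega>. ennreal (((transpose g *v x) \<bullet> (mat_prod \<omega> n *v ones)) powr s) \<partial>PiM {1..n} (%_. \<mu>))
    = ennreal ((T.A ^^ n) T.N (transpose g *v x))"
   by eventually_elim (use Suc.IH pos_mat_cone[OF T.good_pos Suc.prems] in blast)
 qed
 also have "... = ennreal (\<integral>g. (T.A ^^ n) T.N (transpose g *v x) \<partial>\<mu>)"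
 proof (rule nn_integral_eq_integral)
  show "integrable \<mu> (%g. (T.A ^^ n) T.N (transpose g *v x))"
   by (rule matrix_law_image.hcls_integrable_\<mu>[OF T_image T.Apow_hcls[OF T.N_hcls] Suc.prems])
  have "AE g in \<mu>. T.good (transpose g)"
   using T.good_AE by (rule AE_distrD[OF law_id_measurable(2)[OF law]])
  then show "AE g in \<mu>. 0 <= (T.A ^^ n) T.N (transpose g *v x)"
   by eventually_elim (use T.AN_pos[OF pos_mat_cone[OF T.good_pos Suc.prems]] in \<open>blast intro: less_imp_le\<close>)
 qed
 also have "... = ennreal ((T.A ^^ Suc n) T.N x)"
  using T_A_eq[OF T.hcls_homog[OF T.Apow_hcls[OF T.N_hcls]], of n x] by simp
 finally show ?case .
qed

text \<open>The norm is the scalar product of \<open>mat_prod_moment\<close> at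
  \<open>x = ones\<close>; it depends on the first \<open>n\<close> coordinates only, so the
  infinite product can be replaced by a finite one.\<close>

lemma kappa_T: "kappa \<mu> s = T.k"
proof -
 interpret P: product_prob_space "%_::nat. \<mu>" "{1..}" 
  by (intro product_prob_spaceI prob_\<mu>)
 have "(\<integral>\<omega>. mnorm (mat_prod \<omega> n) powr s \<partial>PiM {1..} (%_. \<mu>)) = (T.A ^^ n) T.N ones" for n
 proof -
  have m: "(%\<omega>. (ones \<bullet> (mat_prod \<omega> n *v ones)) powr s) \<in> borel_measurable (PiM J (%_. \<mu>))" if "{1..n} \<subseteq> J" for J
  proof -
   have "(%g::real^'n^'n. ones \<bullet> (g *v ones)) \<in> borel_measurable borel"
    by (intro borel_measurable_continuous_onI continuous_intros)
   from measurable_compose[OF measurable_mat_prod[OF that] this]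
   show ?thesis by measurable
  qed
  have pos: "0 <= (T.A ^^ n) T.N ones" using T.AN_pos[OF ones_cone] by (rule less_imp_le)
  have "(\<integral>\<^sup>+\<omega>. ennreal ((ones \<bullet> (mat_prod \<omega> n *v ones)) powr s) \<partial>PiM {1..n} (%_. \<mu>))
    = (\<integral>\<^sup>+\<omega>. ennreal ((ones \<bullet> (mat_prod \<omega> n *v ones)) powr s) \<partial>distr (PiM {1..} (%_. \<mu>)) (PiM {1..n} (%_. \<mu>)) (%\<omega>. restrict \<omega> {1..n}))"
   by (subst P.distr_PiM_restrict_finite) auto
  also have "... = (\<integral>\<^sup>+\<omega>. ennreal ((ones \<bullet> (mat_prod (restrict \<omega> {1..n}) n *v ones)) powr s) \<partial>PiM {1..} (%_. \<mu>))"
   using m[of "{1..n}"] by (intro nn_integral_distr measurable_restrict_subset) auto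
  also have "... = (\<integral>\<^sup>+\<omega>. ennreal (mnorm (mat_prod \<omega> n) powr s) \<partial>PiM {1..} (%_. \<mu>))"
  proof -
   have rp: "mat_prod (restrict \<omega> {1..n}) n = mat_prod \<omega> n" for \<omega> :: "nat => real ^ 'n ^ 'n"
    by (intro mat_prod_cong) auto
   show ?thesis unfolding rp mnorm_ones ..
  qed
  finally have "(\<integral>\<^sup>+\<omega>. ennreal (mnorm (mat_prod \<omega> n) powr s) \<partial>PiM {1..} (%_. \<mu>)) = ennreal ((T.A ^^ n) T.N ones)"
   using mat_prod_moment[OF ones_cone, of n] by simp
  then show ?thesis
   using m[of "{1..}"] pos by (subst integral_eq_nn_integral) (auto simp: mnorm_ones)
 qed
 then show ?thesis unfolding kappa_def using T.root_limit[OF ones_cone] by (simp add: limI)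
qed

lemma nu_star_eq: "nu_star \<mu> s = T.\<nu>"
proof -
 have "P_star_op \<mu> s = matrix_law_image.transfer s \<mu> transpose"
  by (intro ext) (simp add: P_star_op_def matrix_law_image.transfer_def[OF T_image])
 then show ?thesis unfolding nu_star_def kappa_T using matrix_law_image.the_eigenmeasure[OF T_image] by simp
qed

definition lo where "lo = (if 0 < s then 0 else (SOME \<epsilon>. \<epsilon> > 0 & (\<forall>x\<in>KT. \<forall>i. \<epsilon> <= x $ i)))"

lemma lo: "0 <= lo" "\<not> 0 < s ==> 0 < lo" "x \<in> KT ==> lo <= x $ i"
proof -
 have "\<exists>\<epsilon>. \<epsilon> > 0 & (\<forall>x\<in>KT. \<forall>i. \<epsilon> <= x $ i)" if "\<not> 0 < s" using KT_pos that by auto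
 then have "lo > 0 & (\<forall>x\<in>KT. \<forall>i. lo <= x $ i)" if "\<not> 0 < s"
  using someI_ex[of "%\<epsilon>. \<epsilon> > 0 & (\<forall>x\<in>KT. \<forall>i. \<epsilon> <= x $ i)"] that unfolding lo_def by simp
 then show "0 <= lo" "\<not> 0 < s ==> 0 < lo" "x \<in> KT ==> lo <= x $ i"
  using T.K_sub simplex_D(1)[of x i] by (cases "0 < s"; force simp: lo_def)+
qed

lemma inner_bounds:
 assumes x: "x \<in> pcone" and u: "u \<in> \<S>"
 shows "0 <= x \<bullet> u" "x \<bullet> u <= l1norm x" "u \<in> KT ==> lo * l1norm x <= x \<bullet> u"
proof -
 have nn: "nonneg_vec x" using x by (simp add: pcone_def)
 show "0 <= x \<bullet> u" unfolding inner_vec_def using nn simplex_D(1)[OF u] by (auto intro!: sum_nonneg)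
 show "x \<bullet> u <= l1norm x" unfolding inner_vec_def l1norm_nonneg_vec[OF nn]
  using nn simplex_D[OF u] by (auto intro!: sum_mono mult_left_le)
 show "u \<in> KT ==> lo * l1norm x <= x \<bullet> u" unfolding inner_vec_def l1norm_nonneg_vec[OF nn] sum_distrib_left
 proof (intro sum_mono)
  fix i assume "u \<in> KT"
  then have "x $ i * lo <= x $ i * u $ i" using nn lo(3) by (intro mult_left_mono) auto
  then show "lo * x $ i <= x $ i \<bullet> u $ i" by (simp add: mult.commute)
 qed
qed

text \<open>For negative exponents \<open>u \<mapsto> (x \<bullet> u) powr s\<close> is unbounded near the boundary of the simplex.
 Cutting off at \<open>lo\<close> makes it continuous and changes nothing on \<open>KT\<close>, which carries \<open>T.\<nu>\<close>.\<close>

definition ker :: "real ^ 'n => real ^ 'n => real" where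
 "ker x u = (max (x \<bullet> u) (lo * l1norm x)) powr s"

lemma ker_eq: "x \<in> pcone ==> u \<in> KT ==> ker x u = (x \<bullet> u) powr s"
 using inner_bounds(3)[of x u] T.K_sub by (auto simp: ker_def max_def)

lemma ker_continuous: "x \<in> pcone ==> continuous_on \<S> (ker x)"
 unfolding ker_def
proof (rule continuous_on_powr')
 assume x: "x \<in> pcone"
 have "0 < lo * l1norm x" if "\<not> 0 < s" using lo(2)[OF that] cone_l1norm[OF x] by simp
 then show "\<forall>u\<in>\<S>. 0 <= max (x \<bullet> u) (lo * l1norm x) & (max (x \<bullet> u) (lo * l1norm x) = 0 --> 0 < s)"
  using inner_bounds(1)[OF x] by (force simp: max_def)
qed (intro continuous_intros)+

definition rt :: "real ^ 'n => real" where "rt x = (\<integral>u. (x \<bullet> u) powr s \<partial>T.\<nu>)"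

lemma rt_r_fun: "r_fun \<mu> s = rt" unfolding r_fun_def[abs_def] rt_def[abs_def] nu_star_eq ..

lemma sets_T\<nu> [measurable_cong]: "sets T.\<nu> = sets (restrict_space borel \<S>)" by (rule T.sets_\<nu>)

lemma rt_ker: "x \<in> pcone ==> rt x = (\<integral>u. ker x u \<partial>T.\<nu>)"
 unfolding rt_def
proof (rule integral_cong_AE)
 assume x: "x \<in> pcone"
 show "AE u in T.\<nu>. (x \<bullet> u) powr s = ker x u"
  using T.\<nu>_K by eventually_elim (simp add: ker_eq x)
 show "ker x \<in> borel_measurable T.\<nu>"
  using T.integrable_\<nu>[OF ker_continuous[OF x]] by (rule borel_measurable_integrable)
 have "(%u. (x \<bullet> u) powr s) \<in> borel_measurable (restrict_space borel \<S>)"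
  by (intro measurable_restrict_space1) measurable
 then show "(%u. (x \<bullet> u) powr s) \<in> borel_measurable T.\<nu>" by (simp add: measurable_cong_sets[OF sets_T\<nu> refl])
qed

lemma T\<nu>_id: "(%u. u) \<in> T.\<nu> \<rightarrow>\<^sub>M borel"
 unfolding measurable_cong_sets[OF sets_T\<nu> refl] by (intro measurable_restrict_space1) measurable

lemma integrable_inner_powr: "x \<in> pcone ==> integrable T.\<nu> (%u. (x \<bullet> u) powr s)"
proof -
 assume x: "x \<in> pcone"
 have m: "(%u. (x \<bullet> u) powr s) \<in> borel_measurable T.\<nu>"
  using T\<nu>_id by measurable
 have "AE u in T.\<nu>. ker x u = (x \<bullet> u) powr s"
  using T.\<nu>_K by eventually_elim (simp add: ker_eq x)
 then show ?thesis using T.integrable_\<nu>[OF ker_continuous[OF x]] m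
  by (subst integrable_cong_AE[where g="ker x"]) (auto elim!: eventually_mono intro: borel_measurable_integrable)
qed

lemma rt_L: "x \<in> pcone ==> rt x = T.L (ker x)"
 using rt_ker T.integral_\<nu>[OF ker_continuous] by simp

text \<open>Here the two operators meet: the left side applies \<open>T.A\<close> in the variable
  \<open>u\<close>, the right side is the integrand of \<open>M.A\<close> in the variable
  \<open>x\<close>. Integration over \<open>u\<close> and Fubini turn this into
  \<open>rt_eigen\<close>.\<close>

lemma T_A_ker:
 assumes x: "x \<in> pcone" and u: "u \<in> \<S>"
 shows "T.A (T.hom (ker x)) u = (\<integral>g. ((g *v x) \<bullet> u) powr s \<partial>\<mu>)" "0 < T.A (T.hom (ker x)) u"
proof -
 have h: "T.hcls (T.hom (ker x))" by (intro T.hom_hcls ker_continuous x)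
 have good: "AE g in \<mu>. T.good (transpose g)"
  using T.good_AE by (rule AE_distrD[OF law_id_measurable(2)[OF law]])
 have eq: "T.hom (ker x) (transpose g *v u) = ((g *v x) \<bullet> u) powr s" and pos: "0 < (g *v x) \<bullet> u"
  if g: "T.good (transpose g)" for g
 proof -
  have pg: "pos_mat (transpose g)" by (rule T.good_pos[OF g])
  define w where "w = act (transpose g) u"
  define l where "l = l1norm (transpose g *v u)"
  have w: "w \<in> \<S>" "!!i. 0 < w $ i" "0 < l" "transpose g *v u = l *\<^sub>R w" "w \<in> KT"
   using pos_mat_act[OF pg u] T.good_K[OF g u] by (auto simp: w_def l_def)
  have e: "(g *v x) \<bullet> u = l * (x \<bullet> w)"
   using inner_mat_vec[of u g x] w(4) by (simp add: inner_commute)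
  have xw: "0 < x \<bullet> w"
  proof -
   obtain i where "x $ i ~= 0" using x by (auto simp: pcone_def vec_eq_iff)
   then have "0 < x $ i" using x by (simp add: pcone_def less_le)
   then show ?thesis unfolding inner_vec_def using x w(2)
    by (intro sum_pos2[of _ i]) (auto simp: pcone_def less_imp_le)
  qed
  show "0 < (g *v x) \<bullet> u" unfolding e using xw w(3) by simp
  have "T.hom (ker x) (transpose g *v u) = l powr s * T.hom (ker x) w"
   unfolding w(4) by (intro T.homogD T.hcls_homog h simplex_cone w)
  then show "T.hom (ker x) (transpose g *v u) = ((g *v x) \<bullet> u) powr s"
   using w(3) xw unfolding e by (simp add: T.hom_S w ker_eq[OF x w(5)] powr_mult)
 qed
 have int: "integrable \<mu> (%g. T.hom (ker x) (transpose g *v u))"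
  by (rule matrix_law_image.hcls_integrable_\<mu>[OF T_image h simplex_cone[OF u]])
 have "(%g. ((g *v x) \<bullet> u) powr s) \<in> borel_measurable \<mu>"
 proof -
  have "(%g::real^'n^'n. (g *v x) \<bullet> u) \<in> borel_measurable borel"
   by (intro borel_measurable_continuous_onI continuous_intros)
  from measurable_compose[OF law_id_measurable(1)[OF law] this] show ?thesis by measurable
 qed
 then show "T.A (T.hom (ker x)) u = (\<integral>g. ((g *v x) \<bullet> u) powr s \<partial>\<mu>)"
  unfolding T_A_eq[OF T.hcls_homog[OF h]]
 proof (intro integral_cong_AE)
  show "AE g in \<mu>. T.hom (ker x) (transpose g *v u) = ((g *v x) \<bullet> u) powr s"
   using good by eventually_elim (rule eq)
 qed (use int borel_measurable_integrable in blast)+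
 show "0 < T.A (T.hom (ker x)) u"
 proof -
  interpret prob_space \<mu> by (rule prob_\<mu>)
  have ae: "AE g in \<mu>. 0 < T.hom (ker x) (transpose g *v u)"
   using good by eventually_elim (simp only: eq powr_gt_zero, use pos in force)
  have "0 <= T.A (T.hom (ker x)) u"
   unfolding T_A_eq[OF T.hcls_homog[OF h]] using ae by (intro integral_nonneg_AE) (auto elim!: eventually_mono)
  moreover have "T.A (T.hom (ker x)) u ~= 0"
  proof
   assume "T.A (T.hom (ker x)) u = 0"
   then have "AE g in \<mu>. T.hom (ker x) (transpose g *v u) = 0"
    unfolding T_A_eq[OF T.hcls_homog[OF h]] using ae int
    by (subst (asm) integral_nonneg_eq_0_iff_AE) (auto elim!: eventually_mono)
   with ae have "AE g in \<mu>. False" by eventually_elim simp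
   then show False by simp
  qed
  ultimately show ?thesis by simp
 qed
qed

text \<open>For positive \<open>s\<close> the kernel vanishes when \<open>x\<close> and
  \<open>u\<close> have disjoint supports. One application of \<open>T.A\<close> makes it strictly
  positive, and the eigenvalue equation carries the positivity back to \<open>rt\<close>.\<close>

lemma rt_pos: "x \<in> pcone ==> 0 < rt x"
proof -
 assume x: "x \<in> pcone"
 interpret pf: positive_functional \<S> T.L by (rule T.L_positive_functional)
 have c: "continuous_on \<S> (T.A (T.hom (ker x)))" by (intro T.A_hom_continuous ker_continuous x)
 obtain \<delta> where \<delta>: "0 < \<delta>" "!!v. v \<in> \<S> ==> \<delta> <= T.A (T.hom (ker x)) v"
  using T.positive_min[OF c T_A_ker(2)[OF x]] by blast
 have "T.L (%v. \<delta> * 1) <= T.L (T.A (T.hom (ker x)))"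
  by (rule pf.L_mono) (use \<delta> c in \<open>auto intro: continuous_intros\<close>)
 then have "\<delta> <= T.k * rt x" using pf.L_scale[of "%_. 1" \<delta>] pf.L_one T.L_eigen[OF ker_continuous[OF x]] rt_L[OF x] by simp
 then have "0 < T.k * rt x" using \<delta>(1) by linarith
 then show ?thesis using T.k_pos by (simp add: zero_less_mult_iff)
qed

lemma inner_powr_le:
 assumes x: "x \<in> \<S>" and u: "u \<in> KT"
 shows "(x \<bullet> u) powr s <= max 1 (lo powr s)"
proof -
 have uS: "u \<in> \<S>" using u T.K_sub by auto
 note ib = inner_bounds[OF simplex_cone[OF x] uS] and l1 = simplex_D(4)[OF x]
 show ?thesis
 proof (cases "0 < s")
  case True
  then have "(x \<bullet> u) powr s <= 1" using ib l1 by (intro powr_le1) auto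
  then show ?thesis by simp
 next
  case False
  then have "(x \<bullet> u) powr s <= lo powr s" using ib(3)[OF u] l1 lo(2) by (intro powr_mono2') auto
  then show ?thesis by simp
 qed
qed

text \<open>Membership in \<open>cls\<close> makes \<open>rt\<close> an admissible denominator in
  \<open>decay\<close> and yields its Hoelder continuity.\<close>

lemma rt_cls: "M.cls rt"
proof -
 interpret nu: prob_space T.\<nu> by (rule T.prob_\<nu>)
 have m: "(%(x, u). (x \<bullet> u) powr s) \<in> borel_measurable (borel \<Otimes>\<^sub>M T.\<nu>)"
  using T\<nu>_id by measurable
 have meas: "rt \<in> borel_measurable borel"
  unfolding rt_def[abs_def] using m by (rule nu.borel_measurable_lebesgue_integral)
 have hom: "rt (t *\<^sub>R x) = t powr s * rt x" if "x \<in> pcone" "0 < t" for x t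
 proof -
  have "rt (t *\<^sub>R x) = (\<integral>u. t powr s * (x \<bullet> u) powr s \<partial>T.\<nu>)"
   unfolding rt_def using that inner_bounds(1)[OF that(1)]
   by (intro Bochner_Integration.integral_cong refl) (simp add: T.space_\<nu> powr_mult)
  then show ?thesis by (simp add: rt_def)
 qed
 have cmp: "M.ca a b * rt y <= rt x" if x: "x \<in> pcone" and y: "y \<in> pcone" and ab: "0 < a" "0 < b"
  and le: "\<forall>i. a * y $ i <= x $ i" "\<forall>i. b * x $ i <= y $ i" for x y a b
 proof -
  have "(\<integral>u. M.ca a b * (y \<bullet> u) powr s \<partial>T.\<nu>) <= (\<integral>u. (x \<bullet> u) powr s \<partial>T.\<nu>)"
  proof (intro integral_mono_AE integrable_mult_right integrable_inner_powr x y)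
   show "AE u in T.\<nu>. M.ca a b * (y \<bullet> u) powr s <= (x \<bullet> u) powr s"
    using T.\<nu>_K
   proof eventually_elim
    case (elim u)
    then have u: "u \<in> \<S>" using T.K_sub by auto
    have 1: "a * (y \<bullet> u) <= x \<bullet> u" "b * (x \<bullet> u) <= y \<bullet> u"
     unfolding inner_vec_def sum_distrib_left using le simplex_D(1)[OF u]
     by (auto intro!: sum_mono simp: mult.assoc[symmetric] mult_right_mono)
    show ?case
    proof (cases "0 < s")
     case True
     then have "(a * (y \<bullet> u)) powr s <= (x \<bullet> u) powr s" using 1 ab inner_bounds(1)[OF y u] by (intro powr_mono2) auto
     then show ?thesis using True ab inner_bounds(1)[OF y u] by (simp add: M.ca_def powr_mult)
    next
     case False
     have p: "0 < x \<bullet> u" "0 < y \<bullet> u"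
      using inner_bounds(3)[OF x u elim] inner_bounds(3)[OF y u elim] lo(2)[OF False] cone_l1norm[OF x] cone_l1norm[OF y]
      by (meson less_le_trans mult_pos_pos)+
     have "(y \<bullet> u) powr s <= (b * (x \<bullet> u)) powr s" using 1 False ab p by (intro powr_mono2') auto
     then have "b powr - s * (y \<bullet> u) powr s <= b powr - s * (b powr s * (x \<bullet> u) powr s)"
      using ab p by (intro mult_left_mono) (auto simp: powr_mult)
     also have "... = (x \<bullet> u) powr s" using ab by (simp add: powr_add[symmetric] mult.assoc[symmetric])
     finally show ?thesis using False by (simp add: M.ca_def)
    qed
   qed
  qed
  then show ?thesis by (simp add: rt_def)
 qed
 have bound: "rt x <= max 1 (lo powr s)" if x: "x \<in> \<S>" for x
 proof -
  have "rt x <= (\<integral>u. max 1 (lo powr s) \<partial>T.\<nu>)"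
   unfolding rt_def
  proof (intro integral_mono_AE integrable_inner_powr simplex_cone x)
   show "AE u in T.\<nu>. (x \<bullet> u) powr s <= max 1 (lo powr s)"
    using T.\<nu>_K by eventually_elim (rule inner_powr_le[OF x])
  qed simp
  then show ?thesis by (simp add: nu.prob_space)
 qed
 have pos: "0 < rt x" if x: "x \<in> pcone" for x by (rule rt_pos[OF x])
 show ?thesis unfolding M.cls_def M.homog_def using meas hom pos cmp bound by blast
qed

lemma M_A_eq: "M.homog F ==> M.A F x = (\<integral>g. F (g *v x) \<partial>\<mu>)"
 by (rule matrix_law_image.A_eq[OF M_image])

lemma rt_eigen: "x \<in> pcone ==> M.A rt x = kappa \<mu> s * rt x"
proof -
 assume x: "x \<in> pcone"
 interpret nu: prob_space T.\<nu> by (rule T.prob_\<nu>)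
 interpret mu: prob_space \<mu> by (rule prob_\<mu>)
 interpret pair_sigma_finite \<mu> T.\<nu> ..
 have m: "(%(g, u). ((g *v x) \<bullet> u) powr s) \<in> borel_measurable (\<mu> \<Otimes>\<^sub>M T.\<nu>)"
 proof -
  have "(%(g :: real^'n^'n, u). (g *v x) \<bullet> u) \<in> borel_measurable (borel \<Otimes>\<^sub>M borel)"
   unfolding borel_prod case_prod_beta by (intro borel_measurable_continuous_onI continuous_intros)
  moreover have "(%(g, u). (g, u)) \<in> \<mu> \<Otimes>\<^sub>M T.\<nu> \<rightarrow>\<^sub>M borel \<Otimes>\<^sub>M borel"
   using law_id_measurable(1)[OF law] T\<nu>_id by measurable
  ultimately have "(%z. (%(g :: real^'n^'n, u). (g *v x) \<bullet> u) ((%(g, u). (g, u)) z)) \<in> borel_measurable (\<mu> \<Otimes>\<^sub>M T.\<nu>)"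
   by (rule measurable_compose[rotated])
  then have "(%z. (fst z *v x) \<bullet> snd z) \<in> borel_measurable (\<mu> \<Otimes>\<^sub>M T.\<nu>)" by (simp add: case_prod_unfold)
  then show ?thesis unfolding case_prod_unfold by measurable
 qed
 have good: "AE g in \<mu>. M.good g"
  using M.good_AE by (rule AE_distrD[OF law_id_measurable(1)[OF law]])
 have int: "integrable (\<mu> \<Otimes>\<^sub>M T.\<nu>) (%(g, u). ((g *v x) \<bullet> u) powr s)"
 proof (rule Fubini_integrable[OF m])
  have "integrable \<mu> (%g. rt (g *v x))"
   using M.cls_hcls[OF rt_cls] by (rule matrix_law_image.hcls_integrable_\<mu>[OF M_image _ x])
  then show "integrable \<mu> (%g. \<integral>u. norm (case (g, u) of (g, u) => ((g *v x) \<bullet> u) powr s) \<partial>T.\<nu>)"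
   by (simp add: rt_def)
  show "AE g in \<mu>. integrable T.\<nu> (%u. case (g, u) of (g, u) => ((g *v x) \<bullet> u) powr s)"
   using good by eventually_elim (use integrable_inner_powr[OF pos_mat_cone[OF M.good_pos x]] in simp)
 qed
 have "M.A rt x = (\<integral>g. (\<integral>u. ((g *v x) \<bullet> u) powr s \<partial>T.\<nu>) \<partial>\<mu>)"
  using rt_cls by (subst M_A_eq) (auto simp: M.cls_def rt_def)
 also have "... = (\<integral>u. (\<integral>g. ((g *v x) \<bullet> u) powr s \<partial>\<mu>) \<partial>T.\<nu>)"
  by (rule Fubini_integral[OF int, symmetric])
 also have "... = (\<integral>u. T.A (T.hom (ker x)) u \<partial>T.\<nu>)"
  by (intro Bochner_Integration.integral_cong refl) (simp add: T_A_ker[OF x] T.space_\<nu>)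
 also have "... = T.k * rt x"
  using T.integral_\<nu>[OF T.A_hom_continuous[OF ker_continuous[OF x]]] T.L_eigen[OF ker_continuous[OF x]] rt_L[OF x] by simp
 finally show ?thesis by (simp add: kappa_T)
qed

lemma rt_continuous: "continuous_on \<S> rt"
 unfolding rt_def[abs_def]
proof (rule continuous_on_integral)
 interpret nu: prob_space T.\<nu> by (rule T.prob_\<nu>)
 show "(%u. (x \<bullet> u) powr s) \<in> borel_measurable T.\<nu>" for x :: "real ^ 'n"
  using T\<nu>_id by measurable
 show "integrable T.\<nu> (%u. max 1 (lo powr s))" by simp
 show "AE u in T.\<nu>. continuous_on \<S> (%x. (x \<bullet> u) powr s) & (\<forall>x\<in>\<S>. norm ((x \<bullet> u) powr s) <= max 1 (lo powr s))"
  using T.\<nu>_K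
 proof eventually_elim
  case (elim u)
  then have u: "u \<in> \<S>" using T.K_sub by auto
  have "continuous_on \<S> (%x. (x \<bullet> u) powr s)"
  proof (rule continuous_on_powr')
   show "\<forall>x\<in>\<S>. 0 <= x \<bullet> u & (x \<bullet> u = 0 --> 0 < s)"
   proof
    fix x :: "real ^ 'n" assume x: "x \<in> \<S>"
    show "0 <= x \<bullet> u & (x \<bullet> u = 0 --> 0 < s)"
     using inner_bounds(1)[OF simplex_cone[OF x] u] inner_bounds(3)[OF simplex_cone[OF x] u elim] lo(2) simplex_D(4)[OF x]
     by fastforce
   qed
  qed (intro continuous_intros)+
  then show ?case using inner_powr_le[OF _ elim] by simp
 qed
qed

end

subsection \<open>Spectral gap at a real exponent\<close>

context matrix_law
begin

lemma cls_cr: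
 assumes F: "cls F" and u: "u \<in> \<S>" and v: "v \<in> \<S>"
 shows "cr u v powr \<bar>s\<bar> * F v <= F u"
proof (cases "cr u v = 0")
 case True
 then show ?thesis using clsD(1)[OF F simplex_cone[OF u]] by simp
next
 case False
 define a where "a = m_ratio u v"
 define b where "b = m_ratio v u"
 have ab: "0 < a" "0 < b" "a <= 1" "b <= 1"
  using False m_ratio_0[OF u v] m_ratio_0[OF v u] m_ratio_1[OF u v] m_ratio_1[OF v u]
  by (auto simp: cr_def a_def b_def less_le)
 have "ca a b * F v <= F u"
  using m_ratio_le[OF u v] m_ratio_le[OF v u] ab simplex_cone u v
  by (intro clsD(2)[OF F]) (auto simp: a_def b_def)
 moreover have "cr u v powr \<bar>s\<bar> <= ca a b"
 proof -
  have "(a * b) powr \<bar>s\<bar> = ca a b * ca b a" using ca_mult[of a b] ab by simp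
  also have "... <= ca a b * 1"
   using ab s by (intro mult_left_mono ca_nonneg) (auto simp: ca_def powr_le1)
  finally show ?thesis by (simp add: cr_def a_def b_def)
 qed
 ultimately show ?thesis
  using mult_right_mono[of "cr u v powr \<bar>s\<bar>" "ca a b" "F v"] clsD(1)[OF F simplex_cone[OF v]] by linarith
qed

lemma cls_holder:
 assumes F: "cls F" and B: "!!x. x \<in> \<S> ==> F x <= B" and \<gamma>: "0 < \<gamma>" "\<gamma> <= 1"
  and u: "u \<in> \<S>" and v: "v \<in> \<S>"
 shows "\<bar>F u - F v\<bar> <= (C2 * B) * d_hilbert u v powr \<gamma>"
proof -
 have *: "F v - F u <= (C2 * B) * d_hilbert u v powr \<gamma>" if u: "u \<in> \<S>" and v: "v \<in> \<S>" for u v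
 proof -
  have Fv: "0 <= F v" using clsD(1)[OF F simplex_cone[OF v]] by simp
  have "F v - F u <= (1 - cr u v powr \<bar>s\<bar>) * F v" using cls_cr[OF F u v] by (simp add: algebra_simps)
  also have "... <= (C2 * d_hilbert u v powr \<gamma>) * B"
   using one_minus_cr_powr[OF u v \<gamma>] B[OF v] Fv by (intro mult_mono) (auto simp: C2_def)
  finally show ?thesis by (simp add: mult_ac)
 qed
 show ?thesis using *[OF u v] *[OF v u] by (simp add: d_hilbert_commute abs_le_iff)
qed

end

text \<open>Written with \<open>exp\<close> and \<open>ln\<close>, the integrand is entire in
  \<open>w\<close>; for a real exponent and a positive norm it is the power in
  \<open>P_op\<close>.\<close>

definition Pw :: "(real ^ 'n ^ 'n) measure => complex => (real ^ 'n => complex) => real ^ 'n => complex" where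
 "Pw \<mu> w f v = (if v \<in> \<S>
   then \<integral>g. exp (w * of_real (ln (l1norm (g *v v)))) * f (act g v) \<partial>\<mu> else 0)"

lemma space_B_borel: assumes "f \<in> space_B \<gamma>" shows "f \<in> borel_measurable borel"
proof -
 have "f = (%v. if v \<in> \<S> then f v else 0)" using space_B_outside[OF assms] by auto
 then show ?thesis using borel_measurable_extend_0[OF space_B_cont[OF assms]] by simp
qed

lemma law_measurable_integrand:
 fixes f :: "real ^ 'n => complex"
 assumes "law_on_nonneg_mats \<mu>" "f \<in> borel_measurable borel"
 shows "(%g. exp (w * of_real (ln (l1norm (g *v v)))) * f (act g v)) \<in> borel_measurable \<mu>"
proof -
 have [measurable]: "(%g. g *v v) \<in> \<mu> \<rightarrow>\<^sub>M borel"
  using measurable_compose[OF law_id_measurable(1)[OF assms(1)] measurable_mat_vec] .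
 have [measurable]: "(%g. act g v) \<in> \<mu> \<rightarrow>\<^sub>M borel" unfolding act_def by measurable
 have [measurable]: "f \<in> borel_measurable borel" by fact
 have "(%g. f (act g v)) \<in> borel_measurable \<mu>" by measurable
 moreover have "(%g. exp (w * of_real (ln (l1norm (g *v v))))) \<in> borel_measurable \<mu>" by measurable
 ultimately show ?thesis by measurable
qed

context two_sided_law
begin

lemma M_good: "AE g in \<mu>. M.good g"
 using M.good_AE by (rule AE_distrD[OF law_id_measurable(1)[OF law]])

lemma Pw_transfer:
 assumes f: "f \<in> space_B \<gamma>" and v: "v \<in> \<S>"
 shows "Pw \<mu> (of_real s) f v = of_real (M.A (M.hom (%v. Re (f v))) v) + \<i> * of_real (M.A (M.hom (%v. Im (f v))) v)"
proof -
 have m: "(%g. of_real (l1norm (g *v v) powr s) * f (act g v)) \<in> borel_measurable \<mu>"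
 proof -
  have [measurable]: "(%g. g *v v) \<in> \<mu> \<rightarrow>\<^sub>M borel"
   using measurable_compose[OF law_id_measurable(1)[OF law] measurable_mat_vec] .
  have [measurable]: "(%g. act g v) \<in> \<mu> \<rightarrow>\<^sub>M borel" unfolding act_def by measurable
  have [measurable]: "f \<in> borel_measurable borel" by (rule space_B_borel[OF f])
  show ?thesis by measurable
 qed
 have "Pw \<mu> (of_real s) f v = (\<integral>g. of_real (l1norm (g *v v) powr s) * f (act g v) \<partial>\<mu>)"
  unfolding Pw_def using v
 proof (simp, intro integral_cong_AE law_measurable_integrand law space_B_borel[OF f] m)
  show "AE g in \<mu>. exp (of_real s * of_real (ln (l1norm (g *v v)))) * f (act g v) = of_real (l1norm (g *v v) powr s) * f (act g v)"
   using M_good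
  proof eventually_elim
   case (elim g)
   then have "l1norm (g *v v) ~= 0" using pos_mat_act(3)[OF M.good_pos[OF elim] v] by simp
   then show ?case by (simp add: powr_def flip: exp_of_real)
  qed
 qed
 also have "... = matrix_law_image.transfer s \<mu> (%g. g) f v"
  by (simp add: matrix_law_image.transfer_def[OF M_image])
 finally show ?thesis using matrix_law_image.transfer_eq[OF M_image space_B_cont[OF f] v] by simp
qed

lemma hom_A_pow:
 assumes f: "continuous_on \<S> f" and v: "v \<in> \<S>"
  and h: "!!x. x \<in> \<S> ==> h x = (M.A ^^ n) (M.hom f) x"
 shows "M.A (M.hom h) v = (M.A ^^ Suc n) (M.hom f) v"
proof -
 have \<Phi>: "M.hcls ((M.A ^^ n) (M.hom f))" by (intro M.Apow_hcls M.hom_hcls f)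
 have e: "M.hom h = M.hom ((M.A ^^ n) (M.hom f))"
  using h cone_normalize by (auto simp: M.hom_def fun_eq_iff)
 have c: "continuous_on \<S> ((M.A ^^ n) (M.hom f))"
  by (intro M.Apow_continuous M.hom_hcls M.hom_continuous f)
 show ?thesis unfolding e
  using M.A_cong[OF M.hcls_homog[OF M.hom_hcls[OF c]] M.hcls_homog[OF \<Phi>] simplex_cone[OF v]]
   M.homog_hom[OF M.hcls_homog[OF \<Phi>]] by simp
qed

lemma Pw_pow_transfer:
 assumes V: "!!f. f \<in> space_B \<gamma> ==> Pw \<mu> (of_real s) f \<in> space_B \<gamma>" and f: "f \<in> space_B \<gamma>" and v: "v \<in> \<S>"
 shows "(Pw \<mu> (of_real s) ^^ n) f v = of_real ((M.A ^^ n) (M.hom (%v. Re (f v))) v) + \<i> * of_real ((M.A ^^ n) (M.hom (%v. Im (f v))) v)"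
 using v
proof (induction n arbitrary: v)
 case 0
 then show ?case by (simp add: M.hom_S complex_eq_iff)
next
 case (Suc n)
 have c: "continuous_on \<S> (%v. Re (f v))" "continuous_on \<S> (%v. Im (f v))"
  by (intro continuous_intros space_B_cont[OF f])+
 have PV: "(Pw \<mu> (of_real s) ^^ n) f \<in> space_B \<gamma>" by (induction n) (auto intro: V f)
 have "(Pw \<mu> (of_real s) ^^ Suc n) f v = of_real (M.A (M.hom (%v. Re ((Pw \<mu> (of_real s) ^^ n) f v))) v)
   + \<i> * of_real (M.A (M.hom (%v. Im ((Pw \<mu> (of_real s) ^^ n) f v))) v)"
  using Pw_transfer[OF PV Suc.prems] by simp
 also have "M.A (M.hom (%v. Re ((Pw \<mu> (of_real s) ^^ n) f v))) v = (M.A ^^ Suc n) (M.hom (%v. Re (f v))) v"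
  by (rule hom_A_pow[OF c(1) Suc.prems]) (simp add: Suc.IH)
 also have "M.A (M.hom (%v. Im ((Pw \<mu> (of_real s) ^^ n) f v))) v = (M.A ^^ Suc n) (M.hom (%v. Im (f v))) v"
  by (rule hom_A_pow[OF c(2) Suc.prems]) (simp add: Suc.IH)
 finally show ?case .
qed

text \<open>Multiplication by \<open>rS\<close> and by its inverse \<open>rI\<close> on the simplex
  will conjugate \<open>R_op\<close> to \<open>Pw\<close>, so both have to belong to the algebra
  \<open>space_B\<close>.\<close>

definition rS :: "real ^ 'n => complex" where "rS v = (if v \<in> \<S> then of_real (rt v) else 0)"
definition rI :: "real ^ 'n => complex" where "rI v = (if v \<in> \<S> then of_real (1 / rt v) else 0)"

lemma rS_cont: "continuous_on \<S> rS"
 by (rule continuous_on_eq[of _ "%v. of_real (rt v)"]) (auto simp: rS_def intro!: continuous_intros rt_continuous)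

lemma rI_cont: "continuous_on \<S> rI"
proof (rule continuous_on_eq[of _ "%v. of_real (1 / rt v)"])
 show "continuous_on \<S> (%v. complex_of_real (1 / rt v))"
  using rt_pos[OF simplex_cone] by (intro continuous_intros rt_continuous) force
qed (simp add: rI_def)

lemma rS_rI_space:
 assumes \<gamma>: "0 < \<gamma>" "\<gamma> <= 1"
 shows "rS \<in> space_B \<gamma>" "rI \<in> space_B \<gamma>"
proof -
 obtain B where B: "0 <= B" "!!v. v \<in> \<S> ==> norm (rt v) <= B" using simplex_bounded[OF rt_continuous] by blast
 obtain \<delta> where \<delta>: "0 < \<delta>" "!!v. v \<in> \<S> ==> \<delta> <= rt v"
  using M.positive_min[OF rt_continuous] rt_pos simplex_cone by blast
 have h: "\<bar>rt u - rt v\<bar> <= (M.C2 * B) * d_hilbert u v powr \<gamma>" if "u \<in> \<S>" "v \<in> \<S>" for u v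
  using B by (intro M.cls_holder[OF rt_cls _ \<gamma> that]) force
 have C2: "0 <= M.C2 * B" using B by (simp add: M.C2_def)
 show "rS \<in> space_B \<gamma>"
 proof (rule space_B_I(1)[OF rS_cont _ _ B(1) _ C2])
  show "cmod (rS u - rS v) <= M.C2 * B * d_hilbert u v powr \<gamma>" if "u \<in> \<S>" "v \<in> \<S>" for u v
   using h[OF that] that by (simp add: rS_def flip: of_real_diff)
 qed (use B in \<open>auto simp: rS_def\<close>)
 show "rI \<in> space_B \<gamma>"
 proof (rule space_B_I(1)[OF rI_cont])
  show "0 <= 1 / \<delta>" "0 <= M.C2 * B / (\<delta> * \<delta>)" using \<delta>(1) C2 by auto
  show "cmod (rI v) <= 1 / \<delta>" if "v \<in> \<S>" for v
   using \<delta>(2)[OF that] \<delta>(1) that by (simp add: rI_def norm_divide frac_le)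
  show "cmod (rI u - rI v) <= M.C2 * B / (\<delta> * \<delta>) * d_hilbert u v powr \<gamma>" if uv: "u \<in> \<S>" "v \<in> \<S>" for u v
  proof -
   have p: "0 < rt u" "0 < rt v" using \<delta>(2)[OF uv(1)] \<delta>(2)[OF uv(2)] \<delta>(1) by auto
   have "1 / rt u - 1 / rt v = (rt v - rt u) / (rt u * rt v)" using p by (simp add: field_simps)
   moreover have "\<bar>(rt v - rt u) / (rt u * rt v)\<bar> <= ((M.C2 * B) * d_hilbert u v powr \<gamma>) / (\<delta> * \<delta>)"
    unfolding abs_divide using h[OF uv] \<delta>(2)[OF uv(1)] \<delta>(2)[OF uv(2)] \<delta>(1) p
    by (intro frac_le) (auto simp: abs_minus_commute abs_mult intro!: mult_mono)
   moreover have "cmod (rI u - rI v) = \<bar>1 / rt u - 1 / rt v\<bar>"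
   proof -
    have "rI u - rI v = of_real (1 / rt u - 1 / rt v)" using uv by (simp add: rI_def)
    then show ?thesis by (simp only: norm_of_real)
   qed
   ultimately show ?thesis by simp
  qed
 qed (simp add: rI_def)
qed

lemma kappa_pos: "0 < kappa \<mu> s" using T.k_pos by (simp add: kappa_T)

definition nr where "nr = M.L rt"

lemma nr_pos: "0 < nr"
proof -
 interpret pf: positive_functional \<S> M.L by (rule M.L_positive_functional)
 obtain \<delta> where \<delta>: "0 < \<delta>" "!!v. v \<in> \<S> ==> \<delta> <= rt v"
  using M.positive_min[OF rt_continuous] rt_pos simplex_cone by blast
 have "M.L (%v. \<delta> * 1) <= M.L rt" using \<delta> by (intro pf.L_mono rt_continuous continuous_intros) auto
 then show ?thesis using pf.L_scale[of "%_. 1" \<delta>] pf.L_one \<delta>(1) by (simp add: nr_def)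
qed

text \<open>\<open>kappa_T\<close> identifies \<open>kappa\<close> with the transposed eigenvalue.
  Pairing the eigenfunction with \<open>M.L\<close> gives \<open>k * L r = kappa * L r\<close>, and
  \<open>L r > 0\<close>.\<close>

lemma M_k: "M.k = kappa \<mu> s"
proof -
 interpret pf: positive_functional \<S> M.L by (rule M.L_positive_functional)
 have e: "M.A (M.hom rt) v = kappa \<mu> s * rt v" if v: "v \<in> \<S>" for v
 proof -
  have "M.A (M.hom rt) v = M.A rt v"
   using M.homog_hom[of rt] rt_cls
   by (intro M.A_cong M.hcls_homog M.hom_hcls rt_continuous M.cls_hcls simplex_cone v) (auto simp: M.cls_def)
  then show ?thesis using rt_eigen[OF simplex_cone[OF v]] by simp
 qed
 have "M.L (M.A (M.hom rt)) = M.L (%v. kappa \<mu> s * rt v)"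
  using pf.L_mono[of "M.A (M.hom rt)" "%v. kappa \<mu> s * rt v"] pf.L_mono[of "%v. kappa \<mu> s * rt v" "M.A (M.hom rt)"] e
   continuous_on_mult[OF continuous_on_const rt_continuous] M.A_hom_continuous[OF rt_continuous]
  by (intro antisym) auto
 then have "M.k * M.L rt = kappa \<mu> s * M.L rt"
  using M.L_eigen[OF rt_continuous] pf.L_scale[OF rt_continuous, of "kappa \<mu> s"] by simp
 then show ?thesis using nr_pos by (simp add: nr_def)
qed

lemma nu_eq: "nu \<mu> s = M.\<nu>"
proof -
 have "P_op \<mu> s = matrix_law_image.transfer s \<mu> (%g. g)"
  by (intro ext) (simp add: P_op_def matrix_law_image.transfer_def[OF M_image])
 then show ?thesis unfolding nu_def M_k[symmetric] using matrix_law_image.the_eigenmeasure[OF M_image] by simp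
qed

definition ell :: "(real ^ 'n => complex) => complex" where
 "ell f = (\<integral>v. f v \<partial>M.\<nu>) / of_real nr"

lemma ell_parts: "continuous_on \<S> f ==> ell f = of_real (M.L (%v. Re (f v)) / nr) + \<i> * of_real (M.L (%v. Im (f v)) / nr)"
proof -
 assume f: "continuous_on \<S> f"
 have c: "continuous_on \<S> (%v. Re (f v))" "continuous_on \<S> (%v. Im (f v))"
  by (intro continuous_intros f)+
 have "(\<integral>v. f v \<partial>M.\<nu>) = (\<integral>v. of_real (Re (f v)) + \<i> * of_real (Im (f v)) \<partial>M.\<nu>)" by (simp add: complex_eq[symmetric])
 also have "... = of_real (M.L (%v. Re (f v))) + \<i> * of_real (M.L (%v. Im (f v)))"
  using matrix_law_image.integral_complex_parts[OF M_image M.prob_\<nu> M.sets_\<nu> c] M.integral_\<nu>[OF c(1)] M.integral_\<nu>[OF c(2)] by simp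
 finally show ?thesis by (simp add: ell_def add_divide_distrib)
qed

lemma rt_pow: "x \<in> pcone ==> (M.A ^^ n) rt x = kappa \<mu> s ^ n * rt x"
proof (induction n arbitrary: x)
 case (Suc n)
 have h: "M.hcls rt" by (rule M.cls_hcls[OF rt_cls])
 have "(M.A ^^ Suc n) rt x = M.A (%x. kappa \<mu> s ^ n * rt x + 0 * rt x) x"
  using Suc by (simp, intro M.A_cong M.hcls_homog M.Apow_hcls h) (use M.hcls_lin[OF h h, of "kappa \<mu> s ^ n" 0] in auto)
 then show ?case using M.A_lin[OF h h Suc.prems, of "kappa \<mu> s ^ n" 0] rt_eigen[OF Suc.prems] by simp
qed simp

lemma ratio_limit:
 assumes f: "continuous_on \<S> f" and v: "v \<in> \<S>"
 shows "(%n. (M.A ^^ n) (M.hom f) v / (M.A ^^ n) rt v) \<longlonglongrightarrow> M.L f / nr"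
proof -
 have e: "(M.A ^^ n) (M.hom rt) v = (M.A ^^ n) rt v" for n
  using M.homog_hom[of rt] rt_cls
  by (intro M.Apow_cong M.hom_hcls rt_continuous M.cls_hcls simplex_cone v) (auto simp: M.cls_def)
 have "(%n. M.\<psi> n f v / M.\<psi> n rt v) \<longlonglongrightarrow> M.L f / nr"
  unfolding nr_def using nr_pos by (intro tendsto_divide M.\<psi>_lim f rt_continuous v) (simp add: nr_def)
 moreover have "M.\<psi> n f v / M.\<psi> n rt v = (M.A ^^ n) (M.hom f) v / (M.A ^^ n) rt v" for n
  unfolding M.\<psi>_def e using M.AN_pos[OF simplex_cone[OF v], of n] by simp
 ultimately show ?thesis by simp
qed

text \<open>With the denominator \<open>rt\<close>, for which
  \<open>(M.A ^^ n) rt = kappa ^ n * rt\<close>, the ratios in \<open>decay\<close> are the iterates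
  up to a known factor. Multiplication by \<open>rI\<close> stays in the Hoelder algebra and
  provides the initial bound \<open>h\<close>; real and imaginary parts are treated
  separately.\<close>

theorem real_gap:
 assumes \<gamma>: "0 < \<gamma>" "\<gamma> <= 1" and V: "!!\<phi>. \<phi> \<in> space_B \<gamma> ==> Pw \<mu> (of_real s) \<phi> \<in> space_B \<gamma>"
 shows "\<exists>C \<theta>. 0 <= C & 0 < \<theta> & \<theta> < 1 & (\<forall>\<phi>\<in>space_B \<gamma>. \<forall>n.
   norm_B \<gamma> ((Pw \<mu> (of_real s) ^^ n) \<phi> - sc (of_real (kappa \<mu> s ^ n) * ell \<phi>) rS) <= C * \<theta> ^ n * kappa \<mu> s ^ n * norm_B \<gamma> \<phi>)"
proof -
 obtain \<theta> C3 where \<theta>: "0 < \<theta>" "\<theta> < 1" "0 <= C3" and dec: "\<forall>F \<Phi> os h n u v. M.cls F --> M.hcls \<Phi> --> 0 <= os --> 0 <= h -->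
   M.reg \<gamma> os h (%x. \<Phi> x / F x) --> u \<in> \<S> --> v \<in> \<S> -->
   \<bar>(M.A ^^ n) \<Phi> u / (M.A ^^ n) F u - (M.A ^^ n) \<Phi> v / (M.A ^^ n) F v\<bar> <= C3 * \<theta> ^ n * (os + h) * d_hilbert u v powr \<gamma>"
  using M.decay[OF \<gamma>] by (elim exE conjE) (rule that)
 note rV = rS_rI_space[OF \<gamma>]
 define \<kappa> where "\<kappa> = kappa \<mu> s"
 have \<kappa>: "0 < \<kappa>" using kappa_pos by (simp add: \<kappa>_def)
 define Z where "Z f n v = (M.A ^^ n) (M.hom f) v / (M.A ^^ n) rt v" for f n v
 have real_est: "\<bar>Z f n u - Z f n v\<bar> <= C3 * \<theta> ^ n * (3 * h) * d_hilbert u v powr \<gamma>"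
  "\<bar>Z f n u - M.L f / nr\<bar> <= C3 * \<theta> ^ n * (3 * h)"
  if f: "continuous_on \<S> f" and h: "0 <= h" "!!x y. x \<in> \<S> ==> y \<in> \<S> ==> \<bar>f x / rt x - f y / rt y\<bar> <= h * d_hilbert x y powr \<gamma>"
   and u: "u \<in> \<S>" and v: "v \<in> \<S>" for f h n u v
 proof -
  have r: "M.reg \<gamma> (2 * h) h (%x. M.hom f x / rt x)"
   by (rule M.reg_holder) (use h \<gamma> in \<open>auto simp: M.hom_S\<close>)
  have est: "\<bar>Z f n u - Z f n v\<bar> <= C3 * \<theta> ^ n * (3 * h) * d_hilbert u v powr \<gamma>" if "u \<in> \<S>" "v \<in> \<S>" for u v
   using dec[rule_format, OF rt_cls M.hom_hcls[OF f] _ h(1) r that, of n] h(1) unfolding Z_def by simp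
  show "\<bar>Z f n u - Z f n v\<bar> <= C3 * \<theta> ^ n * (3 * h) * d_hilbert u v powr \<gamma>" by (rule est[OF u v])
  define B where "B = C3 * \<theta> ^ n * (3 * h)"
  have B0: "0 <= B" unfolding B_def using \<theta> h by auto
  have osc: "\<bar>Z f n x - Z f n u\<bar> <= B" if x: "x \<in> \<S>" for x
  proof -
   have "d_hilbert x u powr \<gamma> <= 1" using d_hilbert_bounds[OF x u] \<gamma> by (intro powr_le1) auto
   then have "B * d_hilbert x u powr \<gamma> <= B" using B0 by (intro mult_left_le) auto
   then show ?thesis by (rule order_trans[OF est[OF x u, folded B_def]])
  qed
  \<comment> \<open>The values at later times stay in the range of the ratio at time
    \<open>n\<close>, and so does the limit.\<close>
  have "\<bar>Z f m u - Z f n u\<bar> <= B" if "n <= m" for m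
  proof -
   have b: "Z f n u - B <= (M.A ^^ n) (M.hom f) x / (M.A ^^ n) rt x & (M.A ^^ n) (M.hom f) x / (M.A ^^ n) rt x <= Z f n u + B"
    if "x \<in> \<S>" for x using osc[OF that] unfolding Z_def abs_le_iff by linarith
   have "(M.A ^^ (m - n)) ((M.A ^^ n) F) = (M.A ^^ m) F" for F
    using that by (metis comp_apply funpow_add le_add_diff_inverse2)
   then have "Z f n u - B <= Z f m u" "Z f m u <= Z f n u + B"
    using M.ratio_bounds[OF M.Apow_cls[OF rt_cls] M.Apow_hcls[OF M.hom_hcls[OF f]] b simplex_cone[OF u], of "m - n"]
    by (simp_all add: Z_def)
   then show ?thesis by (simp add: abs_le_iff)
  qed
  then have "\<bar>M.L f / nr - Z f n u\<bar> <= B"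
   using ratio_limit[OF f u] unfolding Z_def[symmetric]
   by (intro LIMSEQ_le_const2[OF tendsto_rabs[OF tendsto_diff[OF _ tendsto_const]]]) auto
  then show "\<bar>Z f n u - M.L f / nr\<bar> <= C3 * \<theta> ^ n * (3 * h)" unfolding B_def by (simp add: abs_minus_commute)
 qed
 define C where "C = 3 * norm_B \<gamma> rS * (12 * C3 * (3 * norm_B \<gamma> rI))"
 have main: "norm_B \<gamma> ((Pw \<mu> (of_real s) ^^ n) \<phi> - sc (of_real (kappa \<mu> s ^ n) * ell \<phi>) rS) <= C * \<theta> ^ n * kappa \<mu> s ^ n * norm_B \<gamma> \<phi>"
  if \<phi>: "\<phi> \<in> space_B \<gamma>" for \<phi> n
 proof -
  define R where "R = (%v. Re (\<phi> v))"
  define I where "I = (%v. Im (\<phi> v))"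
  have c: "continuous_on \<S> R" "continuous_on \<S> I"
   unfolding R_def I_def by (intro continuous_intros space_B_cont[OF \<phi>])+
  define q where "q = (%v. \<phi> v * rI v)"
  have q: "q \<in> space_B \<gamma>" "norm_B \<gamma> q <= 3 * norm_B \<gamma> \<phi> * norm_B \<gamma> rI"
   unfolding q_def by (intro space_B_mult \<phi> rV)+
  define h where "h = norm_B \<gamma> q"
  have h0: "0 <= h" by (simp add: h_def)
  have qh: "cmod (q x - q y) <= h * d_hilbert x y powr \<gamma>" if "x \<in> \<S>" "y \<in> \<S>" for x y
   unfolding h_def by (rule space_B_holder[OF q(1) that])
  have hR: "\<bar>R x / rt x - R y / rt y\<bar> <= h * d_hilbert x y powr \<gamma>" if "x \<in> \<S>" "y \<in> \<S>" for x y
   using qh[OF that] abs_Re_le_cmod[of "q x - q y"] that by (simp add: q_def rI_def R_def Re_divide_of_real)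
  have hI: "\<bar>I x / rt x - I y / rt y\<bar> <= h * d_hilbert x y powr \<gamma>" if "x \<in> \<S>" "y \<in> \<S>" for x y
   using qh[OF that] abs_Im_le_cmod[of "q x - q y"] that by (simp add: q_def rI_def I_def Im_divide_of_real)
  define E where "E v = (if v \<in> \<S> then Complex (Z R n v - M.L R / nr) (Z I n v - M.L I / nr) else 0)" for v
  define b where "b = 2 * (C3 * \<theta> ^ n * (3 * h))"
  have b0: "0 <= b" using \<theta> h0 by (simp add: b_def)
  have nz: "(M.A ^^ n) rt v ~= 0" if "v \<in> \<S>" for v
   using M.clsD(1)[OF M.Apow_cls[OF rt_cls] simplex_cone[OF that], of n] by simp
  have Zc: "continuous_on \<S> (Z f n)" if f: "continuous_on \<S> f" for f
   unfolding Z_def using nz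
   by (intro continuous_intros M.Apow_continuous M.hom_hcls M.hom_continuous M.cls_hcls[OF rt_cls] rt_continuous f) blast
  have Ec: "continuous_on \<S> E"
   by (rule continuous_on_eq[of _ "%v. Complex (Z R n v - M.L R / nr) (Z I n v - M.L I / nr)"])
    (auto simp: E_def intro!: continuous_intros Zc c)
  have E1: "cmod (E v) <= b" if v: "v \<in> \<S>" for v
   using real_est(2)[OF c(1) h0 hR v v, of n] real_est(2)[OF c(2) h0 hI v v, of n] v
    cmod_le[of "E v"] by (simp add: E_def b_def)
  have E2: "cmod (E u - E v) <= b * d_hilbert u v powr \<gamma>" if uv: "u \<in> \<S>" "v \<in> \<S>" for u v
   using real_est(1)[OF c(1) h0 hR uv, of n] real_est(1)[OF c(2) h0 hI uv, of n] uv
    cmod_le[of "E u - E v"] by (simp add: E_def b_def algebra_simps)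
  have EV: "E \<in> space_B \<gamma>" "norm_B \<gamma> E <= b + b"
   by (rule space_B_I[OF Ec _ E1 b0 E2 b0]; simp add: E_def)+
  have eq: "(Pw \<mu> (of_real s) ^^ n) \<phi> - sc (of_real (kappa \<mu> s ^ n) * ell \<phi>) rS = sc (of_real (\<kappa> ^ n)) (%v. rS v * E v)"
  proof
   fix v
   show "((Pw \<mu> (of_real s) ^^ n) \<phi> - sc (of_real (kappa \<mu> s ^ n) * ell \<phi>) rS) v = sc (of_real (\<kappa> ^ n)) (%v. rS v * E v) v"
   proof (cases "v \<in> \<S>")
    case True
    have Zr: "(M.A ^^ n) (M.hom f) v = \<kappa> ^ n * rt v * Z f n v" for f
     using rt_pow[OF simplex_cone[OF True], of n] rt_pos[OF simplex_cone[OF True]] \<kappa> by (simp add: Z_def \<kappa>_def)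
    have P: "(Pw \<mu> (of_real s) ^^ n) \<phi> v = Complex (\<kappa> ^ n * rt v * Z R n v) (\<kappa> ^ n * rt v * Z I n v)"
     using Pw_pow_transfer[OF V \<phi> True, of n] unfolding R_def[symmetric] I_def[symmetric] Zr
     by (simp add: complex_eq_iff)
    have l: "ell \<phi> = Complex (M.L R / nr) (M.L I / nr)"
     using ell_parts[OF space_B_cont[OF \<phi>]] by (simp add: complex_eq_iff R_def I_def)
    have k: "complex_of_real (kappa \<mu> s ^ n) = of_real (\<kappa> ^ n)" by (simp add: \<kappa>_def)
    show ?thesis using True unfolding minus_apply sc_apply P l k
     by (simp only: complex_eq_iff) (simp add: rS_def E_def algebra_simps)
   next
    case False
    have "(Pw \<mu> (of_real s) ^^ n) \<phi> \<in> space_B \<gamma>" by (induction n) (auto intro: V \<phi>)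
    then show ?thesis using False space_B_outside by (auto simp: rS_def)
   qed
  qed
  have "norm_B \<gamma> ((Pw \<mu> (of_real s) ^^ n) \<phi> - sc (of_real (kappa \<mu> s ^ n) * ell \<phi>) rS) = \<kappa> ^ n * norm_B \<gamma> (%v. rS v * E v)"
   unfolding eq using \<kappa> by (subst norm_B_sc[OF space_B_mult(1)[OF rV(1) EV(1)]]) (simp add: norm_power)
  also have "... <= \<kappa> ^ n * (3 * norm_B \<gamma> rS * (b + b))"
   using order_trans[OF space_B_mult(2)[OF rV(1) EV(1)] mult_left_mono[OF EV(2)]] \<kappa>
   by (intro mult_left_mono) simp_all
  also have "... = \<kappa> ^ n * (3 * norm_B \<gamma> rS * (12 * C3 * \<theta> ^ n)) * h" by (simp add: b_def)
  also have "... <= \<kappa> ^ n * (3 * norm_B \<gamma> rS * (12 * C3 * \<theta> ^ n)) * (3 * norm_B \<gamma> \<phi> * norm_B \<gamma> rI)"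
   using q(2) \<kappa> \<theta> unfolding h_def by (intro mult_left_mono) auto
  also have "... = C * \<theta> ^ n * kappa \<mu> s ^ n * norm_B \<gamma> \<phi>" by (simp add: C_def \<kappa>_def)
  finally show ?thesis .
 qed
 have "0 <= C" unfolding C_def using \<theta> by simp
 then show ?thesis using main \<theta> by blast
qed

end

subsection \<open>An equivalent norm that exhibits a spectral gap in one step\<close>

locale gapped = fspace V nm
 for V :: "('x => complex) set" and nm :: "('x => complex) => real" +
 fixes T :: "('x => complex) => 'x => complex" and l :: "('x => complex) => complex" and C \<theta> Cb :: real
 assumes T_V: "f \<in> V ==> T f \<in> V"
  and T_add: "f \<in> V ==> h \<in> V ==> T (f + h) = T f + T h"
  and T_sc: "f \<in> V ==> T (sc c f) = sc c (T f)"
  and T_bd: "f \<in> V ==> nm (T f) <= Cb * nm f" and Cb: "0 <= Cb"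
  and gap: "f \<in> V ==> l f = 0 ==> nm ((T ^^ n) f) <= C * \<theta> ^ n * nm f"
  and \<theta>: "0 < \<theta>" "\<theta> < 1" and C: "0 <= C"
begin

definition \<theta>1 where "\<theta>1 = (1 + \<theta>) / 2"
lemma \<theta>1: "0 < \<theta>1" "\<theta>1 < 1" "\<theta> < \<theta>1" using \<theta> by (auto simp: \<theta>1_def)

definition n0 where "n0 = (SOME n. 0 < n & C * (\<theta> / \<theta>1) ^ n <= 1)"
text \<open>The adapted norm: applying \<open>T\<close> shifts the sum, so that one step gains the
  factor \<open>\<theta>1\<close> up to the difference of the two boundary terms. \<open>n0\<close>
  is chosen so that on the kernel of \<open>l\<close> this difference has the right sign.\<close>

definition anm where "anm f = (\<Sum>j<n0. (1 / \<theta>1) ^ j * nm ((T ^^ j) f))"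
definition E where "E = (\<Sum>j<n0. (1 / \<theta>1) ^ j * Cb ^ j)"

lemma n0: "0 < n0" "C * (\<theta> / \<theta>1) ^ n0 <= 1"
proof -
 have "(%n. C * (\<theta> / \<theta>1) ^ n) \<longlonglongrightarrow> C * 0"
  using \<theta> \<theta>1 by (intro tendsto_mult tendsto_const LIMSEQ_power_zero) simp
 then have "eventually (%n. C * (\<theta> / \<theta>1) ^ n < 1) sequentially" by (intro order_tendstoD(2)[of _ 0]) simp_all
 then have "eventually (%n. 0 < n & C * (\<theta> / \<theta>1) ^ n <= 1) sequentially"
  using eventually_gt_at_top[of 0] by eventually_elim simp
 then have "\<exists>n. 0 < n & C * (\<theta> / \<theta>1) ^ n <= 1" by (auto dest: eventually_happens)
 then show "0 < n0" "C * (\<theta> / \<theta>1) ^ n0 <= 1" unfolding n0_def by (metis (mono_tags, lifting) someI_ex)+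
qed

lemma Tp_V: "f \<in> V ==> (T ^^ j) f \<in> V" by (induction j) (auto intro: T_V)
lemma Tp_add: "f \<in> V ==> h \<in> V ==> (T ^^ j) (f + h) = (T ^^ j) f + (T ^^ j) h"
proof (induction j)
 case (Suc j)
 then show ?case unfolding funpow.simps comp_apply Suc.IH[OF Suc.prems] by (intro T_add Tp_V)
qed simp
lemma Tp_sc: "f \<in> V ==> (T ^^ j) (sc c f) = sc c ((T ^^ j) f)"
proof (induction j)
 case (Suc j)
 then show ?case unfolding funpow.simps comp_apply Suc.IH[OF Suc.prems] by (intro T_sc Tp_V)
qed simp
lemma Tp_bd: "f \<in> V ==> nm ((T ^^ j) f) <= Cb ^ j * nm f"
proof (induction j)
 case (Suc j)
 then show ?case using order_trans[OF T_bd[OF Tp_V[OF Suc.prems]] mult_left_mono[OF Suc.IH[OF Suc.prems] Cb]] by (simp add: mult_ac)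
qed simp

lemma nm_le_anm: "f \<in> V ==> nm f <= anm f"
proof -
 assume f: "f \<in> V"
 have "(\<Sum>j\<in>{0}. (1 / \<theta>1) ^ j * nm ((T ^^ j) f)) <= anm f"
  unfolding anm_def using n0 \<theta>1 f by (intro sum_mono2) (auto intro!: mult_nonneg_nonneg divide_nonneg_nonneg nm_nonneg Tp_V)
 then show ?thesis by simp
qed

lemma anm_le: "f \<in> V ==> anm f <= E * nm f"
 unfolding anm_def E_def sum_distrib_right using \<theta>1 Tp_bd
 by (intro sum_mono) (auto simp: mult.assoc intro!: mult_left_mono)

lemma E_nonneg: "0 <= E" unfolding E_def using \<theta>1 Cb by (intro sum_nonneg) auto

lemma anm_fspace: "fspace V anm"
proof
 fix f h c assume f: "f \<in> V"
 show "anm (sc c f) = cmod c * anm f"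
  unfolding anm_def sum_distrib_left using f by (intro sum.cong refl) (simp add: Tp_sc nm_sc Tp_V)
 show "cmod (f x) <= anm f" for x using nm_ev[OF f, where x=x] nm_le_anm[OF f] by linarith
 assume h: "h \<in> V"
 show "anm (f + h) <= anm f + anm h"
  unfolding anm_def sum.distrib[symmetric] distrib_left[symmetric] Tp_add[OF f h]
  using \<theta>1 by (intro sum_mono mult_left_mono nm_add Tp_V f h) auto
next
 fix F :: "nat => 'x => complex"
 assume F: "!!n. F n \<in> V" and ca: "!!e. 0 < e ==> \<exists>N. \<forall>n\<ge>N. \<forall>m\<ge>N. anm (F n - F m) < e"
 have cauchy: "\<exists>N. \<forall>n\<ge>N. \<forall>m\<ge>N. nm (F n - F m) < e" if "0 < e" for e
 proof -
  obtain N where N: "\<forall>n\<ge>N. \<forall>m\<ge>N. anm (F n - F m) < e" using ca[OF \<open>0 < e\<close>] by blast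
  have "nm (F n - F m) < e" if "n >= N" "m >= N" for n m
   using N[rule_format, of n m] that nm_le_anm[OF V_diff[OF F F], of n m] by linarith
  then show ?thesis by blast
 qed
 obtain f where f: "f \<in> V" "(%n. nm (F n - f)) \<longlonglongrightarrow> 0" using complete[OF F cauchy] by blast
 have "(%n. anm (F n - f)) \<longlonglongrightarrow> 0"
 proof (rule real_tendsto_sandwich[OF _ _ tendsto_const])
  show "\<forall>\<^sub>F n in sequentially. 0 <= anm (F n - f)"
   by (intro always_eventually allI order_trans[OF nm_nonneg nm_le_anm] V_diff F f(1))
  show "\<forall>\<^sub>F n in sequentially. anm (F n - f) <= E * nm (F n - f)" using anm_le[OF V_diff[OF F f(1)]] by simp
  show "(%n. E * nm (F n - f)) \<longlonglongrightarrow> 0" using tendsto_mult_right_zero[OF f(2)] .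
 qed
 then show "\<exists>f\<in>V. (%n. anm (F n - f)) \<longlonglongrightarrow> 0" using f by blast
qed (auto intro: V_0 V_add V_sc)

lemma anm_contr:
 assumes f: "f \<in> V" "l f = 0"
 shows "anm (T f) <= \<theta>1 * anm f"
proof -
 define x where "x j = (1 / \<theta>1) ^ j * nm ((T ^^ j) f)" for j
 have "anm (T f) = (\<Sum>j<n0. \<theta>1 * x (Suc j))"
  unfolding anm_def x_def using \<theta>1 by (intro sum.cong refl) (simp add: funpow_swap1)
 also have "... = \<theta>1 * (\<Sum>j<n0. x (Suc j))" by (simp add: sum_distrib_left)
 also have "(\<Sum>j<n0. x (Suc j)) = (\<Sum>j<Suc n0. x j) - x 0"
  by (simp only: sum.lessThan_Suc_shift)
 also have "... = anm f + (x n0 - x 0)" by (simp add: anm_def x_def)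
 also have "x n0 <= x 0"
 proof -
  have "x n0 <= (1 / \<theta>1) ^ n0 * (C * \<theta> ^ n0 * nm f)"
   unfolding x_def using gap[OF f] \<theta>1 by (intro mult_left_mono) auto
  also have "... = (C * (\<theta> / \<theta>1) ^ n0) * nm f" by (simp add: power_divide)
  also have "... <= 1 * nm f" using n0 nm_nonneg[OF f(1)] by (intro mult_right_mono)
  finally show ?thesis by (simp add: x_def)
 qed
 then have "\<theta>1 * (anm f + (x n0 - x 0)) <= \<theta>1 * anm f" using \<theta>1 by (intro mult_left_mono) auto
 finally show ?thesis .
qed

end

subsection \<open>The operators with complex exponent\<close>

lemma exp_minus_1_bound: "cmod (exp z - 1) <= cmod z * exp (cmod z)"
proof -
 have "norm (exp z - (\<Sum>i\<le>0. z ^ i / fact i)) <= exp (norm z) * (norm z ^ Suc 0) / fact 0"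
  by (rule Taylor_exp_field)
 then show ?thesis by (simp add: mult.commute)
qed

text \<open>Used in both directions, it bounds the variation of \<open>ln (l1norm (g *v v))\<close>
  by \<open>- ln (cr u v)\<close>, uniformly in \<open>g\<close>.\<close>

lemma cr_l1norm_le:
 assumes "pos_mat g" and u: "u \<in> \<S>" and v: "v \<in> \<S>"
 shows "cr u v * l1norm (g *v v) <= l1norm (g *v u)"
proof -
 have gp: "0 <= g $ i $ j" for i j using assms(1) by (simp add: pos_mat_def less_imp_le)
 have c: "cr u v * v $ j <= u $ j" for j
 proof -
  have "cr u v <= m_ratio u v"
   unfolding cr_def using m_ratio_0[OF u v] m_ratio_1[OF v u] by (intro mult_left_le)
  then have "cr u v * v $ j <= m_ratio u v * v $ j" using simplex_D(1)[OF v] by (intro mult_right_mono) auto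
  then show ?thesis using m_ratio_le[OF u v, of j] by linarith
 qed
 have nn: "0 <= (g *v x) $ i" if "x \<in> \<S>" for x i
  unfolding mat_vec_nth using gp simplex_D(1)[OF that] by (intro sum_nonneg) auto
 have "cr u v * (g *v v) $ i <= (g *v u) $ i" for i
  unfolding mat_vec_nth sum_distrib_left mult.left_commute[of "cr u v"]
  by (intro sum_mono mult_left_mono c gp)
 then show ?thesis unfolding l1norm_def sum_distrib_left using nn[OF u] nn[OF v] by (intro sum_mono) simp
qed

text \<open>A power with exponent between \<open>a\<close> and \<open>b\<close> is at most the sum
  of the two extreme powers, so one integrable \<open>Bd\<close> dominates the integrands for all
  \<open>w\<close> in the strip.\<close>

locale strip_law =
 fixes \<mu> :: "(real ^ 'n ^ 'n) measure" and a b \<gamma> :: real and Bd :: "real ^ 'n ^ 'n => real"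
 assumes law\<mu>: "law_on_nonneg_mats \<mu>" and \<gamma>: "0 < \<gamma>" "\<gamma> <= 1"
  and strip_AE: "AE g in \<mu>. pos_mat g & (\<forall>v\<in>\<S>. l1norm (g *v v) powr a + l1norm (g *v v) powr b <= Bd g)"
  and Bd_int: "integrable \<mu> Bd"
begin

abbreviation V :: "(real ^ 'n => complex) set" where "V \<equiv> space_B \<gamma>"
abbreviation nB :: "(real ^ 'n => complex) => real" where "nB \<equiv> norm_B \<gamma>"

abbreviation X where "X w g v \<equiv> exp (w * complex_of_real (ln (l1norm (g *v v))))"
abbreviation ok where "ok g \<equiv> pos_mat g & (\<forall>v\<in>\<S>. l1norm (g *v v) powr a + l1norm (g *v v) powr b <= Bd g)"

definition Hc :: "complex => real" where "Hc w = 4 + 4 * cmod w * exp (2 * cmod w)"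
definition B1 where "B1 = (\<integral>g. Bd g \<partial>\<mu>)"

lemma Hc_nonneg: "0 <= Hc w" by (simp add: Hc_def)

lemma X_bound:
 assumes "ok g" "v \<in> \<S>" "a <= Re w" "Re w <= b"
 shows "cmod (X w g v) <= Bd g"
proof -
 let ?N = "l1norm (g *v v)"
 have N: "0 < ?N" using pos_mat_act(3) assms by blast
 have "cmod (X w g v) = ?N powr Re w" using N by (simp add: powr_def)
 also have "... <= ?N powr a + ?N powr b"
 proof (cases "1 <= ?N")
  case True
  then have "?N powr Re w <= ?N powr b" using assms by (intro powr_mono) auto
  then show ?thesis by (simp add: add_increasing)
 next
  case False
  then have "?N powr Re w <= ?N powr a" using N assms by (intro powr_mono') auto
  then show ?thesis by (simp add: add_increasing2)
 qed
 also have "... <= Bd g" using assms by blast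
 finally show ?thesis .
qed

text \<open>Distant pairs, with \<open>d >= 1/2\<close>, need only the supremum bound because
  \<open>2 <= 4 d\<close>. For close pairs \<open>ln\<close> of the norm varies by at most
  \<open>4 d\<close>, and \<open>exp_minus_1_bound\<close> transfers this to the power;
  \<open>Hc\<close> collects both constants.\<close>

lemma X_holder:
 assumes g: "ok g" and u: "u \<in> \<S>" and v: "v \<in> \<S>" and w: "a <= Re w" "Re w <= b"
 shows "cmod (X w g u - X w g v) <= Hc w * Bd g * d_hilbert u v powr \<gamma>"
proof -
 define d where "d = d_hilbert u v"
 have d: "0 <= d" "d <= 1" using d_hilbert_bounds[OF u v] by (auto simp: d_def)
 have B: "0 <= Bd g" by (rule order_trans[OF norm_ge_zero X_bound[OF g v w]])
 have dg: "d <= d powr \<gamma>"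
 proof (cases "d = 0")
  case False
  then have "d powr 1 <= d powr \<gamma>" using d \<gamma> by (intro powr_mono') auto
  then show ?thesis using d by simp
 qed simp
 show ?thesis
 proof (cases "d < 1/2")
  case False
  have "cmod (X w g u - X w g v) <= 2 * Bd g"
   using norm_triangle_ineq4[of "X w g u" "X w g v"] X_bound[OF g u w] X_bound[OF g v w] by linarith
  also have "2 * Bd g = 4 * Bd g * (1/2)" by simp
  also have "... <= Hc w * Bd g * d powr \<gamma>"
   using False dg B by (intro mult_mono) (auto simp: Hc_def)
  finally show ?thesis by (simp add: d_def)
 next
  case True
  have crd: "cr u v = (1 - d) / (1 + d)" unfolding d_def by (rule d_hilbert_bounds(3)[OF u v])
  then have cr0: "0 < cr u v" using True d by simp
  define Nu where "Nu = l1norm (g *v u)"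
  define Nv where "Nv = l1norm (g *v v)"
  have N: "0 < Nu" "0 < Nv" unfolding Nu_def Nv_def using pos_mat_act(3) g u v by blast+
  have lnle: "ln x - ln y <= 4 * d" if "0 < x" "0 < y" "cr u v * x <= y" for x y
  proof -
   have "ln (cr u v * x) <= ln y" using that cr0 by (intro ln_mono) auto
   then have "ln x - ln y <= - ln (cr u v)" using that cr0 by (simp add: ln_mult)
   also have "... = ln (1 / cr u v)" using cr0 by (simp add: ln_div)
   also have "... <= 1 / cr u v - 1" using cr0 by (intro ln_le_minus_one) simp
   also have "... = 2 * d / (1 - d)" unfolding crd using True d by (simp add: field_simps)
   also have "... <= 4 * d"
   proof -
    have "d * d <= d * (1 / 2)" using True d by (intro mult_left_mono) auto
    then show ?thesis using True by (simp add: divide_le_eq algebra_simps)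
   qed
   finally show ?thesis .
  qed
  define \<delta> where "\<delta> = ln Nu - ln Nv"
  have \<delta>: "\<bar>\<delta>\<bar> <= 4 * d"
   using lnle[of Nu Nv] lnle[of Nv Nu] N cr_l1norm_le[OF _ u v] cr_l1norm_le[OF _ v u] g
   by (auto simp: \<delta>_def Nu_def Nv_def cr_commute[of v u] abs_le_iff)
  have cw: "cmod (w * of_real \<delta>) <= cmod w * (4 * d)"
   using \<delta> by (simp add: norm_mult mult_left_mono)
  have "X w g u = X w g v * exp (w * of_real \<delta>)"
   by (simp add: \<delta>_def Nu_def Nv_def algebra_simps flip: exp_add)
  then have "cmod (X w g u - X w g v) = cmod (X w g v) * cmod (exp (w * of_real \<delta>) - 1)"
   by (metis norm_mult right_diff_distrib mult.right_neutral)
  also have "... <= Bd g * ((cmod w * (4 * d)) * exp (2 * cmod w))"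
  proof (intro mult_mono X_bound[OF g v w] B)
   have "cmod (w * of_real \<delta>) * exp (cmod (w * of_real \<delta>)) <= (cmod w * (4 * d)) * exp (2 * cmod w)"
   proof (intro mult_mono cw)
    have "cmod w * (4 * d) <= cmod w * 2" using True by (intro mult_left_mono) auto
    then show "exp (cmod (w * complex_of_real \<delta>)) <= exp (2 * cmod w)" unfolding exp_le_cancel_iff using cw by linarith
   qed (use d in auto)
   then show "cmod (exp (w * of_real \<delta>) - 1) <= (cmod w * (4 * d)) * exp (2 * cmod w)"
    by (rule order_trans[OF exp_minus_1_bound])
  qed auto
  also have "... = (4 * cmod w * exp (2 * cmod w)) * Bd g * d" by simp
  also have "... <= Hc w * Bd g * d powr \<gamma>"
   using B dg d by (intro mult_mono) (auto simp: Hc_def)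
  finally show ?thesis by (simp add: d_def)
 qed
qed

text \<open>Birkhoff's contraction with the trivial bound \<open>p = 0\<close>, whose factor is
  1.\<close>

lemma act_contract: "pos_mat g ==> u \<in> \<S> ==> v \<in> \<S> ==> d_hilbert (act g u) (act g v) <= d_hilbert u v"
 using birkhoff_contraction[of g 0 u v] by (simp add: cross_ratio_bound_def pos_mat_def less_imp_le)

lemma integrand_bounds:
 assumes g: "ok g" and w: "a <= Re w" "Re w <= b" and f: "f \<in> V"
 shows "v \<in> \<S> ==> cmod (X w g v * f (act g v)) <= Bd g * nB f"
  and "u \<in> \<S> ==> v \<in> \<S> ==>
   cmod (X w g u * f (act g u) - X w g v * f (act g v)) <= ((Hc w + 1) * nB f * d_hilbert u v powr \<gamma>) * Bd g"
proof -
 show "cmod (X w g v * f (act g v)) <= Bd g * nB f" if v: "v \<in> \<S>" for v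
  unfolding norm_mult
  by (intro mult_mono X_bound[OF g v w] space_B_bound[OF f] order_trans[OF norm_ge_zero X_bound[OF g v w]]) simp
 assume u: "u \<in> \<S>" and v: "v \<in> \<S>"
 have B: "0 <= Bd g" by (rule order_trans[OF norm_ge_zero X_bound[OF g v w]])
 have p: "pos_mat g" using g by simp
 let ?D = "d_hilbert u v powr \<gamma>"
 have "X w g u * f (act g u) - X w g v * f (act g v)
   = (X w g u - X w g v) * f (act g u) + X w g v * (f (act g u) - f (act g v))" by (simp add: algebra_simps)
 then have "cmod (X w g u * f (act g u) - X w g v * f (act g v))
   <= cmod (X w g u - X w g v) * cmod (f (act g u)) + cmod (X w g v) * cmod (f (act g u) - f (act g v))"
  unfolding norm_mult[symmetric] by (simp only: norm_triangle_ineq)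
 also have "... <= (Hc w * Bd g * ?D) * nB f + Bd g * (nB f * ?D)"
 proof (intro add_mono mult_mono X_holder[OF g u v w] X_bound[OF g v w] space_B_bound[OF f] B)
  have "cmod (f (act g u) - f (act g v)) <= nB f * d_hilbert (act g u) (act g v) powr \<gamma>"
   using pos_mat_act(1)[OF p] u v by (intro space_B_holder[OF f])
  also have "... <= nB f * ?D"
   using act_contract[OF p u v] d_hilbert_bounds(1)[OF pos_mat_act(1)[OF p u] pos_mat_act(1)[OF p v]] \<gamma>
   by (intro mult_left_mono powr_mono2) auto
  finally show "cmod (f (act g u) - f (act g v)) <= nB f * ?D" .
 qed (use B Hc_nonneg in auto)
 finally show "cmod (X w g u * f (act g u) - X w g v * f (act g v)) <= ((Hc w + 1) * nB f * ?D) * Bd g"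
  by (simp add: algebra_simps)
qed

lemma act_continuous: "pos_mat g ==> continuous_on \<S> (act g)"
 unfolding act_def using pos_mat_act(3)[of g] by (intro continuous_intros) fastforce

lemma Pw_integrable:
 assumes "a <= Re w" "Re w <= b" "f \<in> V" "v \<in> \<S>"
 shows "integrable \<mu> (%g. X w g v * f (act g v))"
proof (rule Bochner_Integration.integrable_bound[of _ "%g. Bd g * nB f"])
 show "AE g in \<mu>. norm (X w g v * f (act g v)) <= norm (Bd g * nB f)"
  using strip_AE
 proof eventually_elim
  case (elim g)
  show ?case by (rule order_trans[OF integrand_bounds(1)[OF elim assms]]) simp
 qed
qed (use Bd_int law_measurable_integrand[OF law\<mu> space_B_borel[OF assms(3)]] in auto)

lemma B1_nonneg: "0 <= B1" if "a <= b"
 unfolding B1_def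
proof (rule integral_nonneg_AE)
 show "AE g in \<mu>. 0 <= Bd g"
  using strip_AE
 proof eventually_elim
  case (elim g)
  then have "cmod (X (of_real a) g center) <= Bd g" using that by (intro X_bound center_simplex) auto
  then show ?case by (rule order_trans[OF norm_ge_zero])
 qed
qed

lemma Pw_V:
 assumes w: "a <= Re w" "Re w <= b" and f: "f \<in> V"
 shows "Pw \<mu> w f \<in> V" "nB (Pw \<mu> w f) <= (Hc w + 2) * B1 * nB f"
proof -
 let ?P = "%v. \<integral>g. X w g v * f (act g v) \<partial>\<mu>"
 have B0: "0 <= B1" using B1_nonneg w by simp
 have b1: "cmod (?P v) <= B1 * nB f" if v: "v \<in> \<S>" for v
 proof -
  have "cmod (?P v) <= (\<integral>g. cmod (X w g v * f (act g v)) \<partial>\<mu>)" by (rule integral_norm_bound)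
  also have "... <= (\<integral>g. Bd g * nB f \<partial>\<mu>)"
  proof (rule integral_mono_AE)
   show "AE g in \<mu>. cmod (X w g v * f (act g v)) <= Bd g * nB f"
    using strip_AE by eventually_elim (rule integrand_bounds(1)[OF _ w f v])
  qed (use Bd_int integrable_norm[OF Pw_integrable[OF w f v]] in auto)
  finally show ?thesis by (simp add: B1_def)
 qed
 have b2: "cmod (?P u - ?P v) <= ((Hc w + 1) * nB f * B1) * d_hilbert u v powr \<gamma>"
  if u: "u \<in> \<S>" and v: "v \<in> \<S>" for u v
 proof -
  have i: "integrable \<mu> (%g. X w g u * f (act g u) - X w g v * f (act g v))"
   by (intro Bochner_Integration.integrable_diff Pw_integrable w f u v)
  have "cmod (?P u - ?P v) = cmod (\<integral>g. X w g u * f (act g u) - X w g v * f (act g v) \<partial>\<mu>)"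
   by (subst Bochner_Integration.integral_diff) (auto intro: Pw_integrable w f u v)
  also have "... <= (\<integral>g. cmod (X w g u * f (act g u) - X w g v * f (act g v)) \<partial>\<mu>)"
   by (rule integral_norm_bound)
  also have "... <= (\<integral>g. ((Hc w + 1) * nB f * d_hilbert u v powr \<gamma>) * Bd g \<partial>\<mu>)"
  proof (rule integral_mono_AE)
   show "AE g in \<mu>. cmod (X w g u * f (act g u) - X w g v * f (act g v)) <= ((Hc w + 1) * nB f * d_hilbert u v powr \<gamma>) * Bd g"
    using strip_AE by eventually_elim (rule integrand_bounds(2)[OF _ w f u v])
  qed (use Bd_int integrable_norm[OF i] in auto)
  finally show ?thesis by (simp add: B1_def mult_ac)
 qed
 have c: "continuous_on \<S> ?P"
 proof (rule continuous_on_integral)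
  show "(%g. X w g v * f (act g v)) \<in> borel_measurable \<mu>" for v
   by (rule law_measurable_integrand[OF law\<mu> space_B_borel[OF f]])
  show "integrable \<mu> (%g. Bd g * nB f)" using Bd_int by simp
  show "AE g in \<mu>. continuous_on \<S> (%v. X w g v * f (act g v)) & (\<forall>v\<in>\<S>. cmod (X w g v * f (act g v)) <= Bd g * nB f)"
   using strip_AE
  proof eventually_elim
   case (elim g)
   then have p: "pos_mat g" by simp
   have nz: "\<forall>v\<in>\<S>. l1norm (g *v v) ~= 0" using pos_mat_act(3)[OF p] by fastforce
   have "continuous_on \<S> (%v. f (act g v))"
    using pos_mat_act(1)[OF p] by (intro continuous_on_compose2[OF space_B_cont[OF f] act_continuous[OF p]]) auto
   then show ?case using nz integrand_bounds(1)[OF elim w f]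
    by (intro conjI ballI continuous_intros) auto
  qed
 qed
 have c': "continuous_on \<S> (Pw \<mu> w f)" by (rule continuous_on_eq[OF c]) (simp add: Pw_def)
 note I = space_B_I[OF c', of "B1 * nB f" "(Hc w + 1) * nB f * B1" \<gamma>]
 show "Pw \<mu> w f \<in> V"
  using b1 b2 B0 Hc_nonneg[of w] by (intro I(1)) (auto simp: Pw_def)
 have "nB (Pw \<mu> w f) <= B1 * nB f + (Hc w + 1) * nB f * B1"
  using b1 b2 B0 Hc_nonneg[of w] by (intro I(2)) (auto simp: Pw_def)
 then show "nB (Pw \<mu> w f) <= (Hc w + 2) * B1 * nB f" by (simp add: algebra_simps)
qed

lemma Pw_add:
 assumes "a <= Re w" "Re w <= b" "f \<in> V" "h \<in> V"
 shows "Pw \<mu> w (f + h) = Pw \<mu> w f + Pw \<mu> w h"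
 using Pw_integrable[OF assms(1,2,3)] Pw_integrable[OF assms(1,2,4)]
 by (intro ext) (simp add: Pw_def plus_fun_def distrib_left)

lemma Pw_sc: "Pw \<mu> w (sc c f) = sc c (Pw \<mu> w f)"
 by (intro ext) (simp add: Pw_def mult.left_commute)

lemma Pw_hol:
 assumes D: "open D" "!!w. w \<in> D ==> a <= Re w & Re w <= b"
  and f: "!!w. w \<in> D ==> f w \<in> V" "!!x. (%w. f w x) holomorphic_on D" "!!w. w \<in> D ==> nB (f w) <= B"
 shows "(%w. Pw \<mu> w (f w) x) holomorphic_on D"
proof (cases "x \<in> \<S>")
 case True
 have "(%w. \<integral>g. X w g x * f w (act g x) \<partial>\<mu>) holomorphic_on D"
 proof (rule holomorphic_integral[OF D(1)])
  show "(%g. X w g x * f w (act g x)) \<in> borel_measurable \<mu>" if "w \<in> D" for w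
   by (rule law_measurable_integrand[OF law\<mu> space_B_borel[OF f(1)[OF that]]])
  show "integrable \<mu> (%g. Bd g * \<bar>B\<bar>)" using Bd_int by simp
  show "AE g in \<mu>. (%w. X w g x * f w (act g x)) holomorphic_on D & (\<forall>w\<in>D. cmod (X w g x * f w (act g x)) <= Bd g * \<bar>B\<bar>)"
   using strip_AE
  proof eventually_elim
   case (elim g)
   have "cmod (X w g x * f w (act g x)) <= Bd g * \<bar>B\<bar>" if w: "w \<in> D" for w
   proof -
    have s: "a <= Re w" "Re w <= b" using D(2)[OF w] by auto
    have "0 <= Bd g" by (rule order_trans[OF norm_ge_zero X_bound[OF elim True s]])
    then have "Bd g * nB (f w) <= Bd g * \<bar>B\<bar>" using f(3)[OF w] by (intro mult_left_mono) auto
    then show ?thesis using integrand_bounds(1)[OF elim s f(1)[OF w] True] by linarith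
   qed
   then show ?case by (intro conjI ballI holomorphic_intros f(2)) auto
  qed
 qed
 then show ?thesis using True by (simp add: Pw_def)
qed (simp add: Pw_def)

text \<open>The scalar estimate is applied to values and to differences at two points. In
  \<open>20 Q / r\<close> the second order term accounts for 16 and the derivative for 4; supremum
  and Hoelder part together double it.\<close>

lemma Pw_lipschitz:
 assumes z: "!!w. w \<in> ball z r ==> a <= Re w & Re w <= b" and r: "0 < r" and w: "cmod (w - z) <= r / 2" and \<phi>: "\<phi> \<in> V"
  and Q: "!!w. w \<in> ball z r ==> (Hc w + 2) * B1 <= Q"
 shows "nB (Pw \<mu> w \<phi> - Pw \<mu> z \<phi>) <= 40 * Q / r * cmod (w - z) * nB \<phi>"
proof -
 let ?n = "nB \<phi>"
 have strip: "a <= Re w" "Re w <= b" if "w \<in> ball z r" for w using z[OF that] by auto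
 have PV: "Pw \<mu> w \<phi> \<in> V" if "w \<in> ball z r" for w using Pw_V(1)[OF strip[OF that] \<phi>] .
 have nb: "nB (Pw \<mu> w \<phi>) <= Q * ?n" if "w \<in> ball z r" for w
  using Pw_V(2)[OF strip[OF that] \<phi>] mult_right_mono[OF Q[OF that], of ?n] by simp
 have Q0: "0 <= Q"
 proof -
  have c: "z \<in> ball z r" using r by simp
  have "a <= b" using strip[OF c] by linarith
  then have "0 <= (Hc z + 2) * B1" using Hc_nonneg[of z] B1_nonneg by simp
  then show ?thesis using Q[OF c] by linarith
 qed
 have holP: "(%w. Pw \<mu> w \<phi> v) holomorphic_on ball z r" for v
  by (rule Pw_hol[where B = ?n]) (use z \<phi> in auto)
 have est: "cmod (f w - f z) <= (20 * Q / r * cmod (w - z) * ?n) * t"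
  if f: "f holomorphic_on ball z r" and b: "!!w. w \<in> ball z r ==> cmod (f w) <= Q * ?n * t" for f t
 proof -
  note so = second_order_estimate[OF f r b w]
  let ?B = "Q * ?n * t" and ?d = "cmod (w - z)"
  have B0: "0 <= ?B" using r by (intro order_trans[OF norm_ge_zero b[of z]]) simp
  have "cmod (f w - f z) <= cmod (f w - f z - (w - z) * deriv f z) + ?d * cmod (deriv f z)"
   using norm_triangle_ineq[of "f w - f z - (w - z) * deriv f z" "(w - z) * deriv f z"] by (simp add: norm_mult)
  also have "... <= 32 * ?B / r\<^sup>2 * ?d\<^sup>2 + ?d * (4 * ?B / r)"
   using so by (intro add_mono mult_left_mono) auto
  also have "32 * ?B / r\<^sup>2 * ?d\<^sup>2 <= 32 * ?B / r\<^sup>2 * (r / 2 * ?d)"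
   using B0 w mult_right_mono[OF w, of ?d] by (intro mult_left_mono) (auto simp: power2_eq_square)
  also have "32 * ?B / r\<^sup>2 * (r / 2 * ?d) = 16 * ?B / r * ?d" using r by (simp add: power2_eq_square)
  also have "16 * ?B / r * ?d + ?d * (4 * ?B / r) = (20 * Q / r * ?d * ?n) * t" using r by (simp add: field_simps)
  finally show ?thesis by simp
 qed
 have wz: "w \<in> ball z r" "z \<in> ball z r" using w r by (auto simp: dist_norm norm_minus_commute)
 have DV: "Pw \<mu> w \<phi> - Pw \<mu> z \<phi> \<in> V" by (intro fspace.V_diff[OF fspace_B] PV wz)
 let ?E = "20 * Q / r * cmod (w - z) * ?n"
 have E0: "0 <= ?E" using Q0 r by auto
 have "nB (Pw \<mu> w \<phi> - Pw \<mu> z \<phi>) <= ?E + ?E"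
 proof (rule space_B_I(2)[OF space_B_cont[OF DV] space_B_outside[OF DV] _ E0 _ E0])
  show "cmod ((Pw \<mu> w \<phi> - Pw \<mu> z \<phi>) v) <= ?E" if "v \<in> \<S>" for v
   using est[OF holP[of v], of 1] order_trans[OF space_B_bound[OF PV] nb] by simp
  show "cmod ((Pw \<mu> w \<phi> - Pw \<mu> z \<phi>) u - (Pw \<mu> w \<phi> - Pw \<mu> z \<phi>) v) <= ?E * d_hilbert u v powr \<gamma>"
   if uv: "u \<in> \<S>" "v \<in> \<S>" for u v
  proof -
   have "cmod ((Pw \<mu> w \<phi> u - Pw \<mu> w \<phi> v) - (Pw \<mu> z \<phi> u - Pw \<mu> z \<phi> v)) <= ?E * d_hilbert u v powr \<gamma>"
   proof (rule est)
    show "cmod (Pw \<mu> w \<phi> u - Pw \<mu> w \<phi> v) <= Q * ?n * d_hilbert u v powr \<gamma>" if "w \<in> ball z r" for w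
     using space_B_holder[OF PV[OF that] uv] mult_right_mono[OF nb[OF that], of "d_hilbert u v powr \<gamma>"] by simp
   qed (intro holomorphic_intros holP)
   then show ?thesis by (simp add: algebra_simps)
  qed
 qed
 also have "?E + ?E = 40 * Q / r * cmod (w - z) * ?n" by (simp add: field_simps)
 finally show ?thesis .
qed

end

subsection \<open>The dominant eigenvalue and its spectral projection\<close>

definition oneS :: "real ^ 'n => complex" where "oneS v = (if v \<in> \<S> then 1 else 0)"

text \<open>The dominant eigenvalue and the projection are defined as limits of iterates, so that they do
 not depend on the point \<open>s\<close> around which the perturbation argument is carried out.\<close>

definition kc :: "(real ^ 'n ^ 'n) measure => complex => complex" where
 "kc \<mu> w = lim (%n. (Pw \<mu> w ^^ Suc n) oneS center / (Pw \<mu> w ^^ n) oneS center)"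

definition Pic :: "(real ^ 'n ^ 'n) measure => complex => (real ^ 'n => complex) => real ^ 'n => complex" where
 "Pic \<mu> w f v = lim (%n. (Pw \<mu> w ^^ n) f v / kc \<mu> w ^ n)"

lemma oneS_space: "oneS \<in> space_B \<gamma>"
 by (rule space_B_I(1)[of _ 1 0]) (auto simp: oneS_def intro: continuous_on_eq[of _ "%_. 1"])

text \<open>Evaluates the limits in \<open>kc\<close> and \<open>Pic\<close> from an error estimate
  with a rate below \<open>cmod k\<close>; the ratio of successive terms makes sense only for a
  non-zero amplitude \<open>c\<close>.\<close>

lemma geometric_ratio:
 fixes x :: "nat => complex"
 assumes b: "!!n. cmod (x n - k ^ n * c) <= B * \<tau> ^ n" and \<tau>: "0 <= \<tau>" "\<tau> < cmod k"
 shows "(%n. x n / k ^ n) \<longlonglongrightarrow> c" "c ~= 0 ==> (%n. x (Suc n) / x n) \<longlonglongrightarrow> k"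
proof -
 have k: "k ~= 0" using \<tau> by auto
 have "(%n. x n / k ^ n - c) \<longlonglongrightarrow> 0"
 proof (rule tendsto_0_le[of "%n. (\<tau> / cmod k) ^ n" _ _ B])
  show "(%n. (\<tau> / cmod k) ^ n) \<longlonglongrightarrow> 0" using \<tau> by (intro LIMSEQ_power_zero) (auto simp: divide_less_eq)
  have "cmod (x n / k ^ n - c) <= (\<tau> / cmod k) ^ n * B" for n
  proof -
   have "x n / k ^ n - c = (x n - k ^ n * c) / k ^ n" using k by (simp add: field_simps)
   then have "cmod (x n / k ^ n - c) = cmod (x n - k ^ n * c) / cmod k ^ n" by (simp add: norm_divide norm_power)
   also have "... <= B * \<tau> ^ n / cmod k ^ n" by (intro divide_right_mono b) simp
   finally show ?thesis by (simp add: power_divide mult.commute)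
  qed
  then show "\<forall>\<^sub>F n in sequentially. norm (x n / k ^ n - c) <= norm ((\<tau> / cmod k) ^ n) * B"
   using \<tau> by (simp add: norm_power abs_of_nonneg)
 qed
 then show l: "(%n. x n / k ^ n) \<longlonglongrightarrow> c" by (simp add: LIM_zero_iff)
 assume c: "c ~= 0"
 have "(%n. k * ((x (Suc n) / k ^ Suc n) / (x n / k ^ n))) \<longlonglongrightarrow> k * (c / c)"
  by (intro tendsto_mult tendsto_const tendsto_divide LIMSEQ_Suc l c)
 moreover have "k * ((x (Suc n) / k ^ Suc n) / (x n / k ^ n)) = x (Suc n) / x n" for n using k by (cases "x n = 0") (auto simp: field_simps)
 ultimately show "(%n. x (Suc n) / x n) \<longlonglongrightarrow> k" by (simp only: divide_self[OF c] mult_1_right)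
qed

text \<open>The constants are shared by the whole disc in \<open>spectral_ball\<close>.
  \<open>Pic \<mu> w oneS\<close> is a non-zero eigenvector: it bounds \<open>kc\<close> and later
  supplies a kernel vector of the remainder.\<close>

definition spectral_at :: "(real ^ 'n ^ 'n) measure => real => real => real => real => complex => bool" where
 "spectral_at \<mu> \<gamma> C \<sigma> \<sigma>1 w \<longleftrightarrow>
   \<sigma>1 <= cmod (kc \<mu> w) & Pic \<mu> w \<in> bounded_ops \<gamma> & Pw \<mu> w \<in> bounded_ops \<gamma> & Pic \<mu> w oneS ~= (%v. 0) &
   (\<forall>f\<in>space_B \<gamma>. norm_B \<gamma> (Pic \<mu> w f) <= C * norm_B \<gamma> f & norm_B \<gamma> (Pw \<mu> w f) <= C * norm_B \<gamma> f &
    Pic \<mu> w (Pw \<mu> w f) = sc (kc \<mu> w) (Pic \<mu> w f) & Pw \<mu> w (Pic \<mu> w f) = sc (kc \<mu> w) (Pic \<mu> w f) &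
    Pic \<mu> w (Pic \<mu> w f) = Pic \<mu> w f &
    (\<forall>n. norm_B \<gamma> ((Pw \<mu> w ^^ n) f - sc (kc \<mu> w ^ n) (Pic \<mu> w f)) <= C * \<sigma> ^ n * norm_B \<gamma> f))"

definition spectral_ball :: "(real ^ 'n ^ 'n) measure => real => real => real => real => real => real => bool" where
 "spectral_ball \<mu> \<gamma> s \<epsilon> C \<sigma> \<sigma>1 \<longleftrightarrow> 0 < \<epsilon> & 0 <= C & 0 <= \<sigma> & \<sigma> < \<sigma>1 &
   kc \<mu> holomorphic_on ball (of_real s) \<epsilon> &
   (\<forall>f\<in>space_B \<gamma>. \<forall>v. (%w. Pic \<mu> w f v) holomorphic_on ball (of_real s) \<epsilon> & (%w. Pw \<mu> w f v) holomorphic_on ball (of_real s) \<epsilon>) &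
   (\<forall>w\<in>ball (of_real s) \<epsilon>. spectral_at \<mu> \<gamma> C \<sigma> \<sigma>1 w)"

context two_sided_law
begin

lemma Pw_rS:
 fixes \<gamma> :: real
 assumes "0 < \<gamma>" "\<gamma> <= 1"
 shows "Pw \<mu> (of_real s) rS = sc (of_real (kappa \<mu> s)) rS"
proof
 fix v
 show "Pw \<mu> (of_real s) rS v = sc (of_real (kappa \<mu> s)) rS v"
 proof (cases "v \<in> \<S>")
  case True
  have "M.A (M.hom (%v. Re (rS v))) v = (M.A ^^ Suc 0) (M.hom rt) v"
   by (rule hom_A_pow[OF rt_continuous True]) (simp add: rS_def M.hom_S)
  also have "... = M.A rt v"
   using M.homog_hom[of rt] rt_cls
   by (simp, intro M.A_cong M.hcls_homog M.hom_hcls rt_continuous M.cls_hcls simplex_cone True) (auto simp: M.cls_def)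
  also have "... = kappa \<mu> s * rt v" by (rule rt_eigen[OF simplex_cone[OF True]])
  finally have R: "M.A (M.hom (%v. Re (rS v))) v = kappa \<mu> s * rt v" .
  have "(%v. Im (rS v)) = (%v. 0)" by (auto simp: rS_def)
  moreover have "M.hom (%v. 0) = (%x. 0)" by (auto simp: M.hom_def)
  ultimately have I: "M.A (M.hom (%v. Im (rS v))) v = 0" by (simp add: M.A_def)
  show ?thesis unfolding Pw_transfer[OF rS_rI_space(1)[OF assms] True] R I using True by (simp add: rS_def)
 qed (simp add: Pw_def rS_def)
qed

lemma rS_center: "rS center ~= 0"
 using rt_pos[OF simplex_cone[OF center_simplex]] unfolding rS_def by (simp add: center_simplex)

lemma ell_rS: "ell rS = 1"
proof -
 have "(\<integral>v. rS v \<partial>M.\<nu>) = (\<integral>v. complex_of_real (rt v) \<partial>M.\<nu>)"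
  by (intro Bochner_Integration.integral_cong refl) (simp add: M.space_\<nu> rS_def)
 also have "... = of_real nr" using M.integral_\<nu>[OF rt_continuous] by (simp add: nr_def)
 finally show ?thesis using nr_pos by (simp add: ell_def)
qed

lemma ell_oneS: "ell oneS = 1 / of_real nr"
proof -
 interpret nu: prob_space M.\<nu> by (rule M.prob_\<nu>)
 have "(\<integral>v. oneS v \<partial>M.\<nu>) = (\<integral>v. 1 \<partial>M.\<nu>)"
  by (intro Bochner_Integration.integral_cong refl) (simp add: M.space_\<nu> oneS_def)
 then show ?thesis by (simp add: ell_def nu.prob_space)
qed

lemma ell_add: "f \<in> space_B \<gamma> ==> h \<in> space_B \<gamma> ==> ell (f + h) = ell f + ell h"
 using M.integrable_\<nu>[OF space_B_cont[of f \<gamma>]] M.integrable_\<nu>[OF space_B_cont[of h \<gamma>]]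
 by (simp add: ell_def plus_fun_def add_divide_distrib)

lemma ell_sc: "ell (sc c f) = c * ell f" by (simp add: ell_def)

lemma ell_bound: "f \<in> space_B \<gamma> ==> cmod (ell f) <= 1 / nr * norm_B \<gamma> f"
proof -
 assume f: "f \<in> space_B \<gamma>"
 interpret nu: prob_space M.\<nu> by (rule M.prob_\<nu>)
 have "cmod (\<integral>v. f v \<partial>M.\<nu>) <= (\<integral>v. cmod (f v) \<partial>M.\<nu>)" by (rule integral_norm_bound)
 also have "... <= (\<integral>v. norm_B \<gamma> f \<partial>M.\<nu>)"
  using M.integrable_\<nu>[OF space_B_cont[OF f]] space_B_bound[OF f] by (intro integral_mono) auto
 finally show ?thesis using nr_pos by (simp add: ell_def norm_divide divide_right_mono nu.prob_space)
qed

lemma ell_hol: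
 assumes D: "open D" and f: "!!w. w \<in> D ==> f w \<in> space_B \<gamma>" "!!x. (%w. f w x) holomorphic_on D" "!!w. w \<in> D ==> norm_B \<gamma> (f w) <= B"
 shows "(%w. ell (f w)) holomorphic_on D"
proof -
 interpret nu: prob_space M.\<nu> by (rule M.prob_\<nu>)
 have b: "cmod (f w v) <= B" if "w \<in> D" for w v using order_trans[OF space_B_bound[OF f(1)] f(3)] that by blast
 have "(%w. \<integral>v. f w v \<partial>M.\<nu>) holomorphic_on D"
  by (rule holomorphic_integral[OF D, where B="%_. B"])
   (use M.integrable_\<nu>[OF space_B_cont[OF f(1)]] f(2) b in auto)
 then show ?thesis unfolding ell_def using nr_pos by (intro holomorphic_intros) auto
qed

text \<open>Applied at every real point of a disc and not only at its centre, this makes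
  \<open>kc\<close> the analytic extension of \<open>kappa\<close>.\<close>

lemma kc_real:
 assumes V: "!!f. f \<in> space_B \<gamma> ==> Pw \<mu> (of_real s) f \<in> space_B \<gamma>"
 shows "kc \<mu> (of_real s) = of_real (kappa \<mu> s)"
proof -
 have e: "(Pw \<mu> (of_real s) ^^ n) oneS center = of_real ((M.A ^^ n) M.N center)" for n
 proof -
  have h: "M.hom (%v. Re (oneS v)) x = M.N x" "M.hom (%v. Im (oneS v)) x = 0" if "x \<in> pcone" for x
   using cone_normalize[OF that] by (auto simp: M.N_def M.hom_def oneS_def)
  have c: "continuous_on \<S> (%v. Re (oneS v))" "continuous_on \<S> (%v. Im (oneS v))"
   by (intro continuous_intros space_B_cont[OF oneS_space[of \<gamma>]])+
  have "(M.A ^^ n) (M.hom (%v. Re (oneS v))) center = (M.A ^^ n) M.N center"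
   using h(1) by (intro M.Apow_cong M.hom_hcls c M.N_hcls simplex_cone center_simplex) auto
  moreover have "(M.A ^^ n) (M.hom (%v. Im (oneS v))) center = 0"
  proof -
   have "(M.A ^^ n) (%x. 0) = (%x. 0)" by (induction n) (auto simp: M.A_def)
   moreover have "(%v :: real ^ 'n. Im (oneS v)) = (%v. 0)" by (auto simp: oneS_def)
   moreover have "M.hom (%v. 0) = (%x. 0)" by (auto simp: M.hom_def)
   ultimately show ?thesis by simp
  qed
  ultimately show ?thesis
   by (subst Pw_pow_transfer[OF V oneS_space center_simplex]) simp_all
 qed
 have "(%n. of_real ((M.A ^^ Suc n) M.N center / (M.A ^^ n) M.N center)) \<longlonglongrightarrow> complex_of_real M.k"
  by (intro tendsto_of_real M.AN_ratio center_simplex)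
 then have "(%n. (Pw \<mu> (of_real s) ^^ Suc n) oneS center / (Pw \<mu> (of_real s) ^^ n) oneS center) \<longlonglongrightarrow> complex_of_real M.k"
  unfolding e by simp
 then show ?thesis unfolding kc_def M_k[symmetric] by (rule limI)
qed

end

locale strip_point = strip_law \<mu> a b \<gamma> Bd + two_sided_law \<mu> s K C p c1 KT CT pT c1T
 for \<mu> :: "(real ^ 'n ^ 'n) measure" and a b \<gamma> Bd s K C p c1 KT CT pT c1T +
 assumes ab: "a < s" "s < b"
begin

lemma V_s: "f \<in> V ==> Pw \<mu> (of_real s) f \<in> V"
 using ab by (intro Pw_V(1)) auto

abbreviation "\<kappa> \<equiv> kappa \<mu> s"

definition Tn :: "complex => (real ^ 'n => complex) => real ^ 'n => complex" where
 "Tn w f = sc (1 / of_real \<kappa>) (Pw \<mu> w f)"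

lemma Tn_pow: "(Tn w ^^ n) f = sc (1 / of_real \<kappa> ^ n) ((Pw \<mu> w ^^ n) f)"
proof (induction n)
 case (Suc n)
 have "(Tn w ^^ Suc n) f = sc (1 / of_real \<kappa>) (Pw \<mu> w (sc (1 / of_real \<kappa> ^ n) ((Pw \<mu> w ^^ n) f)))"
  unfolding Suc.IH[symmetric] by (simp add: Tn_def)
 also have "... = sc (1 / of_real \<kappa>) (sc (1 / of_real \<kappa> ^ n) ((Pw \<mu> w ^^ Suc n) f))"
  unfolding Pw_sc by simp
 finally show ?case by (auto simp: fun_eq_iff)
qed (simp add: fun_eq_iff)

lemma gap_Tn:
 obtains Cg \<theta> where "0 <= Cg" "0 < \<theta>" "\<theta> < 1"
  "!!f n. f \<in> V ==> nB ((Tn (of_real s) ^^ n) f - sc (ell f) rS) <= Cg * \<theta> ^ n * nB f"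
proof -
 obtain C \<theta> where C: "0 <= C" "0 < \<theta>" "\<theta> < 1" and g: "\<forall>f\<in>V. \<forall>n.
   nB ((Pw \<mu> (of_real s) ^^ n) f - sc (of_real (\<kappa> ^ n) * ell f) rS) <= C * \<theta> ^ n * \<kappa> ^ n * nB f"
  by (rule real_gap[OF \<gamma> V_s, THEN exE], assumption, elim exE conjE) (rule that)
 interpret B: fspace V nB by (rule fspace_B)
 have "nB ((Tn (of_real s) ^^ n) f - sc (ell f) rS) <= C * \<theta> ^ n * nB f" if f: "f \<in> V" for f n
 proof -
  let ?x = "(Pw \<mu> (of_real s) ^^ n) f - sc (of_real (\<kappa> ^ n) * ell f) rS"
  have PV: "(Pw \<mu> (of_real s) ^^ n) f \<in> V" by (induction n) (auto intro: V_s f)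
  have xV: "?x \<in> V" by (intro B.V_diff B.V_sc PV rS_rI_space \<gamma>)
  have e: "(Tn (of_real s) ^^ n) f - sc (ell f) rS = sc (1 / of_real \<kappa> ^ n) ?x"
   unfolding Tn_pow using kappa_pos by (auto simp: fun_eq_iff field_simps)
  have "nB (sc (1 / of_real \<kappa> ^ n) ?x) = 1 / \<kappa> ^ n * nB ?x"
   using kappa_pos unfolding norm_B_sc[OF xV] by (simp add: norm_divide norm_power)
  also have "... <= 1 / \<kappa> ^ n * (C * \<theta> ^ n * \<kappa> ^ n * nB f)"
   using kappa_pos g f by (intro mult_left_mono) auto
  finally show ?thesis unfolding e using kappa_pos by simp
 qed
 then show thesis using that C by blast
qed

text \<open>Up to the factor \<open>rS center\<close>, \<open>ell f\<close> is the limit of the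
  iterates of \<open>f\<close> at one point, and a limit is unchanged by an index shift.\<close>

lemma ell_Tn:
 assumes f: "f \<in> V"
 shows "ell (Tn (of_real s) f) = ell f"
proof -
 obtain C \<theta> where C: "0 <= C" "0 < \<theta>" "\<theta> < 1" and
  g: "!!f n. f \<in> V ==> nB ((Tn (of_real s) ^^ n) f - sc (ell f) rS) <= C * \<theta> ^ n * nB f"
  by (rule gap_Tn) (rule that)
 interpret B: fspace V nB by (rule fspace_B)
 have TV: "Tn (of_real s) h \<in> V" if "h \<in> V" for h unfolding Tn_def by (intro B.V_sc V_s that)
 have lim: "(%n. (Tn (of_real s) ^^ n) h center) \<longlonglongrightarrow> ell h * rS center" if h: "h \<in> V" for h
 proof -
  have PV: "(Tn (of_real s) ^^ n) h \<in> V" for n by (induction n) (auto intro: TV h)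
  have "cmod ((Tn (of_real s) ^^ n) h center - 1 ^ n * (ell h * rS center)) <= (C * nB h) * \<theta> ^ n" for n
   using B.nm_ev[OF B.V_diff[OF PV B.V_sc[OF rS_rI_space(1)[OF \<gamma>]]], where x=center, of n "ell h"] g[OF h, of n] by (simp add: mult_ac)
  from geometric_ratio(1)[OF this] C show ?thesis by simp
 qed
 have "(%n. (Tn (of_real s) ^^ Suc n) f center) \<longlonglongrightarrow> ell f * rS center" by (intro LIMSEQ_Suc lim f)
 moreover have "(%n. (Tn (of_real s) ^^ Suc n) f center) \<longlonglongrightarrow> ell (Tn (of_real s) f) * rS center"
  using lim[OF TV[OF f]] by (simp add: funpow_swap1)
 ultimately have "ell f * rS center = ell (Tn (of_real s) f) * rS center" by (rule LIMSEQ_unique)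
 then show ?thesis using rS_center by simp
qed

text \<open>\<open>Tn\<close> has eigenvalue 1 at \<open>s\<close>, and the norm
  \<open>G.anm\<close> turns its gap into the one-step contraction that
  \<open>perturbed_family\<close> demands. The disc is shrunk twice: \<open>e1\<close> makes the
  perturbation small, \<open>e2\<close> keeps the amplitude of \<open>oneS\<close> at
  \<open>center\<close> non-zero, as the ratio limit in \<open>kc\<close> requires.\<close>

theorem local_spectrum:
 obtains \<epsilon> Cs \<sigma> \<sigma>1 where "spectral_ball \<mu> \<gamma> s \<epsilon> Cs \<sigma> \<sigma>1"
  "!!f. f \<in> V ==> Pic \<mu> (of_real s) f = sc (ell f) rS" "kc \<mu> (of_real s) = of_real \<kappa>"
proof -
 let ?s = "complex_of_real s"
 interpret B: fspace V nB by (rule fspace_B)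
 define r0 where "r0 = min (s - a) (b - s)"
 have r0: "0 < r0" using ab by (simp add: r0_def)
 have strip: "a <= Re w & Re w <= b" "cmod w <= \<bar>s\<bar> + r0" if "w \<in> ball ?s r0" for w
 proof -
  have d: "cmod (?s - w) < r0" using that by (simp add: dist_norm)
  have "\<bar>s - Re w\<bar> < r0" using abs_Re_le_cmod[of "?s - w"] d by simp
  then show "a <= Re w & Re w <= b" by (auto simp: r0_def)
  show "cmod w <= \<bar>s\<bar> + r0" using norm_triangle_ineq2[of w ?s] d by (simp add: norm_minus_commute)
 qed
 define Wm where "Wm = \<bar>s\<bar> + r0"
 have B1: "0 <= B1" using B1_nonneg ab by simp
 define Q where "Q = (4 + 4 * Wm * exp (2 * Wm) + 2) * B1"
 have Q: "(Hc w + 2) * B1 <= Q" if "w \<in> ball ?s r0" for w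
  unfolding Q_def Hc_def Wm_def using strip(2)[OF that] B1 r0
  by (intro mult_right_mono add_right_mono add_left_mono mult_mono) auto
 have Q0: "0 <= Q" unfolding Q_def Wm_def using B1 r0 by (intro mult_nonneg_nonneg add_nonneg_nonneg) auto
 have \<kappa>: "0 < \<kappa>" by (rule kappa_pos)
 have PV: "Pw \<mu> w f \<in> V" "nB (Pw \<mu> w f) <= Q * nB f" if "w \<in> ball ?s r0" "f \<in> V" for w f
  using Pw_V[of w f] strip(1)[OF that(1)] that(2) mult_right_mono[OF Q[OF that(1)], of "nB f"] by auto
 have Padd: "Pw \<mu> w (f + h) = Pw \<mu> w f + Pw \<mu> w h" if "w \<in> ball ?s r0" "f \<in> V" "h \<in> V" for w f h
  using Pw_add[of w f h] strip(1)[OF that(1)] that by auto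
 have Tadd: "Tn w (f + h) = Tn w f + Tn w h" if "w \<in> ball ?s r0" "f \<in> V" "h \<in> V" for w f h
  unfolding Tn_def Padd[OF that] by (auto simp: fun_eq_iff distrib_left add_divide_distrib)
 have Tsc: "Tn w (sc c f) = sc c (Tn w f)" for w c f unfolding Tn_def Pw_sc by (auto simp: fun_eq_iff)
 have TV: "Tn w f \<in> V" if "w \<in> ball ?s r0" "f \<in> V" for w f unfolding Tn_def by (intro B.V_sc PV that)
 have sB: "?s \<in> ball ?s r0" using r0 by simp
 obtain C \<theta> where C: "0 <= C" "0 < \<theta>" "\<theta> < 1" and
  g: "!!f n. f \<in> V ==> nB ((Tn ?s ^^ n) f - sc (ell f) rS) <= C * \<theta> ^ n * nB f"
  by (rule gap_Tn) (rule that)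
 interpret G: gapped V nB "Tn ?s" ell C \<theta> "Q / \<kappa>"
 proof unfold_locales
  fix f n assume f: "f \<in> V"
  have "nB (Tn ?s f) = 1 / \<kappa> * nB (Pw \<mu> ?s f)"
   unfolding Tn_def norm_B_sc[OF PV(1)[OF sB f]] using \<kappa> by (simp add: norm_divide)
  also have "... <= 1 / \<kappa> * (Q * nB f)" using PV(2)[OF sB f] \<kappa> by (intro mult_left_mono) auto
  finally show "nB (Tn ?s f) <= Q / \<kappa> * nB f" by simp
  assume "ell f = 0"
  then have "(Tn ?s ^^ n) f - sc (ell f) rS = (Tn ?s ^^ n) f" by (auto simp: fun_eq_iff)
  then show "nB ((Tn ?s ^^ n) f) <= C * \<theta> ^ n * nB f" using g[OF f, of n] by simp
 qed (use TV[OF sB] Tadd[OF sB] Tsc C Q0 \<kappa> in auto)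
 let ?an = G.anm
 define \<epsilon>0 where "\<epsilon>0 = (1 - G.\<theta>1) / 8"
 have \<epsilon>0: "0 < \<epsilon>0" using G.\<theta>1 by (simp add: \<epsilon>0_def)
 define \<Lambda> where "\<Lambda> = 1 / nr"
 have \<Lambda>: "0 <= \<Lambda>" using nr_pos by (simp add: \<Lambda>_def)
 note rV = rS_rI_space(1)[OF \<gamma>]
 have anr: "0 <= ?an rS" using order_trans[OF norm_B_nonneg G.nm_le_anm[OF rV]] .
 \<comment> \<open>Lipschitz constant of \<open>Tn\<close> in the parameter for the adapted norm:
   the constant of \<open>Pw_lipschitz\<close>, the normalization by \<open>\<kappa>\<close>, and
   \<open>G.E\<close> for the change of norm.\<close>
 define Li where "Li = G.E * (40 * Q / r0 / \<kappa>)"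
 have Li: "0 <= Li" unfolding Li_def using G.E_nonneg Q0 r0 \<kappa> by auto
 define W where "W = (1 + ?an rS)\<^sup>2 * (1 + \<Lambda>)"
 have W: "0 <= W" using \<Lambda> by (simp add: W_def)
 define e1 where "e1 = min (r0 / 2) (\<epsilon>0 / (Li * W + 1))"
 have LW: "0 <= Li * W" using Li W by simp
 then have e1: "0 < e1" using r0 \<epsilon>0 by (auto simp: e1_def)
 have e1': "e1 <= r0 / 2" unfolding e1_def by (rule min.cobounded1)
 note e1 = e1 e1'
 have small: "Li * e1 * W <= \<epsilon>0"
 proof -
  have "Li * e1 * W = e1 * (Li * W)" by simp
  also have "... <= (\<epsilon>0 / (Li * W + 1)) * (Li * W + 1)" using LW e1 \<epsilon>0 by (intro mult_mono) (auto simp: e1_def)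
  also have "... = \<epsilon>0" using LW by (simp add: add_nonneg_eq_0_iff)
  finally show ?thesis .
 qed
 have sub: "ball ?s e1 \<subseteq> ball ?s r0" using e1 r0 by (intro subset_ball) auto
 have near: "?an (Tn w f - Tn ?s f) <= Li * e1 * ?an f" if w: "w \<in> ball ?s e1" and f: "f \<in> V" for w f
 proof -
  have wr: "w \<in> ball ?s r0" using w sub by blast
  have dw: "cmod (w - ?s) <= e1" using w by (simp add: dist_norm norm_minus_commute)
  have DV: "Pw \<mu> w f - Pw \<mu> ?s f \<in> V" by (intro B.V_diff PV wr sB f)
  have "nB (Pw \<mu> w f - Pw \<mu> ?s f) <= 40 * Q / r0 * cmod (w - ?s) * nB f"
   using dw e1 by (intro Pw_lipschitz strip(1) r0 f Q) auto
  also have "... <= 40 * Q / r0 * e1 * nB f"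
   using dw Q0 r0 by (intro mult_right_mono mult_left_mono) auto
  finally have 1: "nB (Pw \<mu> w f - Pw \<mu> ?s f) <= 40 * Q / r0 * e1 * nB f" .
  have e: "Tn w f - Tn ?s f = sc (1 / of_real \<kappa>) (Pw \<mu> w f - Pw \<mu> ?s f)"
   by (auto simp: Tn_def fun_eq_iff diff_divide_distrib)
  have TDV: "Tn w f - Tn ?s f \<in> V" by (intro B.V_diff TV wr sB f)
  have "nB (Tn w f - Tn ?s f) = 1 / \<kappa> * nB (Pw \<mu> w f - Pw \<mu> ?s f)"
   unfolding e norm_B_sc[OF DV] using \<kappa> by (simp add: norm_divide)
  also have "... <= 1 / \<kappa> * (40 * Q / r0 * e1 * nB f)" using 1 \<kappa> by (intro mult_left_mono) auto
  also have "... <= 1 / \<kappa> * (40 * Q / r0 * e1 * ?an f)"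
   using \<kappa> Q0 r0 e1 G.nm_le_anm[OF f] by (intro mult_left_mono) auto
  finally have "G.E * nB (Tn w f - Tn ?s f) <= G.E * (1 / \<kappa> * (40 * Q / r0 * e1 * ?an f))"
   using G.E_nonneg by (intro mult_left_mono)
  then have "G.E * nB (Tn w f - Tn ?s f) <= Li * e1 * ?an f" by (simp add: Li_def mult_ac)
  then show ?thesis using G.anm_le[OF TDV] by linarith
 qed
 interpret A: fspace V ?an by (rule G.anm_fspace)
 interpret P: perturbed_family V ?an Tn "ball ?s e1" ?s ell rS G.\<theta>1 "Li * e1" \<Lambda> \<epsilon>0
 proof unfold_locales
  show "open (ball ?s e1)" "?s \<in> ball ?s e1" using e1 by auto
  show "Tn w f \<in> V" if "w \<in> ball ?s e1" "f \<in> V" for w f using TV that sub by blast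
  show "Tn w (f + h) = Tn w f + Tn w h" if "w \<in> ball ?s e1" "f \<in> V" "h \<in> V" for w f h using Tadd that sub by blast
  show "Tn w (sc c f) = sc c (Tn w f)" for w c f by (rule Tsc)
  show "ell (f + h) = ell f + ell h" if "f \<in> V" "h \<in> V" for f h using ell_add that .
  show "ell (sc c f) = c * ell f" for c f by (rule ell_sc)
  show "cmod (ell f) <= \<Lambda> * ?an f" if f: "f \<in> V" for f
   using ell_bound[OF f] mult_left_mono[OF G.nm_le_anm[OF f] \<Lambda>] by (simp add: \<Lambda>_def)
  show "rS \<in> V" by (rule rV)
  show "ell rS = 1" by (rule ell_rS)
  show "Tn ?s rS = rS" unfolding Tn_def Pw_rS[OF \<gamma>] using \<kappa> by (auto simp: fun_eq_iff)
  show "ell (Tn ?s f) = ell f" if "f \<in> V" for f by (rule ell_Tn[OF that])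
  show "?an (Tn ?s f) <= G.\<theta>1 * ?an f" if "f \<in> V" "ell f = 0" for f by (rule G.anm_contr[OF that])
  show "?an (Tn w f - Tn ?s f) <= Li * e1 * ?an f" if "w \<in> ball ?s e1" "f \<in> V" for w f by (rule near[OF that])
  show "0 <= G.\<theta>1" "G.\<theta>1 < 1" using G.\<theta>1 by auto
  show "\<epsilon>0 = (1 - G.\<theta>1) / 8" by (rule \<epsilon>0_def)
  show "0 <= Li * e1" using Li e1 by simp
  show "0 <= \<Lambda>" by (rule \<Lambda>)
  show "Li * e1 * ((1 + ?an rS)\<^sup>2 * (1 + \<Lambda>)) <= \<epsilon>0" using small by (simp add: W_def)
  fix ff B assume ff: "!!w. w \<in> ball ?s e1 ==> ff w \<in> V" "!!x. (%w. ff w x) holomorphic_on ball ?s e1"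
   "!!w. w \<in> ball ?s e1 ==> ?an (ff w) <= B"
  have fb: "nB (ff w) <= B" if "w \<in> ball ?s e1" for w using ff(3)[OF that] G.nm_le_anm[OF ff(1)[OF that]] by linarith
  show "(%w. ell (ff w)) holomorphic_on ball ?s e1" by (rule ell_hol[OF open_ball ff(1,2) fb])
  have "(%w. Pw \<mu> w (ff w) x) holomorphic_on ball ?s e1" for x
   by (rule Pw_hol[OF open_ball _ ff(1,2) fb]) (use strip sub in auto)
  then show "(%w. Tn w (ff w) x) holomorphic_on ball ?s e1" for x
   unfolding Tn_def sc_apply by (intro holomorphic_intros)
 qed
 obtain C1 where C1: "0 <= C1" and sg: "!!w f n. w \<in> ball ?s e1 ==> f \<in> V ==>
   ?an ((Tn w ^^ n) f - sc (P.K w ^ n * P.Lw w f) (P.hh w)) <= C1 * (1 - 4 * \<epsilon>0) ^ n * ?an f"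
  using P.spectral_gap by blast
 define k where "k w = of_real \<kappa> * P.K w" for w
 define Pr where "Pr w f = sc (P.Lw w f) (P.hh w)" for w f
 define \<sigma> where "\<sigma> = \<kappa> * (1 - 4 * \<epsilon>0)"
 define \<sigma>1 where "\<sigma>1 = \<kappa> * (1 - \<epsilon>0)"
 have \<sigma>: "0 <= \<sigma>" "\<sigma> < \<sigma>1" using \<kappa> \<epsilon>0 P.\<epsilon>_pos by (auto simp: \<sigma>_def \<sigma>1_def)
 have k: "\<sigma>1 <= cmod (k w)" if "w \<in> ball ?s e1" for w
  unfolding \<sigma>1_def k_def norm_mult using P.K_ge[OF that] \<kappa> by simp
 have PrV: "Pr w f \<in> V" if "w \<in> ball ?s e1" for w f unfolding Pr_def by (intro B.V_sc P.hh_V that)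
 have PwpV: "(Pw \<mu> w ^^ n) f \<in> V" if "w \<in> ball ?s e1" "f \<in> V" for w n f
  using that sub PV(1) by (induction n) auto
 define C2 where "C2 = C1 * G.E"
 have bnd: "nB ((Pw \<mu> w ^^ n) f - sc (k w ^ n) (Pr w f)) <= C2 * \<sigma> ^ n * nB f"
  if w: "w \<in> ball ?s e1" and f: "f \<in> V" for w f n
 proof -
  let ?x = "(Tn w ^^ n) f - sc (P.K w ^ n * P.Lw w f) (P.hh w)"
  have xV: "?x \<in> V" unfolding Tn_pow by (intro B.V_diff B.V_sc PwpV P.hh_V w f)
  have e: "(Pw \<mu> w ^^ n) f - sc (k w ^ n) (Pr w f) = sc (of_real (\<kappa> ^ n)) ?x"
   unfolding Tn_pow k_def Pr_def using \<kappa> by (auto simp: fun_eq_iff field_simps)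
  have "nB ?x <= C1 * (1 - 4 * \<epsilon>0) ^ n * (G.E * nB f)"
   using P.\<epsilon>_pos C1 by (intro order_trans[OF G.nm_le_anm[OF xV]] order_trans[OF sg[OF w f]] mult_left_mono G.anm_le f) auto
  then have "\<kappa> ^ n * nB ?x <= \<kappa> ^ n * (C1 * (1 - 4 * \<epsilon>0) ^ n * (G.E * nB f))"
   using \<kappa> by (intro mult_left_mono) auto
  then show ?thesis unfolding e norm_B_sc[OF xV] using \<kappa> by (simp add: norm_power \<sigma>_def C2_def power_mult_distrib mult_ac)
 qed
 have ptb: "cmod ((Pw \<mu> w ^^ n) f v - k w ^ n * Pr w f v) <= (C2 * nB f) * \<sigma> ^ n"
  if w: "w \<in> ball ?s e1" and f: "f \<in> V" for w f n v
  using B.nm_ev[OF B.V_diff[OF PwpV[OF w f] B.V_sc[OF PrV[OF w]]], where x=v, of n "k w ^ n" f] bnd[OF w f, of n] by (simp add: mult_ac)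
 have lim1: "(%n. (Pw \<mu> w ^^ n) f v / k w ^ n) \<longlonglongrightarrow> Pr w f v" if w: "w \<in> ball ?s e1" and f: "f \<in> V" for w f v
  using geometric_ratio(1)[OF ptb[OF w f]] \<sigma> k[OF w] by simp
 have lim2: "kc \<mu> w = k w" if w: "w \<in> ball ?s e1" and nz: "Pr w oneS center ~= 0" for w
  unfolding kc_def using \<sigma> k[OF w] by (intro limI geometric_ratio(2)[OF ptb[OF w oneS_space]] nz) auto
 have s1: "?s \<in> ball ?s e1" using e1 by simp
 have Ks: "k ?s = of_real \<kappa>"
 proof -
  have "P.K ?s = 1" unfolding P.K_def P.T_h by (rule P.Lw_h[OF s1])
  then show ?thesis by (simp add: k_def)
 qed
 have Prs: "Pr ?s f v = ell f * rS v" if f: "f \<in> V" for f v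
 proof -
  have "cmod ((Tn ?s ^^ n) f v - 1 ^ n * (ell f * rS v)) <= (C * nB f) * \<theta> ^ n" for n
   using B.nm_ev[OF B.V_diff[OF G.Tp_V[OF f] B.V_sc[OF rV]], where x=v, of n "ell f"] g[OF f, of n] by (simp add: mult_ac)
  from geometric_ratio(1)[OF this] C have "(%n. (Tn ?s ^^ n) f v) \<longlonglongrightarrow> ell f * rS v" by simp
  moreover have "(%n. (Tn ?s ^^ n) f v) \<longlonglongrightarrow> Pr ?s f v"
   using lim1[OF s1 f, of v] unfolding Tn_pow Ks by simp
  ultimately show ?thesis by (rule LIMSEQ_unique[rotated])
 qed
 have Prhol: "(%w. Pr w f v) holomorphic_on ball ?s e1" if "f \<in> V" for f v
  unfolding Pr_def sc_apply by (intro holomorphic_intros P.Lw_hol P.hh_hol that)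
 have nz: "Pr ?s oneS center ~= 0"
  unfolding Prs[OF oneS_space] ell_oneS using nr_pos rS_center by simp
 obtain e2 where e2: "0 < e2" "e2 <= e1" "!!w. w \<in> ball ?s e2 ==> Pr w oneS center ~= 0"
 proof -
  have c: "continuous_on (ball ?s e1) (%w. Pr w oneS center)"
   by (intro holomorphic_on_imp_continuous_on Prhol oneS_space)
  obtain e where e: "0 < e" "\<forall>w\<in>ball ?s e1. dist ?s w < e --> Pr w oneS center ~= 0"
   using continuous_on_avoid[OF c s1 nz] by blast
  show thesis by (rule that[of "min e e1"]) (use e e1 in auto)
 qed
 have sub2: "ball ?s e2 \<subseteq> ball ?s e1" using e2 by (intro subset_ball)
 have kc: "kc \<mu> w = k w" if "w \<in> ball ?s e2" for w using lim2 e2(3)[OF that] that sub2 by blast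
 have Pic: "Pic \<mu> w f = Pr w f" if w: "w \<in> ball ?s e2" and f: "f \<in> V" for w f
 proof
  show "Pic \<mu> w f v = Pr w f v" for v unfolding Pic_def kc[OF w] using w f sub2 by (intro limI lim1) auto
 qed
 define Z where "Z = (\<Lambda> + P.C0) * G.E * (4/3 * (?an rS + 1))"
 have Z0: "0 <= Z" unfolding Z_def using \<Lambda> P.C0 G.E_nonneg anr by auto
 have Prb: "nB (Pr w f) <= Z * nB f" if w: "w \<in> ball ?s e1" and f: "f \<in> V" for w f
 proof -
  have 1: "nB (P.hh w) <= 4/3 * (?an rS + 1)" using G.nm_le_anm[OF P.hh_V[OF w]] P.nm_hh[OF w] by linarith
  have 2: "cmod (P.Lw w f) <= (\<Lambda> + P.C0) * (G.E * nB f)"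
   using P.Lw_bound[OF w f] mult_left_mono[OF G.anm_le[OF f], of "\<Lambda> + P.C0"] \<Lambda> P.C0 by linarith
  have "nB (Pr w f) = cmod (P.Lw w f) * nB (P.hh w)" unfolding Pr_def by (rule norm_B_sc[OF P.hh_V[OF w]])
  also have "... <= ((\<Lambda> + P.C0) * (G.E * nB f)) * (4/3 * (?an rS + 1))"
   using 1 2 \<Lambda> P.C0 G.E_nonneg by (intro mult_mono) auto
  finally show ?thesis by (simp add: Z_def mult_ac)
 qed
 have Lw_Pw: "P.Lw w (Pw \<mu> w f) = k w * P.Lw w f" if w: "w \<in> ball ?s e1" and f: "f \<in> V" for w f
 proof -
  have "w \<in> ball ?s r0" using w sub by blast
  then have "P.Lw w (sc (1 / of_real \<kappa>) (Pw \<mu> w f)) = 1 / of_real \<kappa> * P.Lw w (Pw \<mu> w f)" using w f by (intro P.Lw_sc PV)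
  then show ?thesis using P.Lw_T[OF w f] \<kappa> unfolding Tn_def k_def by (simp add: field_simps)
 qed
 have Pw_hh: "Pw \<mu> w (P.hh w) = sc (k w) (P.hh w)" if w: "w \<in> ball ?s e1" for w
 proof -
  have "sc (of_real \<kappa>) (Tn w (P.hh w)) = sc (of_real \<kappa>) (sc (P.K w) (P.hh w))" unfolding P.T_hh[OF w] ..
  then show ?thesis using \<kappa> unfolding Tn_def k_def by (auto simp: fun_eq_iff)
 qed
 define C where "C = max (max C2 Z) Q"
 have Cge: "C2 <= C" "Z <= C" "Q <= C" "0 <= C" using Z0 by (auto simp: C_def)
 have body: "spectral_at \<mu> \<gamma> C \<sigma> \<sigma>1 w" if w2: "w \<in> ball ?s e2" for w
 proof -
  have w: "w \<in> ball ?s e1" "w \<in> ball ?s r0" using w2 sub sub2 by blast+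
  have le: "x <= C * nB f" if "x <= y * nB f" "y <= C" for x y f
   using that(1) mult_right_mono[OF that(2), of "nB f"] by simp
  have 1: "\<sigma>1 <= cmod (kc \<mu> w)" using k[OF w(1)] kc[OF w2] by simp
  have 2: "Pw \<mu> w \<in> bounded_ops \<gamma>"
   unfolding bounded_ops_iff using PV[OF w(2)] Padd[OF w(2)] Pw_sc by blast
  have 3: "Pic \<mu> w \<in> bounded_ops \<gamma>"
   unfolding bounded_ops_iff
  proof (intro conjI ballI allI exI[of _ C])
   fix f h c assume f: "f \<in> V"
   show "Pic \<mu> w f \<in> V" unfolding Pic[OF w2 f] by (rule PrV[OF w(1)])
   show "nB (Pic \<mu> w f) <= C * nB f" unfolding Pic[OF w2 f] by (rule le[OF Prb[OF w(1) f] Cge(2)])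
   show "Pic \<mu> w (sc c f) = sc c (Pic \<mu> w f)"
    unfolding Pic[OF w2 f] Pic[OF w2 B.V_sc[OF f]] Pr_def P.Lw_sc[OF w(1) f] by (auto simp: fun_eq_iff)
   assume h: "h \<in> V"
   show "Pic \<mu> w (f + h) = Pic \<mu> w f + Pic \<mu> w h"
    unfolding Pic[OF w2 f] Pic[OF w2 h] Pic[OF w2 B.V_add[OF f h]] Pr_def P.Lw_add[OF w(1) f h] by (auto simp: fun_eq_iff distrib_right)
  qed
  have 4: "Pic \<mu> w oneS ~= (%v. 0)" using e2(3)[OF w2] unfolding Pic[OF w2 oneS_space] by metis
  show ?thesis
   unfolding spectral_at_def
  proof (intro conjI ballI allI 1 2 3 4)
   fix f assume f: "f \<in> V"
   show "nB (Pic \<mu> w f) <= C * nB f" unfolding Pic[OF w2 f] by (rule le[OF Prb[OF w(1) f] Cge(2)])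
   show "nB (Pw \<mu> w f) <= C * nB f" by (rule le[OF PV(2)[OF w(2) f] Cge(3)])
   show "Pic \<mu> w (Pw \<mu> w f) = sc (kc \<mu> w) (Pic \<mu> w f)"
    unfolding Pic[OF w2 f] Pic[OF w2 PV(1)[OF w(2) f]] Pr_def Lw_Pw[OF w(1) f] kc[OF w2] by (auto simp: fun_eq_iff)
   show "Pw \<mu> w (Pic \<mu> w f) = sc (kc \<mu> w) (Pic \<mu> w f)"
    unfolding Pic[OF w2 f] Pr_def Pw_sc Pw_hh[OF w(1)] kc[OF w2] by (auto simp: fun_eq_iff)
   show "Pic \<mu> w (Pic \<mu> w f) = Pic \<mu> w f"
    unfolding Pic[OF w2 f] Pic[OF w2 PrV[OF w(1)]] unfolding Pr_def P.Lw_sc[OF w(1) P.hh_V[OF w(1)]] P.Lw_hh[OF w(1)] by simp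
   show "nB ((Pw \<mu> w ^^ n) f - sc (kc \<mu> w ^ n) (Pic \<mu> w f)) <= C * \<sigma> ^ n * nB f" for n
    unfolding Pic[OF w2 f] kc[OF w2]
    using \<sigma> Cge by (intro order_trans[OF bnd[OF w(1) f]] mult_right_mono) auto
  qed
 qed
 have khol: "kc \<mu> holomorphic_on ball ?s e2"
 proof (rule holomorphic_transform[of k])
  show "k holomorphic_on ball ?s e2" unfolding k_def[abs_def]
   by (intro holomorphic_intros holomorphic_on_subset[OF P.K_hol sub2])
 qed (simp add: kc)
 have Phol: "(%w. Pic \<mu> w f v) holomorphic_on ball ?s e2 & (%w. Pw \<mu> w f v) holomorphic_on ball ?s e2" if f: "f \<in> V" for f v
 proof
  show "(%w. Pic \<mu> w f v) holomorphic_on ball ?s e2"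
   by (rule holomorphic_transform[OF holomorphic_on_subset[OF Prhol[OF f] sub2]]) (simp add: Pic f)
  show "(%w. Pw \<mu> w f v) holomorphic_on ball ?s e2"
  proof (rule Pw_hol[where B = "nB f"])
   show "a <= Re w & Re w <= b" if "w \<in> ball ?s e2" for w using that sub sub2 strip(1) by blast
  qed (use f in auto)
 qed
 have s2: "?s \<in> ball ?s e2" using e2 by simp
 show thesis
 proof (rule that)
  show "spectral_ball \<mu> \<gamma> s e2 C \<sigma> \<sigma>1"
   unfolding spectral_ball_def using e2(1) Cge(4) \<sigma> khol Phol body by blast
  show "Pic \<mu> ?s f = sc (ell f) rS" if f: "f \<in> V" for f
   unfolding Pic[OF s2 f] using Prs[OF f] by (auto simp: fun_eq_iff)
  show "kc \<mu> ?s = of_real \<kappa>" using kc[OF s2] Ks by simp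
 qed
qed

end

subsection \<open>The laws satisfying the positivity conditions\<close>

text \<open>\<open>cond_A2\<close> gives \<open>col_comparable\<close> for \<open>g\<close> and
  hence \<open>row_comparable\<close> for its transpose; \<open>cond_A1\<close> gives both
  properties for both matrices.\<close>

definition col_comparable :: "real => real ^ 'n ^ 'm => bool" where
 "col_comparable k g \<longleftrightarrow> (\<forall>i i' j. g $ i $ j <= k * g $ i' $ j)"

definition row_comparable :: "real => real ^ 'n ^ 'm => bool" where
 "row_comparable k g \<longleftrightarrow> (\<forall>i j j'. g $ i $ j <= k * g $ i $ j')"

definition balanced :: "real => (real ^ 'n) set" where
 "balanced k = {x \<in> \<S>. \<forall>i j. x $ i <= k * x $ j}"

lemma balanced_closed: "closed (balanced k :: (real ^ 'n) set)"
proof -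
 have "balanced k = \<S> \<inter> (\<Inter>i. \<Inter>j. {x :: real ^ 'n. x $ i <= k * x $ j})" by (auto simp: balanced_def)
 then show ?thesis by (simp only:) (intro closed_Int closed_simplex closed_INT ballI closed_Collect_le continuous_intros)
qed

lemma balanced_ge:
 fixes x :: "real ^ 'n"
 assumes "x \<in> balanced k"
 shows "1 <= real CARD('n) * k * x $ j"
proof -
 have x: "x \<in> \<S>" using assms by (simp add: balanced_def)
 have "1 = (\<Sum>i\<in>UNIV. x $ i)" using simplex_D(4)[OF x] simplex_D(1)[OF x] by (simp add: l1norm_def)
 also have "... <= (\<Sum>i\<in>(UNIV :: 'n set). k * x $ j)" using assms by (intro sum_mono) (simp add: balanced_def)
 finally show ?thesis by (simp add: mult.assoc)
qed

lemma simplex_le_1: "x \<in> \<S> ==> x $ j <= 1"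
 using member_le_sum[of j UNIV "%i. \<bar>x $ i\<bar>"] by (auto simp: simplex_S_def l1norm_def)

lemma simplex_sum: "x \<in> \<S> ==> (\<Sum>i\<in>UNIV. x $ i) = 1"
proof -
 assume x: "x \<in> \<S>"
 have "(\<Sum>i\<in>UNIV. x $ i) = l1norm x"
  unfolding l1norm_def using simplex_D(1)[OF x] by (intro sum.cong refl) simp
 then show ?thesis by (simp add: simplex_D(4)[OF x])
qed

text \<open>Comparable columns send every vector to a balanced one. A balanced vector has
  coordinates at least \<open>1 / (CARD('n) * k)\<close>, so any two are comparable coordinatewise,
  and so are their images.\<close>

lemma good_mat_col:
 fixes g :: "real ^ 'n ^ 'n"
 assumes g: "pos_mat g" "col_comparable k g" and k: "1 < k"
 shows "good_mat (balanced k) (real CARD('n) * k) (1 / k\<^sup>2) g"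
 unfolding good_mat_def
proof (intro conjI ballI allI)
 have gp: "0 <= g $ i $ j" for i j using g(1) by (simp add: pos_mat_def less_imp_le)
 have c: "g $ i $ j <= k * g $ i' $ j" for i i' j using g(2) by (simp add: col_comparable_def)
 show "act g v \<in> balanced k" if v: "v \<in> \<S>" for v
 proof -
  have "(g *v v) $ i <= k * (g *v v) $ j" for i j
   unfolding mat_vec_nth sum_distrib_left mult.assoc[symmetric]
   using c simplex_D(1)[OF v] by (intro sum_mono mult_right_mono)
  then have "act g v $ i <= k * act g v $ j" for i j
   using pos_mat_act(3)[OF g(1) v] by (simp add: act_def field_simps)
  then show ?thesis using pos_mat_act(1)[OF g(1) v] by (simp add: balanced_def)
 qed
 show "(g *v v) $ i <= (real CARD('n) * k) * (g *v u) $ i" if u: "u \<in> balanced k" and v: "v \<in> balanced k" for u v i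
  unfolding mat_vec_nth sum_distrib_left
 proof (rule sum_mono)
  fix j
  have "v $ j <= real CARD('n) * k * u $ j" using balanced_ge[OF u, of j] simplex_le_1[of v j] v by (simp add: balanced_def)
  then have "g $ i $ j * v $ j <= g $ i $ j * (real CARD('n) * k * u $ j)" by (rule mult_left_mono[OF _ gp])
  then show "g $ i $ j * v $ j <= (real CARD('n) * k) * (g $ i $ j * u $ j)" by (simp add: mult_ac)
 qed
 show "cross_ratio_bound (1 / k\<^sup>2) g"
  unfolding cross_ratio_bound_def
 proof (intro allI)
  fix i j a l
  have "g $ i $ l * g $ a $ j <= (k * g $ a $ l) * (k * g $ i $ j)" using c gp k by (intro mult_mono) auto
  then show "1 / k\<^sup>2 * (g $ i $ l * g $ a $ j) <= g $ i $ j * g $ a $ l"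
   using k by (simp add: field_simps power2_eq_square)
 qed
qed (rule g(1))

lemma row_comparable_mat_vec:
 assumes g: "row_comparable k g" and u: "u \<in> \<S>"
 shows "g $ i $ j <= k * (g *v u) $ i"
proof -
 have "g $ i $ j = (\<Sum>l\<in>UNIV. g $ i $ j * u $ l)" by (simp add: simplex_sum[OF u] flip: sum_distrib_left)
 also have "... <= (\<Sum>l\<in>UNIV. k * g $ i $ l * u $ l)"
  using g simplex_D(1)[OF u] by (intro sum_mono mult_right_mono) (auto simp: row_comparable_def)
 finally show ?thesis by (simp add: mat_vec_nth sum_distrib_left mult.assoc)
qed

text \<open>A row with comparable entries takes comparable values on all vectors of the simplex, so
  the whole simplex can serve as \<open>K\<close>.\<close>

lemma good_mat_row:
 fixes g :: "real ^ 'n ^ 'n"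
 assumes g: "pos_mat g" "row_comparable k g" and k: "1 < k"
 shows "good_mat \<S> k (1 / k\<^sup>2) g"
 unfolding good_mat_def
proof (intro conjI ballI allI)
 have gp: "0 <= g $ i $ j" for i j using g(1) by (simp add: pos_mat_def less_imp_le)
 have c: "g $ i $ j <= k * g $ i $ j'" for i j j' using g(2) by (simp add: row_comparable_def)
 show "act g v \<in> \<S>" if v: "v \<in> \<S>" for v by (rule pos_mat_act(1)[OF g(1) v])
 show "(g *v v) $ i <= k * (g *v u) $ i" if u: "u \<in> \<S>" and v: "v \<in> \<S>" for u v i
 proof -
  have "(g *v v) $ i <= (\<Sum>j\<in>UNIV. (k * (g *v u) $ i) * v $ j)"
   unfolding mat_vec_nth[of g v] using row_comparable_mat_vec[OF g(2) u] simplex_D(1)[OF v]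
   by (intro sum_mono mult_right_mono)
  then show ?thesis by (simp add: simplex_sum[OF v] flip: sum_distrib_left)
 qed
 show "cross_ratio_bound (1 / k\<^sup>2) g"
  unfolding cross_ratio_bound_def
 proof (intro allI)
  fix i j a l
  have "g $ i $ l * g $ a $ j <= (k * g $ i $ j) * (k * g $ a $ l)" using c gp k by (intro mult_mono) auto
  then show "1 / k\<^sup>2 * (g $ i $ l * g $ a $ j) <= g $ i $ j * g $ a $ l"
   using k by (simp add: field_simps power2_eq_square)
 qed
qed (rule g(1))

lemma l1norm_le_mnorm:
 assumes "pos_mat g" "v \<in> \<S>"
 shows "l1norm (g *v v) <= mnorm g"
proof -
 have gp: "0 <= g $ i $ j" for i j using assms(1) by (simp add: pos_mat_def less_imp_le)
 have "\<bar>(g *v v) $ i\<bar> <= (\<Sum>j\<in>UNIV. g $ i $ j)" for i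
 proof -
  have "\<bar>(g *v v) $ i\<bar> = (\<Sum>j\<in>UNIV. g $ i $ j * v $ j)"
   unfolding mat_vec_nth using gp simplex_D(1)[OF assms(2)] by (intro abs_of_nonneg sum_nonneg) auto
  also have "... <= (\<Sum>j\<in>UNIV. g $ i $ j)"
   using gp simplex_le_1[OF assms(2)] by (intro sum_mono mult_left_le)
  finally show ?thesis .
 qed
 then show ?thesis unfolding l1norm_def mnorm_def by (intro sum_mono)
qed

lemma mnorm_le_l1norm:
 fixes g :: "real ^ 'n ^ 'n"
 assumes "row_comparable k g" "v \<in> \<S>" and k: "0 <= k"
 shows "mnorm g <= real CARD('n) * k * l1norm (g *v v)"
proof -
 have "(\<Sum>j\<in>UNIV. g $ i $ j) <= real CARD('n) * k * \<bar>(g *v v) $ i\<bar>" for i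
 proof -
  have "k * (g *v v) $ i <= k * \<bar>(g *v v) $ i\<bar>" using k by (intro mult_left_mono) auto
  then have "(\<Sum>j\<in>UNIV. g $ i $ j) <= (\<Sum>j\<in>(UNIV :: 'n set). k * \<bar>(g *v v) $ i\<bar>)"
   using row_comparable_mat_vec[OF assms(1,2)] by (intro sum_mono) (meson order_trans)
  then show ?thesis by (simp add: mult_ac)
 qed
 then show ?thesis unfolding mnorm_def l1norm_def sum_distrib_left by (intro sum_mono)
qed

lemma mnorm_transpose: "mnorm (transpose g) = mnorm g"
 unfolding mnorm_def transpose_def by (simp, rule sum.swap)

lemma col_transpose: "col_comparable k (transpose g) \<longleftrightarrow> row_comparable k g"
 "row_comparable k (transpose g) \<longleftrightarrow> col_comparable k g" "pos_mat (transpose g) \<longleftrightarrow> pos_mat g"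
 by (auto simp: col_comparable_def row_comparable_def transpose_def pos_mat_def)

lemma comparable_measurable:
 "{g :: real ^ 'n ^ 'n. pos_mat g} \<in> sets borel" "{g :: real ^ 'n ^ 'n. col_comparable k g} \<in> sets borel"
 "{g :: real ^ 'n ^ 'n. row_comparable k g} \<in> sets borel"
proof -
 have "{g :: real ^ 'n ^ 'n. pos_mat g} = (\<Inter>i. \<Inter>j. {g. 0 < g $ i $ j})" by (auto simp: pos_mat_def)
 moreover have "open (\<Inter>i. \<Inter>j. {g :: real ^ 'n ^ 'n. 0 < g $ i $ j})"
  by (intro open_INT ballI open_Collect_less continuous_intros finite)
 ultimately show "{g :: real ^ 'n ^ 'n. pos_mat g} \<in> sets borel" by simp
 have "{g :: real ^ 'n ^ 'n. col_comparable k g} = (\<Inter>i. \<Inter>i'. \<Inter>j. {g. g $ i $ j <= k * g $ i' $ j})"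
  by (auto simp: col_comparable_def)
 moreover have "closed (\<Inter>i. \<Inter>i'. \<Inter>j. {g :: real ^ 'n ^ 'n. g $ i $ j <= k * g $ i' $ j})"
  by (intro closed_INT ballI closed_Collect_le continuous_intros)
 ultimately show "{g :: real ^ 'n ^ 'n. col_comparable k g} \<in> sets borel" by simp
 have "{g :: real ^ 'n ^ 'n. row_comparable k g} = (\<Inter>i. \<Inter>j. \<Inter>j'. {g. g $ i $ j <= k * g $ i $ j'})"
  by (auto simp: row_comparable_def)
 moreover have "closed (\<Inter>i. \<Inter>j. \<Inter>j'. {g :: real ^ 'n ^ 'n. g $ i $ j <= k * g $ i $ j'})"
  by (intro closed_INT ballI closed_Collect_le continuous_intros)
 ultimately show "{g :: real ^ 'n ^ 'n. row_comparable k g} \<in> sets borel" by simp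
qed

lemma continuous_on_mnorm: "continuous_on S (mnorm :: real ^ 'n ^ 'n => real)"
 unfolding mnorm_def[abs_def] by (intro continuous_intros)

definition moment :: "(real ^ 'n ^ 'n) measure => real => bool" where
 "moment \<mu> t \<longleftrightarrow> (\<integral>\<^sup>+ g. ennreal (mnorm g powr t) \<partial>\<mu>) < \<infinity>"

lemma moment_integrable:
 assumes "law_on_nonneg_mats \<mu>" "moment \<mu> t"
 shows "integrable \<mu> (%g. mnorm g powr t)"
proof (rule integrableI_nonneg)
 have "mnorm \<in> borel_measurable borel" by (intro borel_measurable_continuous_onI continuous_on_mnorm)
 from measurable_compose[OF law_id_measurable(1)[OF assms(1)] this]
 have [measurable]: "mnorm \<in> borel_measurable \<mu>" .
 show "(%g. mnorm g powr t) \<in> borel_measurable \<mu>" by measurable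
qed (use assms(2) in \<open>auto simp: moment_def\<close>)

text \<open>Column comparability is needed for the action of \<open>g\<close>; for a negative exponent, lower bounds
 on \<open>l1norm (g *v v)\<close> require row comparability as well.\<close>

lemma matrix_law_distr:
 fixes \<mu> :: "(real ^ 'n ^ 'n) measure" and \<tau> :: "real ^ 'n ^ 'n => real ^ 'n ^ 'n"
 assumes law: "law_on_nonneg_mats \<mu>" and \<tau>: "\<tau> \<in> \<mu> \<rightarrow>\<^sub>M borel" "!!g. mnorm (\<tau> g) = mnorm g"
  and t: "t ~= 0" "moment \<mu> t" and K: "K \<subseteq> \<S>" "closed K" "1 <= C" and k: "1 < k"
  and ae: "AE g in \<mu>. pos_mat (\<tau> g) & (c --> col_comparable k (\<tau> g)) & (r --> row_comparable k (\<tau> g))"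
  and neg: "0 < t \<or> r"
  and good: "!!g. pos_mat g ==> (c ==> col_comparable k g) ==> (r ==> row_comparable k g) ==> good_mat K C (1 / k\<^sup>2) g"
 shows "matrix_law (distr \<mu> borel \<tau>) K C (1 / k\<^sup>2) ((real CARD('n) * k) powr \<bar>t\<bar>) t"
proof -
 have pr: "prob_space \<mu>" using law by (simp add: law_on_nonneg_mats_def)
 interpret D: prob_space "distr \<mu> borel \<tau>" by (rule prob_space.prob_space_distr[OF pr \<tau>(1)])
 let ?P = "%g. pos_mat g & (c --> col_comparable k g) & (r --> row_comparable k g)"
 have s: "{g \<in> space borel. ?P g} \<in> sets borel"
 proof -
  have e: "{g \<in> space borel. ?P g} = {g. pos_mat g} \<inter> (if c then {g. col_comparable k g} else UNIV) \<inter> (if r then {g. row_comparable k g} else UNIV)"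
   by auto
  show ?thesis unfolding e using comparable_measurable(1) comparable_measurable(2,3)[of k]
   by (intro sets.Int) auto
 qed
 have ae': "AE g in distr \<mu> borel \<tau>. ?P g" using ae unfolding AE_distr_iff[OF \<tau>(1) s] .
 show ?thesis
 proof unfold_locales
  show "0 < 1 / k\<^sup>2" "1 / k\<^sup>2 <= 1" using k by auto
  show "AE g in distr \<mu> borel \<tau>. good_mat K C (1 / k\<^sup>2) g" using ae' by eventually_elim (rule good; simp)
  show "AE g in distr \<mu> borel \<tau>. \<forall>v\<in>\<S>. l1norm (g *v v) powr t <= (real CARD('n) * k) powr \<bar>t\<bar> * mnorm g powr t"
   using ae'
  proof eventually_elim
   case (elim g)
   show ?case
   proof
    fix v :: "real ^ 'n" assume v: "v \<in> \<S>"
    have p: "pos_mat g" using elim by simp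
    have d: "1 <= real CARD('n) * k" using k mult_mono[of 1 "real CARD('n)" 1 k] by (simp add: Suc_leI)
    have N: "0 < l1norm (g *v v)" by (rule pos_mat_act(3)[OF p v])
    have m: "0 < mnorm g" using N l1norm_le_mnorm[OF p v] by linarith
    show "l1norm (g *v v) powr t <= (real CARD('n) * k) powr \<bar>t\<bar> * mnorm g powr t"
    proof (cases "0 < t")
     case True
     have "1 * l1norm (g *v v) powr t <= (real CARD('n) * k) powr \<bar>t\<bar> * mnorm g powr t"
      using True N l1norm_le_mnorm[OF p v] d by (intro mult_mono powr_mono2 ge_one_powr_ge_zero) auto
     then show ?thesis by simp
    next
     case False
     then have "mnorm g <= real CARD('n) * k * l1norm (g *v v)" using neg elim v k by (intro mnorm_le_l1norm) auto
     then have "(real CARD('n) * k * l1norm (g *v v)) powr t <= mnorm g powr t" using False m by (intro powr_mono2') auto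
     then have "(real CARD('n) * k) powr - t * ((real CARD('n) * k) powr t * l1norm (g *v v) powr t) <= (real CARD('n) * k) powr - t * mnorm g powr t"
      using d N by (intro mult_left_mono) (auto simp: powr_mult)
     moreover have "(real CARD('n) * k) powr - t * ((real CARD('n) * k) powr t * l1norm (g *v v) powr t) = l1norm (g *v v) powr t"
      using d k by (simp add: mult.assoc[symmetric] flip: powr_add)
     ultimately show ?thesis using False by simp
    qed
   qed
  qed
  have [measurable]: "mnorm \<in> borel_measurable borel" by (intro borel_measurable_continuous_onI continuous_on_mnorm)
  have "(%g :: real ^ 'n ^ 'n. mnorm g powr t) \<in> borel_measurable borel" by measurable
  then show "integrable (distr \<mu> borel \<tau>) (%g. mnorm g powr t)"
   using moment_integrable[OF law t(2)] by (subst integrable_distr_eq[OF \<tau>(1)]) (auto simp: \<tau>(2))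
 qed (use K t in auto)
qed

definition case_A :: "(real ^ 'n ^ 'n) measure => real => bool" where
 "case_A \<mu> t \<longleftrightarrow> cond_A1 \<mu> & t < 0 \<or> cond_A2 \<mu> & 0 < t"

lemma Max_Min_comparable:
 fixes f :: "'a::finite => real"
 assumes "Max {f x |x. True} <= k * Min {f x |x. True}" "0 <= k"
 shows "f x <= k * f y"
proof -
 have e: "{f x |x. True} = range f" by auto
 have "f x <= Max (range f)" "Min (range f) <= f y" by simp_all
 then have "k * Min (range f) <= k * f y" using assms(2) by (intro mult_left_mono)
 then show ?thesis using assms(1) \<open>f x <= _\<close> unfolding e by linarith
qed

text \<open>Under \<open>cond_A1\<close> both laws use balanced vectors, whose coordinates are
  bounded below, as \<open>KT_pos\<close> demands for \<open>t < 0\<close>. Under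
  \<open>cond_A2\<close> the transpose is controlled by its rows only, so its \<open>K\<close> is
  the whole simplex and \<open>KT_pos\<close> holds through \<open>0 < t\<close>.\<close>

lemma two_sided_law_ex:
 fixes \<mu> :: "(real ^ 'n ^ 'n) measure"
 assumes law: "law_on_nonneg_mats \<mu>" and t: "case_A \<mu> t" "moment \<mu> t"
 shows "\<exists>K C p c1 KT CT pT c1T. two_sided_law \<mu> t K C p c1 KT CT pT c1T"
proof -
 note m = law_id_measurable(1,2)[OF law]
 have d: "1 <= real CARD('n) * k" if "1 < k" for k
  using that mult_mono[of 1 "real CARD('n)" 1 k] by (simp add: Suc_leI)
 have bS: "balanced k \<subseteq> (\<S> :: (real ^ 'n) set)" for k by (auto simp: balanced_def)
 from t(1) consider (1) "cond_A1 \<mu>" "t < 0" | (2) "cond_A2 \<mu>" "0 < t" by (auto simp: case_A_def)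
 then show ?thesis
 proof cases
  case 1
  then obtain k where k: "1 < k" and ae: "AE g in \<mu>. pos_mat g & Max {g $ i $ j |i j. True} <= k * Min {g $ i $ j |i j. True}"
   by (auto simp: cond_A1_def)
  have ae': "AE g in \<mu>. pos_mat g & col_comparable k g & row_comparable k g"
   using ae
  proof eventually_elim
   case (elim g)
   have e: "{g $ i $ j |i j. True} = {g $ fst x $ snd x |x. True}" by force
   have "g $ i $ j <= k * g $ i' $ j'" for i j i' j'
    using Max_Min_comparable[of "%x. g $ fst x $ snd x" k "(i, j)" "(i', j')"] elim k unfolding e by simp
   then show ?case using elim by (simp add: col_comparable_def row_comparable_def)
  qed
  have "two_sided_law \<mu> t (balanced k) (real CARD('n) * k) (1 / k\<^sup>2) ((real CARD('n) * k) powr \<bar>t\<bar>)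
   (balanced k) (real CARD('n) * k) (1 / k\<^sup>2) ((real CARD('n) * k) powr \<bar>t\<bar>)"
  proof (intro two_sided_law.intro two_sided_law_axioms.intro law)
   show "matrix_law (distr \<mu> borel (%g. g)) (balanced k) (real CARD('n) * k) (1 / k\<^sup>2) ((real CARD('n) * k) powr \<bar>t\<bar>) t"
    by (rule matrix_law_distr[OF law m(1), where c=True and r=True])
     (use 1 t k d bS balanced_closed good_mat_col ae' in auto)
   show "matrix_law (distr \<mu> borel transpose) (balanced k) (real CARD('n) * k) (1 / k\<^sup>2) ((real CARD('n) * k) powr \<bar>t\<bar>) t"
    by (rule matrix_law_distr[OF law m(2), where c=True and r=True])
     (use 1 t k d bS balanced_closed good_mat_col ae' in \<open>auto simp: mnorm_transpose col_transpose\<close>)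
   have "1 / (real CARD('n) * k) <= x $ i" if "x \<in> balanced k" for x :: "real ^ 'n" and i
    using balanced_ge[OF that, of i] d[OF k] k by (simp add: divide_le_eq mult_ac)
   moreover have "0 < 1 / (real CARD('n) * k)" using k by simp
   ultimately show "0 < t \<or> (\<exists>\<epsilon>>0. \<forall>x\<in>(balanced k :: (real ^ 'n) set). \<forall>i. \<epsilon> <= x $ i)" by blast
  qed
  then show ?thesis by blast
 next
  case 2
  then obtain k where k: "1 < k" and ae: "AE g in \<mu>. pos_mat g & (\<forall>j. Max {g $ i $ j |i. True} <= k * Min {g $ i $ j |i. True})"
   by (auto simp: cond_A2_def)
  have ae': "AE g in \<mu>. pos_mat g & col_comparable k g"
   using ae
  proof eventually_elim
   case (elim g)
   have "g $ i $ j <= k * g $ i' $ j" for i i' j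
    using Max_Min_comparable[of "%i. g $ i $ j" k i i'] elim k by simp
   then show ?case using elim by (simp add: col_comparable_def)
  qed
  have "two_sided_law \<mu> t (balanced k) (real CARD('n) * k) (1 / k\<^sup>2) ((real CARD('n) * k) powr \<bar>t\<bar>)
   \<S> k (1 / k\<^sup>2) ((real CARD('n) * k) powr \<bar>t\<bar>)"
  proof (intro two_sided_law.intro two_sided_law_axioms.intro law)
   show "matrix_law (distr \<mu> borel (%g. g)) (balanced k) (real CARD('n) * k) (1 / k\<^sup>2) ((real CARD('n) * k) powr \<bar>t\<bar>) t"
    by (rule matrix_law_distr[OF law m(1), where c=True and r=False])
     (use 2 t k d bS balanced_closed good_mat_col ae' in auto)
   show "matrix_law (distr \<mu> borel transpose) \<S> k (1 / k\<^sup>2) ((real CARD('n) * k) powr \<bar>t\<bar>) t"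
    by (rule matrix_law_distr[OF law m(2), where c=False and r=True])
     (use 2 t k d closed_simplex good_mat_row ae' in \<open>auto simp: mnorm_transpose col_transpose\<close>)
  qed (use 2 in simp)
  then show ?thesis by blast
 qed
qed

lemma strip_point_ex:
 fixes \<mu> :: "(real ^ 'n ^ 'n) measure"
 assumes law: "law_on_nonneg_mats \<mu>" and t: "!!t. a <= t ==> t <= b ==> case_A \<mu> t & moment \<mu> t"
  and s: "a < s" "s < b" and \<gamma>: "0 < \<gamma>" "\<gamma> <= 1"
 shows "\<exists>Bd K C p c1 KT CT pT c1T. strip_point \<mu> a b \<gamma> Bd s K C p c1 KT CT pT c1T"
proof -
 have D: "\<exists>c1. AE g in \<mu>. pos_mat g & (\<forall>v\<in>\<S>. l1norm (g *v v) powr x <= c1 * mnorm g powr x)" if x: "a <= x" "x <= b" for x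
 proof -
  obtain K C p c1 KT CT pT c1T where "two_sided_law \<mu> x K C p c1 KT CT pT c1T"
   using two_sided_law_ex[OF law] t[OF x] by blast
  then interpret two_sided_law \<mu> x K C p c1 KT CT pT c1T .
  have "AE g in \<mu>. \<forall>v\<in>\<S>. l1norm (g *v v) powr x <= c1 * mnorm g powr x"
   using M.dom by (rule AE_distrD[OF law_id_measurable(1)[OF law]])
  with M_good have "AE g in \<mu>. pos_mat g & (\<forall>v\<in>\<S>. l1norm (g *v v) powr x <= c1 * mnorm g powr x)"
   by eventually_elim (auto dest: M.good_pos)
  then show ?thesis by blast
 qed
 obtain ca where ca: "AE g in \<mu>. pos_mat g & (\<forall>v\<in>\<S>. l1norm (g *v v) powr a <= ca * mnorm g powr a)" using D[of a] s by auto
 obtain cb where cb: "AE g in \<mu>. pos_mat g & (\<forall>v\<in>\<S>. l1norm (g *v v) powr b <= cb * mnorm g powr b)" using D[of b] s by auto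
 define Bd where "Bd g = ca * mnorm g powr a + cb * mnorm g powr b" for g :: "real ^ 'n ^ 'n"
 have sl: "strip_law \<mu> a b \<gamma> Bd"
 proof
  show "AE g in \<mu>. pos_mat g & (\<forall>v\<in>\<S>. l1norm (g *v v) powr a + l1norm (g *v v) powr b <= Bd g)"
   using ca cb by eventually_elim (auto simp: Bd_def intro!: add_mono)
  show "integrable \<mu> Bd" unfolding Bd_def[abs_def]
   using t[of a] t[of b] s moment_integrable[OF law] by (intro Bochner_Integration.integrable_add integrable_mult_right) auto
 qed (rule law \<gamma>)+
 obtain K C p c1 KT CT pT c1T where "two_sided_law \<mu> s K C p c1 KT CT pT c1T"
  using two_sided_law_ex[OF law] t[OF less_imp_le[OF s(1)] less_imp_le[OF s(2)]] by blast
 with sl have "strip_point \<mu> a b \<gamma> Bd s K C p c1 KT CT pT c1T"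
  using s by (intro strip_point.intro strip_point_axioms.intro)
 then show ?thesis by blast
qed

subsection \<open>The normalized operators\<close>

text \<open>As \<open>Pic\<close> is a limit of iterates, this family depends on \<open>s\<close>
  and \<open>z\<close> alone and not on a disc in which the gap was obtained; one choice therefore
  fits all radii.\<close>

definition Proj_op :: "(real ^ 'n ^ 'n) measure => real => complex => (real ^ 'n => complex) => real ^ 'n => complex" where
 "Proj_op \<mu> s z f v = (if v \<in> \<S>
   then Pic \<mu> (of_real s + z) (%u. if u \<in> \<S> then of_real (r_fun \<mu> s u) * f u else 0) v / of_real (r_fun \<mu> s v) else 0)"

definition lam :: "(real ^ 'n ^ 'n) measure => real => complex => complex" where
 "lam \<mu> s z = exp (- of_real (deriv (Lambda \<mu>) s) * z) * (kc \<mu> (of_real s + z) / of_real (kappa \<mu> s))"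

definition N_op :: "(real ^ 'n ^ 'n) measure => real => complex => (real ^ 'n => complex) => real ^ 'n => complex" where
 "N_op \<mu> s z f = R_op \<mu> s z f - sc (lam \<mu> s z) (Proj_op \<mu> s z f)"

text \<open>\<open>Q\<close> is a projection on whose range \<open>R\<close> is multiplication by
  \<open>l\<close>, so \<open>N\<close> is \<open>R\<close> composed with the complementary
  projection. For \<open>n = 0\<close> the power formula would read \<open>f = f - Q f\<close>,
  hence \<open>1 <= n\<close>.\<close>

lemma projection_algebra:
 fixes R Q N :: "'n::finite operator"
 assumes R: "R \<in> bounded_ops \<gamma>" and P: "Q \<in> bounded_ops \<gamma>"
  and QR: "!!f. f \<in> space_B \<gamma> ==> Q (R f) = sc l (Q f)" and RQ: "!!f. f \<in> space_B \<gamma> ==> R (Q f) = sc l (Q f)"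
  and QQ: "!!f. f \<in> space_B \<gamma> ==> Q (Q f) = Q f" and f: "f \<in> space_B \<gamma>"
  and N: "!!f. N f = R f - sc l (Q f)"
 shows "Q (N f) = (%v. 0)" "N (Q f) = (%v. 0)" "1 <= n ==> (N ^^ n) f = (R ^^ n) f - sc (l ^ n) (Q f)"
proof -
 interpret B: fspace "space_B \<gamma>" "norm_B \<gamma>" by (rule fspace_B)
 have RV: "R h \<in> space_B \<gamma>" and QV: "Q h \<in> space_B \<gamma>" if "h \<in> space_B \<gamma>" for h
  using R P that by (auto simp: bounded_ops_iff)
 have Rsc: "R (sc c h) = sc c (R h)" and Qsc: "Q (sc c h) = sc c (Q h)" if "h \<in> space_B \<gamma>" for c h
  using R P that by (auto simp: bounded_ops_iff)
 have Rdiff: "R (h - \<xi>) = R h - R \<xi>" and Qdiff: "Q (h - \<xi>) = Q h - Q \<xi>" if "h \<in> space_B \<gamma>" "\<xi> \<in> space_B \<gamma>" for h \<xi>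
 proof -
  have "R (h + sc (-1) \<xi>) = R h + R (sc (-1) \<xi>)" "Q (h + sc (-1) \<xi>) = Q h + Q (sc (-1) \<xi>)"
   using R P that B.V_sc[OF that(2)] by (auto simp: bounded_ops_iff)
  then show "R (h - \<xi>) = R h - R \<xi>" "Q (h - \<xi>) = Q h - Q \<xi>"
   unfolding B.minus_sc Rsc[OF that(2)] Qsc[OF that(2)] by simp_all
 qed
 have Rn: "(R ^^ n) h \<in> space_B \<gamma>" if "h \<in> space_B \<gamma>" for n h using that by (induction n) (auto intro: RV)
 have QRn: "Q ((R ^^ n) h) = sc (l ^ n) (Q h)" if "h \<in> space_B \<gamma>" for n h
 proof (induction n)
  case (Suc n)
  have "Q ((R ^^ Suc n) h) = sc l (sc (l ^ n) (Q h))" unfolding Suc.IH[symmetric] using QR[OF Rn[OF that]] by simp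
  then show ?case by (simp add: fun_eq_iff)
 qed (simp add: fun_eq_iff)
 show "N (Q f) = (%v. 0)"
  unfolding N RQ[OF f] QQ[OF f] by (simp add: fun_eq_iff)
 show "Q (N f) = (%v. 0)"
  unfolding N Qdiff[OF RV[OF f] B.V_sc[OF QV[OF f]]] QR[OF f] Qsc[OF QV[OF f]] QQ[OF f] by (simp add: fun_eq_iff)
 have Ndiff: "N (h - sc c (Q f)) = N h" if h: "h \<in> space_B \<gamma>" for h c
 proof -
  have V: "sc c (Q f) \<in> space_B \<gamma>" by (intro B.V_sc QV f)
  show ?thesis
   unfolding N Rdiff[OF h V] Qdiff[OF h V] Rsc[OF QV[OF f]] Qsc[OF QV[OF f]] RQ[OF f] QQ[OF f]
   by (simp add: fun_eq_iff algebra_simps)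
 qed
 show "(N ^^ n) f = (R ^^ n) f - sc (l ^ n) (Q f)" if "1 <= n"
  using that
 proof (induction n rule: dec_induct)
  case base
  show ?case using N[of f] by simp
 next
  case (step n)
  have "(N ^^ Suc n) f = N ((R ^^ n) f - sc (l ^ n) (Q f))" unfolding step.IH[symmetric] by simp
  also have "... = R ((R ^^ n) f) - sc l (sc (l ^ n) (Q f))" unfolding Ndiff[OF Rn[OF f]] unfolding N QRn[OF f] ..
  finally show ?case by (simp add: fun_eq_iff mult.assoc)
 qed
qed

text \<open>Two base points are kept apart: the normalization belongs to \<open>s\<close>, the gap
  and its constants come from the disc around \<open>s0\<close>. This is the source of uniformity in
  \<open>s\<close>.\<close>

locale spectral_point = strip_point \<mu> a b \<gamma> Bd s K C p c1 KT CT pT c1T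
 for \<mu> :: "(real ^ 'n ^ 'n) measure" and a b \<gamma> Bd s K C p c1 KT CT pT c1T +
 fixes s0 \<epsilon> Cs \<sigma> \<sigma>1 :: real
 assumes sb: "spectral_ball \<mu> \<gamma> s0 \<epsilon> Cs \<sigma> \<sigma>1"
begin

definition Wr :: "(real ^ 'n => complex) => real ^ 'n => complex" where "Wr f = (%u. rS u * f u)"
definition Ur :: "(real ^ 'n => complex) => real ^ 'n => complex" where "Ur f = (%u. rI u * f u)"
definition cj :: "complex => 'n operator => 'n operator" where "cj c A f = sc c (Ur (A (Wr f)))"

sublocale B: fspace V nB by (rule fspace_B)

lemma rSI: "v \<in> \<S> ==> rS v * rI v = 1"
 using rt_pos[OF simplex_cone, of v] by (simp add: rS_def rI_def)

lemma WU: "f \<in> V ==> Wr (Ur f) = f" and UW: "f \<in> V ==> Ur (Wr f) = f"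
proof -
 assume f: "f \<in> V"
 have "rS v * (rI v * f v) = f v" for v
  using rSI[of v] space_B_outside[OF f, of v] by (cases "v \<in> \<S>") (simp_all flip: mult.assoc)
 then show "Wr (Ur f) = f" "Ur (Wr f) = f" unfolding Wr_def Ur_def fun_eq_iff by (simp_all add: mult_ac)
qed

lemma WrV: "f \<in> V ==> Wr f \<in> V" and Wr_norm: "f \<in> V ==> nB (Wr f) <= 3 * nB rS * nB f"
 and UrV: "f \<in> V ==> Ur f \<in> V" and Ur_norm: "f \<in> V ==> nB (Ur f) <= 3 * nB rI * nB f"
 unfolding Wr_def Ur_def by (simp_all add: space_B_mult rS_rI_space \<gamma>)

lemma Wr_lin: "Wr (f + h) = Wr f + Wr h" "Wr (sc c f) = sc c (Wr f)" "Ur (f + h) = Ur f + Ur h" "Ur (sc c f) = sc c (Ur f)"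
  "Wr (f - h) = Wr f - Wr h" "Ur (f - h) = Ur f - Ur h"
 by (auto simp: Wr_def Ur_def fun_eq_iff algebra_simps)

definition Z where "Z = 9 * nB rI * nB rS"
lemma Z_nonneg: "0 <= Z" by (simp add: Z_def)

lemma cj_norm:
 assumes A: "!!f. f \<in> V ==> A f \<in> V" "!!f. f \<in> V ==> nB (A f) <= B * nB f" "0 <= B"
  and f: "f \<in> V"
 shows "nB (cj c A f) <= cmod c * Z * B * nB f"
proof -
 have "nB (cj c A f) = cmod c * nB (Ur (A (Wr f)))"
  unfolding cj_def by (rule norm_B_sc[OF UrV[OF A(1)[OF WrV[OF f]]]])
 also have "nB (Ur (A (Wr f))) <= 3 * nB rI * nB (A (Wr f))"
  by (rule Ur_norm[OF A(1)[OF WrV[OF f]]])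
 also have "... <= 3 * nB rI * (B * (3 * nB rS * nB f))"
  using A(3) by (intro mult_left_mono order_trans[OF A(2)[OF WrV[OF f]]] Wr_norm f) auto
 also have "cmod c * ... = cmod c * Z * B * nB f" by (simp add: Z_def)
 finally show ?thesis by (simp add: mult_left_mono)
qed

lemma cj_bounded:
 assumes A: "A \<in> bounded_ops \<gamma>"
 shows "cj c A \<in> bounded_ops \<gamma>"
proof -
 obtain B0 where B0: "!!f. f \<in> V ==> nB (A f) <= B0 * nB f" using A unfolding bounded_ops_iff by blast
 have B: "nB (A f) <= max B0 0 * nB f" if "f \<in> V" for f
  by (rule order_trans[OF B0[OF that] mult_right_mono]) auto
 have AV: "A f \<in> V" if "f \<in> V" for f using A that by (auto simp: bounded_ops_iff)
 have lin: "A (Wr f + Wr h) = A (Wr f) + A (Wr h)" "A (sc d (Wr f)) = sc d (A (Wr f))"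
  if "f \<in> V" "h \<in> V" for f h d
  using A WrV[OF that(1)] WrV[OF that(2)] by (auto simp: bounded_ops_iff)
 show ?thesis
  unfolding bounded_ops_iff
 proof (intro conjI ballI allI exI[of _ "cmod c * Z * max B0 0"])
  fix f h :: "real ^ 'n => complex" and d assume f: "f \<in> V"
  show "cj c A f \<in> V" unfolding cj_def by (intro B.V_sc UrV AV WrV f)
  show "cj c A (sc d f) = sc d (cj c A f)"
   unfolding cj_def Wr_lin lin(2)[OF f f] by (auto simp: fun_eq_iff)
  show "nB (cj c A f) <= cmod c * Z * max B0 0 * nB f" by (rule cj_norm[OF AV B _ f]) auto
  assume h: "h \<in> V"
  show "cj c A (f + h) = cj c A f + cj c A h"
   unfolding cj_def Wr_lin lin(1)[OF f h] by (auto simp: fun_eq_iff distrib_left)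
 qed
qed

lemma cj_pow:
 assumes A: "A \<in> bounded_ops \<gamma>" and f: "f \<in> V"
 shows "(cj c A ^^ n) f = cj (c ^ n) (A ^^ n) f"
proof (induction n)
 case 0
 show ?case using UW[OF f] by (simp add: cj_def fun_eq_iff)
next
 case (Suc n)
 have AV: "A h \<in> V" if "h \<in> V" for h using A that by (auto simp: bounded_ops_iff)
 have An: "(A ^^ n) (Wr f) \<in> V" by (induction n) (auto intro: AV WrV f)
 have "(cj c A ^^ Suc n) f = cj c A (cj (c ^ n) (A ^^ n) f)" using Suc.IH by simp
 also have "... = sc c (Ur (A (sc (c ^ n) ((A ^^ n) (Wr f)))))" unfolding cj_def Wr_lin WU[OF An] ..
 also have "A (sc (c ^ n) ((A ^^ n) (Wr f))) = sc (c ^ n) (A ((A ^^ n) (Wr f)))" using A An by (auto simp: bounded_ops_iff)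
 also have "sc c (Ur ...) = cj (c ^ Suc n) (A ^^ Suc n) f" unfolding Wr_lin by (simp add: cj_def fun_eq_iff)
 finally show ?case .
qed

abbreviation "q \<equiv> deriv (Lambda \<mu>) s"
definition cz where "cz z = exp (- of_real q * z) / of_real (kappa \<mu> s)"

lemma Wr_r_fun: "Wr f = (%u. if u \<in> \<S> then of_real (r_fun \<mu> s u) * f u else 0)"
 by (auto simp: Wr_def rS_def rt_r_fun)

lemma Proj_eq: "Proj_op \<mu> s z = cj 1 (Pic \<mu> (of_real s + z))"
 by (auto simp: fun_eq_iff Proj_op_def cj_def Ur_def rI_def rt_r_fun Wr_r_fun divide_inverse)

text \<open>The factor \<open>exp (z * (ln l - q))\<close>, where \<open>l\<close> is the norm of
  the image, merges with \<open>l powr s\<close> into exponent \<open>s + z\<close> and leaves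
  \<open>exp (- q z)\<close>. Hence \<open>R_op\<close> is a scalar multiple of \<open>Pw\<close>
  conjugated by \<open>rS\<close>.\<close>

lemma R_eq: "f \<in> V ==> R_op \<mu> s z f = cj (cz z) (Pw \<mu> (of_real s + z)) f"
proof
 fix v assume f: "f \<in> V"
 show "R_op \<mu> s z f v = cj (cz z) (Pw \<mu> (of_real s + z)) f v"
 proof (cases "v \<in> \<S>")
  case True
  let ?F = "%g. of_real (l1norm (g *v v) powr s) * of_real (r_fun \<mu> s (act g v))
      * exp (z * of_real (ln (l1norm (g *v v)) - q)) * f (act g v)"
  let ?G = "%g. exp (- of_real q * z) * (exp ((of_real s + z) * of_real (ln (l1norm (g *v v)))) * Wr f (act g v))"
  have rm: "rt \<in> borel_measurable borel" using rt_cls by (simp add: M.cls_def M.homog_def)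
  have [measurable]: "(%g. g *v v) \<in> \<mu> \<rightarrow>\<^sub>M borel"
   using measurable_compose[OF law_id_measurable(1)[OF law] measurable_mat_vec] .
  have [measurable]: "(%g. act g v) \<in> \<mu> \<rightarrow>\<^sub>M borel" unfolding act_def by measurable
  have [measurable]: "f \<in> borel_measurable borel" "r_fun \<mu> s \<in> borel_measurable borel"
   using space_B_borel[OF f] rm unfolding rt_r_fun by auto
  have mF: "?F \<in> borel_measurable \<mu>" by measurable
  have mG: "?G \<in> borel_measurable \<mu>"
   by (intro borel_measurable_times borel_measurable_const law_measurable_integrand law space_B_borel[OF WrV[OF f]])
  have "(\<integral>g. ?F g \<partial>\<mu>) = (\<integral>g. ?G g \<partial>\<mu>)"
  proof (rule integral_cong_AE[OF mF mG])
   show "AE g in \<mu>. ?F g = ?G g"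
    using M_good
   proof eventually_elim
    case (elim g)
    have p: "pos_mat g" by (rule M.good_pos[OF elim])
    have N: "0 < l1norm (g *v v)" and S: "act g v \<in> \<S>" using pos_mat_act(1,3)[OF p True] by auto
    let ?L = "ln (l1norm (g *v v))"
    have 1: "complex_of_real (l1norm (g *v v) powr s) = exp (of_real s * of_real ?L)"
     using N by (simp add: powr_def flip: exp_of_real)
    have 2: "exp (of_real s * of_real ?L) * exp (z * of_real (?L - q)) = exp (- of_real q * z) * exp ((of_real s + z) * of_real ?L)"
     by (simp add: algebra_simps flip: exp_add)
    have "?F g = (exp (of_real s * of_real ?L) * exp (z * of_real (?L - q))) * (of_real (r_fun \<mu> s (act g v)) * f (act g v))"
     unfolding 1 by (simp only: mult_ac)
    also have "... = ?G g" unfolding 2 using S by (simp add: Wr_r_fun mult_ac)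
    finally show ?case .
   qed
  qed
  then show ?thesis using True
   by (simp add: R_op_def cj_def Ur_def rI_def rt_r_fun Pw_def cz_def)
 qed (simp add: R_op_def cj_def Ur_def rI_def)
qed

lemma sbD:
 "0 <= Cs" "0 <= \<sigma>" "\<sigma> < \<sigma>1" "kc \<mu> holomorphic_on ball (of_real s0) \<epsilon>"
 "f \<in> V ==> (%w. Pic \<mu> w f v) holomorphic_on ball (of_real s0) \<epsilon>"
 "f \<in> V ==> (%w. Pw \<mu> w f v) holomorphic_on ball (of_real s0) \<epsilon>"
 and sb_at: "w \<in> ball (of_real s0) \<epsilon> ==> spectral_at \<mu> \<gamma> Cs \<sigma> \<sigma>1 w"
 using sb unfolding spectral_ball_def by blast+

lemmas sbw = sb_at[unfolded spectral_at_def]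

definition Rc where "Rc z = cj (cz z) (Pw \<mu> (of_real s + z))"

lemma N_eq: "f \<in> V ==> N_op \<mu> s z f = Rc z f - sc (lam \<mu> s z) (Proj_op \<mu> s z f)"
 by (simp only: N_op_def R_eq Rc_def)

lemma lam_eq: "lam \<mu> s z = cz z * kc \<mu> (of_real s + z)" by (simp add: lam_def cz_def)

context
 fixes z :: complex assumes z: "of_real s + z \<in> ball (of_real s0) \<epsilon>"
begin

lemma Pw_b: "Pw \<mu> (of_real s + z) \<in> bounded_ops \<gamma>" and Pic_b: "Pic \<mu> (of_real s + z) \<in> bounded_ops \<gamma>"
 using sbw[OF z] by auto

lemma Pw_in: "f \<in> V ==> Pw \<mu> (of_real s + z) f \<in> V" and Pic_in: "f \<in> V ==> Pic \<mu> (of_real s + z) f \<in> V"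
 using Pw_b Pic_b by (auto simp: bounded_ops_iff)

lemma Rc_b: "Rc z \<in> bounded_ops \<gamma>" and Proj_b: "Proj_op \<mu> s z \<in> bounded_ops \<gamma>"
 unfolding Rc_def Proj_eq by (intro cj_bounded Pw_b Pic_b)+

lemma Rc_in: "f \<in> V ==> Rc z f \<in> V" and Proj_in: "f \<in> V ==> Proj_op \<mu> s z f \<in> V"
 using Rc_b Proj_b by (auto simp: bounded_ops_iff)

lemma Proj_norm: "f \<in> V ==> nB (Proj_op \<mu> s z f) <= Z * Cs * nB f"
 unfolding Proj_eq using cj_norm[of "Pic \<mu> (of_real s + z)" Cs f 1] Pic_in sbw[OF z] sbD(1) by simp

lemma Rc_norm: "f \<in> V ==> nB (Rc z f) <= cmod (cz z) * Z * Cs * nB f"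
 unfolding Rc_def using cj_norm[of "Pw \<mu> (of_real s + z)" Cs f "cz z"] Pw_in sbw[OF z] sbD(1) by simp

lemma Q_Rc: assumes f: "f \<in> V"
 shows "Proj_op \<mu> s z (Rc z f) = sc (lam \<mu> s z) (Proj_op \<mu> s z f)" (is ?A)
  and "Rc z (Proj_op \<mu> s z f) = sc (lam \<mu> s z) (Proj_op \<mu> s z f)" (is ?B)
  and "Proj_op \<mu> s z (Proj_op \<mu> s z f) = Proj_op \<mu> s z f" (is ?C)
proof -
 let ?w = "complex_of_real s + z"
 note W = WrV[OF f]
 have e: "Pic \<mu> ?w (Pw \<mu> ?w (Wr f)) = sc (kc \<mu> ?w) (Pic \<mu> ?w (Wr f))"
  "Pw \<mu> ?w (Pic \<mu> ?w (Wr f)) = sc (kc \<mu> ?w) (Pic \<mu> ?w (Wr f))"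
  "Pic \<mu> ?w (Pic \<mu> ?w (Wr f)) = Pic \<mu> ?w (Wr f)"
  using sbw[OF z] W by auto
 have s: "Pic \<mu> ?w (sc c h) = sc c (Pic \<mu> ?w h)" if "h \<in> V" for c h using Pic_b that by (auto simp: bounded_ops_iff)
 have sc1: "sc 1 h = h" for h :: "real ^ 'n => complex" by (simp add: fun_eq_iff)
 show ?A unfolding Proj_eq Rc_def cj_def Wr_lin WU[OF Pw_in[OF W]] s[OF Pw_in[OF W]] e lam_eq sc1 by (simp add: fun_eq_iff)
 show ?B unfolding Proj_eq Rc_def cj_def Wr_lin sc1 WU[OF Pic_in[OF W]] e lam_eq by (simp add: fun_eq_iff)
 show ?C unfolding Proj_eq cj_def Wr_lin sc1 WU[OF Pic_in[OF W]] e ..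
qed

text \<open>The identity of \<open>R_op\<close> with the conjugated operator is available on
  \<open>V\<close>. \<open>Nc\<close> coincides with \<open>N_op\<close> there and satisfies its
  defining equation for all arguments, as \<open>projection_algebra\<close> asks.\<close>

definition Nc where "Nc f = Rc z f - sc (lam \<mu> s z) (Proj_op \<mu> s z f)"

lemmas algebra = projection_algebra[OF Rc_b Proj_b Q_Rc _ Nc_def]

lemma Nc_in: "f \<in> V ==> Nc f \<in> V"
 unfolding Nc_def by (intro B.V_diff B.V_sc Rc_in Proj_in)

lemma N_pow: "f \<in> V ==> (N_op \<mu> s z ^^ n) f = (Nc ^^ n) f & (Nc ^^ n) f \<in> V"
proof (induction n)
 case (Suc n)
 then have IH: "(N_op \<mu> s z ^^ n) f = (Nc ^^ n) f" "(Nc ^^ n) f \<in> V" by auto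
 have "N_op \<mu> s z ((Nc ^^ n) f) = Nc ((Nc ^^ n) f)" unfolding Nc_def[of "(Nc ^^ n) f"] by (rule N_eq[OF IH(2)])
 then show ?case using IH Nc_in by simp
qed simp

lemma R_pow: "f \<in> V ==> (R_op \<mu> s z ^^ n) f = (Rc z ^^ n) f & (Rc z ^^ n) f \<in> V"
proof (induction n)
 case (Suc n)
 then have IH: "(R_op \<mu> s z ^^ n) f = (Rc z ^^ n) f" "(Rc z ^^ n) f \<in> V" by auto
 have "R_op \<mu> s z ((Rc z ^^ n) f) = Rc z ((Rc z ^^ n) f)" using R_eq[OF IH(2), of z] by (simp only: Rc_def)
 then show ?case using IH Rc_in by simp
qed simp

lemma N_props:
 assumes f: "f \<in> V"
 shows "Proj_op \<mu> s z (N_op \<mu> s z f) = (%v. 0)" "N_op \<mu> s z (Proj_op \<mu> s z f) = (%v. 0)"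
  "1 <= n ==> (R_op \<mu> s z ^^ n) f = (%v. lam \<mu> s z ^ n * Proj_op \<mu> s z f v + (N_op \<mu> s z ^^ n) f v)"
proof -
 have e: "N_op \<mu> s z h = Nc h" if "h \<in> V" for h using N_pow[OF that, of 1] by simp
 show "Proj_op \<mu> s z (N_op \<mu> s z f) = (%v. 0)" unfolding e[OF f] by (rule algebra(1)[OF _ _ _ f])
 show "N_op \<mu> s z (Proj_op \<mu> s z f) = (%v. 0)" unfolding e[OF Proj_in[OF f]] by (rule algebra(2)[OF _ _ _ f])
 assume n: "1 <= n"
 have "(Nc ^^ n) f = (Rc z ^^ n) f - sc (lam \<mu> s z ^ n) (Proj_op \<mu> s z f)" by (rule algebra(3)[OF _ _ _ f n])
 then show "(R_op \<mu> s z ^^ n) f = (%v. lam \<mu> s z ^ n * Proj_op \<mu> s z f v + (N_op \<mu> s z ^^ n) f v)"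
  using N_pow[OF f, of n] R_pow[OF f, of n] by (simp add: fun_eq_iff)
qed

lemma N_norm:
 assumes f: "f \<in> V"
 shows "nB (N_op \<mu> s z f) <= (cmod (cz z) * Z * Cs + cmod (lam \<mu> s z) * (Z * Cs)) * nB f"
proof -
 have "nB (N_op \<mu> s z f) <= nB (Rc z f) + nB (sc (lam \<mu> s z) (Proj_op \<mu> s z f))"
  unfolding N_eq[OF f] by (intro B.nm_diff B.V_sc Rc_in Proj_in f)
 also have "... <= cmod (cz z) * Z * Cs * nB f + cmod (lam \<mu> s z) * (Z * Cs * nB f)"
  unfolding norm_B_sc[OF Proj_in[OF f]] by (intro add_mono mult_left_mono Rc_norm Proj_norm f) auto
 finally show ?thesis by (simp add: algebra_simps)
qed

lemma N_bounded: "N_op \<mu> s z \<in> bounded_ops \<gamma>"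
proof -
 have lin: "Rc z (f + h) = Rc z f + Rc z h" "Rc z (sc c f) = sc c (Rc z f)"
  "Proj_op \<mu> s z (f + h) = Proj_op \<mu> s z f + Proj_op \<mu> s z h" "Proj_op \<mu> s z (sc c f) = sc c (Proj_op \<mu> s z f)"
  if "f \<in> V" "h \<in> V" for f h c
  using Rc_b Proj_b that by (auto simp: bounded_ops_iff)
 show "N_op \<mu> s z \<in> bounded_ops \<gamma>"
  unfolding bounded_ops_iff
 proof (intro conjI ballI allI exI)
  fix f h :: "real ^ 'n => complex" and c assume f: "f \<in> V"
  show "N_op \<mu> s z f \<in> V" unfolding N_eq[OF f] by (intro B.V_diff B.V_sc Rc_in Proj_in f)
  show "N_op \<mu> s z (sc c f) = sc c (N_op \<mu> s z f)"
   unfolding N_eq[OF f] N_eq[OF B.V_sc[OF f]] lin[OF f f] by (auto simp: fun_eq_iff algebra_simps)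
  show "nB (N_op \<mu> s z f) <= (cmod (cz z) * Z * Cs + cmod (lam \<mu> s z) * (Z * Cs)) * nB f" by (rule N_norm[OF f])
  assume h: "h \<in> V"
  show "N_op \<mu> s z (f + h) = N_op \<mu> s z f + N_op \<mu> s z h"
   unfolding N_eq[OF f] N_eq[OF h] N_eq[OF B.V_add[OF f h]] lin[OF f h] by (auto simp: fun_eq_iff algebra_simps)
 qed
qed

text \<open>In the powers of \<open>N_op\<close> the projection part cancels, which leaves the
  conjugated error term of \<open>spectral_at\<close>, of order
  \<open>(cmod (cz z) * \<sigma>)^n\<close>. The range of the projection provides the kernel vector
  for \<open>spec_radius_le\<close>.\<close>

lemma N_spec_radius:
 assumes \<rho>: "cmod (cz z) * \<sigma> <= \<rho>"
 shows "spec_radius_B \<gamma> (N_op \<mu> s z :: 'n operator) <= \<rho>"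
proof (rule spec_radius_le[OF N_bounded, of "max 1 (Z * Cs)" _ "Proj_op \<mu> s z (Ur oneS)"])
 let ?w = "complex_of_real s + z"
 have c\<sigma>: "0 <= cmod (cz z) * \<sigma>" using sbD(2) by simp
 then show "0 <= \<rho>" using \<rho> by linarith
 show "nB ((N_op \<mu> s z ^^ n) f) <= max 1 (Z * Cs) * \<rho> ^ n * nB f"
  if f: "f \<in> V" for f :: "real ^ 'n => complex" and n
 \<comment> \<open>The power formula starts at \<open>n = 1\<close>; the trivial case is the reason
   for \<open>max 1\<close> in the constant.\<close>
 proof (cases "n = 0")
  case True
  then show ?thesis using mult_right_mono[of 1 "max 1 (Z * Cs)" "nB f"] by simp
 next
  case False
  let ?E = "%h. (Pw \<mu> ?w ^^ n) h - sc (kc \<mu> ?w ^ n) (Pic \<mu> ?w h)"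
  have PwV: "(Pw \<mu> ?w ^^ n) h \<in> V" if "h \<in> V" for h using that by (induction n) (auto intro: Pw_in)
  have "(N_op \<mu> s z ^^ n) f = (Rc z ^^ n) f - sc (lam \<mu> s z ^ n) (Proj_op \<mu> s z f)"
   using N_pow[OF f, of n] algebra(3)[OF _ _ _ f, of n] False by simp
  also have "(Rc z ^^ n) f = cj (cz z ^ n) (Pw \<mu> ?w ^^ n) f" unfolding Rc_def by (rule cj_pow[OF Pw_b f])
  also have "... - sc (lam \<mu> s z ^ n) (Proj_op \<mu> s z f) = cj (cz z ^ n) ?E f"
   unfolding Proj_eq cj_def Wr_lin lam_eq by (simp add: fun_eq_iff algebra_simps power_mult_distrib)
  finally have e: "(N_op \<mu> s z ^^ n) f = cj (cz z ^ n) ?E f" .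
  have "nB (cj (cz z ^ n) ?E f) <= cmod (cz z ^ n) * Z * (Cs * \<sigma> ^ n) * nB f"
  proof (rule cj_norm)
   show "?E h \<in> V" if "h \<in> V" for h by (intro B.V_diff B.V_sc PwV Pic_in that)
   show "nB (?E h) <= Cs * \<sigma> ^ n * nB h" if "h \<in> V" for h using sbw[OF z] that by blast
  qed (use sbD f in auto)
  also have "... = (Z * Cs) * (cmod (cz z) * \<sigma>) ^ n * nB f" by (simp add: norm_power power_mult_distrib)
  also have "... <= max 1 (Z * Cs) * \<rho> ^ n * nB f"
   using \<rho> c\<sigma> Z_nonneg sbD(1) by (intro mult_right_mono mult_mono power_mono) auto
  finally show ?thesis unfolding e .
 qed
 have U: "Ur oneS \<in> V" by (intro UrV oneS_space)
 show "Proj_op \<mu> s z (Ur oneS) \<in> V" by (rule Proj_in[OF U])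
 show "N_op \<mu> s z (Proj_op \<mu> s z (Ur oneS)) = (%v. 0)" by (rule N_props(2)[OF U])
 have "Wr (Proj_op \<mu> s z (Ur oneS)) = Pic \<mu> ?w oneS"
  unfolding Proj_eq cj_def Wr_lin WU[OF oneS_space] WU[OF Pic_in[OF oneS_space]] by (simp add: fun_eq_iff)
 then show "Proj_op \<mu> s z (Ur oneS) ~= (%v. 0)" using sbw[OF z] by (auto simp: Wr_def)
qed

end

text \<open>The explicit projection is known at the centre of a disc. So
  \<open>local_spectrum\<close> is invoked at \<open>s\<close> itself, which is legitimate because
  \<open>Pic\<close> is the same for all discs.\<close>

lemma Proj_0:
 assumes \<phi>: "\<phi> \<in> V" and v: "v \<in> \<S>"
 shows "Proj_op \<mu> s 0 \<phi> v = pi_s \<mu> s \<phi>"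
proof -
 obtain e C' t t1 where "spectral_ball \<mu> \<gamma> s e C' t t1"
  and P: "!!\<phi>. \<phi> \<in> V ==> Pic \<mu> (of_real s) \<phi> = sc (ell \<phi>) rS" and "kc \<mu> (of_real s) = of_real (kappa \<mu> s)"
  by (rule local_spectrum) (rule that)
 have "Proj_op \<mu> s 0 \<phi> v = ell (Wr \<phi>)"
  unfolding Proj_eq cj_def using P[OF WrV[OF \<phi>]] rSI[OF v] by (simp add: Ur_def mult_ac)
 also have "... = (\<integral>v. \<phi> v * of_real (rt v) \<partial>M.\<nu>) / of_real nr"
  unfolding ell_def by (intro arg_cong[where f="%x. x / _"] Bochner_Integration.integral_cong refl)
   (simp add: M.space_\<nu> Wr_def rS_def)
 also have "nr = (\<integral>v. rt v \<partial>M.\<nu>)" using M.integral_\<nu>[OF rt_continuous] by (simp add: nr_def)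
 finally show ?thesis unfolding pi_s_def nu_eq rt_r_fun .
qed

end

subsection \<open>Uniformity in the real parameter\<close>

context spectral_point
begin

lemma cz_hol: "cz holomorphic_on D"
 unfolding cz_def[abs_def] using kappa_pos by (intro holomorphic_intros) auto

lemma cz_bound:
 assumes "cmod z <= \<delta>"
 shows "cmod (cz z) <= exp (\<bar>q\<bar> * \<delta>) / kappa \<mu> s"
proof -
 have "Re (- of_real q * z) <= cmod (- of_real q * z)" by (rule complex_Re_le_cmod)
 also have "... <= \<bar>q\<bar> * \<delta>" using assms by (simp add: norm_mult mult_left_mono)
 finally show ?thesis using kappa_pos by (simp add: cz_def norm_divide divide_right_mono)
qed

text \<open>The norm bound of \<open>Pw\<close> is evaluated on its eigenvector
  \<open>Pic \<mu> w oneS\<close>.\<close>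

lemma kc_bound:
 assumes w: "w \<in> ball (of_real s0) \<epsilon>"
 shows "cmod (kc \<mu> w) <= Cs"
proof -
 let ?x = "Pic \<mu> w oneS"
 have x: "?x \<in> V" using sbw[OF w] oneS_space by (auto simp: bounded_ops_iff)
 have "cmod (kc \<mu> w) * nB ?x = nB (sc (kc \<mu> w) ?x)" by (rule norm_B_sc[OF x, symmetric])
 also have "... = nB (Pw \<mu> w ?x)" using sbw[OF w] oneS_space by metis
 also have "... <= Cs * nB ?x" using sbw[OF w] x by blast
 finally have le: "cmod (kc \<mu> w) * nB ?x <= Cs * nB ?x" .
 obtain v where "?x v ~= 0" using sbw[OF w] by (auto simp: fun_eq_iff)
 then have "0 < nB ?x" using space_B_bound[OF x, of v] by (meson less_le_trans zero_less_norm_iff)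
 then show ?thesis using le by simp
qed

lemma decomposition:
 assumes \<delta>: "0 < \<delta>" and sub: "!!z :: complex. z \<in> ball 0 \<delta> ==> of_real s + z \<in> ball (of_real s0) \<epsilon>"
  and kr: "!!t. \<bar>t - s\<bar> < \<delta> ==> kc \<mu> (of_real t) = of_real (kappa \<mu> t)"
  and I: "!!t. \<bar>t - s\<bar> < \<delta> ==> t \<in> I_mu \<mu>"
 shows "spectral_decomposition \<mu> \<gamma> s \<delta> (Proj_op \<mu> s) (N_op \<mu> s)"
proof -
 let ?D = "ball (0 :: complex) \<delta>"
 have shift: "(%z. f (of_real s + z)) holomorphic_on ?D" if "f holomorphic_on ball (of_real s0) \<epsilon>" for f :: "complex => complex"
 proof -
  have "(%z. of_real s + z) ` ?D \<subseteq> ball (of_real s0) \<epsilon>" using sub by blast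
  then have "(f \<circ> (%z. of_real s + z)) holomorphic_on ?D"
   by (intro holomorphic_on_compose_gen[OF _ that] holomorphic_intros)
  then show ?thesis by (simp add: comp_def)
 qed
 have sub': "ball (complex_of_real s) \<delta> \<subseteq> ball (of_real s0) \<epsilon>"
 proof
  fix w assume "w \<in> ball (complex_of_real s) \<delta>"
  then have "w - of_real s \<in> ?D" by (simp add: dist_norm norm_minus_commute)
  from sub[OF this] show "w \<in> ball (of_real s0) \<epsilon>" by simp
 qed
 have lam_hol: "lam \<mu> s holomorphic_on ?D"
  unfolding lam_eq[abs_def] by (intro holomorphic_intros cz_hol shift sbD(4))
 have Proj_hol: "(%z. Proj_op \<mu> s z \<phi> v) holomorphic_on ?D" if \<phi>: "\<phi> \<in> V" for \<phi> v
  unfolding Proj_eq cj_def sc_apply Ur_def by (intro holomorphic_intros shift sbD(5) WrV \<phi>)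
 have N_hol: "(%z. N_op \<mu> s z \<phi> v) holomorphic_on ?D" if \<phi>: "\<phi> \<in> V" for \<phi> v
  unfolding N_eq[OF \<phi>] Rc_def cj_def fun_diff_def sc_apply Ur_def
  by (intro holomorphic_intros cz_hol lam_hol Proj_hol shift sbD(6) WrV \<phi>)
 define B where "B = exp (\<bar>q\<bar> * \<delta>) / kappa \<mu> s * (Z * Cs + Cs * (Z * Cs))"
 have N_le: "nB (N_op \<mu> s z \<phi>) <= B * nB \<phi>" if z: "z \<in> ?D" and \<phi>: "\<phi> \<in> V" for z \<phi>
 proof -
  have 1: "cmod (cz z) <= exp (\<bar>q\<bar> * \<delta>) / kappa \<mu> s" using z by (intro cz_bound) auto
  have 2: "cmod (lam \<mu> s z) <= cmod (cz z) * Cs"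
   unfolding lam_eq norm_mult by (intro mult_left_mono kc_bound[OF sub[OF z]]) simp
  have "cmod (cz z) * Z * Cs + cmod (lam \<mu> s z) * (Z * Cs) <= cmod (cz z) * Z * Cs + cmod (cz z) * Cs * (Z * Cs)"
   using 2 Z_nonneg sbD(1) by (intro add_left_mono mult_right_mono) auto
  also have "... = cmod (cz z) * (Z * Cs + Cs * (Z * Cs))" by (simp add: algebra_simps)
  also have "... <= B" unfolding B_def using 1 Z_nonneg sbD(1) by (intro mult_right_mono) auto
  finally show ?thesis using N_norm[OF sub[OF z] \<phi>] mult_right_mono[of _ B "nB \<phi>"] by (meson norm_B_nonneg order_trans)
 qed
 show ?thesis
  unfolding spectral_decomposition_def
 proof (intro conjI)
  show "\<forall>z\<in>?D. s + Re z \<in> I_mu \<mu>"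
  proof
   fix z :: complex assume "z \<in> ?D"
   then have "\<bar>(s + Re z) - s\<bar> < \<delta>" using abs_Re_le_cmod[of z] by simp
   then show "s + Re z \<in> I_mu \<mu>" by (rule I)
  qed
  show "\<exists>K l. analytic_extension_at (kappa \<mu>) s \<delta> K &
    l = (%z. exp (- of_real q * z) * (K (of_real s + z) / of_real (kappa \<mu> s))) &
    l analytic_on ?D &
    (\<forall>z\<in>?D. \<forall>n\<ge>1. \<forall>\<phi>\<in>V.
      (R_op \<mu> s z ^^ n) \<phi> = (%v. l z ^ n * Proj_op \<mu> s z \<phi> v + (N_op \<mu> s z ^^ n) \<phi> v))"
  proof (rule exI[of _ "kc \<mu>"], rule exI[of _ "lam \<mu> s"], intro conjI)
   show "analytic_extension_at (kappa \<mu>) s \<delta> (kc \<mu>)"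
    unfolding analytic_extension_at_def analytic_on_open[OF open_ball]
    using holomorphic_on_subset[OF sbD(4) sub'] kr by auto
   show "lam \<mu> s = (%z. exp (- of_real q * z) * (kc \<mu> (of_real s + z) / of_real (kappa \<mu> s)))"
    by (simp add: lam_def fun_eq_iff)
   show "lam \<mu> s analytic_on ?D" unfolding analytic_on_open[OF open_ball] by (rule lam_hol)
   show "\<forall>z\<in>?D. \<forall>n\<ge>1. \<forall>\<phi>\<in>V. (R_op \<mu> s z ^^ n) \<phi> = (%v. lam \<mu> s z ^ n * Proj_op \<mu> s z \<phi> v + (N_op \<mu> s z ^^ n) \<phi> v)"
    using N_props(3)[OF sub] by blast
  qed
  show "op_analytic_on \<gamma> (Proj_op \<mu> s) ?D"
   by (rule op_analytic_onI[OF open_ball Proj_b[OF sub] Proj_norm[OF sub] Proj_hol])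
  show "op_analytic_on \<gamma> (N_op \<mu> s) ?D"
   by (rule op_analytic_onI[OF open_ball N_bounded[OF sub] N_le N_hol])
  show "\<forall>z\<in>?D. \<forall>\<phi>\<in>V. Proj_op \<mu> s z (N_op \<mu> s z \<phi>) = (%v. 0) & N_op \<mu> s z (Proj_op \<mu> s z \<phi>) = (%v. 0)"
   using N_props(1,2)[OF sub] by blast
  show "\<forall>\<phi>\<in>V. \<forall>v\<in>\<S>. Proj_op \<mu> s 0 \<phi> v = pi_s \<mu> s \<phi>" using Proj_0 by blast
 qed
qed

text \<open>Near \<open>s\<close> the function \<open>kappa\<close> is the restriction of the
  holomorphic \<open>kc\<close>, so \<open>q\<close> is a genuine logarithmic derivative and is
  bounded by data of the disc around \<open>s0\<close>.\<close>

lemma q_bound: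
 assumes e: "0 < e" "ball (complex_of_real s) e \<subseteq> ball (of_real s0) \<epsilon>"
  and kr: "!!t. \<bar>t - s\<bar> < e ==> kc \<mu> (of_real t) = of_real (kappa \<mu> t)"
 shows "\<bar>q\<bar> <= cmod (deriv (kc \<mu>) (of_real s)) / \<sigma>1"
proof -
 let ?d = "deriv (kc \<mu>) (of_real s)"
 have sin: "of_real s \<in> ball (complex_of_real s0) \<epsilon>"
  using e(1) centre_in_ball[of "complex_of_real s" e] by (intro subsetD[OF e(2)]) blast
 have "(kc \<mu> has_field_derivative ?d) (at (of_real s))"
  using holomorphic_derivI[OF sbD(4) open_ball sin] .
 then have "((%t. Re (kc \<mu> (of_real t))) has_vector_derivative Re ?d) (at s)"
  by (intro bounded_linear.has_vector_derivative[OF bounded_linear_Re] has_vector_derivative_real_field)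
 then have "((%t. Re (kc \<mu> (of_real t))) has_real_derivative Re ?d) (at s)"
  by (simp add: has_real_derivative_iff_has_vector_derivative)
 then have "(kappa \<mu> has_real_derivative Re ?d) (at s)"
  by (rule has_field_derivative_transform_within_open[where S="ball s e"])
   (use e kr in \<open>auto simp: dist_real_def abs_minus_commute\<close>)
 then have "(Lambda \<mu> has_real_derivative (1 / kappa \<mu> s * Re ?d)) (at s)"
  unfolding Lambda_def[abs_def] using kappa_pos by (auto intro!: derivative_eq_intros)
 then have "q = Re ?d / kappa \<mu> s" by (simp add: DERIV_imp_deriv)
 then have "\<bar>q\<bar> = \<bar>Re ?d\<bar> / kappa \<mu> s" using kappa_pos by simp
 also have "... <= cmod ?d / \<sigma>1"
 proof (intro frac_le abs_Re_le_cmod)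
  show "0 < \<sigma>1" using sbD(2,3) by simp
  have "kc \<mu> (of_real s) = of_real (kappa \<mu> s)" using kr[of s] e by simp
  then show "\<sigma>1 <= kappa \<mu> s" using sbw[OF sin] kappa_pos by simp
 qed auto
 finally show ?thesis .
qed

end

text \<open>The factor \<open>exp (- q z)\<close> may enlarge the error rate, which becomes at most
  \<open>exp (\<bar>q\<bar> \<delta>) * \<sigma> / \<sigma>1\<close>. With \<open>\<tau>\<close>
  halfway between \<open>\<sigma> / \<sigma>1\<close> and 1, \<open>\<delta>\<close> is chosen so
  that the exponential is at most \<open>\<tau>^(-1/2)\<close>; this leaves
  \<open>\<rho> = \<tau>^(1/2)\<close>.\<close>

lemma local_uniform:
 fixes \<mu> :: "(real ^ 'n ^ 'n) measure"
 assumes law: "law_on_nonneg_mats \<mu>" and \<gamma>: "0 < \<gamma>" "\<gamma> <= 1"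
  and t: "!!t. a <= t ==> t <= b ==> case_A \<mu> t & moment \<mu> t" and s0: "a < s0" "s0 < b"
 shows "\<exists>\<delta>>0. \<exists>\<rho><1. \<forall>s. \<bar>s - s0\<bar> < \<delta> --> spectral_decomposition \<mu> \<gamma> s \<delta> (Proj_op \<mu> s) (N_op \<mu> s) &
  (\<forall>z\<in>ball 0 \<delta>. spec_radius_B \<gamma> (N_op \<mu> s z :: 'n operator) <= \<rho>)"
proof -
 have sp: "\<exists>Bd K C p c1 KT CT pT c1T. strip_point \<mu> a b \<gamma> Bd s K C p c1 KT CT pT c1T" if "a < s" "s < b" for s
  by (rule strip_point_ex[OF law t that \<gamma>])
 have kr: "kc \<mu> (of_real s) = of_real (kappa \<mu> s) & 0 < kappa \<mu> s" if s: "a < s" "s < b" for s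
 proof -
  obtain Bd K C p c1 KT CT pT c1T where "strip_point \<mu> a b \<gamma> Bd s K C p c1 KT CT pT c1T" using sp[OF s] by blast
  then interpret strip_point \<mu> a b \<gamma> Bd s K C p c1 KT CT pT c1T .
  show ?thesis using kc_real[OF V_s] kappa_pos by blast
 qed
 obtain \<epsilon> Cs \<sigma> \<sigma>1 where sb: "spectral_ball \<mu> \<gamma> s0 \<epsilon> Cs \<sigma> \<sigma>1"
 proof -
  obtain Bd K C p c1 KT CT pT c1T where "strip_point \<mu> a b \<gamma> Bd s0 K C p c1 KT CT pT c1T" using sp[OF s0] by blast
  then interpret strip_point \<mu> a b \<gamma> Bd s0 K C p c1 KT CT pT c1T .
  show thesis by (rule local_spectrum) (rule that)
 qed
 define e where "e = min \<epsilon> (min (s0 - a) (b - s0))"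
 have e: "0 < e" "e <= \<epsilon>" "!!x. \<bar>x - s0\<bar> < e ==> a < x & x < b"
  using sb s0 by (auto simp: e_def spectral_ball_def)
 have hol: "kc \<mu> holomorphic_on ball (of_real s0) \<epsilon>" and \<sigma>: "0 <= \<sigma>" "\<sigma> < \<sigma>1" using sb by (auto simp: spectral_ball_def)
 have "continuous_on (cball (complex_of_real s0) (e / 2)) (deriv (kc \<mu>))"
  using e by (intro continuous_on_subset[OF holomorphic_on_imp_continuous_on[OF holomorphic_deriv[OF hol open_ball]]]) auto
 from compact_imp_bounded[OF compact_continuous_image[OF this compact_cball]]
 obtain D where D: "!!w. w \<in> cball (of_real s0) (e / 2) ==> cmod (deriv (kc \<mu>) w) <= D"
  unfolding bounded_iff by blast
 have D0: "0 <= D" using e by (intro order_trans[OF norm_ge_zero D[of "of_real s0"]]) simp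
 define Q where "Q = D / \<sigma>1"
 have Q0: "0 <= Q" using D0 \<sigma> by (simp add: Q_def)
 define \<tau> where "\<tau> = (1 + \<sigma> / \<sigma>1) / 2"
 have \<tau>: "0 < \<tau>" "\<tau> < 1" "\<sigma> / \<sigma>1 <= \<tau>" using \<sigma> by (auto simp: \<tau>_def field_simps add_pos_nonneg)
 \<comment> \<open>\<open>e / 4\<close> leaves room for the displacements of both \<open>s\<close>
   and \<open>z\<close> and keeps \<open>s\<close> in the closed disc where \<open>D\<close> bounds
   the derivative.\<close>
 define \<delta> where "\<delta> = min (e / 4) (- ln \<tau> / (2 * (Q + 1)))"
 have ln\<tau>: "ln \<tau> < 0" using \<tau> by simp
 have "0 < \<delta>" using e(1) ln\<tau> Q0 by (auto simp: \<delta>_def divide_neg_pos)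
 moreover have "\<delta> <= e / 4" unfolding \<delta>_def by (rule min.cobounded1)
 ultimately have \<delta>: "0 < \<delta>" "\<delta> <= e / 4" .
 have Q\<delta>: "Q * \<delta> <= - ln \<tau> / 2"
 proof -
  have "Q * \<delta> <= (Q + 1) * (- ln \<tau> / (2 * (Q + 1)))"
   using Q0 \<delta> by (intro mult_mono) (auto simp: \<delta>_def)
  also have "... = - ln \<tau> / 2" using Q0 by (simp add: field_simps)
  finally show ?thesis .
 qed
 define \<rho> where "\<rho> = exp (ln \<tau> / 2)"
 have "spectral_decomposition \<mu> \<gamma> s \<delta> (Proj_op \<mu> s) (N_op \<mu> s) &
  (\<forall>z\<in>ball 0 \<delta>. spec_radius_B \<gamma> (N_op \<mu> s z :: 'n operator) <= \<rho>)" if s: "\<bar>s - s0\<bar> < \<delta>" for s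
 proof -
  have ab: "a < s" "s < b" using e(3)[of s] s \<delta> e(1) by auto
  obtain Bd K C p c1 KT CT pT c1T where "strip_point \<mu> a b \<gamma> Bd s K C p c1 KT CT pT c1T" using sp[OF ab] by blast
  then interpret spectral_point \<mu> a b \<gamma> Bd s K C p c1 KT CT pT c1T s0 \<epsilon> Cs \<sigma> \<sigma>1
   using sb by (intro spectral_point.intro spectral_point_axioms.intro)
  have near: "\<bar>x - s0\<bar> < e" if "\<bar>x - s\<bar> < \<delta>" for x using that s \<delta> e(1) by linarith
  have krs: "kc \<mu> (of_real x) = of_real (kappa \<mu> x)" if "\<bar>x - s\<bar> < \<delta>" for x
   using kr[of x] e(3)[OF near[OF that]] by blast
  have sub: "of_real s + z \<in> ball (of_real s0) \<epsilon>" if "z \<in> ball 0 \<delta>" for z :: complex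
  proof -
   have "cmod (complex_of_real s0 - (of_real s + z)) <= cmod (of_real (s0 - s)) + cmod z"
    using norm_triangle_ineq4[of "complex_of_real (s0 - s)" z] by (simp add: algebra_simps)
   also have "... < \<epsilon>" unfolding norm_of_real using s \<delta> e that by simp
   finally show ?thesis by (simp add: dist_norm)
  qed
  have I: "x \<in> I_mu \<mu>" if "\<bar>x - s\<bar> < \<delta>" for x
   using t[of x] e(3)[OF near[OF that]] by (cases "0 <= x") (auto simp: I_mu_def I_plus_def I_minus_def moment_def)
  have dec: "spectral_decomposition \<mu> \<gamma> s \<delta> (Proj_op \<mu> s) (N_op \<mu> s)" by (rule decomposition[OF \<delta>(1) sub krs I])
  have "spec_radius_B \<gamma> (N_op \<mu> s z :: 'n operator) <= \<rho>" if z: "z \<in> ball 0 \<delta>" for z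
  proof (rule N_spec_radius[OF sub[OF z]])
   have bs: "ball (complex_of_real s) \<delta> \<subseteq> ball (of_real s0) \<epsilon>"
   proof
    fix w assume "w \<in> ball (complex_of_real s) \<delta>"
    then have "w - of_real s \<in> ball 0 \<delta>" by (simp add: dist_norm norm_minus_commute)
    from sub[OF this] show "w \<in> ball (of_real s0) \<epsilon>" by simp
   qed
   have "cmod (complex_of_real s0 - of_real s) = \<bar>s0 - s\<bar>" by (metis norm_of_real of_real_diff)
   then have "of_real s \<in> cball (complex_of_real s0) (e / 2)" unfolding mem_cball dist_norm using s \<delta> e(1) by linarith
   then have "cmod (deriv (kc \<mu>) (of_real s)) / \<sigma>1 <= Q" unfolding Q_def using \<sigma> by (intro divide_right_mono D) auto
   then have q: "\<bar>q\<bar> <= Q" using q_bound[OF \<delta>(1) bs krs] by linarith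
   have qd: "\<bar>q\<bar> * \<delta> <= - ln \<tau> / 2" using mult_right_mono[OF q less_imp_le[OF \<delta>(1)]] Q\<delta> by linarith
   have \<kappa>: "\<sigma>1 <= kappa \<mu> s" using sbw[of "of_real s"] sub[of 0] \<delta>(1) krs[of s] kappa_pos by simp
   have "cmod (cz z) <= exp (\<bar>q\<bar> * \<delta>) / kappa \<mu> s" using z by (intro cz_bound) auto
   also have "... <= exp (- ln \<tau> / 2) / \<sigma>1"
    using \<kappa> \<sigma> qd by (intro frac_le) auto
   finally have "cmod (cz z) * \<sigma> <= exp (- ln \<tau> / 2) / \<sigma>1 * \<sigma>" using \<sigma> by (intro mult_right_mono)
   also have "... = exp (- ln \<tau> / 2) * (\<sigma> / \<sigma>1)" by simp
   also have "... <= exp (- ln \<tau> / 2) * \<tau>" using \<tau> by (intro mult_left_mono) auto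
   also have "... = exp (- ln \<tau> / 2) * exp (ln \<tau>)" using \<tau> by simp
   also have "... = \<rho>" unfolding \<rho>_def exp_add[symmetric] by (simp add: field_simps)
   finally show "cmod (cz z) * \<sigma> <= \<rho>" .
  qed
  with dec show ?thesis by blast
 qed
 moreover have "\<rho> < 1" using ln\<tau> by (simp add: \<rho>_def)
 ultimately show ?thesis using \<delta>(1) by blast
qed

lemma spectral_decomposition_mono:
 assumes "spectral_decomposition \<mu> \<gamma> s \<delta> P N" "\<delta>' <= \<delta>"
 shows "spectral_decomposition \<mu> \<gamma> s \<delta>' P N"
proof -
 have b: "ball x \<delta>' \<subseteq> ball x \<delta>" for x :: complex using assms(2) by (rule subset_ball)
 have op: "op_analytic_on \<gamma> F (ball 0 \<delta>')" if "op_analytic_on \<gamma> F (ball 0 \<delta>)" for F :: "complex => 'a operator"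
  using that b[of 0] unfolding op_analytic_on_def by (meson open_ball subsetD)
 have ext: "analytic_extension_at f s \<delta>' K" if "analytic_extension_at f s \<delta> K" for f K
  using that analytic_on_subset[OF _ b] assms(2) by (auto simp: analytic_extension_at_def)
 show ?thesis
  using assms(1) unfolding spectral_decomposition_def
  apply (elim conjE exE)
  apply (intro conjI op; (assumption)?)
  subgoal using b by blast
  subgoal for K lam using b[of 0] by (rule_tac exI[of _ K], rule_tac exI[of _ lam], intro conjI ext) (blast intro: analytic_on_subset)+
  subgoal using b by blast
  done
qed

text \<open>The interval is kept shorter than \<open>\<bar>s\<bar>\<close> on either side, so all
  its points have the sign of \<open>s\<close> and fall under the same positivity condition.\<close>

lemma regular_point:
 assumes "s \<in> interior (I_plus \<mu>) \<union> interior (I_minus \<mu>) \<or> s \<in> interior (I_mu \<mu>)" "s ~= 0"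
  and c: "(cond_A1 \<mu> & s \<in> I_minus \<mu>) \<or> (cond_A2 \<mu> & s \<in> I_plus \<mu>)"
 obtains a b where "a < s" "s < b" "!!t. a <= t ==> t <= b ==> case_A \<mu> t & moment \<mu> t"
proof -
 have "interior (I_plus \<mu>) \<subseteq> interior (I_mu \<mu>)" "interior (I_minus \<mu>) \<subseteq> interior (I_mu \<mu>)"
  by (intro interior_mono; simp add: I_mu_def)+
 then have "s \<in> interior (I_mu \<mu>)" using assms(1) by blast
 then obtain e where e: "0 < e" "ball s e \<subseteq> I_mu \<mu>" by (auto simp: mem_interior)
 define d where "d = min (e / 2) (\<bar>s\<bar> / 2)"
 have d: "0 < d" "d < e" "d < \<bar>s\<bar>" using e assms(2) by (auto simp: d_def min_def)
 show thesis
 proof (rule that[of "s - d" "s + d"])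
  fix x assume x: "s - d <= x" "x <= s + d"
  then have "x \<in> I_mu \<mu>" using e(2) d by (auto simp: dist_real_def)
  then have m: "moment \<mu> x" by (auto simp: I_mu_def I_plus_def I_minus_def moment_def)
  from c have "case_A \<mu> x"
   unfolding case_A_def using x d assms(2) by (auto simp: I_minus_def I_plus_def)
  with m show "case_A \<mu> x & moment \<mu> x" by blast
 qed (use d in auto)
qed

theorem proposition2p15:
  fixes \<mu> :: "(real ^ 'n ^ 'n) measure" and \<gamma> :: real
  assumes dim: "2 \<le> CARD('n)"
    and law: "law_on_nonneg_mats \<mu>"
    and gamma: "0 < \<gamma>"
  shows "\<exists>Proj N.
    (\<forall>s \<in> interior (I_mu \<mu>) - {0}.
       (cond_A1 \<mu> \<and> s \<in> I_minus \<mu>) \<or> (cond_A2 \<mu> \<and> s \<in> I_plus \<mu>) \<longrightarrow>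
       \<gamma> \<le> min \<bar>s\<bar> 1 \<longrightarrow>
       (\<exists>\<delta>>0. spectral_decomposition \<mu> \<gamma> s \<delta> (Proj s) (N s))) \<and>
    (\<forall>J. compact J \<longrightarrow> J \<subseteq> interior (I_plus \<mu>) \<union> interior (I_minus \<mu>) \<longrightarrow>
       (\<forall>s\<in>J. ((cond_A1 \<mu> \<and> s \<in> I_minus \<mu>) \<or> (cond_A2 \<mu> \<and> s \<in> I_plus \<mu>)) \<and> \<gamma> \<le> min \<bar>s\<bar> 1) \<longrightarrow>
       (\<exists>\<delta>>0. (\<forall>s\<in>J. spectral_decomposition \<mu> \<gamma> s \<delta> (Proj s) (N s)) \<and>
              (SUP s\<in>J. SUP z\<in>ball 0 \<delta>. ereal (spec_radius_B \<gamma> (N s z))) < 1))"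
\<comment> \<open>Both families are defined for every \<open>s\<close> without reference to a disc,
  so one pair of witnesses serves the pointwise and the uniform claim.\<close>
proof (rule exI[of _ "Proj_op \<mu>"], rule exI[of _ "N_op \<mu>"], intro conjI ballI allI impI)
 fix s assume s: "s \<in> interior (I_mu \<mu>) - {0}" "(cond_A1 \<mu> & s \<in> I_minus \<mu>) \<or> (cond_A2 \<mu> & s \<in> I_plus \<mu>)" "\<gamma> <= min \<bar>s\<bar> 1"
 obtain a b where ab: "a < s" "s < b" "!!t. a <= t ==> t <= b ==> case_A \<mu> t & moment \<mu> t"
  by (rule regular_point[of s \<mu>]) (use s in auto)
 have "\<gamma> <= 1" using s by simp
 from local_uniform[OF law gamma this ab(3,1,2)]
 show "\<exists>\<delta>>0. spectral_decomposition \<mu> \<gamma> s \<delta> (Proj_op \<mu> s) (N_op \<mu> s)" by fastforce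
next
 fix J assume J: "compact J" "J \<subseteq> interior (I_plus \<mu>) \<union> interior (I_minus \<mu>)"
  "\<forall>s\<in>J. ((cond_A1 \<mu> & s \<in> I_minus \<mu>) \<or> (cond_A2 \<mu> & s \<in> I_plus \<mu>)) & \<gamma> <= min \<bar>s\<bar> 1"
 let ?G = "%s0 \<delta> \<rho>. 0 < \<delta> & \<rho> < 1 & (\<forall>s. \<bar>s - s0\<bar> < \<delta> --> spectral_decomposition \<mu> \<gamma> s \<delta> (Proj_op \<mu> s) (N_op \<mu> s) &
  (\<forall>z\<in>ball 0 \<delta>. spec_radius_B \<gamma> (N_op \<mu> s z :: 'n operator) <= \<rho>))"
 have "\<forall>s0\<in>J. \<exists>\<delta> \<rho>. ?G s0 \<delta> \<rho>"
 proof
  fix s0 assume s0: "s0 \<in> J"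
  have nz: "s0 ~= 0" "\<gamma> <= 1" using J(3) s0 gamma by force+
  obtain a b where ab: "a < s0" "s0 < b" "!!t. a <= t ==> t <= b ==> case_A \<mu> t & moment \<mu> t"
   by (rule regular_point[of s0 \<mu>]) (use s0 J nz in auto)
  from local_uniform[OF law gamma nz(2) ab(3,1,2)] show "\<exists>\<delta> \<rho>. ?G s0 \<delta> \<rho>" by blast
 qed
 then obtain \<delta> \<rho> where G: "!!s0. s0 \<in> J ==> ?G s0 (\<delta> s0) (\<rho> s0)" by metis
 have "J \<subseteq> (\<Union>s0\<in>J. ball s0 (\<delta> s0))" using G by auto
 then obtain F where F: "F \<subseteq> J" "finite F" "J \<subseteq> (\<Union>s0\<in>F. ball s0 (\<delta> s0))"
  using compactE_image[OF J(1), of J "%s0. ball s0 (\<delta> s0)"] by auto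
 \<comment> \<open>The inserted values, 1 here and 0 for \<open>r\<close>, cover an empty
   \<open>F\<close>, which occurs for empty \<open>J\<close>, and preserve \<open>0 < d\<close> and
   \<open>r < 1\<close>.\<close>
 define d where "d = Min (insert 1 (\<delta> ` F))"
 define r where "r = Max (insert 0 (\<rho> ` F))"
 have d: "0 < d" unfolding d_def using F G by (subst Min_gr_iff) auto
 have r: "r < 1" unfolding r_def using F G by (subst Max_less_iff) auto
 have main: "spectral_decomposition \<mu> \<gamma> s d (Proj_op \<mu> s) (N_op \<mu> s) & (\<forall>z\<in>ball 0 d. spec_radius_B \<gamma> (N_op \<mu> s z :: 'n operator) <= r)"
  if s: "s \<in> J" for s
 proof -
  obtain s0 where s0: "s0 \<in> F" "\<bar>s - s0\<bar> < \<delta> s0" using F(3) s by (auto simp: dist_real_def abs_minus_commute)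
  have dd: "d <= \<delta> s0" "\<rho> s0 <= r" unfolding d_def r_def using F(2) s0(1) by (auto intro!: Min_le Max_ge)
  have 1: "spectral_decomposition \<mu> \<gamma> s (\<delta> s0) (Proj_op \<mu> s) (N_op \<mu> s)"
   and 2: "!!z. z \<in> ball 0 (\<delta> s0) ==> spec_radius_B \<gamma> (N_op \<mu> s z :: 'n operator) <= \<rho> s0"
   using G[of s0] s0 F(1) by blast+
  have "spec_radius_B \<gamma> (N_op \<mu> s z :: 'n operator) <= r" if "z \<in> ball 0 d" for z
   using 2[of z] that dd by (auto intro: order_trans)
  then show ?thesis using spectral_decomposition_mono[OF 1 dd(1)] by blast
 qed
 have "(SUP s\<in>J. SUP z\<in>ball 0 d. ereal (spec_radius_B \<gamma> (N_op \<mu> s z :: 'n operator))) <= ereal r"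
  using main by (intro SUP_least) auto
 also have "... < 1" using r by simp
 finally show "\<exists>\<delta>>0. (\<forall>s\<in>J. spectral_decomposition \<mu> \<gamma> s \<delta> (Proj_op \<mu> s) (N_op \<mu> s)) &
   (SUP s\<in>J. SUP z\<in>ball 0 \<delta>. ereal (spec_radius_B \<gamma> (N_op \<mu> s z))) < 1"
  using main d by blast
qed

end
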